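(* Let $L=N\colon \mathrm{Mod}(\mathbb{Z})^{\Delta}\to\mathscr{C}(\mathbb{Z})^-$ be the normalized chain complex functor. The functor $L^{\mathrm{mon}}\colon \mathrm{Mon}(\mathrm{Mod}(\mathbb{Z})^{\Delta})\to\mathrm{Mon}(\mathscr{C}(\mathbb{Z})^-)$ is isomorphic to the functor $\tilde L^{\mathrm{mon}}$ defined, for a monoid $X$ in $\mathrm{Mod}(\mathbb{Z})^{\Delta}$, by $$\tilde L^{\mathrm{mon}}(X)=L(X)/\mathscr{J}(X),$$ where the right-hand side is the quotient-monoid of the monoid $L(X)$ (whose monoid structure is defined out of the shuffle lax-monoidal structure $\nabla$ on $L$) by the monoid-ideal $\mathscr{J}(X)$.
   Context: $\mathrm{Mod}(\mathbb{Z})^{\Delta}$ is the symmetric monoidal category of simplicial abelian groups (degree-wise tensor product), $\mathscr{C}(\mathbb{Z})^-$ the symmetric monoidal category of $\mathbb{Z}_{\le 0}$-graded complexes of abelian groups (differential of degree $+1$), and $\mathrm{Mon}$ denotes the category of monoids. $L=N$ is the left adjoint in the Dold–Kan adjoint equivalence $N\colon \mathrm{Mod}(\mathbb{Z})^{\Delta}\rightleftarrows\mathscr{C}(\mathbb{Z})^-\colon\Gamma$. The functor $L$ carries the Alexander–Whitney colax-monoidal structure $AW\colon L(A\otimes B)\to L(A)\otimes L(B)$, $AW(a^k\otimes b^k)=\sum_{i+j=k}d_{\mathrm{fin}}^i a^k\otimes d_0^j b^k$ ($d_0$, $d_{\mathrm{fin}}$ are the first and the last face maps), and the Eilenberg–MacLane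 shuffle lax-monoidal structure $\nabla\colon L(A)\otimes L(B)\to L(A\otimes B)$ (signed sum over shuffles). One has $AW\circ\nabla=\mathrm{id}$. $T_{\Delta}$ and $T_{\mathrm{dg}}$ denote the free (tensor) monoid functors $T(X)=\coprod_{n\ge0}X^{\otimes n}$ in $\mathrm{Mod}(\mathbb{Z})^{\Delta}$ and $\mathscr{C}(\mathbb{Z})^-$. Definition of $L^{\mathrm{mon}}$: for a monoid $X$, $L^{\mathrm{mon}}(X)$ is the co-equalizer in $\mathrm{Mon}(\mathscr{C}(\mathbb{Z})^-)$ of two maps of monoids $\alpha,\beta\colon T_{\mathrm{dg}}(L(T_\Delta X))\rightrightarrows T_{\mathrm{dg}}(LX)$, where $\alpha$ is induced by $L$ applied to the product map $T_\Delta X\to X$ (equal on generators $L(X^{\otimes n})$ to $L(m_n)\colon L(X^{\otimes n})\to L(X)$, with $m_n$ the iterated product), and $\beta$ is given on the generators $L(X^{\otimes n})$ by the iterated Alexander–Whitney map $L(X^{\otimes n})\to L(X)^{\otimes n}$. Monoid structure on $L(X)$: for a monoid $X$ with product $m_X$, the product on $L(X)$ is $L(X)\otimes L(X)\xrightarrow{\nabla}L(X\otimes X)\xrightarrow{L(m_X)}L(X)$. Let $m_\nabla\colon T_{\mathrm{dg}}(LX)\to LX$ be the iterated product map for this monoid structure. Definition of $\mathscr{J}(X)$: put $\mathscr{K}(X)=\mathrm{Ker}(\beta\colon T_{\mathrm{dg}}(L(T_\Delta X))\to T_{\mathrm{dg}}(LX))$, $\mathscr{I}(X)=\alpha(\mathscr{K}(X))\subset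 T_{\mathrm{dg}}(LX)$, and $\mathscr{J}(X)=m_\nabla(\mathscr{I}(X))\subset L(X)$. These $\mathscr{I}(X)$, $\mathscr{J}(X)$ are monoid-ideals. *)

theory Defs
  imports "HOL-Algebra.Free_Abelian_Groups" "HOL-Algebra.Ring"
begin

text \<open>
  Abelian groups are the commutative groups of HOL-Algebra; their operation is written
  multiplicatively by the library, so that a signed sum becomes a \<open>finprod\<close> of powers with
  exponents \<open>(- 1) ^ i\<close>. A map out of a quotient group that is induced by a map \<open>h\<close> on
  representatives is written \<open>c \<mapsto> the_elem (h ` c)\<close>.
\<close>

definition induced :: "('a \<Rightarrow> 'b) \<Rightarrow> 'a set \<Rightarrow> 'b" where
  "induced h c = the_elem (h ` c)"

definition induced2 :: "('a \<Rightarrow> 'b \<Rightarrow> 'c) \<Rightarrow> 'a set \<Rightarrow> 'b set \<Rightarrow> 'c" where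
  "induced2 h c d = the_elem ((\<lambda>(x, y). h x y) ` (c \<times> d))"

text \<open>Extension of a map on a basis to the homomorphism on the free abelian group.\<close>

definition lin_ext :: "('b, 'm) monoid_scheme \<Rightarrow> ('a \<Rightarrow> 'b) \<Rightarrow> ('a \<Rightarrow>\<^sub>0 int) \<Rightarrow> 'b" where
  "lin_ext G f c =
     finprod G (\<lambda>a. f a [^]\<^bsub>G\<^esub> Poly_Mapping.lookup c a) (Poly_Mapping.keys c)"


section \<open>Simplicial abelian groups and simplicial rings\<close>

text \<open>
  \<open>face X n i\<close> is the face map \<open>d_i\<close> from level \<open>n\<close> to level \<open>n - 1\<close> (used for \<open>n > 0\<close>),
  \<open>degen X n i\<close> is the degeneracy \<open>s_i\<close> from level \<open>n\<close> to level \<open>n + 1\<close>.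
\<close>

record ('o, 'a) simplicial =
  level :: "nat \<Rightarrow> 'o"
  face :: "nat \<Rightarrow> nat \<Rightarrow> 'a \<Rightarrow> 'a"
  degen :: "nat \<Rightarrow> nat \<Rightarrow> 'a \<Rightarrow> 'a"

type_synonym 'a simp_ab = "('a monoid, 'a) simplicial"
type_synonym 'a simp_ring = "('a ring, 'a) simplicial"

locale simplicial_ab_group =
  fixes X :: "'a simp_ab"
  assumes level_comm_group: "comm_group (level X n)"
    and face_hom: "\<lbrakk>0 < n; i \<le> n\<rbrakk> \<Longrightarrow> face X n i \<in> hom (level X n) (level X (n - 1))"
    and degen_hom: "i \<le> n \<Longrightarrow> degen X n i \<in> hom (level X n) (level X (Suc n))"
    and face_face: "\<lbrakk>2 \<le> n; i < j; j \<le> n; x \<in> carrier (level X n)\<rbrakk> \<Longrightarrow>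
      face X (n - 1) i (face X n j x) = face X (n - 1) (j - 1) (face X n i x)"
    and degen_degen: "\<lbrakk>i \<le> j; j \<le> n; x \<in> carrier (level X n)\<rbrakk> \<Longrightarrow>
      degen X (Suc n) i (degen X n j x) = degen X (Suc n) (Suc j) (degen X n i x)"
    and face_degen: "\<lbrakk>j \<le> n; i \<le> Suc n; x \<in> carrier (level X n)\<rbrakk> \<Longrightarrow>
      face X (Suc n) i (degen X n j x) =
        (if i < j then degen X (n - 1) (j - 1) (face X n i x)
         else if i \<le> Suc j then x
         else degen X (n - 1) j (face X n (i - 1) x))"

definition additive :: "'a simp_ring \<Rightarrow> 'a simp_ab" where
  "additive X = \<lparr>level = (\<lambda>n. add_monoid (level X n)), face = face X, degen = degen X\<rparr>"

text \<open>
  As a map out of the degreewise tensor product \<open>X \<otimes> X\<close> is a degreewise bilinear map, a monoid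
  in simplicial abelian groups is a simplicial (associative unital) ring.
\<close>

locale simplicial_ring =
  fixes X :: "'a simp_ring"
  assumes level_ring: "ring (level X n)"
    and additive_simplicial: "simplicial_ab_group (additive X)"
    and face_ring_hom: "\<lbrakk>0 < n; i \<le> n\<rbrakk> \<Longrightarrow> face X n i \<in> ring_hom (level X n) (level X (n - 1))"
    and degen_ring_hom: "i \<le> n \<Longrightarrow> degen X n i \<in> ring_hom (level X n) (level X (Suc n))"

definition simp_ring_hom :: "'a simp_ring \<Rightarrow> 'b simp_ring \<Rightarrow> (nat \<Rightarrow> 'a \<Rightarrow> 'b) \<Rightarrow> bool" where
  "simp_ring_hom X Y f \<longleftrightarrow>
     simplicial_ring X \<and> simplicial_ring Y \<and>
     (\<forall>n. f n \<in> ring_hom (level X n) (level Y n)) \<and>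
     (\<forall>n i. \<forall>x \<in> carrier (level X n). 0 < n \<and> i \<le> n \<longrightarrow>
        f (n - 1) (face X n i x) = face Y n i (f n x)) \<and>
     (\<forall>n i. \<forall>x \<in> carrier (level X n). i \<le> n \<longrightarrow>
        f (Suc n) (degen X n i x) = degen Y n i (f n x))"

text \<open>\<open>d_0 ^ j\<close> and \<open>d_fin ^ j\<close> on level \<open>n\<close>, where \<open>d_fin\<close> is the last face map.\<close>

primrec first_faces :: "('o, 'a) simplicial \<Rightarrow> nat \<Rightarrow> nat \<Rightarrow> 'a \<Rightarrow> 'a" where
  "first_faces X n 0 x = x"
| "first_faces X n (Suc j) x = face X (n - j) 0 (first_faces X n j x)"

primrec last_faces :: "('o, 'a) simplicial \<Rightarrow> nat \<Rightarrow> nat \<Rightarrow> 'a \<Rightarrow> 'a" where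
  "last_faces X n 0 x = x"
| "last_faces X n (Suc j) x = face X (n - j) (n - j) (last_faces X n j x)"

text \<open>\<open>degens X n [j_1, \<dots>, j_q]\<close> is \<open>s_{j_q} \<circ> \<dots> \<circ> s_{j_1}\<close> on level \<open>n\<close>.\<close>

primrec degens :: "('o, 'a) simplicial \<Rightarrow> nat \<Rightarrow> nat list \<Rightarrow> 'a \<Rightarrow> 'a" where
  "degens X n [] x = x"
| "degens X n (j # js) x = degens X (Suc n) js (degen X n j x)"


section \<open>The free monoid on a simplicial abelian group\<close>

text \<open>
  The direct sum of all tensor powers of an abelian group \<open>A\<close>, presented as the free abelian
  group on words in \<open>A\<close> modulo multilinearity; the \<open>n\<close>-th tensor power is the part spanned by
  the words of length \<open>n\<close>.
\<close>

definition tensor_rel :: "'a monoid \<Rightarrow> ('a list \<Rightarrow>\<^sub>0 int) set" where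
  "tensor_rel A = generate (free_Abelian_group (lists (carrier A)))
     {frag_of (us @ (x \<otimes>\<^bsub>A\<^esub> y) # vs) - frag_of (us @ x # vs) - frag_of (us @ y # vs) | us x y vs.
        us \<in> lists (carrier A) \<and> x \<in> carrier A \<and> y \<in> carrier A \<and> vs \<in> lists (carrier A)}"

definition tensor :: "'a monoid \<Rightarrow> ('a list \<Rightarrow>\<^sub>0 int) set monoid" where
  "tensor A = free_Abelian_group (lists (carrier A)) Mod tensor_rel A"

definition tensor_cls :: "'a monoid \<Rightarrow> ('a list \<Rightarrow>\<^sub>0 int) \<Rightarrow> ('a list \<Rightarrow>\<^sub>0 int) set" where
  "tensor_cls A c = tensor_rel A #>\<^bsub>free_Abelian_group (lists (carrier A))\<^esub> c"

definition tensor_map :: "'b monoid \<Rightarrow> ('a \<Rightarrow> 'b) \<Rightarrow> ('a list \<Rightarrow>\<^sub>0 int) set \<Rightarrow> ('b list \<Rightarrow>\<^sub>0 int) set" where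
  "tensor_map B f = induced (lin_ext (tensor B) (\<lambda>w. tensor_cls B (frag_of (map f w))))"

definition T_Delta :: "'a simp_ab \<Rightarrow> ('a list \<Rightarrow>\<^sub>0 int) set simp_ab" where
  "T_Delta X = \<lparr>level = (\<lambda>n. tensor (level X n)),
                face = (\<lambda>n i. tensor_map (level X (n - 1)) (face X n i)),
                degen = (\<lambda>n i. tensor_map (level X (Suc n)) (degen X n i))\<rparr>"

text \<open>The product map \<open>T_Delta X \<rightarrow> X\<close>, the iterated product on each tensor power.\<close>

definition T_Delta_prod :: "'a simp_ring \<Rightarrow> nat \<Rightarrow> ('a list \<Rightarrow>\<^sub>0 int) set \<Rightarrow> 'a" where
  "T_Delta_prod X n =
     induced (lin_ext (add_monoid (level X n))
       (\<lambda>w. foldr (\<otimes>\<^bsub>level X n\<^esub>) w \<one>\<^bsub>level X n\<^esub>))"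


section \<open>Complexes and monoids in complexes\<close>

text \<open>
  \<open>grp V k\<close> is the component of degree \<open>-k\<close>, and \<open>bd V k\<close>, for \<open>k > 0\<close>, is the
  differential from degree \<open>-k\<close> to degree \<open>-k + 1\<close>; the value of \<open>bd V 0\<close> is irrelevant.
\<close>

record 'a cpx =
  grp :: "nat \<Rightarrow> 'a monoid"
  bd :: "nat \<Rightarrow> 'a \<Rightarrow> 'a"

record 'a dgring = "'a cpx" +
  gmult :: "nat \<Rightarrow> nat \<Rightarrow> 'a \<Rightarrow> 'a \<Rightarrow> 'a"
  gone :: 'a

locale cochain_complex =
  fixes V :: "('a, 'm) cpx_scheme"
  assumes grp_comm_group: "comm_group (grp V k)"
    and bd_hom: "0 < k \<Longrightarrow> bd V k \<in> hom (grp V k) (grp V (k - 1))"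
    and bd_bd: "\<lbrakk>2 \<le> k; x \<in> carrier (grp V k)\<rbrakk> \<Longrightarrow> bd V (k - 1) (bd V k x) = \<one>\<^bsub>grp V (k - 2)\<^esub>"

text \<open>
  A monoid in complexes is a graded ring with a compatible differential: the product
  \<open>B \<otimes> B \<rightarrow> B\<close> is given by bilinear maps \<open>gmult B i j\<close> on components, and its
  compatibility with the differential of \<open>B \<otimes> B\<close> is the Leibniz rule. A term with a
  differential of an element of degree \<open>0\<close> is omitted.
\<close>

locale dg_ring = cochain_complex B for B :: "'a dgring" +
  assumes gmult_closed: "\<lbrakk>x \<in> carrier (grp B i); y \<in> carrier (grp B j)\<rbrakk> \<Longrightarrow>
      gmult B i j x y \<in> carrier (grp B (i + j))"
    and gmult_left: "\<lbrakk>x \<in> carrier (grp B i); x' \<in> carrier (grp B i); y \<in> carrier (grp B j)\<rbrakk> \<Longrightarrow>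
      gmult B i j (x \<otimes>\<^bsub>grp B i\<^esub> x') y = gmult B i j x y \<otimes>\<^bsub>grp B (i + j)\<^esub> gmult B i j x' y"
    and gmult_right: "\<lbrakk>x \<in> carrier (grp B i); y \<in> carrier (grp B j); y' \<in> carrier (grp B j)\<rbrakk> \<Longrightarrow>
      gmult B i j x (y \<otimes>\<^bsub>grp B j\<^esub> y') = gmult B i j x y \<otimes>\<^bsub>grp B (i + j)\<^esub> gmult B i j x y'"
    and gmult_assoc: "\<lbrakk>x \<in> carrier (grp B i); y \<in> carrier (grp B j); z \<in> carrier (grp B k)\<rbrakk> \<Longrightarrow>
      gmult B (i + j) k (gmult B i j x y) z = gmult B i (j + k) x (gmult B j k y z)"
    and gone_closed: "gone B \<in> carrier (grp B 0)"
    and gone_left: "x \<in> carrier (grp B i) \<Longrightarrow> gmult B 0 i (gone B) x = x"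
    and gone_right: "x \<in> carrier (grp B i) \<Longrightarrow> gmult B i 0 x (gone B) = x"
    and leibniz: "\<lbrakk>0 < i + j; x \<in> carrier (grp B i); y \<in> carrier (grp B j)\<rbrakk> \<Longrightarrow>
      bd B (i + j) (gmult B i j x y) =
        (if i = 0 then \<one>\<^bsub>grp B (i + j - 1)\<^esub> else gmult B (i - 1) j (bd B i x) y)
        \<otimes>\<^bsub>grp B (i + j - 1)\<^esub>
        (if j = 0 then \<one>\<^bsub>grp B (i + j - 1)\<^esub>
         else gmult B i (j - 1) x (bd B j y) [^]\<^bsub>grp B (i + j - 1)\<^esub> ((- 1) ^ i :: int))"

definition dg_hom :: "'a dgring \<Rightarrow> 'b dgring \<Rightarrow> (nat \<Rightarrow> 'a \<Rightarrow> 'b) \<Rightarrow> bool" where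
  "dg_hom A B f \<longleftrightarrow>
     dg_ring A \<and> dg_ring B \<and>
     (\<forall>k. f k \<in> hom (grp A k) (grp B k)) \<and>
     (\<forall>k > 0. \<forall>x \<in> carrier (grp A k). f (k - 1) (bd A k x) = bd B k (f k x)) \<and>
     (\<forall>i j. \<forall>x \<in> carrier (grp A i). \<forall>y \<in> carrier (grp A j).
        f (i + j) (gmult A i j x y) = gmult B i j (f i x) (f j y)) \<and>
     f 0 (gone A) = gone B"

definition dg_iso :: "'a dgring \<Rightarrow> 'b dgring \<Rightarrow> (nat \<Rightarrow> 'a \<Rightarrow> 'b) \<Rightarrow> bool" where
  "dg_iso A B f \<longleftrightarrow> dg_hom A B f \<and> (\<forall>k. f k \<in> iso (grp A k) (grp B k))"

text \<open>A monoid-ideal is a two-sided ideal that is also a subcomplex.\<close>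

definition dg_ideal :: "'a dgring \<Rightarrow> (nat \<Rightarrow> 'a set) \<Rightarrow> bool" where
  "dg_ideal B J \<longleftrightarrow>
     (\<forall>k. subgroup (J k) (grp B k)) \<and>
     (\<forall>k > 0. \<forall>x \<in> J k. bd B k x \<in> J (k - 1)) \<and>
     (\<forall>i j. \<forall>x \<in> carrier (grp B i). \<forall>y \<in> J j. gmult B i j x y \<in> J (i + j)) \<and>
     (\<forall>i j. \<forall>x \<in> J i. \<forall>y \<in> carrier (grp B j). gmult B i j x y \<in> J (i + j))"

definition dg_ideal_generated :: "'a dgring \<Rightarrow> (nat \<Rightarrow> 'a set) \<Rightarrow> nat \<Rightarrow> 'a set" where
  "dg_ideal_generated B S k = \<Inter> {J k | J. dg_ideal B J \<and> (\<forall>l. S l \<subseteq> J l)}"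

definition dg_quot_cls :: "'a dgring \<Rightarrow> (nat \<Rightarrow> 'a set) \<Rightarrow> nat \<Rightarrow> 'a \<Rightarrow> 'a set" where
  "dg_quot_cls B J k x = J k #>\<^bsub>grp B k\<^esub> x"

definition dg_quot :: "'a dgring \<Rightarrow> (nat \<Rightarrow> 'a set) \<Rightarrow> 'a set dgring" where
  "dg_quot B J =
     \<lparr>grp = (\<lambda>k. grp B k Mod J k),
      bd = (\<lambda>k. induced (\<lambda>x. dg_quot_cls B J (k - 1) (bd B k x))),
      gmult = (\<lambda>i j. induced2 (\<lambda>x y. dg_quot_cls B J (i + j) (gmult B i j x y))),
      gone = dg_quot_cls B J 0 (gone B)\<rparr>"

text \<open>
  \<open>q\<close> is a co-equalizer of \<open>f\<close> and \<open>g\<close> in monoids in complexes, with universal property tested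
  against all objects with elements in the type \<open>'d\<close>.
\<close>

definition dg_coequalizer ::
  "'d itself \<Rightarrow> 'a dgring \<Rightarrow> 'b dgring \<Rightarrow> (nat \<Rightarrow> 'a \<Rightarrow> 'b) \<Rightarrow> (nat \<Rightarrow> 'a \<Rightarrow> 'b) \<Rightarrow>
   'c dgring \<Rightarrow> (nat \<Rightarrow> 'b \<Rightarrow> 'c) \<Rightarrow> bool" where
  "dg_coequalizer _ A B f g C q \<longleftrightarrow>
     dg_hom A B f \<and> dg_hom A B g \<and> dg_hom B C q \<and>
     (\<forall>k. \<forall>a \<in> carrier (grp A k). q k (f k a) = q k (g k a)) \<and>
     (\<forall>(D :: 'd dgring) h.
        dg_hom B D h \<and> (\<forall>k. \<forall>a \<in> carrier (grp A k). h k (f k a) = h k (g k a)) \<longrightarrow>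
        (\<exists>u. dg_hom C D u \<and> (\<forall>k. \<forall>b \<in> carrier (grp B k). u k (q k b) = h k b) \<and>
             (\<forall>u'. dg_hom C D u' \<and> (\<forall>k. \<forall>b \<in> carrier (grp B k). u' k (q k b) = h k b) \<longrightarrow>
                   (\<forall>k. \<forall>c \<in> carrier (grp C k). u' k c = u k c))))"


section \<open>The free monoid on a complex\<close>

text \<open>
  The component of degree \<open>-k\<close> of the direct sum of all tensor powers of a complex \<open>V\<close>: a word
  \<open>[(k_1, v_1), \<dots>, (k_n, v_n)]\<close> with \<open>v_i\<close> in degree \<open>-k_i\<close> and \<open>k_1 + \<dots> + k_n = k\<close> stands
  for the tensor \<open>v_1 \<otimes> \<dots> \<otimes> v_n\<close>.
\<close>

definition wdeg :: "(nat \<times> 'a) list \<Rightarrow> nat" where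
  "wdeg w = sum_list (map fst w)"

definition gwords :: "('a, 'm) cpx_scheme \<Rightarrow> nat \<Rightarrow> (nat \<times> 'a) list set" where
  "gwords V k = {w. (\<forall>(i, v) \<in> set w. v \<in> carrier (grp V i)) \<and> wdeg w = k}"

definition gtensor_rel :: "('a, 'm) cpx_scheme \<Rightarrow> nat \<Rightarrow> ((nat \<times> 'a) list \<Rightarrow>\<^sub>0 int) set" where
  "gtensor_rel V k = generate (free_Abelian_group (gwords V k))
     {frag_of (us @ (i, x \<otimes>\<^bsub>grp V i\<^esub> y) # vs) - frag_of (us @ (i, x) # vs)
        - frag_of (us @ (i, y) # vs) | us i x y vs.
        x \<in> carrier (grp V i) \<and> y \<in> carrier (grp V i) \<and> us @ (i, x) # vs \<in> gwords V k}"

definition gtensor_cls ::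
  "('a, 'm) cpx_scheme \<Rightarrow> nat \<Rightarrow> ((nat \<times> 'a) list \<Rightarrow>\<^sub>0 int) \<Rightarrow> ((nat \<times> 'a) list \<Rightarrow>\<^sub>0 int) set" where
  "gtensor_cls V k c = gtensor_rel V k #>\<^bsub>free_Abelian_group (gwords V k)\<^esub> c"

definition gtensor ::
  "('a, 'm) cpx_scheme \<Rightarrow> nat \<Rightarrow> ((nat \<times> 'a) list \<Rightarrow>\<^sub>0 int) set monoid" where
  "gtensor V k = free_Abelian_group (gwords V k) Mod gtensor_rel V k"

text \<open>The differential is the graded derivation extending that of \<open>V\<close>.\<close>

definition gtensor_bd_word ::
  "('a, 'm) cpx_scheme \<Rightarrow> nat \<Rightarrow> (nat \<times> 'a) list \<Rightarrow> ((nat \<times> 'a) list \<Rightarrow>\<^sub>0 int) set" where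
  "gtensor_bd_word V k w =
     finprod (gtensor V (k - 1))
       (\<lambda>p. gtensor_cls V (k - 1)
              (frag_of (w[p := (fst (w ! p) - 1, bd V (fst (w ! p)) (snd (w ! p)))]))
            [^]\<^bsub>gtensor V (k - 1)\<^esub> ((- 1) ^ wdeg (take p w) :: int))
       {p. p < length w \<and> 0 < fst (w ! p)}"

definition concat_prod :: "('a list \<Rightarrow>\<^sub>0 int) \<Rightarrow> ('a list \<Rightarrow>\<^sub>0 int) \<Rightarrow> ('a list \<Rightarrow>\<^sub>0 int)" where
  "concat_prod c d = frag_extend (\<lambda>u. frag_extend (\<lambda>v. frag_of (u @ v)) d) c"

definition T_dg :: "('a, 'm) cpx_scheme \<Rightarrow> ((nat \<times> 'a) list \<Rightarrow>\<^sub>0 int) set dgring" where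
  "T_dg V =
     \<lparr>grp = gtensor V,
      bd = (\<lambda>k. induced (lin_ext (gtensor V (k - 1)) (gtensor_bd_word V k))),
      gmult = (\<lambda>i j. induced2 (\<lambda>c d. gtensor_cls V (i + j) (concat_prod c d))),
      gone = gtensor_cls V 0 (frag_of [])\<rparr>"

definition T_dg_gen :: "('a, 'm) cpx_scheme \<Rightarrow> nat \<Rightarrow> 'a \<Rightarrow> ((nat \<times> 'a) list \<Rightarrow>\<^sub>0 int) set" where
  "T_dg_gen V k v = gtensor_cls V k (frag_of [(k, v)])"

text \<open>\<open>T_dg_lift B \<phi>\<close> is the map of monoids out of the free monoid given by \<open>\<phi>\<close> on generators.\<close>

fun word_prod :: "'b dgring \<Rightarrow> (nat \<Rightarrow> 'a \<Rightarrow> 'b) \<Rightarrow> (nat \<times> 'a) list \<Rightarrow> 'b" where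
  "word_prod B \<phi> [] = gone B"
| "word_prod B \<phi> ((k, v) # w) = gmult B k (wdeg w) (\<phi> k v) (word_prod B \<phi> w)"

definition T_dg_lift ::
  "'b dgring \<Rightarrow> (nat \<Rightarrow> 'a \<Rightarrow> 'b) \<Rightarrow> nat \<Rightarrow> ((nat \<times> 'a) list \<Rightarrow>\<^sub>0 int) set \<Rightarrow> 'b" where
  "T_dg_lift B \<phi> k = induced (lin_ext (grp B k) (word_prod B \<phi>))"

definition T_dg_map ::
  "('b, 'm) cpx_scheme \<Rightarrow> (nat \<Rightarrow> 'a \<Rightarrow> 'b) \<Rightarrow> nat \<Rightarrow>
   ((nat \<times> 'a) list \<Rightarrow>\<^sub>0 int) set \<Rightarrow> ((nat \<times> 'b) list \<Rightarrow>\<^sub>0 int) set" where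
  "T_dg_map W f = T_dg_lift (T_dg W) (\<lambda>k v. T_dg_gen W k (f k v))"


section \<open>The normalized chain complex\<close>

text \<open>
  The normalized complex is taken as the quotient by degenerate simplices, the model in which the
  usual formulas for the Alexander--Whitney and shuffle maps make sense literally.
\<close>

definition degenerate :: "'a simp_ab \<Rightarrow> nat \<Rightarrow> 'a set" where
  "degenerate X k =
     generate (level X k) (\<Union>j<k. degen X (k - 1) j ` carrier (level X (k - 1)))"

definition N_cls :: "'a simp_ab \<Rightarrow> nat \<Rightarrow> 'a \<Rightarrow> 'a set" where
  "N_cls X k x = degenerate X k #>\<^bsub>level X k\<^esub> x"

definition N :: "'a simp_ab \<Rightarrow> 'a set cpx" where
  "N X =
     \<lparr>grp = (\<lambda>k. level X k Mod degenerate X k),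
      bd = (\<lambda>k. induced (\<lambda>x. N_cls X (k - 1)
              (finprod (level X (k - 1))
                 (\<lambda>i. face X k i x [^]\<^bsub>level X (k - 1)\<^esub> ((- 1) ^ i :: int)) {..k})))\<rparr>"

definition N_map :: "'b simp_ab \<Rightarrow> (nat \<Rightarrow> 'a \<Rightarrow> 'b) \<Rightarrow> nat \<Rightarrow> 'a set \<Rightarrow> 'b set" where
  "N_map Y f k = induced (\<lambda>x. N_cls Y k (f k x))"


section \<open>Alexander--Whitney and shuffle maps\<close>

text \<open>
  The iterated Alexander--Whitney maps on words, from the \<open>k\<close>-simplices of the \<open>n\<close>-th tensor
  power of \<open>X\<close> to the \<open>n\<close>-th tensor power of \<open>N X\<close>, for all \<open>n\<close> at once. The recursion is
  \<open>AW_{n+1} = (id \<otimes> AW_n) \<circ> AW\<close> with the binary map \<open>AW\<close> taken for \<open>X\<close> and the \<open>n\<close>-th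
  tensor power, on which the face maps act diagonally. The case \<open>n = 0\<close> is the identification of
  the normalized complex of the constant simplicial group of integers with the unit complex.
\<close>

fun aw_word :: "'a simp_ab \<Rightarrow> nat \<Rightarrow> 'a list \<Rightarrow> ((nat \<times> 'a set) list \<Rightarrow>\<^sub>0 int)" where
  "aw_word X k [] = (if k = 0 then frag_of [] else 0)"
| "aw_word X k (x # w) =
     (\<Sum>i\<le>k. frag_extend (\<lambda>u. frag_of ((k - i, N_cls X (k - i) (last_faces X k i x)) # u))
                (aw_word X i (map (first_faces X k (k - i)) w)))"

definition AW ::
  "'a simp_ab \<Rightarrow> nat \<Rightarrow> ('a list \<Rightarrow>\<^sub>0 int) set set \<Rightarrow> ((nat \<times> 'a set) list \<Rightarrow>\<^sub>0 int) set" where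
  "AW X k = induced (induced
     (lin_ext (grp (T_dg (N X)) k) (\<lambda>w. gtensor_cls (N X) k (aw_word X k w))))"

text \<open>
  The \<open>(p, q)\<close>-shuffles are indexed by the subsets \<open>M = {\<mu>_1 < \<dots> < \<mu>_p}\<close> of
  \<open>{0, \<dots>, p + q - 1}\<close>, with complement \<open>{\<nu>_1 < \<dots> < \<nu>_q}\<close>; the sign is that of the
  permutation \<open>(\<mu>_1, \<dots>, \<mu>_p, \<nu>_1, \<dots>, \<nu>_q)\<close>. The simplex \<open>x\<close> is degenerated along
  \<open>\<nu>\<close> and \<open>y\<close> along \<open>\<mu>\<close>. The target \<open>N (X \<otimes> X)\<close> is the length two part of
  \<open>N (T_Delta X)\<close>.
\<close>

definition shuffle_sign :: "nat \<Rightarrow> nat set \<Rightarrow> int" where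
  "shuffle_sign n M = (- 1) ^ card {(m, l). m \<in> M \<and> l \<in> {..<n} - M \<and> l < m}"

definition shuffle_sum :: "'a simp_ab \<Rightarrow> nat \<Rightarrow> nat \<Rightarrow> 'a \<Rightarrow> 'a \<Rightarrow> ('a list \<Rightarrow>\<^sub>0 int)" where
  "shuffle_sum X p q x y =
     (\<Sum>M \<in> {M. M \<subseteq> {..<p + q} \<and> card M = p}.
        frag_cmul (shuffle_sign (p + q) M)
          (frag_of [degens X p (sorted_list_of_set ({..<p + q} - M)) x,
                    degens X q (sorted_list_of_set M) y]))"

definition nabla ::
  "'a simp_ab \<Rightarrow> nat \<Rightarrow> nat \<Rightarrow> 'a set \<Rightarrow> 'a set \<Rightarrow> ('a list \<Rightarrow>\<^sub>0 int) set set" where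
  "nabla X p q = induced2 (\<lambda>x y.
     N_cls (T_Delta X) (p + q) (tensor_cls (level X (p + q)) (shuffle_sum X p q x y)))"


section \<open>The functors\<close>

text \<open>The monoid \<open>L(X)\<close> for a monoid \<open>X\<close>, with product \<open>L(m_X) \<circ> \<nabla>\<close>.\<close>

definition L :: "'a simp_ring \<Rightarrow> 'a set dgring" where
  "L X =
     \<lparr>grp = grp (N (additive X)),
      bd = bd (N (additive X)),
      gmult = (\<lambda>p q u v.
        N_map (additive X) (T_Delta_prod X) (p + q) (nabla (additive X) p q u v)),
      gone = N_cls (additive X) 0 \<one>\<^bsub>level X 0\<^esub>\<rparr>"

definition T_L :: "'a simp_ring \<Rightarrow> ((nat \<times> 'a set) list \<Rightarrow>\<^sub>0 int) set dgring" where
  "T_L X = T_dg (N (additive X))"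

definition T_L_T ::
  "'a simp_ring \<Rightarrow> ((nat \<times> ('a list \<Rightarrow>\<^sub>0 int) set set) list \<Rightarrow>\<^sub>0 int) set dgring" where
  "T_L_T X = T_dg (N (T_Delta (additive X)))"

definition alpha ::
  "'a simp_ring \<Rightarrow> nat \<Rightarrow> ((nat \<times> ('a list \<Rightarrow>\<^sub>0 int) set set) list \<Rightarrow>\<^sub>0 int) set \<Rightarrow>
   ((nat \<times> 'a set) list \<Rightarrow>\<^sub>0 int) set" where
  "alpha X = T_dg_map (N (additive X)) (N_map (additive X) (T_Delta_prod X))"

definition beta ::
  "'a simp_ring \<Rightarrow> nat \<Rightarrow> ((nat \<times> ('a list \<Rightarrow>\<^sub>0 int) set set) list \<Rightarrow>\<^sub>0 int) set \<Rightarrow>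
   ((nat \<times> 'a set) list \<Rightarrow>\<^sub>0 int) set" where
  "beta X = T_dg_lift (T_L X) (AW (additive X))"

text \<open>The co-equalizer of \<open>alpha X\<close> and \<open>beta X\<close>, realized as a quotient of \<open>T_L X\<close>.\<close>

definition L_mon_ideal :: "'a simp_ring \<Rightarrow> nat \<Rightarrow> ((nat \<times> 'a set) list \<Rightarrow>\<^sub>0 int) set set" where
  "L_mon_ideal X = dg_ideal_generated (T_L X)
     (\<lambda>k. {alpha X k z \<otimes>\<^bsub>grp (T_L X) k\<^esub> inv\<^bsub>grp (T_L X) k\<^esub> beta X k z | z.
            z \<in> carrier (grp (T_L_T X) k)})"

definition L_mon :: "'a simp_ring \<Rightarrow> ((nat \<times> 'a set) list \<Rightarrow>\<^sub>0 int) set set dgring" where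
  "L_mon X = dg_quot (T_L X) (L_mon_ideal X)"

definition L_mon_map ::
  "'a simp_ring \<Rightarrow> 'a simp_ring \<Rightarrow> (nat \<Rightarrow> 'a \<Rightarrow> 'a) \<Rightarrow> nat \<Rightarrow>
   ((nat \<times> 'a set) list \<Rightarrow>\<^sub>0 int) set set \<Rightarrow> ((nat \<times> 'a set) list \<Rightarrow>\<^sub>0 int) set set" where
  "L_mon_map X Y f k = induced (\<lambda>t. dg_quot_cls (T_L Y) (L_mon_ideal Y) k
     (T_dg_map (N (additive Y)) (N_map (additive Y) f) k t))"

definition m_nabla :: "'a simp_ring \<Rightarrow> nat \<Rightarrow> ((nat \<times> 'a set) list \<Rightarrow>\<^sub>0 int) set \<Rightarrow> 'a set" where
  "m_nabla X = T_dg_lift (L X) (\<lambda>k v. v)"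

definition K_ker ::
  "'a simp_ring \<Rightarrow> nat \<Rightarrow> ((nat \<times> ('a list \<Rightarrow>\<^sub>0 int) set set) list \<Rightarrow>\<^sub>0 int) set set" where
  "K_ker X k = kernel (grp (T_L_T X) k) (grp (T_L X) k) (beta X k)"

definition I_ideal :: "'a simp_ring \<Rightarrow> nat \<Rightarrow> ((nat \<times> 'a set) list \<Rightarrow>\<^sub>0 int) set set" where
  "I_ideal X k = alpha X k ` K_ker X k"

definition J_ideal :: "'a simp_ring \<Rightarrow> nat \<Rightarrow> 'a set set" where
  "J_ideal X k = m_nabla X k ` I_ideal X k"

definition L_tilde :: "'a simp_ring \<Rightarrow> 'a set set dgring" where
  "L_tilde X = dg_quot (L X) (J_ideal X)"

definition L_tilde_map ::
  "'a simp_ring \<Rightarrow> 'a simp_ring \<Rightarrow> (nat \<Rightarrow> 'a \<Rightarrow> 'a) \<Rightarrow> nat \<Rightarrow> 'a set set \<Rightarrow> 'a set set" where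
  "L_tilde_map X Y f k =
     induced (\<lambda>v. dg_quot_cls (L Y) (J_ideal Y) k (N_map (additive Y) f k v))"

text \<open>
  Functors from simplicial rings with elements in \<open>'a\<close> to monoids in complexes, and isomorphisms
  of such functors. Morphisms are compared on the carriers only.
\<close>

definition dg_functor ::
  "('a simp_ring \<Rightarrow> 'b dgring) \<Rightarrow>
   ('a simp_ring \<Rightarrow> 'a simp_ring \<Rightarrow> (nat \<Rightarrow> 'a \<Rightarrow> 'a) \<Rightarrow> nat \<Rightarrow> 'b \<Rightarrow> 'b) \<Rightarrow> bool" where
  "dg_functor F Fm \<longleftrightarrow>
     (\<forall>X. simplicial_ring X \<longrightarrow> dg_ring (F X)) \<and>
     (\<forall>X Y f. simp_ring_hom X Y f \<longrightarrow> dg_hom (F X) (F Y) (Fm X Y f)) \<and>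
     (\<forall>X Y f g k. simp_ring_hom X Y f \<and> simp_ring_hom X Y g \<and>
        (\<forall>n. \<forall>x \<in> carrier (level X n). f n x = g n x) \<longrightarrow>
        (\<forall>c \<in> carrier (grp (F X) k). Fm X Y f k c = Fm X Y g k c)) \<and>
     (\<forall>X k. simplicial_ring X \<longrightarrow> (\<forall>c \<in> carrier (grp (F X) k). Fm X X (\<lambda>n x. x) k c = c)) \<and>
     (\<forall>X Y Z f g k. simp_ring_hom X Y f \<and> simp_ring_hom Y Z g \<longrightarrow>
        (\<forall>c \<in> carrier (grp (F X) k).
           Fm X Z (\<lambda>n x. g n (f n x)) k c = Fm Y Z g k (Fm X Y f k c)))"

definition functor_iso ::
  "('a simp_ring \<Rightarrow> 'b dgring) \<Rightarrow>
   ('a simp_ring \<Rightarrow> 'a simp_ring \<Rightarrow> (nat \<Rightarrow> 'a \<Rightarrow> 'a) \<Rightarrow> nat \<Rightarrow> 'b \<Rightarrow> 'b) \<Rightarrow>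
   ('a simp_ring \<Rightarrow> 'c dgring) \<Rightarrow>
   ('a simp_ring \<Rightarrow> 'a simp_ring \<Rightarrow> (nat \<Rightarrow> 'a \<Rightarrow> 'a) \<Rightarrow> nat \<Rightarrow> 'c \<Rightarrow> 'c) \<Rightarrow>
   ('a simp_ring \<Rightarrow> nat \<Rightarrow> 'b \<Rightarrow> 'c) \<Rightarrow> bool" where
  "functor_iso F Fm G Gm \<theta> \<longleftrightarrow>
     (\<forall>X. simplicial_ring X \<longrightarrow> dg_iso (F X) (G X) (\<theta> X)) \<and>
     (\<forall>X Y f k. simp_ring_hom X Y f \<longrightarrow>
        (\<forall>c \<in> carrier (grp (F X) k). \<theta> Y k (Fm X Y f k c) = Gm X Y f k (\<theta> X k c)))"

end

theory Submission
  imports Defs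
begin

text \<open>
  Let \<open>I\<close> be the ideal of the free monoid \<open>T_dg (L X)\<close> generated by the differences of
  \<open>\<alpha>\<close> and \<open>\<beta>\<close>, so that the quotient by \<open>I\<close> is the co-equalizer \<open>L_mon X\<close>.

  The maps \<open>\<alpha>\<close> and \<open>\<beta>\<close> have a common section \<open>s\<close>, induced by the inclusion of \<open>X\<close> in
  \<open>T_Delta X\<close> as the words of length one. Hence \<open>\<alpha> z - \<beta> z = \<alpha> (z - s (\<beta> z))\<close>, where the
  argument lies in the kernel of \<open>\<beta>\<close>, and the image of this kernel under the surjection \<open>\<alpha>\<close> is
  already an ideal: \<open>I = \<alpha> (Ker \<beta>)\<close> (\<open>I_ideal_eq\<close>).

  Let \<open>gen\<close> be the inclusion of \<open>L X\<close> in the free monoid as the generators. Applied to the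
  generator \<open>z = \<nabla> (u \<otimes> v)\<close>, the relation \<open>\<alpha> z = \<beta> z\<close> says, because of
  \<open>AW \<circ> \<nabla> = id\<close>, that \<open>gen (u \<cdot> v)\<close> and \<open>gen u \<otimes> gen v\<close> agree modulo \<open>I\<close>
  (\<open>\<pi>_gen_mult\<close>); here \<open>u \<cdot> v\<close> is the shuffle product. By induction every \<open>t\<close> is congruent
  to \<open>gen (m_nabla t)\<close> (\<open>\<pi>_gen_m_nabla\<close>). So \<open>gen\<close> induces a surjection from \<open>L X\<close> to the
  co-equalizer. Its kernel is \<open>J = m_nabla (I)\<close>: if \<open>t\<close> lies in \<open>I\<close>, then so does
  \<open>gen (m_nabla t)\<close>, and conversely \<open>v = m_nabla (gen v)\<close> (\<open>J_ideal_eq\<close>). The induced bijection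
  between \<open>L X / J\<close> and \<open>L_mon X\<close> respects differentials, products and units, and it is natural in
  \<open>X\<close>. Therefore the axioms of a monoid in complexes and the functor laws are proved for \<open>L_mon\<close>,
  where they come from the free monoid, and are carried over to \<open>L X / J\<close>. In particular,
  associativity and the Leibniz rule for the product of \<open>L X / J\<close> come from the free monoid
  and not from an analysis of shuffles. About the shuffle map itself three facts are proved: it is
  well defined on normalized complexes, it is bilinear, and \<open>AW\<close> is a left inverse of it.

  The other ingredients are that the normalized complex is a complex, that the free monoid on a
  complex is a monoid with the expected universal property, and that the iterated Alexander--Whitney
  maps are natural maps of complexes. All of these concern groups presented by generators and
  relations. The calculations are carried out with formal sums of words, where addition is that of a
  type, modulo an ideal of relations (\<open>trel\<close>).
\<close>

(* Cosets are handled through homomorphisms; the product of two cosets as a set is not unfolded. *)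
declare mult_FactGroup [simp del] one_FactGroup [simp del]

section \<open>Quotients and presentations of abelian groups\<close>

lemma induced_eq:
  assumes "x \<in> c" "\<And>y. y \<in> c \<Longrightarrow> h y = h x"
  shows "induced h c = h x"
proof -
  have "h ` c \<subseteq> {h x}" using assms(2) by blast
  then have "h ` c = {h x}" using assms(1) by blast
  then show ?thesis by (simp add: induced_def)
qed

lemma induced2_eq:
  assumes "x \<in> c" "y \<in> d" "\<And>x' y'. \<lbrakk>x' \<in> c; y' \<in> d\<rbrakk> \<Longrightarrow> h x' y' = h x y"
  shows "induced2 h c d = h x y"
proof -
  have "(\<lambda>(x, y). h x y) p \<in> {h x y}" if "p \<in> c \<times> d" for p
    using that by (cases p) (simp add: assms(3))
  then have "(\<lambda>(x, y). h x y) ` (c \<times> d) \<subseteq> {h x y}" by (rule image_subsetI)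
  moreover have "h x y \<in> (\<lambda>(x, y). h x y) ` (c \<times> d)" using assms(1,2) by (intro image_eqI[of _ _ "(x, y)"]) simp_all
  ultimately have "(\<lambda>(x, y). h x y) ` (c \<times> d) = {h x y}" by blast
  then show ?thesis by (simp add: induced2_def)
qed

lemma (in group_hom) hom_generate_one:
  assumes "B \<subseteq> carrier G" "\<And>b. b \<in> B \<Longrightarrow> h b = \<one>\<^bsub>H\<^esub>" "x \<in> generate G B"
  shows "h x = \<one>\<^bsub>H\<^esub>"
proof -
  have "generate G B \<subseteq> kernel G H h"
    by (rule G.generate_subgroup_incl) (use assms in \<open>auto simp: kernel_def subgroup_kernel[unfolded kernel_def]\<close>)
  then show ?thesis using assms by (auto simp: kernel_def)
qed

context
  fixes G :: "('a, 'm) monoid_scheme" and H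
  assumes G: "comm_group G" and H: "subgroup H G"
begin

interpretation G: comm_group G by (rule G)

lemma quotient_cls_hom: "(\<lambda>x. H #>\<^bsub>G\<^esub> x) \<in> hom G (G Mod H)"
  using normal.r_coset_hom_Mod[OF G.subgroup_imp_normal[OF H]] .

lemma quotient_comm_group: "comm_group (G Mod H)"
  by (rule G.abelian_FactGroup[OF H])

lemma quotient_cls_mem: "x \<in> carrier G \<Longrightarrow> x \<in> H #>\<^bsub>G\<^esub> x"
  by (simp add: G.rcos_self H)

lemma quotient_cls_eq_iff:
  assumes "x \<in> carrier G" "y \<in> carrier G"
  shows "H #>\<^bsub>G\<^esub> x = H #>\<^bsub>G\<^esub> y \<longleftrightarrow> x \<otimes>\<^bsub>G\<^esub> inv\<^bsub>G\<^esub> y \<in> H"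
proof -
  have "x \<otimes>\<^bsub>G\<^esub> inv\<^bsub>G\<^esub> y \<in> H \<longleftrightarrow> x \<in> H #>\<^bsub>G\<^esub> y"
    using subgroup.rcos_module[OF H G.is_group assms(2,1)] by simp
  also have "\<dots> \<longleftrightarrow> H #>\<^bsub>G\<^esub> x = H #>\<^bsub>G\<^esub> y"
    using G.repr_independence[OF _ assms(2) H] quotient_cls_mem[OF assms(1)] by metis
  finally show ?thesis by simp
qed

lemma quotient_cls_mem_iff:
  assumes "x \<in> carrier G" "y \<in> carrier G"
  shows "x \<in> H #>\<^bsub>G\<^esub> y \<longleftrightarrow> x \<otimes>\<^bsub>G\<^esub> inv\<^bsub>G\<^esub> y \<in> H"
  using subgroup.rcos_module[OF H G.is_group assms(2,1)] by simp

lemma quotient_cls_one_iff: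
  assumes "x \<in> carrier G" shows "H #>\<^bsub>G\<^esub> x = \<one>\<^bsub>G Mod H\<^esub> \<longleftrightarrow> x \<in> H"
  using G.coset_join1[OF _ assms H] G.coset_join2[OF assms H] subgroup.subset[OF H]
  by (auto simp: one_FactGroup)

lemma cls_subset_carrier: "x \<in> carrier G \<Longrightarrow> y \<in> H #>\<^bsub>G\<^esub> x \<Longrightarrow> y \<in> carrier G"
  using G.r_coset_subset_G[OF subgroup.subset[OF H]] by blast

text \<open>
  A map that is constant on cosets, and in particular a homomorphism that kills the subgroup, can be
  evaluated on any representative.
\<close>

lemma induced_cls_general:
  assumes "x \<in> carrier G" and "\<And>y. \<lbrakk>y \<in> carrier G; y \<otimes>\<^bsub>G\<^esub> inv\<^bsub>G\<^esub> x \<in> H\<rbrakk> \<Longrightarrow> h y = h x"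
  shows "induced h (H #>\<^bsub>G\<^esub> x) = h x"
proof (rule induced_eq)
  show "x \<in> H #>\<^bsub>G\<^esub> x" using assms(1) by (rule quotient_cls_mem)
  fix y assume y: "y \<in> H #>\<^bsub>G\<^esub> x"
  have c: "y \<in> carrier G" using cls_subset_carrier[OF assms(1) y] .
  then show "h y = h x" using assms(2)[OF c] y quotient_cls_mem_iff[OF c assms(1)] by simp
qed

lemma hom_eq_of_diff:
  assumes K: "group K" and h: "h \<in> hom G K" and one: "\<And>x. x \<in> H \<Longrightarrow> h x = \<one>\<^bsub>K\<^esub>"
    and x: "x \<in> carrier G" and y: "y \<in> carrier G" and d: "y \<otimes>\<^bsub>G\<^esub> inv\<^bsub>G\<^esub> x \<in> H"
  shows "h y = h x"
proof -
  interpret group_hom G K h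
    using h K by (simp add: G.is_group group_hom.intro group_hom_axioms.intro)
  have "h (y \<otimes>\<^bsub>G\<^esub> inv\<^bsub>G\<^esub> x) = \<one>\<^bsub>K\<^esub>" using one d .
  then have "h y \<otimes>\<^bsub>K\<^esub> inv\<^bsub>K\<^esub> h x = \<one>\<^bsub>K\<^esub>" using x y by simp
  then show ?thesis using x y
    by (metis H.inv_equality H.inv_inv hom_closed hom_inv G.inv_closed)
qed

lemma induced_cls:
  assumes "group K" "h \<in> hom G K" "\<And>x. x \<in> H \<Longrightarrow> h x = \<one>\<^bsub>K\<^esub>" "x \<in> carrier G"
  shows "induced h (H #>\<^bsub>G\<^esub> x) = h x"
  using assms by (intro induced_cls_general) (auto intro: hom_eq_of_diff)

lemma induced_hom:
  assumes K: "group K" and h: "h \<in> hom G K" and one: "\<And>x. x \<in> H \<Longrightarrow> h x = \<one>\<^bsub>K\<^esub>"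
  shows "induced h \<in> hom (G Mod H) K"
proof (rule homI)
  fix c assume "c \<in> carrier (G Mod H)"
  then show "induced h c \<in> carrier K"
    using assms hom_in_carrier[OF h] by (auto simp: carrier_FactGroup induced_cls)
next
  fix c d assume "c \<in> carrier (G Mod H)" "d \<in> carrier (G Mod H)"
  then obtain x y where xy: "x \<in> carrier G" "y \<in> carrier G" "c = H #>\<^bsub>G\<^esub> x" "d = H #>\<^bsub>G\<^esub> y"
    by (auto simp: carrier_FactGroup)
  then show "induced h (c \<otimes>\<^bsub>G Mod H\<^esub> d) = induced h c \<otimes>\<^bsub>K\<^esub> induced h d"
    using hom_mult[OF quotient_cls_hom xy(1,2)] hom_mult[OF h xy(1,2)]
    by (metis G.m_closed induced_cls[OF assms])
qed

lemma carrier_quotientE: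
  assumes "c \<in> carrier (G Mod H)" obtains x where "x \<in> carrier G" "c = H #>\<^bsub>G\<^esub> x"
  using assms by (auto simp: carrier_FactGroup)

end

lemma induced2_cls:
  assumes G: "comm_group G" and H: "subgroup H G" and G': "comm_group G'" and H': "subgroup H' G'"
    and K: "group K"
    and l: "\<And>y. y \<in> carrier G' \<Longrightarrow> (\<lambda>x. h x y) \<in> hom G K"
    and r: "\<And>x. x \<in> carrier G \<Longrightarrow> h x \<in> hom G' K"
    and l1: "\<And>x y. \<lbrakk>x \<in> H; y \<in> carrier G'\<rbrakk> \<Longrightarrow> h x y = \<one>\<^bsub>K\<^esub>"
    and r1: "\<And>x y. \<lbrakk>x \<in> carrier G; y \<in> H'\<rbrakk> \<Longrightarrow> h x y = \<one>\<^bsub>K\<^esub>"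
    and x: "x \<in> carrier G" and y: "y \<in> carrier G'"
  shows "induced2 h (H #>\<^bsub>G\<^esub> x) (H' #>\<^bsub>G'\<^esub> y) = h x y"
proof (rule induced2_eq)
  show "x \<in> H #>\<^bsub>G\<^esub> x" "y \<in> H' #>\<^bsub>G'\<^esub> y"
    by (simp_all add: assms quotient_cls_mem)
  fix x' y' assume x': "x' \<in> H #>\<^bsub>G\<^esub> x" and y': "y' \<in> H' #>\<^bsub>G'\<^esub> y"
  have c: "x' \<in> carrier G" "y' \<in> carrier G'"
    using cls_subset_carrier[OF G H x x'] cls_subset_carrier[OF G' H' y y'] .
  have "h x' y' = h x y'"
    using hom_eq_of_diff[OF G H K l[OF c(2)] l1 x c(1)] c x' by (simp add: quotient_cls_mem_iff[OF G H] x)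
  also have "\<dots> = h x y"
    using hom_eq_of_diff[OF G' H' K r[OF x] r1 y c(2)] c y' x by (simp add: quotient_cls_mem_iff[OF G' H'] y)
  finally show "h x' y' = h x y" .
qed

subsection \<open>Linear extension\<close>

lemma image_keys_frag_extend:
  assumes "\<And>a. a \<in> Poly_Mapping.keys c \<Longrightarrow> f ` Poly_Mapping.keys (g a) \<subseteq> C"
  shows "f ` Poly_Mapping.keys (frag_extend g c) \<subseteq> C"
proof (rule image_subsetI)
  fix x assume "x \<in> Poly_Mapping.keys (frag_extend g c)"
  then obtain a where "a \<in> Poly_Mapping.keys c" "x \<in> Poly_Mapping.keys (g a)"
    using keys_frag_extend[of g c] by blast
  then show "f x \<in> C" using assms by blast
qed

lemma keys_frag_extend_subset:
  assumes "\<And>a. a \<in> Poly_Mapping.keys c \<Longrightarrow> Poly_Mapping.keys (g a) \<subseteq> T"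
  shows "Poly_Mapping.keys (frag_extend g c) \<subseteq> T"
  using image_keys_frag_extend[of c "\<lambda>x. x" g T] assms by simp

lemmas frag_keys_induct = free_Abelian_group_induct [consumes 1, case_names zero diff gen]

context comm_group
begin

lemma commutator_one: "\<lbrakk>a \<in> carrier G; b \<in> carrier G\<rbrakk> \<Longrightarrow> a \<otimes> b \<otimes> inv a \<otimes> inv b = \<one>"
proof -
  assume ab: "a \<in> carrier G" "b \<in> carrier G"
  then have "a \<otimes> b \<otimes> inv a \<otimes> inv b = (a \<otimes> b) \<otimes> inv (a \<otimes> b)"
    by (simp add: m_assoc inv_mult)
  then show ?thesis using ab by simp
qed

lemma lin_ext_superset:
  assumes "Poly_Mapping.keys c \<subseteq> A" "finite A" "f ` A \<subseteq> carrier G"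
  shows "lin_ext G f c = finprod G (\<lambda>a. f a [^] Poly_Mapping.lookup c a) A"
  unfolding lin_ext_def
  by (rule finprod_mono_neutral_cong_left) (use assms in \<open>auto simp: in_keys_iff\<close>)

lemma lin_ext_closed:
  assumes "f ` Poly_Mapping.keys c \<subseteq> carrier G" shows "lin_ext G f c \<in> carrier G"
  unfolding lin_ext_def by (rule finprod_closed) (use assms in auto)

lemma lin_ext_cong:
  assumes "\<And>a. a \<in> Poly_Mapping.keys c \<Longrightarrow> f a = g a" "g ` Poly_Mapping.keys c \<subseteq> carrier G"
  shows "lin_ext G f c = lin_ext G g c"
  unfolding lin_ext_def by (rule finprod_cong') (use assms in auto)

lemma lin_ext_0 [simp]: "lin_ext G f 0 = \<one>"
  by (simp add: lin_ext_def)

lemma lin_ext_frag_of [simp]: "f a \<in> carrier G \<Longrightarrow> lin_ext G f (frag_of a) = f a"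
  by (simp add: lin_ext_def)

lemma lin_ext_add:
  assumes "f ` Poly_Mapping.keys c \<subseteq> carrier G" "f ` Poly_Mapping.keys d \<subseteq> carrier G"
  shows "lin_ext G f (c + d) = lin_ext G f c \<otimes> lin_ext G f d"
proof -
  let ?A = "Poly_Mapping.keys c \<union> Poly_Mapping.keys d"
  have A: "finite ?A" "f ` ?A \<subseteq> carrier G" using assms by auto
  have "lin_ext G f (c + d) = finprod G (\<lambda>a. f a [^] Poly_Mapping.lookup (c + d) a) ?A"
    using A by (intro lin_ext_superset) (use keys_add[of c d] in auto)
  also have "\<dots> = finprod G (\<lambda>a. f a [^] Poly_Mapping.lookup c a \<otimes> f a [^] Poly_Mapping.lookup d a) ?A"
    using A by (intro finprod_cong') (auto simp: lookup_add int_pow_mult)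
  also have "\<dots> = finprod G (\<lambda>a. f a [^] Poly_Mapping.lookup c a) ?A
      \<otimes> finprod G (\<lambda>a. f a [^] Poly_Mapping.lookup d a) ?A"
    using A by (intro finprod_multf) auto
  also have "\<dots> = lin_ext G f c \<otimes> lin_ext G f d"
    using A by (simp add: lin_ext_superset[of _ ?A])
  finally show ?thesis .
qed

lemma lin_ext_hom:
  assumes "f ` S \<subseteq> carrier G" shows "lin_ext G f \<in> hom (free_Abelian_group S) G"
proof (rule homI)
  fix c assume "c \<in> carrier (free_Abelian_group S)"
  then have "f ` Poly_Mapping.keys c \<subseteq> carrier G" using assms by auto
  then show "lin_ext G f c \<in> carrier G" by (rule lin_ext_closed)
next
  fix c d assume "c \<in> carrier (free_Abelian_group S)" "d \<in> carrier (free_Abelian_group S)"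
  then have "f ` Poly_Mapping.keys c \<subseteq> carrier G" "f ` Poly_Mapping.keys d \<subseteq> carrier G"
    using assms by auto
  then show "lin_ext G f (c \<otimes>\<^bsub>free_Abelian_group S\<^esub> d) = lin_ext G f c \<otimes> lin_ext G f d"
    by (simp add: lin_ext_add)
qed

lemma lin_ext_group_hom:
  assumes "f ` S \<subseteq> carrier G" shows "group_hom (free_Abelian_group S) G (lin_ext G f)"
  using lin_ext_hom[OF assms] by (simp add: group_hom_def group_hom_axioms_def)

lemma lin_ext_diff:
  assumes "f ` Poly_Mapping.keys c \<subseteq> carrier G" "f ` Poly_Mapping.keys d \<subseteq> carrier G"
  shows "lin_ext G f (c - d) = lin_ext G f c \<otimes> inv lin_ext G f d"
proof -
  interpret h: group_hom "free_Abelian_group (Poly_Mapping.keys c \<union> Poly_Mapping.keys d)" G "lin_ext G f"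
    by (rule lin_ext_group_hom) (use assms in auto)
  have "lin_ext G f (c + - d) = lin_ext G f c \<otimes> lin_ext G f (- d)"
    using assms by (intro lin_ext_add) auto
  also have "lin_ext G f (- d) = inv lin_ext G f d"
    using h.hom_inv[of d] by simp
  finally show ?thesis by simp
qed

lemma lin_ext_cmul:
  assumes "f ` Poly_Mapping.keys c \<subseteq> carrier G"
  shows "lin_ext G f (frag_cmul n c) = lin_ext G f c [^] n"
proof -
  interpret h: group_hom "free_Abelian_group (Poly_Mapping.keys c)" G "lin_ext G f"
    by (rule lin_ext_group_hom) (use assms in auto)
  show ?thesis using h.hom_int_pow[of c n] by simp
qed

lemma lin_ext_sum:
  assumes "finite I" "\<And>i. i \<in> I \<Longrightarrow> f ` Poly_Mapping.keys (c i) \<subseteq> carrier G"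
  shows "lin_ext G f (\<Sum>i\<in>I. c i) = finprod G (\<lambda>i. lin_ext G f (c i)) I"
  using assms
proof (induction I rule: finite_induct)
  case (insert i I)
  have "f ` Poly_Mapping.keys (sum c I) \<subseteq> carrier G"
    using insert.prems keys_sum[of c I] by fastforce
  moreover have "(\<lambda>i. lin_ext G f (c i)) \<in> I \<rightarrow> carrier G"
    using insert.prems by (auto intro!: lin_ext_closed)
  ultimately show ?case
    using insert by (simp add: lin_ext_add lin_ext_closed)
qed simp

lemma lin_ext_signed_sum:
  assumes "finite I" "\<And>i. i \<in> I \<Longrightarrow> f (s i) \<in> carrier G"
  shows "lin_ext G f (\<Sum>i\<in>I. frag_cmul (n i) (frag_of (s i))) = finprod G (\<lambda>i. f (s i) [^] n i) I"
proof -
  have "lin_ext G f (\<Sum>i\<in>I. frag_cmul (n i) (frag_of (s i)))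
      = finprod G (\<lambda>i. lin_ext G f (frag_cmul (n i) (frag_of (s i)))) I"
    using assms keys_cmul by (intro lin_ext_sum) fastforce+
  also have "\<dots> = finprod G (\<lambda>i. f (s i) [^] n i) I"
    using assms by (intro finprod_cong') (auto simp: lin_ext_cmul)
  finally show ?thesis .
qed

lemma hom_lin_ext:
  assumes K: "comm_group K" and h: "h \<in> hom G K" and f: "f ` Poly_Mapping.keys c \<subseteq> carrier G"
  shows "h (lin_ext G f c) = lin_ext K (\<lambda>a. h (f a)) c"
proof -
  interpret K: comm_group K by (rule K)
  interpret h: group_hom G K h using h by (simp add: group_hom_def group_hom_axioms_def)
  define S' where "S' = Poly_Mapping.keys c"
  have hf: "(\<lambda>a. h (f a)) ` S' \<subseteq> carrier K" using f by (auto simp: S'_def)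
  have f': "f ` S' \<subseteq> carrier G" using f by (simp add: S'_def)
  have "Poly_Mapping.keys c \<subseteq> S'" by (simp add: S'_def)
  then show ?thesis
  proof (induction c rule: frag_keys_induct)
    case (diff x y)
    have "f ` Poly_Mapping.keys x \<subseteq> carrier G" "f ` Poly_Mapping.keys y \<subseteq> carrier G"
      "(\<lambda>a. h (f a)) ` Poly_Mapping.keys x \<subseteq> carrier K" "(\<lambda>a. h (f a)) ` Poly_Mapping.keys y \<subseteq> carrier K"
      using f' hf diff.hyps(1,2) by blast+
    then show ?case using diff by (simp add: lin_ext_diff K.lin_ext_diff lin_ext_closed)
  qed (use f' in auto)
qed

text \<open>
  Formal substitution followed by evaluation is evaluation of the substituted letters. Through this
  rule an identity between homomorphisms is reduced to one between formal sums, which live in a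
  type with ordinary addition.
\<close>

lemma lin_ext_frag_extend:
  assumes "\<And>a. a \<in> Poly_Mapping.keys c \<Longrightarrow> f ` Poly_Mapping.keys (g a) \<subseteq> carrier G"
  shows "lin_ext G f (frag_extend g c) = lin_ext G (\<lambda>a. lin_ext G f (g a)) c"
proof -
  define S' where "S' = Poly_Mapping.keys c"
  have gc: "(\<lambda>a. lin_ext G f (g a)) ` S' \<subseteq> carrier G"
    using assms by (auto simp: S'_def intro: lin_ext_closed)
  have g: "f ` Poly_Mapping.keys (g a) \<subseteq> carrier G" if "a \<in> S'" for a
    using assms that by (simp add: S'_def)
  have "Poly_Mapping.keys c \<subseteq> S'" by (simp add: S'_def)
  then show ?thesis
  proof (induction c rule: frag_keys_induct)
    case (diff x y)
    have "f ` Poly_Mapping.keys (frag_extend g x) \<subseteq> carrier G" "f ` Poly_Mapping.keys (frag_extend g y) \<subseteq> carrier G"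
      by (rule image_keys_frag_extend, use g diff.hyps(1,2) in blast)+
    moreover have "(\<lambda>a. lin_ext G f (g a)) ` Poly_Mapping.keys x \<subseteq> carrier G"
       "(\<lambda>a. lin_ext G f (g a)) ` Poly_Mapping.keys y \<subseteq> carrier G"
      using gc diff.hyps(1,2) by blast+
    ultimately show ?case using diff by (simp add: frag_extend_diff lin_ext_diff)
  qed (use gc in auto)
qed

end

subsection \<open>Presented abelian groups\<close>

locale presentation =
  fixes S :: "'a set" and R :: "('a \<Rightarrow>\<^sub>0 int) set"
  assumes relator_keys: "r \<in> R \<Longrightarrow> Poly_Mapping.keys r \<subseteq> S"
begin

abbreviation F where "F \<equiv> free_Abelian_group S"
abbreviation Rel where "Rel \<equiv> generate F R"
abbreviation Q where "Q \<equiv> F Mod Rel"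
abbreviation cls where "cls c \<equiv> Rel #>\<^bsub>F\<^esub> c"

sublocale F: comm_group F by (rule abelian_free_Abelian_group)

lemma relators_carrier: "R \<subseteq> carrier F" using relator_keys by auto

lemma Rel_subgroup: "subgroup Rel F"
  by (rule F.generate_is_subgroup[OF relators_carrier])

sublocale Q: comm_group Q by (rule quotient_comm_group[OF F.comm_group_axioms Rel_subgroup])

lemma Rel_keys: "c \<in> Rel \<Longrightarrow> Poly_Mapping.keys c \<subseteq> S"
  using subgroup.subset[OF Rel_subgroup] by (metis carrier_free_Abelian_group_iff subsetD)

lemma Rel_0 [simp]: "0 \<in> Rel" using subgroup.one_closed[OF Rel_subgroup] by simp

lemma Rel_add: "c \<in> Rel \<Longrightarrow> d \<in> Rel \<Longrightarrow> c + d \<in> Rel"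
  using subgroup.m_closed[OF Rel_subgroup] by simp

lemma Rel_minus: "c \<in> Rel \<Longrightarrow> - c \<in> Rel"
  using subgroup.m_inv_closed[OF Rel_subgroup] Rel_keys by fastforce

lemma Rel_diff: "c \<in> Rel \<Longrightarrow> d \<in> Rel \<Longrightarrow> c - d \<in> Rel"
  using Rel_add[OF _ Rel_minus] by fastforce

lemma Rel_relator: "r \<in> R \<Longrightarrow> r \<in> Rel" by (rule generate.incl)

lemma cls_hom: "cls \<in> hom F Q"
  by (rule quotient_cls_hom[OF F.comm_group_axioms Rel_subgroup])

lemma cls_closed: "Poly_Mapping.keys c \<subseteq> S \<Longrightarrow> cls c \<in> carrier Q"
  using hom_in_carrier[OF cls_hom] by simp

lemma cls_add: "\<lbrakk>Poly_Mapping.keys c \<subseteq> S; Poly_Mapping.keys d \<subseteq> S\<rbrakk> \<Longrightarrow> cls (c + d) = cls c \<otimes>\<^bsub>Q\<^esub> cls d"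
  using hom_mult[OF cls_hom, of c d] by simp

lemma cls_group_hom: "group_hom F Q cls"
  using cls_hom by (simp add: group_hom_def group_hom_axioms_def)

lemma cls_0: "cls 0 = \<one>\<^bsub>Q\<^esub>"
  using group_hom.hom_one[OF cls_group_hom] by simp

lemma cls_cmul: "Poly_Mapping.keys c \<subseteq> S \<Longrightarrow> cls (frag_cmul n c) = cls c [^]\<^bsub>Q\<^esub> n"
  using group_hom.hom_int_pow[OF cls_group_hom, of c n] by simp

lemma cls_diff:
  "\<lbrakk>Poly_Mapping.keys c \<subseteq> S; Poly_Mapping.keys d \<subseteq> S\<rbrakk> \<Longrightarrow> cls (c - d) = cls c \<otimes>\<^bsub>Q\<^esub> inv\<^bsub>Q\<^esub> cls d"
  using cls_add[of c "- d"] group_hom.hom_inv[OF cls_group_hom, of d] by simp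

lemma cls_eq_iff:
  assumes "Poly_Mapping.keys c \<subseteq> S" "Poly_Mapping.keys d \<subseteq> S"
  shows "cls c = cls d \<longleftrightarrow> c - d \<in> Rel"
  using quotient_cls_eq_iff[OF F.comm_group_axioms Rel_subgroup, of c d] assms by simp

lemma cls_one_iff:
  assumes "Poly_Mapping.keys c \<subseteq> S"
  shows "cls c = \<one>\<^bsub>Q\<^esub> \<longleftrightarrow> c \<in> Rel"
  using quotient_cls_one_iff[OF F.comm_group_axioms Rel_subgroup, of c] assms by simp

lemma cls_cases:
  assumes "q \<in> carrier Q" obtains c where "Poly_Mapping.keys c \<subseteq> S" "q = cls c"
  using assms carrier_quotientE[OF F.comm_group_axioms Rel_subgroup assms] by auto

lemma Q_hom_eqI:
  assumes K: "group K" and h: "h \<in> hom Q K" "h' \<in> hom Q K"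
    and eq: "\<And>s. s \<in> S \<Longrightarrow> h (cls (frag_of s)) = h' (cls (frag_of s))" and q: "q \<in> carrier Q"
  shows "h q = h' q"
proof -
  interpret h: group_hom Q K h using h K by (simp add: group_hom_def group_hom_axioms_def)
  interpret h': group_hom Q K h' using h K by (simp add: group_hom_def group_hom_axioms_def)
  obtain c where c: "Poly_Mapping.keys c \<subseteq> S" "q = cls c" using q by (rule cls_cases)
  from c(1) have "h (cls c) = h' (cls c)"
  proof (induction c rule: frag_keys_induct)
    case zero show ?case unfolding cls_0 by simp
  next
    case (diff x y) then show ?case by (simp add: cls_diff cls_closed)
  qed (use eq in auto)
  then show ?thesis using c by simp
qed

lemma lift_kills:
  assumes K: "comm_group K" and f: "f ` S \<subseteq> carrier K"
    and rel: "\<And>r. r \<in> R \<Longrightarrow> lin_ext K f r = \<one>\<^bsub>K\<^esub>" and c: "c \<in> Rel"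
  shows "lin_ext K f c = \<one>\<^bsub>K\<^esub>"
  using group_hom.hom_generate_one[OF comm_group.lin_ext_group_hom[OF K f] relators_carrier rel c] .

lemma lift_hom:
  assumes K: "comm_group K" and f: "f ` S \<subseteq> carrier K"
    and rel: "\<And>r. r \<in> R \<Longrightarrow> lin_ext K f r = \<one>\<^bsub>K\<^esub>"
  shows "induced (lin_ext K f) \<in> hom Q K"
  using induced_hom[OF F.comm_group_axioms Rel_subgroup comm_group.axioms(2)[OF K]
      comm_group.lin_ext_hom[OF K f] lift_kills[OF assms]] .

lemma lift_cls:
  assumes K: "comm_group K" and f: "f ` S \<subseteq> carrier K"
    and rel: "\<And>r. r \<in> R \<Longrightarrow> lin_ext K f r = \<one>\<^bsub>K\<^esub>" and c: "Poly_Mapping.keys c \<subseteq> S"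
  shows "induced (lin_ext K f) (cls c) = lin_ext K f c"
  using induced_cls[OF F.comm_group_axioms Rel_subgroup comm_group.axioms(2)[OF K]
      comm_group.lin_ext_hom[OF K f] lift_kills[OF assms(1-3)]] c by simp

text \<open>
  A homomorphism into a presented group that is given on generators by formal sums is computed by
  formal substitution.
\<close>

lemma lin_ext_cls:
  assumes "\<And>a. a \<in> Poly_Mapping.keys c \<Longrightarrow> Poly_Mapping.keys (g a) \<subseteq> S"
  shows "lin_ext Q (\<lambda>a. cls (g a)) c = cls (frag_extend g c)"
proof -
  define S' where "S' = Poly_Mapping.keys c"
  have gc: "(\<lambda>a. cls (g a)) ` S' \<subseteq> carrier Q"
    using assms by (auto simp: S'_def intro!: cls_closed)
  have g: "Poly_Mapping.keys (g a) \<subseteq> S" if "a \<in> S'" for a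
    using assms that by (simp add: S'_def)
  have "Poly_Mapping.keys c \<subseteq> S'" by (simp add: S'_def)
  then show ?thesis
  proof (induction c rule: frag_keys_induct)
    case zero show ?case using cls_0 by simp
  next
    case (diff x y)
    have "Poly_Mapping.keys (frag_extend g x) \<subseteq> S" "Poly_Mapping.keys (frag_extend g y) \<subseteq> S"
      by (rule keys_frag_extend_subset, use g diff.hyps(1,2) in blast)+
    moreover have "(\<lambda>a. cls (g a)) ` Poly_Mapping.keys x \<subseteq> carrier Q"
       "(\<lambda>a. cls (g a)) ` Poly_Mapping.keys y \<subseteq> carrier Q"
      using gc diff.hyps(1,2) by blast+
    ultimately show ?case using diff by (simp add: frag_extend_diff Q.lin_ext_diff cls_diff)
  qed (use g cls_closed in \<open>auto intro!: Q.lin_ext_frag_of\<close>)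
qed

end

section \<open>The free monoid on a complex\<close>

subsection \<open>Concatenation of formal sums of words\<close>

lemma frag_cmul_diff2: "frag_cmul n (a - b) = frag_cmul n a - frag_cmul n b"
  by (rule poly_mapping_eqI) (simp add: lookup_minus right_diff_distrib)

lemma concat_prod_of [simp]: "concat_prod (frag_of u) (frag_of v) = frag_of (u @ v)"
  by (simp add: concat_prod_def)

lemma concat_prod_0_left [simp]: "concat_prod 0 d = 0"
  by (simp add: concat_prod_def)

lemma concat_prod_diff_left: "concat_prod (c - c') d = concat_prod c d - concat_prod c' d"
  by (simp add: concat_prod_def frag_extend_diff)

lemma concat_prod_add_left: "concat_prod (c + c') d = concat_prod c d + concat_prod c' d"
  by (simp add: concat_prod_def frag_extend_add)

lemma concat_prod_cmul_left: "concat_prod (frag_cmul n c) d = frag_cmul n (concat_prod c d)"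
  by (simp add: concat_prod_def frag_extend_cmul)

lemma concat_prod_of_left: "concat_prod (frag_of u) d = frag_extend (\<lambda>v. frag_of (u @ v)) d"
  by (simp add: concat_prod_def)

lemma concat_prod_0_right [simp]: "concat_prod c 0 = 0"
  by (simp add: concat_prod_def frag_extend_eq_0)

lemma concat_prod_diff_right: "concat_prod c (d - d') = concat_prod c d - concat_prod c d'"
  by (induction c rule: frag_induction[OF subset_UNIV])
    (auto simp: concat_prod_diff_left concat_prod_of_left frag_extend_diff)

lemma concat_prod_add_right: "concat_prod c (d + d') = concat_prod c d + concat_prod c d'"
  by (induction c rule: frag_induction[OF subset_UNIV])
    (auto simp: concat_prod_diff_left concat_prod_of_left frag_extend_add)

lemma concat_prod_cmul_right: "concat_prod c (frag_cmul n d) = frag_cmul n (concat_prod c d)"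
proof (induction c rule: frag_induction[OF subset_UNIV])
  case (3 a b)
  then show ?case by (simp add: concat_prod_diff_left frag_cmul_diff2)
qed (auto simp: concat_prod_of_left frag_extend_cmul)

lemma concat_prod_sum_right: "concat_prod c (sum d I) = (\<Sum>i\<in>I. concat_prod c (d i))"
  by (induction I rule: infinite_finite_induct) (auto simp: concat_prod_add_right)

lemma concat_prod_assoc: "concat_prod (concat_prod c d) e = concat_prod c (concat_prod d e)"
proof (induction c rule: frag_induction[OF subset_UNIV])
  case (2 u)
  show ?case
  proof (induction d rule: frag_induction[OF subset_UNIV])
    case (2 v)
    show ?case
      by (induction e rule: frag_induction[OF subset_UNIV]) (auto simp: concat_prod_diff_right)
  qed (auto simp: concat_prod_diff_right concat_prod_diff_left)
qed (auto simp: concat_prod_diff_left)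

lemma concat_prod_Nil_left [simp]: "concat_prod (frag_of []) d = d"
  using frag_expansion[of d] by (simp add: concat_prod_of_left)

lemma concat_prod_Nil_right [simp]: "concat_prod c (frag_of []) = c"
  using frag_expansion[of c] by (simp add: concat_prod_def)

lemma keys_concat_prod:
  "Poly_Mapping.keys (concat_prod c d) \<subseteq> {u @ v | u v. u \<in> Poly_Mapping.keys c \<and> v \<in> Poly_Mapping.keys d}"
  unfolding concat_prod_def by (intro keys_frag_extend_subset) auto

lemmas concat_prod_simps =
  concat_prod_diff_left concat_prod_add_left concat_prod_cmul_left
  concat_prod_diff_right concat_prod_add_right concat_prod_cmul_right concat_prod_assoc

lemmas frag_extend_simps = frag_extend_diff frag_extend_add frag_extend_cmul

subsection \<open>Words with letters in a complex\<close>

lemma wdeg_simps [simp]: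
  "wdeg [] = 0" "wdeg ((i, v) # w) = i + wdeg w" "wdeg (u @ w) = wdeg u + wdeg w"
  by (simp_all add: wdeg_def)

definition letters :: "('a, 'm) cpx_scheme \<Rightarrow> (nat \<times> 'a) set" where
  "letters V = {(i, v). v \<in> carrier (grp V i)}"

lemma letters_iff [simp]: "(i, v) \<in> letters V \<longleftrightarrow> v \<in> carrier (grp V i)"
  by (simp add: letters_def)

lemma gwords_iff: "w \<in> gwords V k \<longleftrightarrow> w \<in> lists (letters V) \<and> wdeg w = k"
  unfolding gwords_def letters_def by (auto simp: lists_eq_set)

text \<open>
  The multilinearity relations of all degrees at once. They form a two-sided ideal for
  concatenation, and their part of degree \<open>k\<close> is \<^const>\<open>gtensor_rel\<close>. Two formal
  sums represent the same tensor if their difference lies in \<open>trel\<close>, and this can be checked with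
  ordinary additive calculations that do not track degrees.
\<close>

inductive_set trel :: "('a, 'm) cpx_scheme \<Rightarrow> ((nat \<times> 'a) list \<Rightarrow>\<^sub>0 int) set"
  for V :: "('a, 'm) cpx_scheme" where
  zero: "0 \<in> trel V"
| multilinear: "\<lbrakk>us \<in> lists (letters V); vs \<in> lists (letters V); x \<in> carrier (grp V i); y \<in> carrier (grp V i)\<rbrakk> \<Longrightarrow>
    frag_of (us @ (i, x \<otimes>\<^bsub>grp V i\<^esub> y) # vs) - frag_of (us @ (i, x) # vs)
      - frag_of (us @ (i, y) # vs) \<in> trel V"
| diff: "\<lbrakk>a \<in> trel V; b \<in> trel V\<rbrakk> \<Longrightarrow> a - b \<in> trel V"

declare trel.zero [simp]

lemma trel_minus: "a \<in> trel V \<Longrightarrow> - a \<in> trel V"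
  using trel.diff[OF trel.zero, of a] by simp

lemma trel_add: "\<lbrakk>a \<in> trel V; b \<in> trel V\<rbrakk> \<Longrightarrow> a + b \<in> trel V"
  using trel.diff[OF _ trel_minus, of a V b] by simp

lemma trel_cmul: "a \<in> trel V \<Longrightarrow> frag_cmul n a \<in> trel V"
  by (rule frag_closure_minus_cmul) (auto intro: trel.diff)

lemma trel_sum: "(\<And>i. i \<in> I \<Longrightarrow> c i \<in> trel V) \<Longrightarrow> sum c I \<in> trel V"
  by (induction I rule: infinite_finite_induct) (auto intro: trel_add)

lemma trel_concat_left:
  assumes a: "a \<in> trel V" and c: "Poly_Mapping.keys c \<subseteq> lists (letters V)"
  shows "concat_prod c a \<in> trel V"
  using c
proof (induction c rule: frag_keys_induct)
  case (gen u)
  show ?case using a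
  proof induction
    case (multilinear us vs x i y)
    then show ?case using gen trel.multilinear[of "u @ us" V vs x i y] by (simp add: concat_prod_diff_right)
  qed (auto simp: concat_prod_diff_right intro: trel.diff)
qed (auto simp: concat_prod_diff_left intro: trel.diff)

lemma trel_concat_right:
  assumes a: "a \<in> trel V" and c: "Poly_Mapping.keys c \<subseteq> lists (letters V)"
  shows "concat_prod a c \<in> trel V"
  using c
proof (induction c rule: frag_keys_induct)
  case (gen u)
  show ?case using a
  proof induction
    case (multilinear us vs x i y)
    then show ?case using gen trel.multilinear[of us V "vs @ u" x i y] by (simp add: concat_prod_diff_left)
  qed (auto simp: concat_prod_diff_left intro: trel.diff)
qed (auto simp: concat_prod_diff_right intro: trel.diff)

lemma trel_letter:
  "\<lbrakk>x \<in> carrier (grp V i); y \<in> carrier (grp V i)\<rbrakk> \<Longrightarrow>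
    frag_of [(i, x \<otimes>\<^bsub>grp V i\<^esub> y)] - frag_of [(i, x)] - frag_of [(i, y)] \<in> trel V"
  using trel.multilinear[of "[]" V "[]" x i y] by simp

definition gtensor_relators :: "('a, 'm) cpx_scheme \<Rightarrow> nat \<Rightarrow> ((nat \<times> 'a) list \<Rightarrow>\<^sub>0 int) set" where
  "gtensor_relators V k = {frag_of (us @ (i, x \<otimes>\<^bsub>grp V i\<^esub> y) # vs) - frag_of (us @ (i, x) # vs)
        - frag_of (us @ (i, y) # vs) | us i x y vs.
        x \<in> carrier (grp V i) \<and> y \<in> carrier (grp V i) \<and> us @ (i, x) # vs \<in> gwords V k}"

lemma gtensor_rel_presented:
  "gtensor_rel V k = generate (free_Abelian_group (gwords V k)) (gtensor_relators V k)"
  by (simp add: gtensor_rel_def gtensor_relators_def)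

locale graded_group =
  fixes V :: "('a, 'm) cpx_scheme"
  assumes graded_comm_group: "comm_group (grp V k)"

sublocale cochain_complex \<subseteq> graded_group
  by (intro graded_group.intro grp_comm_group)

context graded_group
begin

lemma grp_m_closed [simp]: "\<lbrakk>x \<in> carrier (grp V i); y \<in> carrier (grp V i)\<rbrakk> \<Longrightarrow> x \<otimes>\<^bsub>grp V i\<^esub> y \<in> carrier (grp V i)"
  using graded_comm_group[of i] by (simp add: comm_group_def group.is_monoid monoid.m_closed)

lemma grp_one_closed [simp]: "\<one>\<^bsub>grp V i\<^esub> \<in> carrier (grp V i)"
  using graded_comm_group[of i] by (simp add: comm_group_def group.is_monoid monoid.one_closed)

lemma gtensor_presentation: "presentation (gwords V k) (gtensor_relators V k)"
proof
  fix r assume "r \<in> gtensor_relators V k"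
  then obtain us i x y vs where r: "r = frag_of (us @ (i, x \<otimes>\<^bsub>grp V i\<^esub> y) # vs) - frag_of (us @ (i, x) # vs)
        - frag_of (us @ (i, y) # vs)" "x \<in> carrier (grp V i)" "y \<in> carrier (grp V i)" "us @ (i, x) # vs \<in> gwords V k"
    unfolding gtensor_relators_def by blast
  then have "{us @ (i, x \<otimes>\<^bsub>grp V i\<^esub> y) # vs, us @ (i, x) # vs, us @ (i, y) # vs} \<subseteq> gwords V k"
    by (auto simp: gwords_iff)
  then show "Poly_Mapping.keys r \<subseteq> gwords V k"
    using keys_diff[of "frag_of (us @ (i, x \<otimes>\<^bsub>grp V i\<^esub> y) # vs) - frag_of (us @ (i, x) # vs)" "frag_of (us @ (i, y) # vs)"]
      keys_diff[of "frag_of (us @ (i, x \<otimes>\<^bsub>grp V i\<^esub> y) # vs)" "frag_of (us @ (i, x) # vs)"]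
    unfolding r by auto
qed

sublocale T: presentation "gwords V k" "gtensor_relators V k" for k
  by (rule gtensor_presentation)

lemma gtensor_eq: "gtensor V k = T.Q k"
  by (simp add: gtensor_def gtensor_rel_presented)

lemma gtensor_cls_eq: "gtensor_cls V k c = T.cls k c"
  by (simp add: gtensor_cls_def gtensor_rel_presented)

lemma gtensor_comm_group: "comm_group (gtensor V k)"
  unfolding gtensor_eq by (rule T.Q.comm_group_axioms)

lemma one_in_trel:
  assumes "us \<in> lists (letters V)" "vs \<in> lists (letters V)"
  shows "frag_of (us @ (i, \<one>\<^bsub>grp V i\<^esub>) # vs) \<in> trel V"
proof -
  have "\<one>\<^bsub>grp V i\<^esub> \<otimes>\<^bsub>grp V i\<^esub> \<one>\<^bsub>grp V i\<^esub> = \<one>\<^bsub>grp V i\<^esub>"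
    using graded_comm_group[of i] by (simp add: comm_group_def group.is_monoid monoid.l_one)
  then show ?thesis
    using trel_minus[OF trel.multilinear[OF assms, of "\<one>\<^bsub>grp V i\<^esub>" i "\<one>\<^bsub>grp V i\<^esub>"]] by simp
qed

text \<open>Discarding the words of the wrong degree maps a relation to a relation of degree \<open>k\<close>.\<close>

lemma trel_imp_gtensor_rel:
  assumes "c \<in> trel V" "Poly_Mapping.keys c \<subseteq> gwords V k"
  shows "c \<in> gtensor_rel V k"
proof -
  let ?p = "frag_extend (\<lambda>w. if wdeg w = k then frag_of w else 0)"
  have "?p c \<in> T.Rel k" using assms(1)
  proof induction
    case (multilinear us vs x i y)
    let ?r = "frag_of (us @ (i, x \<otimes>\<^bsub>grp V i\<^esub> y) # vs) - frag_of (us @ (i, x) # vs) - frag_of (us @ (i, y) # vs)"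
    show ?case
    proof (cases "wdeg us + (i + wdeg vs) = k")
      case True
      then have "?r \<in> gtensor_relators V k"
        using multilinear unfolding gtensor_relators_def by (intro CollectI exI) (auto simp: gwords_iff)
      then show ?thesis using True T.Rel_relator by (simp add: frag_extend_diff)
    qed (simp add: frag_extend_diff)
  qed (auto simp: frag_extend_diff intro: T.Rel_diff)
  moreover have "?p c = frag_extend frag_of c"
    using assms(2) by (intro frag_extend_eq) (auto simp: gwords_iff)
  ultimately show ?thesis
    using frag_expansion[of c] by (simp add: gtensor_rel_presented)
qed

lemma gtensor_rel_subset_trel: "gtensor_rel V k \<subseteq> trel V"
proof
  fix c assume "c \<in> gtensor_rel V k"
  then have "c \<in> T.Rel k" by (simp add: gtensor_rel_presented)
  then show "c \<in> trel V"
  proof induction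
    case (incl h)
    then show ?case by (auto simp: gtensor_relators_def gwords_iff intro: trel.multilinear)
  next
    case (inv h)
    then have "h \<in> trel V" by (auto simp: gtensor_relators_def gwords_iff intro: trel.multilinear)
    moreover have "inv\<^bsub>free_Abelian_group (gwords V k)\<^esub> h = - h"
      using T.relator_keys[OF inv] by (rule inv_free_Abelian_group)
    ultimately show ?case by (simp add: trel_minus)
  qed (auto intro: trel_add)
qed

lemma gtensor_cls_eqI:
  assumes "c - d \<in> trel V" "Poly_Mapping.keys c \<subseteq> gwords V k" "Poly_Mapping.keys d \<subseteq> gwords V k"
  shows "gtensor_cls V k c = gtensor_cls V k d"
proof -
  have "Poly_Mapping.keys (c - d) \<subseteq> gwords V k" using keys_diff[of c d] assms by blast
  then show ?thesis
    using trel_imp_gtensor_rel[OF assms(1)] assms(2,3)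
    by (simp add: gtensor_cls_eq T.cls_eq_iff gtensor_rel_presented)
qed

lemma gtensor_cls_one:
  assumes "c \<in> trel V" "Poly_Mapping.keys c \<subseteq> gwords V k"
  shows "gtensor_cls V k c = \<one>\<^bsub>gtensor V k\<^esub>"
  using trel_imp_gtensor_rel[OF assms] assms(2)
  by (simp add: gtensor_cls_eq gtensor_eq T.cls_one_iff gtensor_rel_presented)

lemma concat_prod_gwords:
  "\<lbrakk>Poly_Mapping.keys c \<subseteq> gwords V i; Poly_Mapping.keys d \<subseteq> gwords V j\<rbrakk> \<Longrightarrow>
   Poly_Mapping.keys (concat_prod c d) \<subseteq> gwords V (i + j)"
  using keys_concat_prod[of c d] by (fastforce simp: gwords_iff)

lemma gwords_lists: "Poly_Mapping.keys c \<subseteq> gwords V i \<Longrightarrow> Poly_Mapping.keys c \<subseteq> lists (letters V)"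
  using gwords_iff by blast

lemma gwords_diff:
  "\<lbrakk>Poly_Mapping.keys c \<subseteq> gwords V k; Poly_Mapping.keys d \<subseteq> gwords V k\<rbrakk> \<Longrightarrow>
    Poly_Mapping.keys (c - d) \<subseteq> gwords V k"
  using keys_diff[of c d] by blast

lemma gwords_add:
  "\<lbrakk>Poly_Mapping.keys c \<subseteq> gwords V k; Poly_Mapping.keys d \<subseteq> gwords V k\<rbrakk> \<Longrightarrow>
    Poly_Mapping.keys (c + d) \<subseteq> gwords V k"
  using keys_add[of c d] by blast

lemma gwords_cmul:
  "Poly_Mapping.keys c \<subseteq> gwords V k \<Longrightarrow> Poly_Mapping.keys (frag_cmul n c) \<subseteq> gwords V k"
  using keys_cmul[of n c] by blast

lemma grp_T_dg [simp]: "grp (T_dg V) = gtensor V"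
  by (simp add: T_dg_def)

lemma gone_T_dg: "gone (T_dg V) = gtensor_cls V 0 (frag_of [])"
  by (simp add: T_dg_def)

lemma gmult_T_dg:
  assumes c: "Poly_Mapping.keys c \<subseteq> gwords V i" and d: "Poly_Mapping.keys d \<subseteq> gwords V j"
  shows "gmult (T_dg V) i j (gtensor_cls V i c) (gtensor_cls V j d) = gtensor_cls V (i + j) (concat_prod c d)"
proof -
  let ?h = "\<lambda>c d. gtensor_cls V (i + j) (concat_prod c d)"
  have "induced2 ?h (T.cls i c) (T.cls j d) = ?h c d"
  proof (rule induced2_cls[OF T.F.comm_group_axioms T.Rel_subgroup T.F.comm_group_axioms T.Rel_subgroup
        T.Q.is_group[of "i + j"]])
    fix d assume "d \<in> carrier (T.F j)"
    then show "(\<lambda>c. ?h c d) \<in> hom (T.F i) (T.Q (i + j))"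
      by (intro homI) (auto simp: gtensor_cls_eq concat_prod_add_left concat_prod_gwords T.cls_add T.cls_closed)
  next
    fix c assume "c \<in> carrier (T.F i)"
    then show "?h c \<in> hom (T.F j) (T.Q (i + j))"
      by (intro homI) (auto simp: gtensor_cls_eq concat_prod_add_right concat_prod_gwords T.cls_add T.cls_closed)
  next
    fix c d assume "c \<in> T.Rel i" "d \<in> carrier (T.F j)"
    then show "?h c d = \<one>\<^bsub>T.Q (i + j)\<^esub>"
      using gtensor_rel_subset_trel[of i] T.Rel_keys[of c i]
      by (intro gtensor_cls_one[unfolded gtensor_eq] concat_prod_gwords trel_concat_right gwords_lists)
        (auto simp: gtensor_rel_presented)
  next
    fix c d assume "c \<in> carrier (T.F i)" "d \<in> T.Rel j"
    then show "?h c d = \<one>\<^bsub>T.Q (i + j)\<^esub>"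
      using gtensor_rel_subset_trel[of j] T.Rel_keys[of d j]
      by (intro gtensor_cls_one[unfolded gtensor_eq] concat_prod_gwords trel_concat_left gwords_lists)
        (auto simp: gtensor_rel_presented)
  qed (use c d in auto)
  then show ?thesis by (simp add: T_dg_def gtensor_cls_eq)
qed

lemma gtensor_cls_closed: "Poly_Mapping.keys c \<subseteq> gwords V k \<Longrightarrow> gtensor_cls V k c \<in> carrier (gtensor V k)"
  unfolding gtensor_eq gtensor_cls_eq by (rule T.cls_closed)

lemma gtensor_cls_add:
  "\<lbrakk>Poly_Mapping.keys c \<subseteq> gwords V k; Poly_Mapping.keys d \<subseteq> gwords V k\<rbrakk> \<Longrightarrow>
   gtensor_cls V k (c + d) = gtensor_cls V k c \<otimes>\<^bsub>gtensor V k\<^esub> gtensor_cls V k d"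
  unfolding gtensor_eq gtensor_cls_eq by (rule T.cls_add)

lemma gtensor_cls_cmul:
  "Poly_Mapping.keys c \<subseteq> gwords V k \<Longrightarrow>
   gtensor_cls V k (frag_cmul n c) = gtensor_cls V k c [^]\<^bsub>gtensor V k\<^esub> n"
  unfolding gtensor_eq gtensor_cls_eq by (rule T.cls_cmul)

lemma gtensor_cls_0: "gtensor_cls V k 0 = \<one>\<^bsub>gtensor V k\<^esub>"
  unfolding gtensor_eq gtensor_cls_eq by (rule T.cls_0)

lemma gtensor_cases:
  assumes "q \<in> carrier (gtensor V k)"
  obtains c where "Poly_Mapping.keys c \<subseteq> gwords V k" "q = gtensor_cls V k c"
  using assms T.cls_cases unfolding gtensor_eq gtensor_cls_eq by metis

lemma lin_ext_gtensor_cls: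
  assumes "\<And>a. a \<in> Poly_Mapping.keys c \<Longrightarrow> Poly_Mapping.keys (g a) \<subseteq> gwords V k"
  shows "lin_ext (gtensor V k) (\<lambda>a. gtensor_cls V k (g a)) c = gtensor_cls V k (frag_extend g c)"
  using T.lin_ext_cls[OF assms] unfolding gtensor_eq gtensor_cls_eq .

end

subsection \<open>The differential\<close>

text \<open>
  The derivation \<^const>\<open>gtensor_bd_word\<close>, as a formal sum and in the recursive form in which
  the Leibniz rule is visible.
\<close>

fun bd_word :: "('a, 'm) cpx_scheme \<Rightarrow> (nat \<times> 'a) list \<Rightarrow> ((nat \<times> 'a) list \<Rightarrow>\<^sub>0 int)" where
  "bd_word V [] = 0"
| "bd_word V ((i, x) # w) = (if i = 0 then 0 else frag_of ((i - 1, bd V i x) # w))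
     + frag_cmul ((- 1) ^ i) (concat_prod (frag_of [(i, x)]) (bd_word V w))"

lemma bd_word_append:
  "bd_word V (u @ w) = concat_prod (bd_word V u) (frag_of w)
     + frag_cmul ((- 1) ^ wdeg u) (concat_prod (frag_of u) (bd_word V w))"
proof (induction u)
  case (Cons a u)
  obtain i x where a: "a = (i, x)" by force
  have "concat_prod (frag_of [(i, x)]) (concat_prod (frag_of u) (bd_word V w))
      = concat_prod (frag_of ((i, x) # u)) (bd_word V w)"
    by (simp flip: concat_prod_assoc)
  then show ?case
    using Cons by (simp add: a concat_prod_simps frag_cmul_distrib2 power_add)
qed simp

lemma bd_word_sum:
  "bd_word V w = (\<Sum>p | p < length w \<and> 0 < fst (w ! p).
     frag_cmul ((- 1) ^ wdeg (take p w)) (frag_of (w[p := (fst (w ! p) - 1, bd V (fst (w ! p)) (snd (w ! p)))])))"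
proof (induction w)
  case (Cons a w)
  obtain i x where a: "a = (i, x)" by force
  let ?S = "{p. p < length w \<and> 0 < fst (w ! p)}"
  let ?f = "\<lambda>w p. frag_cmul ((- 1) ^ wdeg (take p w))
    (frag_of (w[p := (fst (w ! p) - 1, bd V (fst (w ! p)) (snd (w ! p)))]))"
  have S: "{p. p < length (a # w) \<and> 0 < fst ((a # w) ! p)} = (if i = 0 then {} else {0}) \<union> Suc ` ?S" 
    by (rule Set.set_eqI, rename_tac p, case_tac p) (auto simp: a)
  have "sum (?f (a # w)) (Suc ` ?S) = (\<Sum>p\<in>?S. ?f (a # w) (Suc p))"
    by (subst sum.reindex) auto
  also have "\<dots> = frag_cmul ((- 1) ^ i) (concat_prod (frag_of [(i, x)]) (bd_word V w))"
    unfolding Cons concat_prod_sum_right frag_cmul_sum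
    by (rule sum.cong) (auto simp: a concat_prod_cmul_right power_add)
  finally show ?case
    unfolding S by (subst sum.union_disjoint) (auto simp: a)
qed simp

context cochain_complex
begin

lemma bd_closed: "\<lbrakk>0 < i; x \<in> carrier (grp V i)\<rbrakk> \<Longrightarrow> bd V i x \<in> carrier (grp V (i - 1))"
  by (rule hom_in_carrier[OF bd_hom])

lemma bd_word_degree_0: "wdeg w = 0 \<Longrightarrow> bd_word V w = 0"
  by (induction w) auto

lemma bd_word_gwords: "w \<in> gwords V k \<Longrightarrow> Poly_Mapping.keys (bd_word V w) \<subseteq> gwords V (k - 1)"
proof (induction w arbitrary: k)
  case (Cons a w)
  obtain i x where a: "a = (i, x)" by force
  have w: "w \<in> gwords V (k - i)" and ix: "[(i, x)] \<in> gwords V i" and k: "k = i + wdeg w"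
    using Cons.prems by (auto simp: a gwords_iff)
  have "Poly_Mapping.keys (concat_prod (frag_of [(i, x)]) (bd_word V w)) \<subseteq> gwords V (k - 1)"
  proof (cases "wdeg w = 0")
    case False
    then have "i + (k - i - 1) = k - 1" using k by simp
    then show ?thesis
      using concat_prod_gwords[of "frag_of [(i, x)]" i "bd_word V w" "k - i - 1"] ix Cons.IH[OF w] by simp
  qed (simp add: bd_word_degree_0)
  moreover have "Poly_Mapping.keys (if i = 0 then 0 else frag_of ((i - 1, bd V i x) # w)) \<subseteq> gwords V (k - 1)"
    using Cons.prems bd_closed[of i x] by (auto simp: a gwords_iff)
  ultimately show ?case
    unfolding a bd_word.simps by (intro gwords_add gwords_cmul)
qed simp

lemma bd_word_lists: "w \<in> lists (letters V) \<Longrightarrow> Poly_Mapping.keys (bd_word V w) \<subseteq> lists (letters V)"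
  using bd_word_gwords[of w "wdeg w"] gwords_lists by (metis gwords_iff)

text \<open>The Leibniz rule for homogeneous formal sums.\<close>

lemma frag_extend_bd_word_concat:
  assumes "Poly_Mapping.keys c \<subseteq> gwords V i"
  shows "frag_extend (bd_word V) (concat_prod c d) = concat_prod (frag_extend (bd_word V) c) d
     + frag_cmul ((- 1) ^ i) (concat_prod c (frag_extend (bd_word V) d))"
  using assms
proof (induction c rule: frag_keys_induct)
  case (gen u)
  then have "wdeg u = i" by (simp add: gwords_iff)
  then show ?case
    by (induction d rule: frag_induction[OF subset_UNIV])
      (auto simp: concat_prod_simps frag_extend_simps bd_word_append frag_cmul_diff2)
qed (auto simp: concat_prod_simps frag_extend_simps frag_cmul_diff2)

lemma bd_word_letter_trel:
  assumes "x \<in> carrier (grp V i)" "y \<in> carrier (grp V i)"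
  shows "frag_extend (bd_word V) (frag_of [(i, x \<otimes>\<^bsub>grp V i\<^esub> y)] - frag_of [(i, x)] - frag_of [(i, y)]) \<in> trel V"
proof (cases "i = 0")
  case False
  then have "frag_of [(i - 1, bd V i x \<otimes>\<^bsub>grp V (i - 1)\<^esub> bd V i y)] - frag_of [(i - 1, bd V i x)]
      - frag_of [(i - 1, bd V i y)] \<in> trel V"
    using assms by (intro trel_letter bd_closed) auto
  then show ?thesis
    using False hom_mult[OF bd_hom assms] by (simp add: frag_extend_simps)
qed (simp add: frag_extend_simps)

text \<open>
  A relation is \<open>us \<cdot> e \<cdot> vs\<close> with a relation \<open>e\<close> between single letters. By the
  Leibniz rule it is enough that the derivation preserves \<open>e\<close>, where it acts by the additive
  differential of the complex.
\<close>

lemma bd_word_trel: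
  assumes "c \<in> trel V" shows "frag_extend (bd_word V) c \<in> trel V"
  using assms
proof induction
  case (multilinear us vs x i y)
  let ?e = "frag_of [(i, x \<otimes>\<^bsub>grp V i\<^esub> y)] - frag_of [(i, x)] - frag_of [(i, y)]"
  have e: "?e \<in> trel V" "frag_extend (bd_word V) ?e \<in> trel V"
    using multilinear by (intro trel_letter bd_word_letter_trel; simp)+
  have ke: "Poly_Mapping.keys ?e \<subseteq> gwords V i"
    using multilinear by (intro gwords_diff) (auto simp: gwords_iff)
  have us: "Poly_Mapping.keys (frag_of us) \<subseteq> gwords V (wdeg us)" using multilinear by (simp add: gwords_iff)
  have k: "Poly_Mapping.keys (frag_of us) \<subseteq> lists (letters V)" "Poly_Mapping.keys (frag_of vs) \<subseteq> lists (letters V)"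
    "Poly_Mapping.keys (bd_word V us) \<subseteq> lists (letters V)" "Poly_Mapping.keys (bd_word V vs) \<subseteq> lists (letters V)"
    using multilinear bd_word_lists by auto
  have "frag_of (us @ (i, x \<otimes>\<^bsub>grp V i\<^esub> y) # vs) - frag_of (us @ (i, x) # vs) - frag_of (us @ (i, y) # vs)
      = concat_prod (frag_of us) (concat_prod ?e (frag_of vs))"
    by (simp add: concat_prod_simps)
  moreover have "frag_extend (bd_word V) (concat_prod (frag_of us) (concat_prod ?e (frag_of vs))) \<in> trel V"
  proof -
    have "concat_prod (bd_word V us) (concat_prod ?e (frag_of vs)) \<in> trel V"
      by (rule trel_concat_left[OF trel_concat_right[OF e(1) k(2)] k(3)])
    moreover have "concat_prod (frag_of us) (concat_prod (frag_extend (bd_word V) ?e) (frag_of vs)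
        + frag_cmul ((- 1) ^ i) (concat_prod ?e (bd_word V vs))) \<in> trel V"
      by (rule trel_concat_left[OF trel_add[OF trel_concat_right[OF e(2) k(2)]
              trel_cmul[OF trel_concat_right[OF e(1) k(4)]]] k(1)])
    ultimately show ?thesis
      unfolding frag_extend_bd_word_concat[OF us] frag_extend_bd_word_concat[OF ke] frag_extend_of
      by (intro trel_add trel_cmul)
  qed
  ultimately show ?case by simp
qed (auto simp: frag_extend_simps intro: trel.diff)

text \<open>
  Splitting off the first letter \<open>x\<close>, the two mixed terms \<open>d x \<cdot> d w\<close> occur with opposite
  signs, and \<open>d (d x)\<close> is a zero letter.
\<close>

lemma bd_word_bd_word:
  "w \<in> lists (letters V) \<Longrightarrow> frag_extend (bd_word V) (bd_word V w) \<in> trel V"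
proof (induction w)
  case (Cons a w)
  obtain i x where a: "a = (i, x)" by force
  have ix: "[(i, x)] \<in> gwords V i" and w: "w \<in> lists (letters V)"
    using Cons.prems by (auto simp: gwords_iff a)
  let ?L = "concat_prod (frag_of [(i, x)]) (frag_extend (bd_word V) (bd_word V w))"
  have L: "?L \<in> trel V"
    using Cons ix by (intro trel_concat_left) (auto simp: gwords_iff)
  define b where "b = bd_word V [(i, x)]"
  have b: "b = (if i = 0 then 0 else frag_of [(i - 1, bd V i x)])" by (simp add: b_def)
  have kb: "Poly_Mapping.keys b \<subseteq> gwords V (i - 1)"
    using ix bd_closed[of i x] by (auto simp: b gwords_iff)
  have bb: "frag_extend (bd_word V) b \<in> trel V"
  proof (cases "i \<ge> 2")
    case True
    then have "bd V (i - 1) (bd V i x) = \<one>\<^bsub>grp V (i - 2)\<^esub>"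
      using ix by (intro bd_bd) (auto simp: gwords_iff)
    then show ?thesis using True one_in_trel[of "[]" "[]" "i - 2"]
      by (simp add: b numeral_2_eq_2)
  qed (auto simp: b)
  have "frag_extend (bd_word V) (bd_word V (a # w))
     = frag_extend (bd_word V) (concat_prod b (frag_of w)
       + frag_cmul ((- 1) ^ i) (concat_prod (frag_of [(i, x)]) (bd_word V w)))"
    by (simp add: a b)
  also have "\<dots> = concat_prod (frag_extend (bd_word V) b) (frag_of w)
       + (frag_cmul ((- 1) ^ (i - 1)) (concat_prod b (bd_word V w))
       + frag_cmul ((- 1) ^ i) (concat_prod b (bd_word V w))) + frag_cmul ((- 1) ^ i * (- 1) ^ i) ?L"
    using frag_extend_bd_word_concat[OF kb, of "frag_of w"]
      frag_extend_bd_word_concat[of "frag_of [(i, x)]" i "bd_word V w"] ix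
    by (simp add: frag_extend_simps frag_cmul_distrib2 b_def del: bd_word.simps)
  also have "frag_cmul ((- 1) ^ (i - 1)) (concat_prod b (bd_word V w))
       + frag_cmul ((- 1) ^ i) (concat_prod b (bd_word V w)) = 0"
    by (cases i) (auto simp: b simp flip: frag_cmul_distrib)
  finally show ?case
    using trel_concat_right[OF bb, of "frag_of w"] w L by (auto intro!: trel_add trel_cmul)
qed simp

lemma gtensor_bd_word_eq:
  assumes "w \<in> gwords V k"
  shows "gtensor_bd_word V k w = gtensor_cls V (k - 1) (bd_word V w)"
proof -
  interpret K: comm_group "gtensor V (k - 1)" by (rule gtensor_comm_group)
  let ?s = "\<lambda>p. w[p := (fst (w ! p) - 1, bd V (fst (w ! p)) (snd (w ! p)))]"
  let ?P = "{p. p < length w \<and> 0 < fst (w ! p)}"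
  have s: "?s p \<in> gwords V (k - 1)" if "p \<in> ?P" for p
  proof -
    have w: "w = take p w @ w ! p # drop (Suc p) w" using that by (simp add: id_take_nth_drop)
    have sw: "set w \<subseteq> letters V" using assms by (auto simp: gwords_iff lists_eq_set)
    have l: "take p w \<in> lists (letters V)" "drop (Suc p) w \<in> lists (letters V)"
      using sw set_take_subset[of p w] set_drop_subset[of "Suc p" w] unfolding lists_eq_set by blast+
    have lp: "snd (w ! p) \<in> carrier (grp V (fst (w ! p)))"
      using subsetD[OF sw nth_mem[of p w]] that letters_iff[of "fst (w ! p)" "snd (w ! p)" V] by simp
    have d: "k = wdeg (take p w) + (fst (w ! p) + wdeg (drop (Suc p) w))"
      using arg_cong[OF w, of wdeg] assms by (cases "w ! p") (simp add: gwords_iff)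
    show ?thesis
      using that l lp d bd_closed[of "fst (w ! p)" "snd (w ! p)"] by (auto simp: upd_conv_take_nth_drop gwords_iff)
  qed
  have "gtensor_bd_word V k w = lin_ext (gtensor V (k - 1)) (\<lambda>a. gtensor_cls V (k - 1) (frag_of a))
      (\<Sum>p\<in>?P. frag_cmul ((- 1) ^ wdeg (take p w)) (frag_of (?s p)))"
    unfolding gtensor_bd_word_def
    by (rule K.lin_ext_signed_sum[symmetric]) (use s in \<open>simp_all add: gtensor_cls_closed\<close>)
  also have "\<dots> = gtensor_cls V (k - 1) (frag_extend frag_of (bd_word V w))"
    unfolding bd_word_sum[symmetric] using bd_word_gwords[OF assms] by (intro lin_ext_gtensor_cls) auto
  finally show ?thesis by (simp flip: frag_expansion)
qed

lemma frag_extend_bd_word_gwords: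
  "Poly_Mapping.keys c \<subseteq> gwords V k \<Longrightarrow> Poly_Mapping.keys (frag_extend (bd_word V) c) \<subseteq> gwords V (k - 1)"
  using bd_word_gwords by (intro keys_frag_extend_subset) blast

lemma bd_T_dg_eq_lin_ext:
  assumes c: "Poly_Mapping.keys c \<subseteq> gwords V k"
  shows "lin_ext (gtensor V (k - 1)) (gtensor_bd_word V k) c = gtensor_cls V (k - 1) (frag_extend (bd_word V) c)"
proof -
  interpret K: comm_group "gtensor V (k - 1)" by (rule gtensor_comm_group)
  have "lin_ext (gtensor V (k - 1)) (gtensor_bd_word V k) c
      = lin_ext (gtensor V (k - 1)) (\<lambda>w. gtensor_cls V (k - 1) (bd_word V w)) c"
    using c by (intro K.lin_ext_cong image_subsetI gtensor_cls_closed bd_word_gwords gtensor_bd_word_eq) blast+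
  also have "\<dots> = gtensor_cls V (k - 1) (frag_extend (bd_word V) c)"
    using c bd_word_gwords by (intro lin_ext_gtensor_cls) blast
  finally show ?thesis .
qed

lemma bd_T_dg_hom_cls:
  shows bd_T_dg_hom: "bd (T_dg V) k \<in> hom (gtensor V k) (gtensor V (k - 1))"
    and bd_T_dg: "Poly_Mapping.keys c \<subseteq> gwords V k \<Longrightarrow>
      bd (T_dg V) k (gtensor_cls V k c) = gtensor_cls V (k - 1) (frag_extend (bd_word V) c)"
proof -
  have bd: "bd (T_dg V) k = induced (lin_ext (gtensor V (k - 1)) (gtensor_bd_word V k))"
    by (simp add: T_dg_def)
  have f: "gtensor_bd_word V k ` gwords V k \<subseteq> carrier (gtensor V (k - 1))"
    using gtensor_bd_word_eq gtensor_cls_closed bd_word_gwords by (intro image_subsetI) metis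
  have r: "lin_ext (gtensor V (k - 1)) (gtensor_bd_word V k) r = \<one>\<^bsub>gtensor V (k - 1)\<^esub>" if "r \<in> gtensor_relators V k" for r
  proof -
    have "r \<in> trel V"
      using T.Rel_relator[OF that] gtensor_rel_subset_trel[of k] gtensor_rel_presented by blast
    then show ?thesis
      using T.relator_keys[OF that]
      by (simp only: bd_T_dg_eq_lin_ext gtensor_cls_one bd_word_trel frag_extend_bd_word_gwords)
  qed
  show "bd (T_dg V) k \<in> hom (gtensor V k) (gtensor V (k - 1))"
    unfolding bd using T.lift_hom[OF gtensor_comm_group f r] by (simp add: gtensor_eq)
  show "bd (T_dg V) k (gtensor_cls V k c) = gtensor_cls V (k - 1) (frag_extend (bd_word V) c)"
    if "Poly_Mapping.keys c \<subseteq> gwords V k"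
    using trans[OF T.lift_cls[OF gtensor_comm_group f r that] bd_T_dg_eq_lin_ext[OF that]]
    by (simp add: bd gtensor_cls_eq)
qed

end

subsection \<open>Graded multiplications\<close>

text \<open>
  The axioms of \<^locale>\<open>dg_ring\<close> on which products in quotients and iterated products of words
  rest. The shuffle product is treated in this generality: its bilinearity is proved directly, and
  associativity and the Leibniz rule are obtained for the quotient of interest, by comparison with
  the free monoid.
\<close>

locale graded_mult = graded_group B for B :: "'a dgring" +
  assumes mult_closed: "\<lbrakk>x \<in> carrier (grp B i); y \<in> carrier (grp B j)\<rbrakk> \<Longrightarrow>
      gmult B i j x y \<in> carrier (grp B (i + j))"
    and mult_left: "\<lbrakk>x \<in> carrier (grp B i); x' \<in> carrier (grp B i); y \<in> carrier (grp B j)\<rbrakk> \<Longrightarrow>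
      gmult B i j (x \<otimes>\<^bsub>grp B i\<^esub> x') y = gmult B i j x y \<otimes>\<^bsub>grp B (i + j)\<^esub> gmult B i j x' y"
    and mult_right: "\<lbrakk>x \<in> carrier (grp B i); y \<in> carrier (grp B j); y' \<in> carrier (grp B j)\<rbrakk> \<Longrightarrow>
      gmult B i j x (y \<otimes>\<^bsub>grp B j\<^esub> y') = gmult B i j x y \<otimes>\<^bsub>grp B (i + j)\<^esub> gmult B i j x y'"
    and unit_closed: "gone B \<in> carrier (grp B 0)"
begin

lemma grp_is_group: "group (grp B k)"
  using graded_comm_group[of k] by (simp add: comm_group_def)

lemma mult_left_hom: "y \<in> carrier (grp B j) \<Longrightarrow> (\<lambda>x. gmult B i j x y) \<in> hom (grp B i) (grp B (i + j))"
  by (intro homI mult_closed mult_left)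

lemma mult_right_hom: "x \<in> carrier (grp B i) \<Longrightarrow> gmult B i j x \<in> hom (grp B j) (grp B (i + j))"
  by (intro homI mult_closed mult_right)

lemma mult_left_group_hom:
  "y \<in> carrier (grp B j) \<Longrightarrow> group_hom (grp B i) (grp B (i + j)) (\<lambda>x. gmult B i j x y)"
  by (simp add: group_hom_def group_hom_axioms_def grp_is_group mult_left_hom)

lemma mult_right_group_hom:
  "x \<in> carrier (grp B i) \<Longrightarrow> group_hom (grp B j) (grp B (i + j)) (gmult B i j x)"
  by (simp add: group_hom_def group_hom_axioms_def grp_is_group mult_right_hom)

end

sublocale dg_ring \<subseteq> graded_mult
  by unfold_locales (rule gmult_closed gmult_left gmult_right gone_closed; assumption?)+

lemma dg_hom_bd: "dg_hom A B f \<Longrightarrow> 0 < k \<Longrightarrow> x \<in> carrier (grp A k) \<Longrightarrow> f (k - 1) (bd A k x) = bd B k (f k x)"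
  unfolding dg_hom_def by blast

lemma dg_hom_hom: "dg_hom A B f \<Longrightarrow> f k \<in> hom (grp A k) (grp B k)"
  unfolding dg_hom_def by blast

lemma dg_hom_mult: "dg_hom A B f \<Longrightarrow> x \<in> carrier (grp A i) \<Longrightarrow> y \<in> carrier (grp A j) \<Longrightarrow>
    f (i + j) (gmult A i j x y) = gmult B i j (f i x) (f j y)"
  unfolding dg_hom_def by blast

lemma dg_hom_one: "dg_hom A B f \<Longrightarrow> f 0 (gone A) = gone B"
  unfolding dg_hom_def by blast

lemma dg_hom_closed: "dg_hom A B f \<Longrightarrow> x \<in> carrier (grp A k) \<Longrightarrow> f k x \<in> carrier (grp B k)"
  by (rule hom_in_carrier[OF dg_hom_hom])

lemma dg_hom_comp:
  assumes f: "dg_hom A B f" and g: "dg_hom B C g"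
  shows "dg_hom A C (\<lambda>k x. g k (f k x))"
proof -
  have "(\<lambda>x. g k (f k x)) \<in> hom (grp A k) (grp C k)" for k
    using hom_compose[OF dg_hom_hom[OF f] dg_hom_hom[OF g], of k] by (simp add: comp_def)
  moreover have "\<forall>k>0. \<forall>x\<in>carrier (grp A k). g (k - 1) (f (k - 1) (bd A k x)) = bd C k (g k (f k x))"
    using dg_hom_bd[OF f] dg_hom_bd[OF g] dg_hom_closed[OF f] by metis
  moreover have "\<forall>i j. \<forall>x\<in>carrier (grp A i). \<forall>y\<in>carrier (grp A j).
        g (i + j) (f (i + j) (gmult A i j x y)) = gmult C i j (g i (f i x)) (g j (f j y))"
    using dg_hom_mult[OF f] dg_hom_mult[OF g] dg_hom_closed[OF f] by metis
  ultimately show ?thesis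
    using f g by (simp add: dg_hom_def)
qed

lemma dg_hom_id: "dg_ring A \<Longrightarrow> dg_hom A A (\<lambda>k x. x)"
  by (auto simp: dg_hom_def intro!: homI)

subsection \<open>The free monoid is a monoid, and it is free\<close>

context cochain_complex
begin

lemma T_dg_dg_ring: "dg_ring (T_dg V)"
proof (intro dg_ring.intro cochain_complex.intro dg_ring_axioms.intro)
  show "comm_group (grp (T_dg V) k)" for k
    unfolding grp_T_dg by (rule gtensor_comm_group)
  show "0 < k \<Longrightarrow> bd (T_dg V) k \<in> hom (grp (T_dg V) k) (grp (T_dg V) (k - 1))" for k
    unfolding grp_T_dg by (rule bd_T_dg_hom)
next
  fix k x assume k: "2 \<le> k" and "x \<in> carrier (grp (T_dg V) k)"
  then obtain c where c: "Poly_Mapping.keys c \<subseteq> gwords V k" "x = gtensor_cls V k c"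
    by (auto elim: gtensor_cases)
  have D: "Poly_Mapping.keys (frag_extend (bd_word V) c) \<subseteq> gwords V (k - 1)"
    by (rule frag_extend_bd_word_gwords[OF c(1)])
  have "frag_extend (bd_word V) (frag_extend (bd_word V) c) \<in> trel V"
    using gwords_lists[OF c(1)]
    by (induction c rule: frag_keys_induct) (auto simp: frag_extend_diff bd_word_bd_word intro: trel.diff)
  moreover have "k - 1 - 1 = k - 2" by simp
  ultimately show "bd (T_dg V) (k - 1) (bd (T_dg V) k x) = \<one>\<^bsub>grp (T_dg V) (k - 2)\<^esub>"
    using gtensor_cls_one[of _ "k - 2"] frag_extend_bd_word_gwords[OF D]
    by (simp only: c(2) bd_T_dg[OF c(1)] bd_T_dg[OF D] grp_T_dg)
next
  fix x y i j assume "x \<in> carrier (grp (T_dg V) i)" "y \<in> carrier (grp (T_dg V) j)"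
  then obtain c d where c: "Poly_Mapping.keys c \<subseteq> gwords V i" "x = gtensor_cls V i c"
    and d: "Poly_Mapping.keys d \<subseteq> gwords V j" "y = gtensor_cls V j d"
    by (auto elim!: gtensor_cases)
  have cd: "Poly_Mapping.keys (concat_prod c d) \<subseteq> gwords V (i + j)" using c(1) d(1) by (rule concat_prod_gwords)
  show "gmult (T_dg V) i j x y \<in> carrier (grp (T_dg V) (i + j))"
    using gtensor_cls_closed[OF cd] by (simp add: c d gmult_T_dg)
  { fix x' assume "x' \<in> carrier (grp (T_dg V) i)"
    then obtain c' where c': "Poly_Mapping.keys c' \<subseteq> gwords V i" "x' = gtensor_cls V i c'"
      by (auto elim!: gtensor_cases)
    show "gmult (T_dg V) i j (x \<otimes>\<^bsub>grp (T_dg V) i\<^esub> x') y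
        = gmult (T_dg V) i j x y \<otimes>\<^bsub>grp (T_dg V) (i + j)\<^esub> gmult (T_dg V) i j x' y"
      using gwords_add[OF c(1) c'(1)]
      by (simp add: c c' d gmult_T_dg concat_prod_add_left concat_prod_gwords flip: gtensor_cls_add) }
  { fix y' assume "y' \<in> carrier (grp (T_dg V) j)"
    then obtain d' where d': "Poly_Mapping.keys d' \<subseteq> gwords V j" "y' = gtensor_cls V j d'"
      by (auto elim!: gtensor_cases)
    show "gmult (T_dg V) i j x (y \<otimes>\<^bsub>grp (T_dg V) j\<^esub> y')
        = gmult (T_dg V) i j x y \<otimes>\<^bsub>grp (T_dg V) (i + j)\<^esub> gmult (T_dg V) i j x y'"
      using gwords_add[OF d(1) d'(1)]
      by (simp add: c d d' gmult_T_dg concat_prod_add_right concat_prod_gwords flip: gtensor_cls_add) }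
  { fix z k assume "z \<in> carrier (grp (T_dg V) k)"
    then obtain e where e: "Poly_Mapping.keys e \<subseteq> gwords V k" "z = gtensor_cls V k e"
      by (auto elim!: gtensor_cases)
    show "gmult (T_dg V) (i + j) k (gmult (T_dg V) i j x y) z
        = gmult (T_dg V) i (j + k) x (gmult (T_dg V) j k y z)"
      using concat_prod_gwords[OF d(1) e(1)]
      by (simp add: c d e cd gmult_T_dg concat_prod_assoc add.assoc) }
  assume k: "0 < i + j"
  have Dc: "Poly_Mapping.keys (frag_extend (bd_word V) c) \<subseteq> gwords V (i - 1)"
    and Dd: "Poly_Mapping.keys (frag_extend (bd_word V) d) \<subseteq> gwords V (j - 1)"
    using frag_extend_bd_word_gwords c d by auto
  have c0: "frag_extend (bd_word V) c = 0" if "i = 0"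
    using c(1) that by (intro frag_extend_eq_0 bd_word_degree_0) (auto simp: gwords_iff)
  have d0: "frag_extend (bd_word V) d = 0" if "j = 0"
    using d(1) that by (intro frag_extend_eq_0 bd_word_degree_0) (auto simp: gwords_iff)
  define l where "l = concat_prod (frag_extend (bd_word V) c) d"
  define r where "r = concat_prod c (frag_extend (bd_word V) d)"
  have l: "Poly_Mapping.keys l \<subseteq> gwords V (i + j - 1)"
    using concat_prod_gwords[OF Dc d(1)] c0 k by (cases "i = 0") (auto simp: l_def)
  have r: "Poly_Mapping.keys r \<subseteq> gwords V (i + j - 1)"
    using concat_prod_gwords[OF c(1) Dd] d0 k by (cases "j = 0") (auto simp: r_def)
  have "bd (T_dg V) (i + j) (gmult (T_dg V) i j x y)
      = gtensor_cls V (i + j - 1) (l + frag_cmul ((- 1) ^ i) r)"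
    using c(1) by (simp add: c(2) d(2) gmult_T_dg[OF c(1) d(1)] bd_T_dg[OF cd] frag_extend_bd_word_concat l_def r_def)
  also have "\<dots> = gtensor_cls V (i + j - 1) l \<otimes>\<^bsub>gtensor V (i + j - 1)\<^esub>
      gtensor_cls V (i + j - 1) r [^]\<^bsub>gtensor V (i + j - 1)\<^esub> ((- 1) ^ i :: int)"
    using l r by (simp only: gtensor_cls_add gtensor_cls_cmul gwords_cmul)
  also have "gtensor_cls V (i + j - 1) l = (if i = 0 then \<one>\<^bsub>grp (T_dg V) (i + j - 1)\<^esub>
      else gmult (T_dg V) (i - 1) j (bd (T_dg V) i x) y)"
    using gmult_T_dg[OF Dc d(1)] c0 by (auto simp: gtensor_cls_0 l_def c(2) d(2) bd_T_dg[OF c(1)])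
  also have "gtensor_cls V (i + j - 1) r [^]\<^bsub>gtensor V (i + j - 1)\<^esub> ((- 1) ^ i :: int)
      = (if j = 0 then \<one>\<^bsub>grp (T_dg V) (i + j - 1)\<^esub>
         else gmult (T_dg V) i (j - 1) x (bd (T_dg V) j y) [^]\<^bsub>grp (T_dg V) (i + j - 1)\<^esub> ((- 1) ^ i :: int))"
    using gmult_T_dg[OF c(1) Dd] d0 gtensor_comm_group[of "i + j - 1"]
    by (auto simp: gtensor_cls_0 r_def c(2) d(2) bd_T_dg[OF d(1)] comm_group_def group.int_pow_one)
  finally show "bd (T_dg V) (i + j) (gmult (T_dg V) i j x y) =
        (if i = 0 then \<one>\<^bsub>grp (T_dg V) (i + j - 1)\<^esub> else gmult (T_dg V) (i - 1) j (bd (T_dg V) i x) y)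
        \<otimes>\<^bsub>grp (T_dg V) (i + j - 1)\<^esub>
        (if j = 0 then \<one>\<^bsub>grp (T_dg V) (i + j - 1)\<^esub>
         else gmult (T_dg V) i (j - 1) x (bd (T_dg V) j y) [^]\<^bsub>grp (T_dg V) (i + j - 1)\<^esub> ((- 1) ^ i :: int))"
    by simp
next
  have n: "Poly_Mapping.keys (frag_of []) \<subseteq> gwords V 0" by (simp add: gwords_iff)
  show "gone (T_dg V) \<in> carrier (grp (T_dg V) 0)"
    using gtensor_cls_closed[OF n] by (simp add: gone_T_dg)
  fix x i assume "x \<in> carrier (grp (T_dg V) i)"
  then obtain c where c: "Poly_Mapping.keys c \<subseteq> gwords V i" "x = gtensor_cls V i c"
    by (auto elim!: gtensor_cases)
  show "gmult (T_dg V) 0 i (gone (T_dg V)) x = x" "gmult (T_dg V) i 0 x (gone (T_dg V)) = x"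
    using gmult_T_dg[OF n c(1)] gmult_T_dg[OF c(1) n] by (simp_all add: gone_T_dg c(2))
qed

end

definition cpx_hom :: "('a, 'm) cpx_scheme \<Rightarrow> ('b, 'n) cpx_scheme \<Rightarrow> (nat \<Rightarrow> 'a \<Rightarrow> 'b) \<Rightarrow> bool" where
  "cpx_hom V W \<phi> \<longleftrightarrow>
     (\<forall>k. \<phi> k \<in> hom (grp V k) (grp W k)) \<and>
     (\<forall>k > 0. \<forall>x \<in> carrier (grp V k). \<phi> (k - 1) (bd V k x) = bd W k (\<phi> k x))"

lemma cpx_hom_comp:
  assumes f: "cpx_hom V W f" and g: "cpx_hom W U g"
  shows "cpx_hom V U (\<lambda>k x. g k (f k x))"
proof -
  have "(\<lambda>x. g k (f k x)) \<in> hom (grp V k) (grp U k)" for k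
    using hom_compose[of "f k" "grp V k" "grp W k" "g k" "grp U k"] f g by (simp add: comp_def cpx_hom_def)
  moreover have "\<forall>k>0. \<forall>x\<in>carrier (grp V k). g (k - 1) (f (k - 1) (bd V k x)) = bd U k (g k (f k x))"
    using f g hom_in_carrier unfolding cpx_hom_def by metis
  ultimately show ?thesis by (simp add: cpx_hom_def)
qed

text \<open>
  Iterated products of words are multilinear, and hence define homomorphisms on the free monoid,
  for every bilinear product on the target.
\<close>

locale graded_lift = V: graded_group V + B: graded_mult B
  for V :: "('a, 'm) cpx_scheme" and B :: "'b dgring" +
  fixes \<phi> :: "nat \<Rightarrow> 'a \<Rightarrow> 'b"
  assumes \<phi>_hom: "\<phi> k \<in> hom (grp V k) (grp B k)"
begin

lemma \<phi>_closed: "x \<in> carrier (grp V k) \<Longrightarrow> \<phi> k x \<in> carrier (grp B k)"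
  by (rule hom_in_carrier[OF \<phi>_hom])

lemma word_prod_closed: "w \<in> lists (letters V) \<Longrightarrow> word_prod B \<phi> w \<in> carrier (grp B (wdeg w))"
  by (induction w) (auto simp: B.unit_closed intro!: B.mult_closed \<phi>_closed)

lemma word_prod_gwords: "w \<in> gwords V k \<Longrightarrow> word_prod B \<phi> w \<in> carrier (grp B k)"
  using word_prod_closed by (auto simp: gwords_iff)

lemma word_prod_keys: "Poly_Mapping.keys c \<subseteq> gwords V k \<Longrightarrow> word_prod B \<phi> ` Poly_Mapping.keys c \<subseteq> carrier (grp B k)"
  using word_prod_gwords by blast

lemma lin_ext_word_prod_0 [simp]: "lin_ext (grp B k) (word_prod B \<phi>) 0 = \<one>\<^bsub>grp B k\<^esub>"
  by (rule comm_group.lin_ext_0[OF B.graded_comm_group])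

lemma lin_ext_word_prod_of:
  "w \<in> gwords V k \<Longrightarrow> lin_ext (grp B k) (word_prod B \<phi>) (frag_of w) = word_prod B \<phi> w"
  by (intro comm_group.lin_ext_frag_of B.graded_comm_group word_prod_gwords)

lemma word_prod_multilinear:
  assumes "us \<in> lists (letters V)" "vs \<in> lists (letters V)" "x \<in> carrier (grp V i)" "y \<in> carrier (grp V i)"
    "k = wdeg us + (i + wdeg vs)"
  shows "word_prod B \<phi> (us @ (i, x \<otimes>\<^bsub>grp V i\<^esub> y) # vs)
    = word_prod B \<phi> (us @ (i, x) # vs) \<otimes>\<^bsub>grp B k\<^esub> word_prod B \<phi> (us @ (i, y) # vs)"
  using assms(1,5)
proof (induction us arbitrary: k rule: list.induct)
  case Nil
  then show ?case
    using assms word_prod_closed[of vs] by (simp add: hom_mult[OF \<phi>_hom] \<phi>_closed B.mult_left)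
next
  case (Cons a us)
  obtain j v where a: "a = (j, v)" by force
  let ?d = "wdeg us + (i + wdeg vs)"
  have "word_prod B \<phi> (us @ (i, x) # vs) \<in> carrier (grp B ?d)" "word_prod B \<phi> (us @ (i, y) # vs) \<in> carrier (grp B ?d)"
    using Cons.prems assms by (auto intro!: word_prod_gwords simp: gwords_iff)
  then show ?case
    using Cons B.mult_right[of "\<phi> j v" j _ ?d] \<phi>_closed[of v j] by (simp add: a add.assoc)
qed

lemma lift_relator:
  assumes "r \<in> gtensor_relators V k" shows "lin_ext (grp B k) (word_prod B \<phi>) r = \<one>\<^bsub>grp B k\<^esub>"
proof -
  interpret K: comm_group "grp B k" by (rule B.graded_comm_group)
  obtain us i x y vs where r: "r = frag_of (us @ (i, x \<otimes>\<^bsub>grp V i\<^esub> y) # vs) - frag_of (us @ (i, x) # vs)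
        - frag_of (us @ (i, y) # vs)" "x \<in> carrier (grp V i)" "y \<in> carrier (grp V i)" "us @ (i, x) # vs \<in> gwords V k"
    using assms unfolding gtensor_relators_def by blast
  have w: "us @ (i, x \<otimes>\<^bsub>grp V i\<^esub> y) # vs \<in> gwords V k" "us @ (i, y) # vs \<in> gwords V k"
    using r by (auto simp: gwords_iff)
  have "Poly_Mapping.keys (frag_of (us @ (i, x \<otimes>\<^bsub>grp V i\<^esub> y) # vs) - frag_of (us @ (i, x) # vs)) \<subseteq> gwords V k"
    using w r(4) by (intro V.gwords_diff) auto
  then have "lin_ext (grp B k) (word_prod B \<phi>) r
      = word_prod B \<phi> (us @ (i, x \<otimes>\<^bsub>grp V i\<^esub> y) # vs) \<otimes>\<^bsub>grp B k\<^esub> inv\<^bsub>grp B k\<^esub> word_prod B \<phi> (us @ (i, x) # vs)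
        \<otimes>\<^bsub>grp B k\<^esub> inv\<^bsub>grp B k\<^esub> word_prod B \<phi> (us @ (i, y) # vs)"
    using w r(4) by (simp add: r(1) K.lin_ext_diff word_prod_keys word_prod_gwords del: word_prod.simps)
  also have "word_prod B \<phi> (us @ (i, x \<otimes>\<^bsub>grp V i\<^esub> y) # vs)
      = word_prod B \<phi> (us @ (i, x) # vs) \<otimes>\<^bsub>grp B k\<^esub> word_prod B \<phi> (us @ (i, y) # vs)"
    using r by (intro word_prod_multilinear) (auto simp: gwords_iff)
  finally show ?thesis
    using word_prod_gwords[OF r(4)] word_prod_gwords[OF w(2)]
    by (simp add: K.commutator_one del: word_prod.simps)
qed

lemma word_prod_image: "word_prod B \<phi> ` gwords V k \<subseteq> carrier (grp B k)"
  using word_prod_gwords by blast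

lemma T_dg_lift_hom: "T_dg_lift B \<phi> k \<in> hom (gtensor V k) (grp B k)"
  unfolding T_dg_lift_def V.gtensor_eq
  by (rule V.T.lift_hom[OF B.graded_comm_group word_prod_image lift_relator])

lemma T_dg_lift_cls:
  "Poly_Mapping.keys c \<subseteq> gwords V k \<Longrightarrow> T_dg_lift B \<phi> k (gtensor_cls V k c) = lin_ext (grp B k) (word_prod B \<phi>) c"
  unfolding T_dg_lift_def V.gtensor_cls_eq
  by (rule V.T.lift_cls[OF B.graded_comm_group word_prod_image lift_relator])

end

locale cpx_to_dg = V: cochain_complex V + B: dg_ring B
  for V :: "('a, 'm) cpx_scheme" and B :: "'b dgring" +
  fixes \<phi> :: "nat \<Rightarrow> 'a \<Rightarrow> 'b"
  assumes \<phi>: "cpx_hom V B \<phi>"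

sublocale cpx_to_dg \<subseteq> graded_lift V B \<phi>
  by unfold_locales (use \<phi> in \<open>simp add: cpx_hom_def\<close>)

context cpx_to_dg
begin

lemma word_prod_append:
  assumes "u \<in> lists (letters V)" "w \<in> lists (letters V)"
  shows "word_prod B \<phi> (u @ w) = gmult B (wdeg u) (wdeg w) (word_prod B \<phi> u) (word_prod B \<phi> w)"
  using assms(1)
proof (induction u)
  case (Cons a u)
  obtain i x where a: "a = (i, x)" by force
  then show ?case
    using Cons assms(2) by (simp add: B.gmult_assoc \<phi>_closed word_prod_closed)
qed (simp add: B.gone_left word_prod_closed assms)

lemma lin_ext_word_prod_concat:
  assumes c: "Poly_Mapping.keys c \<subseteq> gwords V i" and d: "Poly_Mapping.keys d \<subseteq> gwords V j"
  shows "lin_ext (grp B (i + j)) (word_prod B \<phi>) (concat_prod c d)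
    = gmult B i j (lin_ext (grp B i) (word_prod B \<phi>) c) (lin_ext (grp B j) (word_prod B \<phi>) d)"
proof -
  interpret I: comm_group "grp B i" by (rule B.grp_comm_group)
  interpret J: comm_group "grp B j" by (rule B.grp_comm_group)
  interpret IJ: comm_group "grp B (i + j)" by (rule B.grp_comm_group)
  have dc: "lin_ext (grp B j) (word_prod B \<phi>) d \<in> carrier (grp B j)"
    by (rule J.lin_ext_closed[OF word_prod_keys[OF d]])
  interpret hl: group_hom "grp B i" "grp B (i + j)" "\<lambda>x. gmult B i j x (lin_ext (grp B j) (word_prod B \<phi>) d)"
    by (rule B.mult_left_group_hom[OF dc])
  show ?thesis using c
  proof (induction c rule: frag_keys_induct)
    case (diff x y)
    then show ?case
      using hl.hom_mult[of "lin_ext (grp B i) (word_prod B \<phi>) x" "inv\<^bsub>grp B i\<^esub> lin_ext (grp B i) (word_prod B \<phi>) y"]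
      by (simp add: concat_prod_diff_left I.lin_ext_diff IJ.lin_ext_diff word_prod_keys I.lin_ext_closed
          V.concat_prod_gwords d)
  next
    case (gen u)
    interpret hr: group_hom "grp B j" "grp B (i + j)" "gmult B i j (word_prod B \<phi> u)"
      by (rule B.mult_right_group_hom[OF word_prod_gwords[OF gen]])
    have u: "Poly_Mapping.keys (frag_of u) \<subseteq> gwords V i" using gen by simp
    show ?case using d
    proof (induction d rule: frag_keys_induct)
      case (diff x y)
      then show ?case
        using hr.hom_mult[of "lin_ext (grp B j) (word_prod B \<phi>) x" "inv\<^bsub>grp B j\<^esub> lin_ext (grp B j) (word_prod B \<phi>) y"]
        by (simp add: concat_prod_diff_right J.lin_ext_diff IJ.lin_ext_diff word_prod_keys J.lin_ext_closed
            V.concat_prod_gwords[OF u] lin_ext_word_prod_of[OF gen])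
    next
      case (gen w)
      have uw: "u @ w \<in> gwords V (i + j)" using u gen by (auto simp: gwords_iff)
      show ?case
        using u gen word_prod_append[of u w] by (simp add: lin_ext_word_prod_of uw) (simp add: gwords_iff)
    qed (use word_prod_gwords[OF gen] in simp)
  qed simp
qed

text \<open>
  Compatibility with the differential, by induction on the word: the recursion for
  \<^const>\<open>bd_word\<close> is matched by the Leibniz rule of the target.
\<close>

lemma lin_ext_bd_word:
  assumes "w \<in> gwords V k" "0 < k"
  shows "lin_ext (grp B (k - 1)) (word_prod B \<phi>) (bd_word V w) = bd B k (word_prod B \<phi> w)"
  using assms
proof (induction w arbitrary: k)
  case (Cons a w)
  obtain i x where a: "a = (i, x)" by force
  let ?j = "wdeg w"
  have x: "x \<in> carrier (grp V i)" and w: "w \<in> gwords V ?j" and k: "k = i + ?j"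
    using Cons.prems by (auto simp: a gwords_iff)
  interpret K: comm_group "grp B (k - 1)" by (rule B.grp_comm_group)
  let ?l = "if i = 0 then 0 else frag_of ((i - 1, bd V i x) # w)"
  let ?r = "concat_prod (frag_of [(i, x)]) (bd_word V w)"
  have l: "Poly_Mapping.keys ?l \<subseteq> gwords V (k - 1)"
    using V.bd_closed[of i x] x w k by (auto simp: gwords_iff)
  have le: "lin_ext (grp B (k - 1)) (word_prod B \<phi>) ?l
      = (if i = 0 then \<one>\<^bsub>grp B (k - 1)\<^esub> else gmult B (i - 1) ?j (bd B i (\<phi> i x)) (word_prod B \<phi> w))"
  proof (cases "i = 0")
    case False
    then have "lin_ext (grp B (k - 1)) (word_prod B \<phi>) ?l = word_prod B \<phi> ((i - 1, bd V i x) # w)"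
      using l by (simp del: word_prod.simps add: lin_ext_word_prod_of)
    then show ?thesis using False x \<phi> by (simp add: cpx_hom_def)
  qed simp
  have ix: "Poly_Mapping.keys (frag_of [(i, x)]) \<subseteq> gwords V i" using x by (simp add: gwords_iff)
  have \<phi>1: "lin_ext (grp B i) (word_prod B \<phi>) (frag_of [(i, x)]) = \<phi> i x"
    using x ix by (simp add: lin_ext_word_prod_of B.gone_right \<phi>_closed)
  have r: "Poly_Mapping.keys ?r \<subseteq> gwords V (k - 1) \<and> lin_ext (grp B (k - 1)) (word_prod B \<phi>) ?r
      = (if ?j = 0 then \<one>\<^bsub>grp B (k - 1)\<^esub> else gmult B i (?j - 1) (\<phi> i x) (bd B ?j (word_prod B \<phi> w)))"
  proof (cases "?j = 0")
    case False
    have kj: "i + (?j - 1) = k - 1" using k False by simp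
    have "lin_ext (grp B (?j - 1)) (word_prod B \<phi>) (bd_word V w) = bd B ?j (word_prod B \<phi> w)"
      using Cons.IH[OF w] False by simp
    then show ?thesis
      using lin_ext_word_prod_concat[OF ix V.bd_word_gwords[OF w]] V.concat_prod_gwords[OF ix V.bd_word_gwords[OF w]] False
      by (simp only: kj \<phi>1 if_False simp_thms)
  qed (simp add: V.bd_word_degree_0)
  have "lin_ext (grp B (k - 1)) (word_prod B \<phi>) (bd_word V (a # w))
      = lin_ext (grp B (k - 1)) (word_prod B \<phi>) ?l \<otimes>\<^bsub>grp B (k - 1)\<^esub>
        lin_ext (grp B (k - 1)) (word_prod B \<phi>) ?r [^]\<^bsub>grp B (k - 1)\<^esub> ((- 1) ^ i :: int)"
    unfolding a bd_word.simps using l r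
    by (simp only: K.lin_ext_add K.lin_ext_cmul word_prod_keys V.gwords_cmul)
  also have "lin_ext (grp B (k - 1)) (word_prod B \<phi>) ?r [^]\<^bsub>grp B (k - 1)\<^esub> ((- 1) ^ i :: int)
      = (if ?j = 0 then \<one>\<^bsub>grp B (k - 1)\<^esub> else gmult B i (?j - 1) (\<phi> i x) (bd B ?j (word_prod B \<phi> w))
          [^]\<^bsub>grp B (k - 1)\<^esub> ((- 1) ^ i :: int))"
    unfolding conjunct2[OF r] using K.int_pow_one by (cases "?j = 0") (simp_all only: if_True if_False simp_thms)
  also have "lin_ext (grp B (k - 1)) (word_prod B \<phi>) ?l \<otimes>\<^bsub>grp B (k - 1)\<^esub> \<dots> = bd B k (word_prod B \<phi> (a # w))"
    unfolding a k word_prod.simps le[unfolded k]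
    by (rule B.leibniz[symmetric]) (use Cons.prems(2) k \<phi>_closed[OF x] word_prod_gwords[OF w] in simp_all)
  finally show ?case .
qed (simp add: gwords_iff)

lemma T_dg_lift_dg_hom: "dg_hom (T_dg V) B (T_dg_lift B \<phi>)"
  unfolding dg_hom_def
proof (intro conjI allI ballI impI)
  show "dg_ring (T_dg V)" "dg_ring B"
    by (rule V.T_dg_dg_ring, rule B.dg_ring_axioms)
  show "T_dg_lift B \<phi> k \<in> hom (grp (T_dg V) k) (grp B k)" for k
    using T_dg_lift_hom by simp
next
  fix k :: nat and x assume k: "0 < k" and "x \<in> carrier (grp (T_dg V) k)"
  then obtain c where c: "Poly_Mapping.keys c \<subseteq> gwords V k" "x = gtensor_cls V k c"
    by (auto elim: V.gtensor_cases)
  interpret K: comm_group "grp B (k - 1)" by (rule B.grp_comm_group)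
  have "lin_ext (grp B (k - 1)) (word_prod B \<phi>) (frag_extend (bd_word V) c)
      = lin_ext (grp B (k - 1)) (\<lambda>w. lin_ext (grp B (k - 1)) (word_prod B \<phi>) (bd_word V w)) c"
    using c(1) V.bd_word_gwords by (intro K.lin_ext_frag_extend word_prod_keys) blast
  also have "\<dots> = lin_ext (grp B (k - 1)) (\<lambda>w. bd B k (word_prod B \<phi> w)) c"
    using c(1) k by (intro K.lin_ext_cong lin_ext_bd_word image_subsetI hom_in_carrier[OF B.bd_hom] word_prod_gwords) blast+
  also have "\<dots> = bd B k (lin_ext (grp B k) (word_prod B \<phi>) c)"
    by (rule comm_group.hom_lin_ext[OF B.grp_comm_group B.grp_comm_group B.bd_hom[OF k] word_prod_keys[OF c(1)], symmetric])
  finally show "T_dg_lift B \<phi> (k - 1) (bd (T_dg V) k x) = bd B k (T_dg_lift B \<phi> k x)"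
    by (simp only: c(2) V.bd_T_dg[OF c(1)] T_dg_lift_cls c(1) V.frag_extend_bd_word_gwords)
next
  fix i j x y assume "x \<in> carrier (grp (T_dg V) i)" "y \<in> carrier (grp (T_dg V) j)"
  then obtain c d where c: "Poly_Mapping.keys c \<subseteq> gwords V i" "x = gtensor_cls V i c"
    and d: "Poly_Mapping.keys d \<subseteq> gwords V j" "y = gtensor_cls V j d"
    by (auto elim!: V.gtensor_cases)
  show "T_dg_lift B \<phi> (i + j) (gmult (T_dg V) i j x y) = gmult B i j (T_dg_lift B \<phi> i x) (T_dg_lift B \<phi> j y)"
    using c d by (simp add: V.gmult_T_dg T_dg_lift_cls V.concat_prod_gwords lin_ext_word_prod_concat)
next
  show "T_dg_lift B \<phi> 0 (gone (T_dg V)) = gone B"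
    using T_dg_lift_cls[of "frag_of []" 0] lin_ext_word_prod_of[of "[]" 0]
    by (simp add: V.gone_T_dg gwords_iff)
qed

lemma T_dg_lift_gen: "v \<in> carrier (grp V k) \<Longrightarrow> T_dg_lift B \<phi> k (T_dg_gen V k v) = \<phi> k v"
  using T_dg_lift_cls[of "frag_of [(k, v)]" k] lin_ext_word_prod_of[of "[(k, v)]" k]
  by (simp add: T_dg_gen_def gwords_iff B.gone_right \<phi>_closed)

end

context cochain_complex
begin

lemma T_dg_gen_closed: "v \<in> carrier (grp V k) \<Longrightarrow> T_dg_gen V k v \<in> carrier (gtensor V k)"
  unfolding T_dg_gen_def by (rule gtensor_cls_closed) (simp add: gwords_iff)

lemma T_dg_gen_cpx_hom: "cpx_hom V (T_dg V) (T_dg_gen V)"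
  unfolding cpx_hom_def grp_T_dg
proof (intro conjI allI impI ballI)
  show "T_dg_gen V k \<in> hom (grp V k) (gtensor V k)" for k
  proof (rule homI)
    fix x y assume xy: "x \<in> carrier (grp V k)" "y \<in> carrier (grp V k)"
    have "gtensor_cls V k (frag_of [(k, x \<otimes>\<^bsub>grp V k\<^esub> y)]) = gtensor_cls V k (frag_of [(k, x)] + frag_of [(k, y)])"
      using trel_letter[OF xy] xy by (intro gtensor_cls_eqI gwords_add) (auto simp: gwords_iff algebra_simps)
    then show "T_dg_gen V k (x \<otimes>\<^bsub>grp V k\<^esub> y) = T_dg_gen V k x \<otimes>\<^bsub>gtensor V k\<^esub> T_dg_gen V k y"
      using xy by (simp add: T_dg_gen_def gtensor_cls_add gwords_iff)
  qed (rule T_dg_gen_closed)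
  fix k :: nat and x assume k: "0 < k" and x: "x \<in> carrier (grp V k)"
  then show "T_dg_gen V (k - 1) (bd V k x) = bd (T_dg V) k (T_dg_gen V k x)"
    using bd_T_dg[of "frag_of [(k, x)]" k] by (simp add: T_dg_gen_def gwords_iff)
qed

text \<open>Every word is a product of generators, so a map of monoids is determined by its values there.\<close>

lemma T_dg_dg_hom_eqI:
  assumes f: "dg_hom (T_dg V) B f" and g: "dg_hom (T_dg V) B g"
    and eq: "\<And>k v. v \<in> carrier (grp V k) \<Longrightarrow> f k (T_dg_gen V k v) = g k (T_dg_gen V k v)"
    and t: "t \<in> carrier (grp (T_dg V) k)"
  shows "f k t = g k t"
proof -
  have "f k (gtensor_cls V k (frag_of w)) = g k (gtensor_cls V k (frag_of w))" if "w \<in> gwords V k" for w k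
    using that
  proof (induction w arbitrary: k)
    case Nil
    then show ?case using dg_hom_one[OF f] dg_hom_one[OF g] by (simp add: gone_T_dg gwords_iff)
  next
    case (Cons a w)
    obtain i x where a: "a = (i, x)" by force
    have x: "x \<in> carrier (grp V i)" and w: "w \<in> gwords V (wdeg w)" and k: "k = i + wdeg w"
      using Cons.prems by (auto simp: a gwords_iff)
    have "gtensor_cls V k (frag_of (a # w))
        = gmult (T_dg V) i (wdeg w) (T_dg_gen V i x) (gtensor_cls V (wdeg w) (frag_of w))"
      using gmult_T_dg[of "frag_of [(i, x)]" i "frag_of w" "wdeg w"] x w
      by (simp add: T_dg_gen_def a k gwords_iff)
    then show ?case
      using dg_hom_mult[OF f, of "T_dg_gen V i x" i "gtensor_cls V (wdeg w) (frag_of w)" "wdeg w"]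
        dg_hom_mult[OF g, of "T_dg_gen V i x" i "gtensor_cls V (wdeg w) (frag_of w)" "wdeg w"]
        T_dg_gen_closed[OF x] gtensor_cls_closed[of "frag_of w" "wdeg w"] w Cons.IH[OF w] eq[OF x]
      by (simp add: k)
  qed
  then show ?thesis
    using T.Q_hom_eqI[of "grp B k" "f k" k "g k" t] dg_hom_hom[OF f, of k] dg_hom_hom[OF g, of k] t f
    by (auto simp: gtensor_eq gtensor_cls_eq dg_hom_def dg_ring_def cochain_complex_def comm_group_def)
qed

end

lemma T_dg_map_dg_hom:
  assumes V: "cochain_complex V" and W: "cochain_complex W" and f: "cpx_hom V W f"
  shows "dg_hom (T_dg V) (T_dg W) (T_dg_map W f)"
    and "v \<in> carrier (grp V k) \<Longrightarrow> T_dg_map W f k (T_dg_gen V k v) = T_dg_gen W k (f k v)"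
proof -
  interpret cpx_to_dg V "T_dg W" "\<lambda>k v. T_dg_gen W k (f k v)"
    using V W cochain_complex.T_dg_dg_ring[OF W] cpx_hom_comp[OF f cochain_complex.T_dg_gen_cpx_hom[OF W]]
    by (simp add: cpx_to_dg_def cpx_to_dg_axioms_def)
  show "dg_hom (T_dg V) (T_dg W) (T_dg_map W f)"
    unfolding T_dg_map_def by (rule T_dg_lift_dg_hom)
  show "v \<in> carrier (grp V k) \<Longrightarrow> T_dg_map W f k (T_dg_gen V k v) = T_dg_gen W k (f k v)"
    unfolding T_dg_map_def by (rule T_dg_lift_gen)
qed

section \<open>Ideals, quotients and co-equalizers of monoids in complexes\<close>

lemma dg_ideal_subgroup: "dg_ideal B J \<Longrightarrow> subgroup (J k) (grp B k)"
  by (simp add: dg_ideal_def)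

lemma dg_ideal_bd: "dg_ideal B J \<Longrightarrow> 0 < k \<Longrightarrow> x \<in> J k \<Longrightarrow> bd B k x \<in> J (k - 1)"
  by (simp add: dg_ideal_def)

lemma dg_ideal_left: "dg_ideal B J \<Longrightarrow> x \<in> carrier (grp B i) \<Longrightarrow> y \<in> J j \<Longrightarrow> gmult B i j x y \<in> J (i + j)"
  by (simp add: dg_ideal_def)

lemma dg_ideal_right: "dg_ideal B J \<Longrightarrow> x \<in> J i \<Longrightarrow> y \<in> carrier (grp B j) \<Longrightarrow> gmult B i j x y \<in> J (i + j)"
  by (simp add: dg_ideal_def)

text \<open>
  Being a monoid in complexes passes to surjective images: each axiom is an identity between
  elements that can be lifted. This is applied to quotients, and to \<^const>\<open>L_tilde\<close> as an image of
  \<^const>\<open>L_mon\<close>.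
\<close>

lemma dg_ring_image:
  assumes A: "dg_ring A"
    and C: "\<And>k. comm_group (grp C k)"
    and hom: "\<And>k. f k \<in> hom (grp A k) (grp C k)"
    and surj: "\<And>k. carrier (grp C k) \<subseteq> f k ` carrier (grp A k)"
    and bd: "\<And>k x. \<lbrakk>0 < k; x \<in> carrier (grp A k)\<rbrakk> \<Longrightarrow> bd C k (f k x) = f (k - 1) (bd A k x)"
    and mult: "\<And>i j x y. \<lbrakk>x \<in> carrier (grp A i); y \<in> carrier (grp A j)\<rbrakk> \<Longrightarrow>
      gmult C i j (f i x) (f j y) = f (i + j) (gmult A i j x y)"
    and one: "gone C = f 0 (gone A)"
  shows "dg_ring C" and "dg_hom A C f"
proof -
  interpret A: dg_ring A by (rule A)
  have grp: "Group.group (grp C k)" for k using C[of k] by (simp add: comm_group_def)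
  have gh: "group_hom (grp A k) (grp C k) (f k)" for k
    using hom grp by (simp add: group_hom_def group_hom_axioms_def A.grp_is_group)
  have fc: "f k x \<in> carrier (grp C k)" if "x \<in> carrier (grp A k)" for k x
    using hom_in_carrier[OF hom that] .
  have ex: "\<exists>x. x \<in> carrier (grp A k) \<and> c = f k x" if "c \<in> carrier (grp C k)" for k c
    using surj that by blast
  show C_ring: "dg_ring C"
  proof (intro dg_ring.intro cochain_complex.intro dg_ring_axioms.intro)
    fix k :: nat assume k: "0 < k"
    show "bd C k \<in> hom (grp C k) (grp C (k - 1))"
    proof (rule homI)
      fix c assume "c \<in> carrier (grp C k)"
      then obtain x where x: "x \<in> carrier (grp A k)" "c = f k x" using ex by blast
      show "bd C k c \<in> carrier (grp C (k - 1))"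
        using fc[OF A.bd_closed[OF k x(1)]] bd[OF k x(1)] x by simp
    next
      fix c d assume "c \<in> carrier (grp C k)" "d \<in> carrier (grp C k)"
      then obtain x y where x: "x \<in> carrier (grp A k)" "c = f k x" "y \<in> carrier (grp A k)" "d = f k y"
        using ex by metis
      show "bd C k (c \<otimes>\<^bsub>grp C k\<^esub> d) = bd C k c \<otimes>\<^bsub>grp C (k - 1)\<^esub> bd C k d"
        using x k hom_mult[OF A.bd_hom[OF k] x(1,3)] hom_mult[OF hom x(1,3)]
          hom_mult[OF hom A.bd_closed[OF k x(1)] A.bd_closed[OF k x(3)]] bd[OF k A.grp_m_closed[OF x(1,3)]]
        by (simp add: bd)
    qed
  next
    fix k :: nat and c assume k: "2 \<le> k" and "c \<in> carrier (grp C k)"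
    then obtain x where x: "x \<in> carrier (grp A k)" "c = f k x" using ex by blast
    have "bd C (k - 1) (bd C k c) = f (k - 1 - 1) (bd A (k - 1) (bd A k x))"
      using k x bd[of k x] bd[of "k - 1" "bd A k x"] A.bd_closed[of k x] by simp
    also have "\<dots> = \<one>\<^bsub>grp C (k - 2)\<^esub>"
      using A.bd_bd[OF k x(1)] group_hom.hom_one[OF gh] by (simp add: numeral_2_eq_2)
    finally show "bd C (k - 1) (bd C k c) = \<one>\<^bsub>grp C (k - 2)\<^esub>" .
  next
    fix i j c d assume "c \<in> carrier (grp C i)" and "d \<in> carrier (grp C j)"
    then obtain x y where x: "x \<in> carrier (grp A i)" "c = f i x" and y: "y \<in> carrier (grp A j)" "d = f j y"
      using ex by metis
    have xy: "gmult A i j x y \<in> carrier (grp A (i + j))" using x y by (simp add: A.gmult_closed)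
    show "gmult C i j c d \<in> carrier (grp C (i + j))"
      using x y xy by (simp add: mult fc)
    { fix c' assume "c' \<in> carrier (grp C i)"
      then obtain x' where x': "x' \<in> carrier (grp A i)" "c' = f i x'" using ex by metis
      show "gmult C i j (c \<otimes>\<^bsub>grp C i\<^esub> c') d = gmult C i j c d \<otimes>\<^bsub>grp C (i + j)\<^esub> gmult C i j c' d"
        using mult[OF A.grp_m_closed[OF x(1) x'(1)] y(1)] x x' y
        by (simp add: hom_mult[OF hom] mult A.gmult_left A.gmult_closed) }
    { fix d' assume "d' \<in> carrier (grp C j)"
      then obtain y' where y': "y' \<in> carrier (grp A j)" "d' = f j y'" using ex by metis
      show "gmult C i j c (d \<otimes>\<^bsub>grp C j\<^esub> d') = gmult C i j c d \<otimes>\<^bsub>grp C (i + j)\<^esub> gmult C i j c d'"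
        using mult[OF x(1) A.grp_m_closed[OF y(1) y'(1)]] x y y'
        by (simp add: hom_mult[OF hom] mult A.gmult_right A.gmult_closed) }
    { fix k e assume "e \<in> carrier (grp C k)"
      then obtain z where z: "z \<in> carrier (grp A k)" "e = f k z" using ex by metis
      show "gmult C (i + j) k (gmult C i j c d) e = gmult C i (j + k) c (gmult C j k d e)"
        using x y z mult[OF xy z(1)] mult[OF x(1) A.gmult_closed[OF y(1) z(1)]]
        by (simp add: mult A.gmult_assoc add.assoc) }
    assume k: "0 < i + j"
    let ?l = "if i = 0 then \<one>\<^bsub>grp A (i + j - 1)\<^esub> else gmult A (i - 1) j (bd A i x) y"
    let ?r = "if j = 0 then \<one>\<^bsub>grp A (i + j - 1)\<^esub> else gmult A i (j - 1) x (bd A j y)"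
    have l: "?l \<in> carrier (grp A (i + j - 1))"
      using A.gmult_closed[OF A.bd_closed[OF _ x(1)] y(1)] by (cases "i = 0") auto
    have r: "?r \<in> carrier (grp A (i + j - 1))"
      using A.gmult_closed[OF x(1) A.bd_closed[OF _ y(1)]] by (cases "j = 0") auto
    have "bd C (i + j) (gmult C i j c d) = f (i + j - 1) (bd A (i + j) (gmult A i j x y))"
      using x y by (simp only: mult bd[OF k xy])
    also have "bd A (i + j) (gmult A i j x y) = ?l \<otimes>\<^bsub>grp A (i + j - 1)\<^esub> (?r [^]\<^bsub>grp A (i + j - 1)\<^esub> ((- 1) ^ i :: int))"
      unfolding A.leibniz[OF k x(1) y(1)]
      by (cases "j = 0") (simp_all add: group.int_pow_one[OF A.grp_is_group])
    also have "f (i + j - 1) \<dots> = f (i + j - 1) ?l \<otimes>\<^bsub>grp C (i + j - 1)\<^esub>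
        (f (i + j - 1) ?r [^]\<^bsub>grp C (i + j - 1)\<^esub> ((- 1) ^ i :: int))"
      using l r group.int_pow_closed[OF A.grp_is_group r]
      by (simp only: hom_mult[OF hom] group_hom.hom_int_pow[OF gh])
    also have "f (i + j - 1) ?l = (if i = 0 then \<one>\<^bsub>grp C (i + j - 1)\<^esub> else gmult C (i - 1) j (bd C i c) d)"
      using x y mult[OF A.bd_closed[OF _ x(1)] y(1)] group_hom.hom_one[OF gh] by (simp add: bd)
    also have "f (i + j - 1) ?r [^]\<^bsub>grp C (i + j - 1)\<^esub> ((- 1) ^ i :: int)
      = (if j = 0 then \<one>\<^bsub>grp C (i + j - 1)\<^esub> else gmult C i (j - 1) c (bd C j d) [^]\<^bsub>grp C (i + j - 1)\<^esub> ((- 1) ^ i :: int))"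
      using x y mult[OF x(1) A.bd_closed[OF _ y(1)]] group_hom.hom_one[OF gh]
        group.int_pow_one[OF grp] by (simp add: bd)
    finally show "bd C (i + j) (gmult C i j c d) =
        (if i = 0 then \<one>\<^bsub>grp C (i + j - 1)\<^esub> else gmult C (i - 1) j (bd C i c) d) \<otimes>\<^bsub>grp C (i + j - 1)\<^esub>
        (if j = 0 then \<one>\<^bsub>grp C (i + j - 1)\<^esub>
         else gmult C i (j - 1) c (bd C j d) [^]\<^bsub>grp C (i + j - 1)\<^esub> ((- 1) ^ i :: int))" .
  next
    show "gone C \<in> carrier (grp C 0)" using fc[OF A.gone_closed] by (simp add: one)
    fix c i assume "c \<in> carrier (grp C i)"
    then obtain x where x: "x \<in> carrier (grp A i)" "c = f i x" using ex by metis
    show "gmult C 0 i (gone C) c = c" "gmult C i 0 c (gone C) = c"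
      using x mult[OF A.gone_closed x(1)] mult[OF x(1) A.gone_closed]
      by (simp_all add: one A.gone_left A.gone_right)
  qed (rule C)
  show "dg_hom A C f"
    using C_ring A hom by (simp add: dg_hom_def bd mult one)
qed

locale dg_ideal_quotient = graded_mult B for B :: "'a dgring" +
  fixes J :: "nat \<Rightarrow> 'a set"
  assumes ideal: "dg_ideal B J"
    and bd_is_hom: "0 < k \<Longrightarrow> bd B k \<in> hom (grp B k) (grp B (k - 1))"
begin

lemma J_subgroup: "subgroup (J k) (grp B k)"
  by (rule dg_ideal_subgroup[OF ideal])

lemma J_carrier: "x \<in> J k \<Longrightarrow> x \<in> carrier (grp B k)"
  using subgroup.subset[OF J_subgroup] by blast

lemma grp_quot: "grp (dg_quot B J) k = grp B k Mod J k"
  by (simp add: dg_quot_def)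

lemma gone_quot: "gone (dg_quot B J) = dg_quot_cls B J 0 (gone B)"
  by (simp add: dg_quot_def)

lemma quot_comm_group: "comm_group (grp (dg_quot B J) k)"
  unfolding grp_quot by (rule quotient_comm_group[OF graded_comm_group J_subgroup])

lemma quot_group: "Group.group (grp (dg_quot B J) k)"
  using quot_comm_group by (simp add: comm_group_def)

lemma quot_cls_hom: "dg_quot_cls B J k \<in> hom (grp B k) (grp (dg_quot B J) k)"
  unfolding grp_quot dg_quot_cls_def by (rule quotient_cls_hom[OF graded_comm_group J_subgroup])

lemma quot_cls_closed: "x \<in> carrier (grp B k) \<Longrightarrow> dg_quot_cls B J k x \<in> carrier (grp (dg_quot B J) k)"
  by (rule hom_in_carrier[OF quot_cls_hom])

lemma quot_cls_one_iff:
  "x \<in> carrier (grp B k) \<Longrightarrow> dg_quot_cls B J k x = \<one>\<^bsub>grp (dg_quot B J) k\<^esub> \<longleftrightarrow> x \<in> J k"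
  unfolding grp_quot dg_quot_cls_def by (rule quotient_cls_one_iff[OF graded_comm_group J_subgroup])

lemma quot_cls_eq_iff:
  "\<lbrakk>x \<in> carrier (grp B k); y \<in> carrier (grp B k)\<rbrakk> \<Longrightarrow>
    dg_quot_cls B J k x = dg_quot_cls B J k y \<longleftrightarrow> x \<otimes>\<^bsub>grp B k\<^esub> inv\<^bsub>grp B k\<^esub> y \<in> J k"
  unfolding dg_quot_cls_def by (rule quotient_cls_eq_iff[OF graded_comm_group J_subgroup])

lemma quot_cls_mem_iff:
  "\<lbrakk>x \<in> carrier (grp B k); y \<in> carrier (grp B k)\<rbrakk> \<Longrightarrow>
    x \<in> dg_quot_cls B J k y \<longleftrightarrow> x \<otimes>\<^bsub>grp B k\<^esub> inv\<^bsub>grp B k\<^esub> y \<in> J k"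
  unfolding dg_quot_cls_def by (rule quotient_cls_mem_iff[OF graded_comm_group J_subgroup])

lemma quot_cls_subset: "\<lbrakk>x \<in> carrier (grp B k); y \<in> dg_quot_cls B J k x\<rbrakk> \<Longrightarrow> y \<in> carrier (grp B k)"
  unfolding dg_quot_cls_def by (rule cls_subset_carrier[OF graded_comm_group J_subgroup])

lemma quot_cases:
  assumes "c \<in> carrier (grp (dg_quot B J) k)"
  obtains x where "x \<in> carrier (grp B k)" "c = dg_quot_cls B J k x"
  using carrier_quotientE[OF graded_comm_group J_subgroup assms[unfolded grp_quot]]
  unfolding dg_quot_cls_def by metis

lemma quot_induced:
  assumes "Group.group K" "h \<in> hom (grp B k) K" "\<And>x. x \<in> J k \<Longrightarrow> h x = \<one>\<^bsub>K\<^esub>"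
  shows quot_induced_hom: "induced h \<in> hom (grp (dg_quot B J) k) K"
    and quot_induced_cls: "x \<in> carrier (grp B k) \<Longrightarrow> induced h (dg_quot_cls B J k x) = h x"
  unfolding grp_quot dg_quot_cls_def
  by (rule induced_hom[OF graded_comm_group J_subgroup assms], assumption)
    (rule induced_cls[OF graded_comm_group J_subgroup assms], assumption)

lemma quot_bd:
  assumes k: "0 < k" and x: "x \<in> carrier (grp B k)"
  shows "bd (dg_quot B J) k (dg_quot_cls B J k x) = dg_quot_cls B J (k - 1) (bd B k x)"
proof -
  have h: "(\<lambda>x. dg_quot_cls B J (k - 1) (bd B k x)) \<in> hom (grp B k) (grp (dg_quot B J) (k - 1))"
    using hom_compose[OF bd_is_hom[OF k] quot_cls_hom] by (simp add: comp_def)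
  have "dg_quot_cls B J (k - 1) (bd B k x) = \<one>\<^bsub>grp (dg_quot B J) (k - 1)\<^esub>" if "x \<in> J k" for x
    using dg_ideal_bd[OF ideal k that] J_carrier quot_cls_one_iff by blast
  from quot_induced_cls[OF quot_group h this x] show ?thesis
    by (simp add: dg_quot_def)
qed

lemma quot_mult:
  assumes x: "x \<in> carrier (grp B i)" and y: "y \<in> carrier (grp B j)"
  shows "gmult (dg_quot B J) i j (dg_quot_cls B J i x) (dg_quot_cls B J j y)
    = dg_quot_cls B J (i + j) (gmult B i j x y)"
proof -
  let ?h = "\<lambda>x y. dg_quot_cls B J (i + j) (gmult B i j x y)"
  have "induced2 ?h (J i #>\<^bsub>grp B i\<^esub> x) (J j #>\<^bsub>grp B j\<^esub> y) = ?h x y"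
  proof (rule induced2_cls[OF graded_comm_group J_subgroup graded_comm_group J_subgroup quot_group[of "i + j"]])
    fix y assume "y \<in> carrier (grp B j)"
    then show "(\<lambda>x. ?h x y) \<in> hom (grp B i) (grp (dg_quot B J) (i + j))"
      using hom_compose[OF mult_left_hom quot_cls_hom] by (simp add: comp_def)
  next
    fix x assume "x \<in> carrier (grp B i)"
    then show "?h x \<in> hom (grp B j) (grp (dg_quot B J) (i + j))"
      using hom_compose[OF mult_right_hom quot_cls_hom] by (simp add: comp_def)
  next
    fix x y assume "x \<in> J i" "y \<in> carrier (grp B j)"
    then show "?h x y = \<one>\<^bsub>grp (dg_quot B J) (i + j)\<^esub>"
      using dg_ideal_right[OF ideal] J_carrier quot_cls_one_iff by blast
  next
    fix x y assume "x \<in> carrier (grp B i)" "y \<in> J j"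
    then show "?h x y = \<one>\<^bsub>grp (dg_quot B J) (i + j)\<^esub>"
      using dg_ideal_left[OF ideal] J_carrier quot_cls_one_iff by blast
  qed (use x y in auto)
  then show ?thesis by (simp add: dg_quot_def dg_quot_cls_def)
qed

lemma quot_surj: "carrier (grp (dg_quot B J) k) \<subseteq> dg_quot_cls B J k ` carrier (grp B k)"
  by (auto elim: quot_cases)

end

context
  fixes B :: "'a dgring" and J
  assumes B: "dg_ring B" and J: "dg_ideal B J"
begin

interpretation B: dg_ring B by (rule B)

lemma dg_ring_ideal_quotient: "dg_ideal_quotient B J"
  by (intro dg_ideal_quotient.intro dg_ideal_quotient_axioms.intro B.graded_mult_axioms J B.bd_hom)

interpretation Q: dg_ideal_quotient B J by (rule dg_ring_ideal_quotient)

lemma dg_quot_dg_ring: "dg_ring (dg_quot B J)"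
  and dg_quot_cls_dg_hom: "dg_hom B (dg_quot B J) (dg_quot_cls B J)"
  by (rule dg_ring_image[OF B Q.quot_comm_group Q.quot_cls_hom Q.quot_surj Q.quot_bd Q.quot_mult Q.gone_quot]; assumption)+

lemma dg_quot_induced:
  assumes h: "dg_hom B D h" and one: "\<And>k x. x \<in> J k \<Longrightarrow> h k x = \<one>\<^bsub>grp D k\<^esub>"
  shows dg_quot_induced_cls: "x \<in> carrier (grp B k) \<Longrightarrow> induced (h k) (dg_quot_cls B J k x) = h k x"
    and dg_quot_induced_dg_hom: "dg_hom (dg_quot B J) D (\<lambda>k. induced (h k))"
proof -
  have D: "dg_ring D" using h by (simp add: dg_hom_def)
  interpret D: dg_ring D by (rule D)
  have cls: "induced (h k) (dg_quot_cls B J k x) = h k x" if "x \<in> carrier (grp B k)" for k x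
    by (rule Q.quot_induced_cls[OF D.grp_is_group dg_hom_hom[OF h] one that])
  then show "x \<in> carrier (grp B k) \<Longrightarrow> induced (h k) (dg_quot_cls B J k x) = h k x" .
  show "dg_hom (dg_quot B J) D (\<lambda>k. induced (h k))"
    unfolding dg_hom_def
  proof (intro conjI allI ballI impI)
    show "induced (h k) \<in> hom (grp (dg_quot B J) k) (grp D k)" for k
      by (rule Q.quot_induced_hom[OF D.grp_is_group dg_hom_hom[OF h] one])
  next
    fix k :: nat and c assume k: "0 < k" and "c \<in> carrier (grp (dg_quot B J) k)"
    then obtain x where "x \<in> carrier (grp B k)" "c = dg_quot_cls B J k x"
      by (auto elim: Q.quot_cases)
    then show "induced (h (k - 1)) (bd (dg_quot B J) k c) = bd D k (induced (h k) c)"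
      using k by (simp add: Q.quot_bd cls dg_hom_bd[OF h] B.bd_closed flip: One_nat_def)
  next
    fix i j c d assume "c \<in> carrier (grp (dg_quot B J) i)" "d \<in> carrier (grp (dg_quot B J) j)"
    then obtain x y where "x \<in> carrier (grp B i)" "c = dg_quot_cls B J i x"
       "y \<in> carrier (grp B j)" "d = dg_quot_cls B J j y"
      by (auto elim!: Q.quot_cases)
    then show "induced (h (i + j)) (gmult (dg_quot B J) i j c d) = gmult D i j (induced (h i) c) (induced (h j) d)"
      by (simp add: Q.quot_mult cls dg_hom_mult[OF h] B.gmult_closed)
  qed (use dg_quot_dg_ring D dg_hom_one[OF h] in \<open>auto simp: Q.gone_quot cls B.gone_closed\<close>)
qed

end

lemma dg_ideal_zero:
  assumes "dg_ring D" shows "dg_ideal D (\<lambda>k. {\<one>\<^bsub>grp D k\<^esub>})"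
proof -
  interpret D: dg_ring D by (rule assms)
  have bd: "bd D k \<one>\<^bsub>grp D k\<^esub> = \<one>\<^bsub>grp D (k - 1)\<^esub>" if "0 < k" for k
    using hom_one[OF D.bd_hom[OF that]] D.grp_is_group by blast
  show ?thesis
    unfolding dg_ideal_def
    using bd group_hom.hom_one[OF D.mult_left_group_hom] group_hom.hom_one[OF D.mult_right_group_hom]
      group.triv_subgroup[OF D.grp_is_group] by simp
qed

lemma dg_ideal_preimage:
  assumes h: "dg_hom B D h" and J: "dg_ideal D J"
  shows "dg_ideal B (\<lambda>k. {x \<in> carrier (grp B k). h k x \<in> J k})"
proof -
  interpret B: dg_ring B using h by (simp add: dg_hom_def)
  interpret D: dg_ring D using h by (simp add: dg_hom_def)
  have "subgroup {x \<in> carrier (grp B k). h k x \<in> J k} (grp B k)" for k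
  proof -
    interpret hk: group_hom "grp B k" "grp D k" "h k"
      by (simp add: group_hom_def group_hom_axioms_def B.grp_is_group D.grp_is_group dg_hom_hom[OF h])
    interpret Jk: subgroup "J k" "grp D k" by (rule dg_ideal_subgroup[OF J])
    show ?thesis by (rule hk.G.subgroupI) auto
  qed
  then show ?thesis
    unfolding dg_ideal_def
    using dg_ideal_bd[OF J] dg_ideal_left[OF J] dg_ideal_right[OF J] dg_hom_closed[OF h]
    by (auto simp: dg_hom_bd[OF h] dg_hom_mult[OF h] B.bd_closed B.gmult_closed simp del: One_nat_def)
qed

lemma dg_ring_graded_mult: "dg_ring B \<Longrightarrow> graded_mult B"
proof -
  assume "dg_ring B"
  then interpret dg_ring B .
  show "graded_mult B" by (rule graded_mult_axioms)
qed

lemma dg_ideal_carrier: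
  assumes "dg_ring B" shows "dg_ideal B (\<lambda>k. carrier (grp B k))"
proof -
  interpret dg_ring B by (rule assms)
  show ?thesis
    unfolding dg_ideal_def
    by (intro conjI allI ballI impI group.subgroup_self grp_is_group bd_closed gmult_closed)
qed

lemma dg_ideal_generated_le: "\<lbrakk>dg_ideal B J; \<And>l. S l \<subseteq> J l\<rbrakk> \<Longrightarrow> dg_ideal_generated B S k \<subseteq> J k"
  unfolding dg_ideal_generated_def by blast

lemma dg_ideal_generated_incl: "S k \<subseteq> dg_ideal_generated B S k"
  unfolding dg_ideal_generated_def by blast

lemma dg_ideal_generated_ideal:
  assumes B: "dg_ring B" and S: "\<And>l. S l \<subseteq> carrier (grp B l)"
  shows "dg_ideal B (dg_ideal_generated B S)"
proof -
  let ?\<J> = "{J. dg_ideal B J \<and> (\<forall>l. S l \<subseteq> J l)}"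
  have gen: "x \<in> dg_ideal_generated B S k \<longleftrightarrow> (\<forall>J\<in>?\<J>. x \<in> J k)" for k x
    by (auto simp: dg_ideal_generated_def)
  have ne: "(\<lambda>k. carrier (grp B k)) \<in> ?\<J>" using dg_ideal_carrier[OF B] S by simp
  have "subgroup (dg_ideal_generated B S k) (grp B k)" for k
    unfolding dg_ideal_generated_def
    by (rule group.subgroups_Inter[OF graded_mult.grp_is_group[OF dg_ring_graded_mult[OF B]]])
      (use ne in \<open>auto simp: dg_ideal_def\<close>)
  then show ?thesis
    unfolding dg_ideal_def
  proof (intro conjI allI ballI impI)
    fix k :: nat and x assume "0 < k" "x \<in> dg_ideal_generated B S k"
    then show "bd B k x \<in> dg_ideal_generated B S (k - 1)"
      unfolding gen using dg_ideal_bd[of B _ k x] by blast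
  next
    fix i j x y assume "x \<in> carrier (grp B i)" "y \<in> dg_ideal_generated B S j"
    then show "gmult B i j x y \<in> dg_ideal_generated B S (i + j)"
      unfolding gen using dg_ideal_left[of B _ x i y j] by blast
  next
    fix i j x y assume "x \<in> dg_ideal_generated B S i" "y \<in> carrier (grp B j)"
    then show "gmult B i j x y \<in> dg_ideal_generated B S (i + j)"
      unfolding gen using dg_ideal_right[of B _ x i y j] by blast
  qed
qed

text \<open>
  A map of monoids that equalizes \<open>f\<close> and \<open>g\<close> has an ideal as its kernel, and this ideal contains
  all differences \<open>f z - g z\<close>; so it factors through the quotient by the ideal they generate.
\<close>

lemma dg_quot_coequalizer:
  assumes f: "dg_hom A B f" and g: "dg_hom A B g"
  defines "J \<equiv> dg_ideal_generated B
     (\<lambda>k. {f k z \<otimes>\<^bsub>grp B k\<^esub> inv\<^bsub>grp B k\<^esub> g k z | z. z \<in> carrier (grp A k)})"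
  shows "dg_ideal B J" and "dg_coequalizer TYPE('d) A B f g (dg_quot B J) (dg_quot_cls B J)"
proof -
  have B: "dg_ring B" using f by (simp add: dg_hom_def)
  interpret B: dg_ring B by (rule B)
  let ?S = "\<lambda>k. {f k z \<otimes>\<^bsub>grp B k\<^esub> inv\<^bsub>grp B k\<^esub> g k z | z. z \<in> carrier (grp A k)}"
  have S: "?S k \<subseteq> carrier (grp B k)" for k
    using dg_hom_closed[OF f] dg_hom_closed[OF g] B.grp_is_group[of k]
    by (auto intro!: B.grp_m_closed group.inv_closed)
  show J: "dg_ideal B J" unfolding J_def by (rule dg_ideal_generated_ideal[OF B S])
  interpret Q: dg_ideal_quotient B J by (rule dg_ring_ideal_quotient[OF B J])
  have eq: "dg_quot_cls B J k (f k a) = dg_quot_cls B J k (g k a)" if "a \<in> carrier (grp A k)" for k a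
  proof -
    have "f k a \<otimes>\<^bsub>grp B k\<^esub> inv\<^bsub>grp B k\<^esub> g k a \<in> J k"
      using dg_ideal_generated_incl[of ?S k B] that unfolding J_def by blast
    then show ?thesis
      using Q.quot_cls_eq_iff dg_hom_closed[OF f that] dg_hom_closed[OF g that] by blast
  qed
  show "dg_coequalizer TYPE('d) A B f g (dg_quot B J) (dg_quot_cls B J)"
    unfolding dg_coequalizer_def
  proof (intro conjI allI impI ballI f g dg_quot_cls_dg_hom[OF B J] eq)
    fix D :: "'d dgring" and h
    assume h': "dg_hom B D h \<and> (\<forall>k. \<forall>a\<in>carrier (grp A k). h k (f k a) = h k (g k a))"
    then have h: "dg_hom B D h" by simp
    interpret D: dg_ring D using h by (simp add: dg_hom_def)
    have le: "J k \<subseteq> {x \<in> carrier (grp B k). h k x \<in> {\<one>\<^bsub>grp D k\<^esub>}}" for k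
      unfolding J_def
    proof (rule dg_ideal_generated_le[OF dg_ideal_preimage[OF h dg_ideal_zero]])
      fix l
      interpret hl: group_hom "grp B l" "grp D l" "h l"
        by (simp add: group_hom_def group_hom_axioms_def B.grp_is_group D.grp_is_group dg_hom_hom[OF h])
      show "?S l \<subseteq> {x \<in> carrier (grp B l). h l x \<in> {\<one>\<^bsub>grp D l\<^esub>}}"
        using dg_hom_closed[OF f] dg_hom_closed[OF g] h' by auto
    qed (rule D.dg_ring_axioms)
    then have one: "h k x = \<one>\<^bsub>grp D k\<^esub>" if "x \<in> J k" for k x using that by auto
    show "\<exists>u. dg_hom (dg_quot B J) D u \<and> (\<forall>k. \<forall>b\<in>carrier (grp B k). u k (dg_quot_cls B J k b) = h k b) \<and>
        (\<forall>u'. dg_hom (dg_quot B J) D u' \<and> (\<forall>k. \<forall>b\<in>carrier (grp B k). u' k (dg_quot_cls B J k b) = h k b) \<longrightarrow>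
          (\<forall>k. \<forall>c\<in>carrier (grp (dg_quot B J) k). u' k c = u k c))"
      using dg_quot_induced_cls[OF B J h one] dg_quot_induced_dg_hom[OF B J h one]
      by (intro exI[of _ "\<lambda>k. induced (h k)"]) (auto elim!: Q.quot_cases)
  qed
qed

(* Degrees are kept in the form k - 1 in which the axioms of the locales state them. *)
declare One_nat_def [simp del]

section \<open>Normalized complexes\<close>

text \<open>
  The alternating sum of the faces as a formal sum. Signs can then be cancelled with ordinary
  addition before the sum is evaluated in a multiplicatively written group.
\<close>

definition face_sum :: "('o, 'a) simplicial \<Rightarrow> nat \<Rightarrow> 'a \<Rightarrow> ('a \<Rightarrow>\<^sub>0 int)" where
  "face_sum X k x = (\<Sum>i\<le>k. frag_cmul ((- 1) ^ i) (frag_of (face X k i x)))"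

lemma keys_face_sum: "Poly_Mapping.keys (face_sum X k x) \<subseteq> (\<lambda>i. face X k i x) ` {..k}"
proof -
  have "Poly_Mapping.keys (face_sum X k x) \<subseteq> (\<Union>i\<in>{..k}. Poly_Mapping.keys (frag_cmul ((- 1) ^ i) (frag_of (face X k i x))))"
    unfolding face_sum_def by (rule keys_sum)
  also have "\<dots> \<subseteq> (\<lambda>i. face X k i x) ` {..k}"
  proof (rule UN_least)
    fix i assume "i \<in> {..k}"
    then show "Poly_Mapping.keys (frag_cmul ((- 1) ^ i) (frag_of (face X k i x))) \<subseteq> (\<lambda>i. face X k i x) ` {..k}"
      using keys_cmul[of "(- 1) ^ i" "frag_of (face X k i x)"] by auto
  qed
  finally show ?thesis .
qed

lemma grp_N: "grp (N X) k = level X k Mod degenerate X k"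
  by (simp add: N_def)

lemma hom_restrict_eq:
  assumes "h \<in> hom G K" "Group.group G" "\<And>x. x \<in> carrier G \<Longrightarrow> h' x = h x"
  shows "h' \<in> hom G K"
  using assms by (auto simp: hom_def group.is_monoid monoid.m_closed)

context simplicial_ab_group
begin

lemma level_group: "Group.group (level X k)"
  using level_comm_group[of k] by (simp add: comm_group_def)

lemma face_closed: "\<lbrakk>0 < n; i \<le> n; x \<in> carrier (level X n)\<rbrakk> \<Longrightarrow> face X n i x \<in> carrier (level X (n - 1))"
  by (rule hom_in_carrier[OF face_hom])

lemma degen_closed: "\<lbrakk>i \<le> n; x \<in> carrier (level X n)\<rbrakk> \<Longrightarrow> degen X n i x \<in> carrier (level X (Suc n))"
  by (rule hom_in_carrier[OF degen_hom])

lemma degen_closed': "\<lbrakk>j < k; x \<in> carrier (level X (k - 1))\<rbrakk> \<Longrightarrow> degen X (k - 1) j x \<in> carrier (level X k)"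
  using degen_closed[of j "k - 1" x] by (cases k) auto

lemma degenerate_generators:
  "(\<Union>j<k. degen X (k - 1) j ` carrier (level X (k - 1))) \<subseteq> carrier (level X k)"
  using degen_closed' by auto

lemma degenerate_subgroup: "subgroup (degenerate X k) (level X k)"
  unfolding degenerate_def by (rule group.generate_is_subgroup[OF level_group degenerate_generators])

lemma N_comm_group: "comm_group (grp (N X) k)"
  unfolding grp_N by (rule quotient_comm_group[OF level_comm_group degenerate_subgroup])

lemma N_group: "Group.group (grp (N X) k)"
  using N_comm_group by (simp add: comm_group_def)

lemma N_cls_hom: "N_cls X k \<in> hom (level X k) (grp (N X) k)"
  unfolding grp_N N_cls_def by (rule quotient_cls_hom[OF level_comm_group degenerate_subgroup])

lemma N_cls_closed: "x \<in> carrier (level X k) \<Longrightarrow> N_cls X k x \<in> carrier (grp (N X) k)"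
  by (rule hom_in_carrier[OF N_cls_hom])

lemma N_cases:
  assumes "u \<in> carrier (grp (N X) k)" obtains x where "x \<in> carrier (level X k)" "u = N_cls X k x"
  using carrier_quotientE[OF level_comm_group degenerate_subgroup assms[unfolded grp_N]]
  unfolding N_cls_def by metis

lemma N_cls_degen:
  assumes "j < k" "x \<in> carrier (level X (k - 1))"
  shows "N_cls X k (degen X (k - 1) j x) = \<one>\<^bsub>grp (N X) k\<^esub>"
proof -
  have "degen X (k - 1) j x \<in> degenerate X k"
    unfolding degenerate_def by (rule generate.incl) (use assms in auto)
  then show ?thesis
    unfolding grp_N N_cls_def
    using quotient_cls_one_iff[OF level_comm_group degenerate_subgroup degen_closed'[OF assms]] by blast
qed

lemma degenerate_hom_one:
  assumes "Group.group K" "h \<in> hom (level X k) K"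
    and "\<And>j x. \<lbrakk>j < k; x \<in> carrier (level X (k - 1))\<rbrakk> \<Longrightarrow> h (degen X (k - 1) j x) = \<one>\<^bsub>K\<^esub>"
    and "x \<in> degenerate X k"
  shows "h x = \<one>\<^bsub>K\<^esub>"
proof -
  interpret group_hom "level X k" K h
    using assms level_group by (simp add: group_hom_def group_hom_axioms_def)
  show ?thesis
    by (rule hom_generate_one[OF degenerate_generators _ assms(4)[unfolded degenerate_def]]) (use assms(3) in auto)
qed

lemma N_induced:
  assumes "Group.group K" "h \<in> hom (level X k) K"
    and "\<And>j x. \<lbrakk>j < k; x \<in> carrier (level X (k - 1))\<rbrakk> \<Longrightarrow> h (degen X (k - 1) j x) = \<one>\<^bsub>K\<^esub>"
  shows N_induced_hom: "induced h \<in> hom (grp (N X) k) K"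
    and N_induced_cls: "x \<in> carrier (level X k) \<Longrightarrow> induced h (N_cls X k x) = h x"
  unfolding grp_N N_cls_def
  by (rule induced_hom[OF level_comm_group degenerate_subgroup assms(1,2) degenerate_hom_one[OF assms]]; assumption)
    (rule induced_cls[OF level_comm_group degenerate_subgroup assms(1,2) degenerate_hom_one[OF assms]]; assumption)

lemma face_sum_keys_level:
  "\<lbrakk>0 < k; x \<in> carrier (level X k)\<rbrakk> \<Longrightarrow> Poly_Mapping.keys (face_sum X k x) \<subseteq> carrier (level X (k - 1))"
  using keys_face_sum[of X k x] face_closed[of k _ x] by blast

lemma N_cls_face_sum_keys:
  "\<lbrakk>0 < k; x \<in> carrier (level X k)\<rbrakk> \<Longrightarrow>
    N_cls X (k - 1) ` Poly_Mapping.keys (face_sum X k x) \<subseteq> carrier (grp (N X) (k - 1))"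
  using face_sum_keys_level N_cls_closed by blast

lemma face_sum_face_sum:
  assumes k: "2 \<le> k" and x: "x \<in> carrier (level X k)"
  shows "frag_extend (face_sum X (k - 1)) (face_sum X k x) = 0"
proof -
  let ?f = "\<lambda>(i, j). frag_cmul ((- 1) ^ (i + j)) (frag_of (face X (k - 1) i (face X k j x)))"
  let ?A = "{(i, j). i < j \<and> j \<le> k}" and ?B = "{(i, j). j \<le> i \<and> i \<le> k - 1}"
  have fin: "finite ?A" "finite ?B"
    by (rule finite_subset[of _ "{..k} \<times> {..k}"]; auto)+
  have AB: "{..k - 1} \<times> {..k} = ?A \<union> ?B" using k by auto
  have "frag_extend (face_sum X (k - 1)) (face_sum X k x)
      = (\<Sum>j\<le>k. \<Sum>i\<le>k - 1. ?f (i, j))"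
    unfolding face_sum_def
    by (simp add: frag_extend_sum frag_extend_cmul frag_cmul_sum comp_def power_add mult.commute)
  also have "\<dots> = sum ?f ({..k - 1} \<times> {..k})"
    by (rule trans[OF sum.swap]) (simp only: sum.cartesian_product case_prod_eta)
  also have "\<dots> = sum ?f ?A + sum ?f ?B"
    unfolding AB
  proof (rule sum.union_disjoint[OF fin])
    show "?A \<inter> ?B = {}" by fastforce
  qed
  \<comment> \<open>The identity \<open>d\<^sub>i d\<^sub>j = d\<^sub>j\<^sub>-\<^sub>1 d\<^sub>i\<close> for \<open>i < j\<close> pairs the two halves, with opposite signs.\<close>
  also have "sum ?f ?A = sum (\<lambda>p. - ?f p) ?B"
  proof (rule sum.reindex_bij_witness[where i = "\<lambda>(i, j). (j, Suc i)" and j = "\<lambda>(i, j). (j - 1, i)"])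
    fix p assume "p \<in> ?A"
    then obtain i j where p: "p = (i, j)" "i < j" "j \<le> k" by auto
    have "(- 1) ^ (j - 1 + i) = - ((- 1) ^ (i + j) :: int)" using p by (cases j) (auto simp: power_add)
    then show "- ?f (case p of (i, j) \<Rightarrow> (j - 1, i)) = ?f p"
      by (simp only: p(1) prod.case face_face[OF k p(2,3) x]) simp
  qed (use k in auto)
  finally show ?thesis by (simp add: sum_negf)
qed

lemma N_face_sum_hom:
  assumes k: "0 < k"
  shows "(\<lambda>x. lin_ext (grp (N X) (k - 1)) (N_cls X (k - 1)) (face_sum X k x)) \<in> hom (level X k) (grp (N X) (k - 1))"
    (is "?h \<in> _")
proof -
  interpret K: comm_group "grp (N X) (k - 1)" by (rule N_comm_group)
  have c: "N_cls X (k - 1) (face X k i x) \<in> carrier (grp (N X) (k - 1))"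
    if "x \<in> carrier (level X k)" "i \<le> k" for x i
    using that k by (intro N_cls_closed face_closed)
  have h: "?h x = finprod (grp (N X) (k - 1)) (\<lambda>i. N_cls X (k - 1) (face X k i x) [^]\<^bsub>grp (N X) (k - 1)\<^esub> ((- 1) ^ i :: int)) {..k}"
    if "x \<in> carrier (level X k)" for x
    unfolding face_sum_def using c[OF that] by (intro K.lin_ext_signed_sum) auto
  show ?thesis
  proof (rule homI)
    fix x assume "x \<in> carrier (level X k)"
    then show "?h x \<in> carrier (grp (N X) (k - 1))"
      using k by (intro K.lin_ext_closed N_cls_face_sum_keys)
  next
    fix x y assume x: "x \<in> carrier (level X k)" and y: "y \<in> carrier (level X k)"
    have xy: "x \<otimes>\<^bsub>level X k\<^esub> y \<in> carrier (level X k)"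
      using x y level_group[of k] by (simp add: group.is_monoid monoid.m_closed)
    have "?h (x \<otimes>\<^bsub>level X k\<^esub> y) = finprod (grp (N X) (k - 1)) (\<lambda>i.
        N_cls X (k - 1) (face X k i x) [^]\<^bsub>grp (N X) (k - 1)\<^esub> ((- 1) ^ i :: int) \<otimes>\<^bsub>grp (N X) (k - 1)\<^esub>
        N_cls X (k - 1) (face X k i y) [^]\<^bsub>grp (N X) (k - 1)\<^esub> ((- 1) ^ i :: int)) {..k}"
      unfolding h[OF xy] using c x y k
      by (intro K.finprod_cong')
        (auto simp: hom_mult[OF face_hom] hom_mult[OF N_cls_hom] face_closed K.int_pow_distrib simp del: One_nat_def)
    also have "\<dots> = ?h x \<otimes>\<^bsub>grp (N X) (k - 1)\<^esub> ?h y"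
      unfolding h[OF x] h[OF y] using c x y by (intro K.finprod_multf) auto
    finally show "?h (x \<otimes>\<^bsub>level X k\<^esub> y) = ?h x \<otimes>\<^bsub>grp (N X) (k - 1)\<^esub> ?h y" .
  qed
qed

text \<open>
  The two faces \<open>d\<^sub>j\<close> and \<open>d\<^sub>j\<^sub>+\<^sub>1\<close> of \<open>s\<^sub>j x\<close> are equal to \<open>x\<close> and carry opposite
  signs; the others are degenerate.
\<close>

lemma N_face_sum_degen:
  assumes j: "j < k" and x: "x \<in> carrier (level X (k - 1))"
  shows "lin_ext (grp (N X) (k - 1)) (N_cls X (k - 1)) (face_sum X k (degen X (k - 1) j x)) = \<one>\<^bsub>grp (N X) (k - 1)\<^esub>"
proof -
  interpret K: comm_group "grp (N X) (k - 1)" by (rule N_comm_group)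
  obtain n where k: "k = Suc n" using j by (cases k) auto
  have jn: "j \<le> n" and xn: "x \<in> carrier (level X n)" using j x k by auto
  let ?g = "\<lambda>i. frag_cmul ((- 1) ^ i) (frag_of (face X k i (degen X (k - 1) j x)))"
  let ?I = "{..k} - {j, Suc j}"
  have fd: "face X k i (degen X (k - 1) j x) = (if i < j then degen X (n - 1) (j - 1) (face X n i x)
         else if i \<le> Suc j then x else degen X (n - 1) j (face X n (i - 1) x))" if "i \<le> k" for i
    using face_degen[OF jn _ xn, of i] that by (simp add: k)
  have "face_sum X k (degen X (k - 1) j x) = sum ?g ?I + sum ?g {j, Suc j}"
    unfolding face_sum_def using j by (intro sum.subset_diff) auto
  also have "sum ?g {j, Suc j} = 0"
    using j by (simp add: fd flip: frag_cmul_distrib)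
  finally have e: "face_sum X k (degen X (k - 1) j x) = sum ?g ?I" by simp
  have one: "N_cls X (k - 1) (face X k i (degen X (k - 1) j x)) = \<one>\<^bsub>grp (N X) (k - 1)\<^esub>" if i: "i \<in> ?I" for i
  proof (cases "i < j")
    case True
    then show ?thesis
      using i jn xn face_closed[of n i x] N_cls_degen[of "j - 1" n "face X n i x"] fd[of i] by (simp add: k)
  next
    case False
    then have "0 < n" "i - 1 \<le> n" "j < n" "Suc j < i" using i jn k by auto
    then show ?thesis
      using False i xn face_closed[of n "i - 1" x] N_cls_degen[of j n "face X n (i - 1) x"] fd[of i] by (simp add: k)
  qed
  have "lin_ext (grp (N X) (k - 1)) (N_cls X (k - 1)) (sum ?g ?I)
      = finprod (grp (N X) (k - 1)) (\<lambda>i. N_cls X (k - 1) (face X k i (degen X (k - 1) j x)) [^]\<^bsub>grp (N X) (k - 1)\<^esub> ((- 1) ^ i :: int)) ?I"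
    using one by (intro K.lin_ext_signed_sum) auto
  also have "\<dots> = \<one>\<^bsub>grp (N X) (k - 1)\<^esub>"
    using one K.int_pow_one by (intro K.finprod_one_eqI) metis
  finally show ?thesis using e by simp
qed

lemma N_bd_induced:
  assumes k: "0 < k" and x: "x \<in> carrier (level X k)"
  shows "N_cls X (k - 1) (finprod (level X (k - 1)) (\<lambda>i. face X k i x [^]\<^bsub>level X (k - 1)\<^esub> ((- 1) ^ i :: int)) {..k})
    = lin_ext (grp (N X) (k - 1)) (N_cls X (k - 1)) (face_sum X k x)"
proof -
  interpret L: comm_group "level X (k - 1)" by (rule level_comm_group)
  have "finprod (level X (k - 1)) (\<lambda>i. face X k i x [^]\<^bsub>level X (k - 1)\<^esub> ((- 1) ^ i :: int)) {..k}
      = lin_ext (level X (k - 1)) (\<lambda>y. y) (face_sum X k x)"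
    unfolding face_sum_def using face_closed[OF k _ x] by (intro L.lin_ext_signed_sum[symmetric]) auto
  then show ?thesis
    using L.hom_lin_ext[OF N_comm_group N_cls_hom, of "\<lambda>y. y" "face_sum X k x"] face_sum_keys_level[OF k x] by simp
qed

lemma N_bd_eq_induced:
  "bd (N X) k = induced (\<lambda>x. N_cls X (k - 1) (finprod (level X (k - 1)) (\<lambda>i. face X k i x [^]\<^bsub>level X (k - 1)\<^esub> ((- 1) ^ i :: int)) {..k}))"
  by (simp add: N_def)

lemma
  assumes k: "0 < k"
  shows N_bd_hom: "bd (N X) k \<in> hom (grp (N X) k) (grp (N X) (k - 1))"
    and N_bd: "x \<in> carrier (level X k) \<Longrightarrow>
      bd (N X) k (N_cls X k x) = lin_ext (grp (N X) (k - 1)) (N_cls X (k - 1)) (face_sum X k x)"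
proof -
  let ?h = "\<lambda>x. N_cls X (k - 1) (finprod (level X (k - 1)) (\<lambda>i. face X k i x [^]\<^bsub>level X (k - 1)\<^esub> ((- 1) ^ i :: int)) {..k})"
  have h: "?h \<in> hom (level X k) (grp (N X) (k - 1))"
    by (rule hom_restrict_eq[OF N_face_sum_hom[OF k] level_group N_bd_induced[OF k]])
  have d: "?h (degen X (k - 1) j x) = \<one>\<^bsub>grp (N X) (k - 1)\<^esub>" if "j < k" "x \<in> carrier (level X (k - 1))" for j x
    using N_bd_induced[OF k degen_closed'[OF that]] N_face_sum_degen[OF that] by simp
  show "bd (N X) k \<in> hom (grp (N X) k) (grp (N X) (k - 1))"
    unfolding N_bd_eq_induced by (rule N_induced_hom[OF N_group h d])
  show "bd (N X) k (N_cls X k x) = lin_ext (grp (N X) (k - 1)) (N_cls X (k - 1)) (face_sum X k x)"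
    if "x \<in> carrier (level X k)"
    unfolding N_bd_eq_induced by (rule trans[OF N_induced_cls[OF N_group h d that] N_bd_induced[OF k that]])
qed

lemma N_cochain_complex: "cochain_complex (N X)"
proof (intro cochain_complex.intro)
  show "comm_group (grp (N X) k)" for k by (rule N_comm_group)
  show "0 < k \<Longrightarrow> bd (N X) k \<in> hom (grp (N X) k) (grp (N X) (k - 1))" for k by (rule N_bd_hom)
  fix k u assume k: "2 \<le> k" and "u \<in> carrier (grp (N X) k)"
  then obtain x where x: "x \<in> carrier (level X k)" "u = N_cls X k x" by (auto elim: N_cases)
  have k0: "0 < k" "0 < k - 1" using k by auto
  let ?K = "grp (N X) (k - 1 - 1)" and ?c = "N_cls X (k - 1 - 1)"
  interpret K: comm_group ?K by (rule N_comm_group)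
  have keys: "Poly_Mapping.keys (face_sum X k x) \<subseteq> carrier (level X (k - 1))"
    by (rule face_sum_keys_level[OF k0(1) x(1)])
  have cl: "?c ` Poly_Mapping.keys (face_sum X (k - 1) y) \<subseteq> carrier ?K" if "y \<in> Poly_Mapping.keys (face_sum X k x)" for y
    using N_cls_face_sum_keys[OF k0(2)] keys that by blast
  have "bd (N X) (k - 1) (bd (N X) k u) = lin_ext ?K (\<lambda>y. bd (N X) (k - 1) (N_cls X (k - 1) y)) (face_sum X k x)"
    unfolding x(2) N_bd[OF k0(1) x(1)]
    by (rule comm_group.hom_lin_ext[OF N_comm_group N_comm_group N_bd_hom[OF k0(2)] N_cls_face_sum_keys[OF k0(1) x(1)]])
  also have "\<dots> = lin_ext ?K (\<lambda>y. lin_ext ?K ?c (face_sum X (k - 1) y)) (face_sum X k x)"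
  proof (rule K.lin_ext_cong)
    show "bd (N X) (k - 1) (N_cls X (k - 1) y) = lin_ext ?K ?c (face_sum X (k - 1) y)"
      if "y \<in> Poly_Mapping.keys (face_sum X k x)" for y
      using N_bd[OF k0(2)] keys that by blast
    show "(\<lambda>y. lin_ext ?K ?c (face_sum X (k - 1) y)) ` Poly_Mapping.keys (face_sum X k x) \<subseteq> carrier ?K"
      by (rule image_subsetI) (rule K.lin_ext_closed[OF cl])
  qed
  also have "\<dots> = lin_ext ?K ?c (frag_extend (face_sum X (k - 1)) (face_sum X k x))"
    by (rule K.lin_ext_frag_extend[OF cl, symmetric])
  finally show "bd (N X) (k - 1) (bd (N X) k u) = \<one>\<^bsub>grp (N X) (k - 2)\<^esub>"
    unfolding face_sum_face_sum[OF k x(1)] using K.lin_ext_0 by (simp add: numeral_2_eq_2)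
qed

end

definition simp_ab_hom :: "('a monoid, 'a) simplicial \<Rightarrow> ('b monoid, 'b) simplicial \<Rightarrow> (nat \<Rightarrow> 'a \<Rightarrow> 'b) \<Rightarrow> bool" where
  "simp_ab_hom X Y f \<longleftrightarrow>
     (\<forall>n. f n \<in> hom (level X n) (level Y n)) \<and>
     (\<forall>n i. \<forall>x \<in> carrier (level X n). 0 < n \<and> i \<le> n \<longrightarrow> f (n - 1) (face X n i x) = face Y n i (f n x)) \<and>
     (\<forall>n i. \<forall>x \<in> carrier (level X n). i \<le> n \<longrightarrow> f (Suc n) (degen X n i x) = degen Y n i (f n x))"

context
  fixes X :: "'a simp_ab" and Y :: "'b simp_ab" and f
  assumes X: "simplicial_ab_group X" and Y: "simplicial_ab_group Y" and f: "simp_ab_hom X Y f"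
begin

interpretation X: simplicial_ab_group X by (rule X)
interpretation Y: simplicial_ab_group Y by (rule Y)

lemma simp_ab_hom_hom: "f n \<in> hom (level X n) (level Y n)"
  using f by (simp add: simp_ab_hom_def)

lemma simp_ab_hom_closed: "x \<in> carrier (level X n) \<Longrightarrow> f n x \<in> carrier (level Y n)"
  by (rule hom_in_carrier[OF simp_ab_hom_hom])

lemma N_map_induced:
  shows N_map_hom: "N_map Y f k \<in> hom (grp (N X) k) (grp (N Y) k)"
    and N_map_cls: "x \<in> carrier (level X k) \<Longrightarrow> N_map Y f k (N_cls X k x) = N_cls Y k (f k x)"
proof -
  have h: "(\<lambda>x. N_cls Y k (f k x)) \<in> hom (level X k) (grp (N Y) k)"
    using hom_compose[OF simp_ab_hom_hom Y.N_cls_hom] by (simp add: comp_def)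
  have d: "N_cls Y k (f k (degen X (k - 1) j x)) = \<one>\<^bsub>grp (N Y) k\<^esub>" if "j < k" "x \<in> carrier (level X (k - 1))" for j x
  proof -
    have "f (Suc (k - 1)) (degen X (k - 1) j x) = degen Y (k - 1) j (f (k - 1) x)"
    proof -
      have "j \<le> k - 1" using that by simp
      then show ?thesis using f that(2) unfolding simp_ab_hom_def by blast
    qed
    then show ?thesis using Y.N_cls_degen[OF that(1) simp_ab_hom_closed[OF that(2)]] that by simp
  qed
  show "N_map Y f k \<in> hom (grp (N X) k) (grp (N Y) k)"
    unfolding N_map_def by (rule X.N_induced_hom[OF Y.N_group h d])
  show "x \<in> carrier (level X k) \<Longrightarrow> N_map Y f k (N_cls X k x) = N_cls Y k (f k x)"
    unfolding N_map_def by (rule X.N_induced_cls[OF Y.N_group h d])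
qed

lemma face_sum_natural:
  assumes "0 < k" "x \<in> carrier (level X k)"
  shows "frag_extend (\<lambda>y. frag_of (f (k - 1) y)) (face_sum X k x) = face_sum Y k (f k x)"
  using assms f unfolding face_sum_def
  by (auto simp: frag_extend_sum frag_extend_cmul simp_ab_hom_def intro!: sum.cong)

lemma N_map_cpx_hom: "cpx_hom (N X) (N Y) (N_map Y f)"
  unfolding cpx_hom_def
proof (intro conjI allI impI ballI N_map_hom)
  fix k :: nat and u assume k: "0 < k" and "u \<in> carrier (grp (N X) k)"
  then obtain x where x: "x \<in> carrier (level X k)" "u = N_cls X k x" by (auto elim: X.N_cases)
  let ?K = "grp (N Y) (k - 1)"
  interpret K: comm_group ?K by (rule Y.N_comm_group)
  have keys: "Poly_Mapping.keys (face_sum X k x) \<subseteq> carrier (level X (k - 1))"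
    by (rule X.face_sum_keys_level[OF k x(1)])
  have "N_map Y f (k - 1) (bd (N X) k u)
      = lin_ext ?K (\<lambda>y. N_map Y f (k - 1) (N_cls X (k - 1) y)) (face_sum X k x)"
    unfolding x(2) X.N_bd[OF k x(1)]
    by (rule comm_group.hom_lin_ext[OF X.N_comm_group Y.N_comm_group N_map_hom X.N_cls_face_sum_keys[OF k x(1)]])
  also have "\<dots> = lin_ext ?K (\<lambda>y. lin_ext ?K (N_cls Y (k - 1)) (frag_of (f (k - 1) y))) (face_sum X k x)"
    using keys N_map_cls Y.N_cls_closed[OF simp_ab_hom_closed]
    by (intro K.lin_ext_cong) (auto simp: subset_iff simp del: One_nat_def)
  also have "\<dots> = lin_ext ?K (N_cls Y (k - 1)) (frag_extend (\<lambda>y. frag_of (f (k - 1) y)) (face_sum X k x))"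
    using keys Y.N_cls_closed[OF simp_ab_hom_closed]
    by (intro K.lin_ext_frag_extend[symmetric]) (auto simp: subset_iff)
  also have "\<dots> = bd (N Y) k (N_map Y f k u)"
    using x(1) by (simp only: x(2) N_map_cls Y.N_bd[OF k] simp_ab_hom_closed face_sum_natural[OF k])
  finally show "N_map Y f (k - 1) (bd (N X) k u) = bd (N Y) k (N_map Y f k u)" .
qed

end

section \<open>Tensor powers and the free simplicial ring\<close>

definition tensor_relators :: "'a monoid \<Rightarrow> ('a list \<Rightarrow>\<^sub>0 int) set" where
  "tensor_relators A =
     {frag_of (us @ (x \<otimes>\<^bsub>A\<^esub> y) # vs) - frag_of (us @ x # vs) - frag_of (us @ y # vs) | us x y vs.
        us \<in> lists (carrier A) \<and> x \<in> carrier A \<and> y \<in> carrier A \<and> vs \<in> lists (carrier A)}"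

locale tensor_power = comm_group A for A :: "'a monoid"
begin

lemma tensor_presentation: "presentation (lists (carrier A)) (tensor_relators A)"
proof
  fix r assume "r \<in> tensor_relators A"
  then obtain us x y vs where r: "r = frag_of (us @ (x \<otimes>\<^bsub>A\<^esub> y) # vs) - frag_of (us @ x # vs) - frag_of (us @ y # vs)"
    "us \<in> lists (carrier A)" "x \<in> carrier A" "y \<in> carrier A" "vs \<in> lists (carrier A)"
    unfolding tensor_relators_def by blast
  then have "{us @ (x \<otimes>\<^bsub>A\<^esub> y) # vs, us @ x # vs, us @ y # vs} \<subseteq> lists (carrier A)" by auto
  then show "Poly_Mapping.keys r \<subseteq> lists (carrier A)"
    using keys_diff[of "frag_of (us @ (x \<otimes>\<^bsub>A\<^esub> y) # vs) - frag_of (us @ x # vs)" "frag_of (us @ y # vs)"]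
      keys_diff[of "frag_of (us @ (x \<otimes>\<^bsub>A\<^esub> y) # vs)" "frag_of (us @ x # vs)"]
    unfolding r(1) keys_frag_of by blast
qed

sublocale P: presentation "lists (carrier A)" "tensor_relators A"
  by (rule tensor_presentation)

lemma tensor_rel_eq: "tensor_rel A = P.Rel"
  by (simp add: tensor_rel_def tensor_relators_def)

lemma tensor_eq: "tensor A = P.Q"
  by (simp add: tensor_def tensor_rel_eq)

lemma tensor_cls_eq: "tensor_cls A c = P.cls c"
  by (simp add: tensor_cls_def tensor_rel_eq)

lemma tensor_comm_group: "comm_group (tensor A)"
  unfolding tensor_eq by (rule P.Q.comm_group_axioms)

lemma tensor_group: "Group.group (tensor A)"
  using tensor_comm_group by (simp add: comm_group_def)

lemma tensor_cls_closed: "Poly_Mapping.keys c \<subseteq> lists (carrier A) \<Longrightarrow> tensor_cls A c \<in> carrier (tensor A)"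
  unfolding tensor_eq tensor_cls_eq by (rule P.cls_closed)

lemma tensor_word_closed: "w \<in> lists (carrier A) \<Longrightarrow> tensor_cls A (frag_of w) \<in> carrier (tensor A)"
  by (rule tensor_cls_closed) simp

lemma lin_ext_tensor_cls:
  assumes "\<And>a. a \<in> Poly_Mapping.keys c \<Longrightarrow> Poly_Mapping.keys (g a) \<subseteq> lists (carrier A)"
  shows "lin_ext (tensor A) (\<lambda>a. tensor_cls A (g a)) c = tensor_cls A (frag_extend g c)"
  using P.lin_ext_cls[OF assms] unfolding tensor_eq tensor_cls_eq .

lemma tensor_hom_eqI:
  assumes "Group.group K" "h \<in> hom (tensor A) K" "h' \<in> hom (tensor A) K"
    and "\<And>w. w \<in> lists (carrier A) \<Longrightarrow> h (tensor_cls A (frag_of w)) = h' (tensor_cls A (frag_of w))"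
    and "t \<in> carrier (tensor A)"
  shows "h t = h' t"
  using P.Q_hom_eqI[of K h h' t] assms unfolding tensor_eq tensor_cls_eq by blast

lemma tensor_lift:
  assumes K: "comm_group K" and f: "\<And>w. w \<in> lists (carrier A) \<Longrightarrow> f w \<in> carrier K"
    and ml: "\<And>us x y vs. \<lbrakk>us \<in> lists (carrier A); x \<in> carrier A; y \<in> carrier A; vs \<in> lists (carrier A)\<rbrakk> \<Longrightarrow>
      f (us @ (x \<otimes>\<^bsub>A\<^esub> y) # vs) = f (us @ x # vs) \<otimes>\<^bsub>K\<^esub> f (us @ y # vs)"
  shows tensor_lift_hom: "induced (lin_ext K f) \<in> hom (tensor A) K"
    and tensor_lift_cls: "Poly_Mapping.keys c \<subseteq> lists (carrier A) \<Longrightarrow> induced (lin_ext K f) (tensor_cls A c) = lin_ext K f c"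
    and tensor_lift_word: "w \<in> lists (carrier A) \<Longrightarrow> induced (lin_ext K f) (tensor_cls A (frag_of w)) = f w"
proof -
  interpret K: comm_group K by (rule K)
  have fS: "f ` lists (carrier A) \<subseteq> carrier K" using f by blast
  have r: "lin_ext K f r = \<one>\<^bsub>K\<^esub>" if rel: "r \<in> tensor_relators A" for r
  proof -
    obtain us x y vs where r: "r = frag_of (us @ (x \<otimes>\<^bsub>A\<^esub> y) # vs) - frag_of (us @ x # vs) - frag_of (us @ y # vs)"
      "us \<in> lists (carrier A)" "x \<in> carrier A" "y \<in> carrier A" "vs \<in> lists (carrier A)"
      using rel unfolding tensor_relators_def by blast
    let ?w = "us @ (x \<otimes>\<^bsub>A\<^esub> y) # vs" and ?x = "us @ x # vs" and ?y = "us @ y # vs"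
    have c: "f ?w \<in> carrier K" "f ?x \<in> carrier K" "f ?y \<in> carrier K"
      using r by (auto intro!: f)
    have "f ` Poly_Mapping.keys (frag_of ?w - frag_of ?x) \<subseteq> carrier K"
      using keys_diff[of "frag_of ?w" "frag_of ?x"] c by auto
    then have "lin_ext K f r = f ?w \<otimes>\<^bsub>K\<^esub> inv\<^bsub>K\<^esub> f ?x \<otimes>\<^bsub>K\<^esub> inv\<^bsub>K\<^esub> f ?y"
      using c unfolding r(1) by (simp add: K.lin_ext_diff)
    then show ?thesis using ml[OF r(2-5)] c by (simp add: K.commutator_one)
  qed
  show "induced (lin_ext K f) \<in> hom (tensor A) K"
    unfolding tensor_eq by (rule P.lift_hom[OF K fS r])
  show cls: "induced (lin_ext K f) (tensor_cls A c) = lin_ext K f c" if "Poly_Mapping.keys c \<subseteq> lists (carrier A)" for c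
    unfolding tensor_cls_eq by (rule P.lift_cls[OF K fS r that])
  show "w \<in> lists (carrier A) \<Longrightarrow> induced (lin_ext K f) (tensor_cls A (frag_of w)) = f w"
    using cls[of "frag_of w"] f[of w] by simp
qed

lemma tensor_cls_multilinear:
  assumes "us \<in> lists (carrier A)" "x \<in> carrier A" "y \<in> carrier A" "vs \<in> lists (carrier A)"
  shows "tensor_cls A (frag_of (us @ (x \<otimes>\<^bsub>A\<^esub> y) # vs))
    = tensor_cls A (frag_of (us @ x # vs)) \<otimes>\<^bsub>tensor A\<^esub> tensor_cls A (frag_of (us @ y # vs))"
proof -
  let ?r = "frag_of (us @ (x \<otimes>\<^bsub>A\<^esub> y) # vs) - frag_of (us @ x # vs) - frag_of (us @ y # vs)"
  have "?r \<in> P.Rel"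
    by (rule P.Rel_relator) (use assms in \<open>auto simp: tensor_relators_def\<close>)
  moreover have "Poly_Mapping.keys (frag_of (us @ x # vs) + frag_of (us @ y # vs)) \<subseteq> lists (carrier A)"
  proof -
    have "{us @ x # vs, us @ y # vs} \<subseteq> lists (carrier A)" using assms by auto
    then show ?thesis
      using keys_add[of "frag_of (us @ x # vs)" "frag_of (us @ y # vs)"] unfolding keys_frag_of by blast
  qed
  ultimately have "P.cls (frag_of (us @ (x \<otimes>\<^bsub>A\<^esub> y) # vs)) = P.cls (frag_of (us @ x # vs) + frag_of (us @ y # vs))"
    using assms by (subst P.cls_eq_iff) (auto simp: diff_diff_eq)
  then show ?thesis
    using assms by (simp add: tensor_cls_eq tensor_eq P.cls_add)
qed

end

context
  fixes A :: "'a monoid" and B :: "'b monoid" and f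
  assumes A: "comm_group A" and B: "comm_group B" and f: "f \<in> hom A B"
begin

interpretation A: tensor_power A using A by (simp add: tensor_power_def)
interpretation B: tensor_power B using B by (simp add: tensor_power_def)

lemma map_hom_lists: "w \<in> lists (carrier A) \<Longrightarrow> map f w \<in> lists (carrier B)"
  using hom_in_carrier[OF f] by (auto simp: lists_eq_set)

lemma tensor_map_lift:
  shows tensor_map_hom: "tensor_map B f \<in> hom (tensor A) (tensor B)"
    and tensor_map_word: "w \<in> lists (carrier A) \<Longrightarrow> tensor_map B f (tensor_cls A (frag_of w)) = tensor_cls B (frag_of (map f w))"
proof -
  have c: "tensor_cls B (frag_of (map f w)) \<in> carrier (tensor B)" if "w \<in> lists (carrier A)" for w
    using map_hom_lists[OF that] by (rule B.tensor_word_closed)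
  have ml: "tensor_cls B (frag_of (map f (us @ (x \<otimes>\<^bsub>A\<^esub> y) # vs)))
      = tensor_cls B (frag_of (map f (us @ x # vs))) \<otimes>\<^bsub>tensor B\<^esub> tensor_cls B (frag_of (map f (us @ y # vs)))"
    if "us \<in> lists (carrier A)" "x \<in> carrier A" "y \<in> carrier A" "vs \<in> lists (carrier A)" for us x y vs
    using B.tensor_cls_multilinear[of "map f us" "f x" "f y" "map f vs"] that map_hom_lists hom_in_carrier[OF f]
    by (simp add: hom_mult[OF f])
  show "tensor_map B f \<in> hom (tensor A) (tensor B)"
    unfolding tensor_map_def by (rule A.tensor_lift_hom[OF B.tensor_comm_group c ml])
  show "w \<in> lists (carrier A) \<Longrightarrow> tensor_map B f (tensor_cls A (frag_of w)) = tensor_cls B (frag_of (map f w))"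
    unfolding tensor_map_def by (rule A.tensor_lift_word[OF B.tensor_comm_group c ml])
qed

end

lemma tensor_map_cong:
  assumes A: "comm_group A" and B: "comm_group B" and f: "f \<in> hom A B" and g: "g \<in> hom A B"
    and eq: "\<And>x. x \<in> carrier A \<Longrightarrow> g x = f x" and t: "t \<in> carrier (tensor A)"
  shows "tensor_map B f t = tensor_map B g t"
proof -
  interpret A: tensor_power A using A by (simp add: tensor_power_def)
  interpret B: tensor_power B using B by (simp add: tensor_power_def)
  have fg: "map f w = map g w" if "w \<in> lists (carrier A)" for w
    using that eq by (auto simp: lists_eq_set)
  show ?thesis
    by (rule A.tensor_hom_eqI[OF B.tensor_group tensor_map_hom[OF A B f] tensor_map_hom[OF A B g] _ t])
      (simp only: tensor_map_word[OF A B f] tensor_map_word[OF A B g] fg)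
qed

lemma tensor_map_id:
  assumes A: "comm_group A" and f: "\<And>x. x \<in> carrier A \<Longrightarrow> f x = x" and t: "t \<in> carrier (tensor A)"
  shows "tensor_map A f t = t"
proof -
  interpret A: tensor_power A using A by (simp add: tensor_power_def)
  have fh: "f \<in> hom A A" using f by (auto simp: hom_def)
  have "map f w = w" if "w \<in> lists (carrier A)" for w
    using that f by (intro map_idI) (auto simp: lists_eq_set)
  then show ?thesis
    using A.tensor_hom_eqI[OF A.tensor_group tensor_map_hom[OF A A fh], of "\<lambda>t. t" t] t
    by (auto simp: tensor_map_word[OF A A fh] hom_def)
qed

lemma tensor_map_comp:
  assumes A: "comm_group A" and B: "comm_group B" and C: "comm_group C"
    and f: "f \<in> hom A B" and g: "g \<in> hom B C" and t: "t \<in> carrier (tensor A)"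
  shows "tensor_map C g (tensor_map B f t) = tensor_map C (\<lambda>x. g (f x)) t"
proof -
  interpret A: tensor_power A using A by (simp add: tensor_power_def)
  interpret C: tensor_power C using C by (simp add: tensor_power_def)
  have gf: "(\<lambda>x. g (f x)) \<in> hom A C" using hom_compose[OF f g] by (simp add: comp_def)
  have h: "(\<lambda>t. tensor_map C g (tensor_map B f t)) \<in> hom (tensor A) (tensor C)"
    using hom_compose[OF tensor_map_hom[OF A B f] tensor_map_hom[OF B C g]] by (simp add: comp_def)
  show ?thesis
    by (rule A.tensor_hom_eqI[OF C.tensor_group h tensor_map_hom[OF A C gf] _ t])
      (simp add: tensor_map_word[OF A B f] tensor_map_word[OF B C g] tensor_map_word[OF A C gf]
        map_hom_lists[OF A B f] comp_def)
qed

text \<open>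
  An identity between composites of homomorphisms passes to the induced maps of tensor algebras; the
  simplicial identities of \<^const>\<open>T_Delta\<close> are obtained in this way from those of \<open>X\<close>.
\<close>

lemma tensor_map_square:
  assumes "comm_group A" "comm_group B" "comm_group B'" "comm_group C"
    and "f \<in> hom A B" "g \<in> hom B C" "f' \<in> hom A B'" "g' \<in> hom B' C"
    and "\<And>x. x \<in> carrier A \<Longrightarrow> g (f x) = g' (f' x)" "t \<in> carrier (tensor A)"
  shows "tensor_map C g (tensor_map B f t) = tensor_map C g' (tensor_map B' f' t)"
proof -
  have "(\<lambda>x. g (f x)) \<in> hom A C" "(\<lambda>x. g' (f' x)) \<in> hom A C"
    using hom_compose[OF assms(5,6)] hom_compose[OF assms(7,8)] by (simp_all add: comp_def)
  then show ?thesis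
    using tensor_map_cong[OF assms(1,4), of "\<lambda>x. g (f x)" "\<lambda>x. g' (f' x)" t] assms(9,10)
    by (simp add: tensor_map_comp[OF assms(1,2,4,5,6)] tensor_map_comp[OF assms(1,3,4,7,8)])
qed

lemma T_Delta_simps [simp]:
  "level (T_Delta X) n = tensor (level X n)"
  "face (T_Delta X) n i = tensor_map (level X (n - 1)) (face X n i)"
  "degen (T_Delta X) n i = tensor_map (level X (Suc n)) (degen X n i)"
  by (simp_all add: T_Delta_def)

context simplicial_ab_group
begin

lemma level_tensor_power: "tensor_power (level X n)"
  using level_comm_group by (simp add: tensor_power_def)

sublocale L: tensor_power "level X n" for n by (rule level_tensor_power)

lemma degen_hom': "j < k \<Longrightarrow> degen X (k - 1) j \<in> hom (level X (k - 1)) (level X k)"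
  using degen_hom[of j "k - 1"] by simp

lemma T_Delta_simplicial: "simplicial_ab_group (T_Delta X)"
proof (intro simplicial_ab_group.intro)
  show "comm_group (level (T_Delta X) n)" for n
    by (simp add: L.tensor_comm_group)
  show "face (T_Delta X) n i \<in> hom (level (T_Delta X) n) (level (T_Delta X) (n - 1))" if "0 < n" "i \<le> n" for n i
    using that by (simp add: tensor_map_hom level_comm_group face_hom)
  show "degen (T_Delta X) n i \<in> hom (level (T_Delta X) n) (level (T_Delta X) (Suc n))" if "i \<le> n" for n i
    using that by (simp add: tensor_map_hom level_comm_group degen_hom)
next
  fix n i j t assume n: "2 \<le> n" "i < j" "j \<le> n" and t: "t \<in> carrier (level (T_Delta X) n)"
  have f: "face X n i \<in> hom (level X n) (level X (n - 1))" "face X n j \<in> hom (level X n) (level X (n - 1))"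
    "face X (n - 1) i \<in> hom (level X (n - 1)) (level X (n - 1 - 1))"
    "face X (n - 1) (j - 1) \<in> hom (level X (n - 1)) (level X (n - 1 - 1))"
    using n face_hom[of "n - 1" i] face_hom[of "n - 1" "j - 1"] by (auto intro!: face_hom)
  show "face (T_Delta X) (n - 1) i (face (T_Delta X) n j t) = face (T_Delta X) (n - 1) (j - 1) (face (T_Delta X) n i t)"
    unfolding T_Delta_simps
    by (rule tensor_map_square[OF level_comm_group level_comm_group level_comm_group level_comm_group f(2,3,1,4)
          face_face[OF n] t[unfolded T_Delta_simps]])
next
  fix n i j t assume n: "i \<le> j" "j \<le> n" and t: "t \<in> carrier (level (T_Delta X) n)"
  have d: "degen X n j \<in> hom (level X n) (level X (Suc n))" "degen X n i \<in> hom (level X n) (level X (Suc n))"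
    "degen X (Suc n) i \<in> hom (level X (Suc n)) (level X (Suc (Suc n)))"
    "degen X (Suc n) (Suc j) \<in> hom (level X (Suc n)) (level X (Suc (Suc n)))"
    using n by (auto intro!: degen_hom)
  show "degen (T_Delta X) (Suc n) i (degen (T_Delta X) n j t) = degen (T_Delta X) (Suc n) (Suc j) (degen (T_Delta X) n i t)"
    unfolding T_Delta_simps
    by (rule tensor_map_square[OF level_comm_group level_comm_group level_comm_group level_comm_group d(1,3,2,4)
          degen_degen[OF n] t[unfolded T_Delta_simps]])
next
  fix n i j t assume n: "j \<le> n" "i \<le> Suc n" and t: "t \<in> carrier (level (T_Delta X) n)"
  note t = t[unfolded T_Delta_simps]
  have s: "degen X n j \<in> hom (level X n) (level X (Suc n))" using n by (intro degen_hom)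
  have d: "face X (Suc n) i \<in> hom (level X (Suc n)) (level X n)" using n face_hom[of "Suc n" i] by simp
  have sd: "tensor_map (level X n) (face X (Suc n) i) (tensor_map (level X (Suc n)) (degen X n j) t)
      = tensor_map (level X n) (degen X (n - 1) j') (tensor_map (level X (n - 1)) (face X n i') t)"
    if "0 < n" "i' \<le> n" "j' < n"
      "\<And>x. x \<in> carrier (level X n) \<Longrightarrow> face X (Suc n) i (degen X n j x) = degen X (n - 1) j' (face X n i' x)" for i' j'
    by (rule tensor_map_square[OF level_comm_group level_comm_group level_comm_group level_comm_group s d
          face_hom[OF that(1,2)] degen_hom'[OF that(3)] that(4) t])
  have id: "tensor_map (level X n) (face X (Suc n) i) (tensor_map (level X (Suc n)) (degen X n j) t) = t"
    if "\<not> i < j" "i \<le> Suc j"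
    unfolding tensor_map_comp[OF level_comm_group level_comm_group level_comm_group s d t]
    using face_degen[OF n] that by (intro tensor_map_id[OF level_comm_group _ t]) simp
  show "face (T_Delta X) (Suc n) i (degen (T_Delta X) n j t) =
        (if i < j then degen (T_Delta X) (n - 1) (j - 1) (face (T_Delta X) n i t)
         else if i \<le> Suc j then t
         else degen (T_Delta X) (n - 1) j (face (T_Delta X) n (i - 1) t))"
  proof (cases "i < j")
    case True
    then show ?thesis using n sd[of i "j - 1"] face_degen[OF n] by simp
  next
    case False
    show ?thesis
    proof (cases "i \<le> Suc j")
      case True
      then show ?thesis using id False by simp
    next
      case gt: False
      then show ?thesis using False n sd[of "i - 1" j] face_degen[OF n] by simp
    qed
  qed
qed

end

section \<open>The Alexander--Whitney map\<close>

lemma concat_prod_sum_left: "concat_prod (sum c I) d = (\<Sum>i\<in>I. concat_prod (c i) d)"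
  by (induction I rule: infinite_finite_induct) (auto simp: concat_prod_add_left)

lemma keys_sum_subset: "(\<And>i. i \<in> I \<Longrightarrow> Poly_Mapping.keys (c i) \<subseteq> S) \<Longrightarrow> Poly_Mapping.keys (sum c I) \<subseteq> S"
  using keys_sum[of c I] by blast

text \<open>
  The recursion of \<^const>\<open>aw_word\<close> continues with the faces of the remaining letters, that is,
  with another word of the same length.
\<close>

lemma length_list_induct [case_names Nil Cons]:
  assumes "P []" and "\<And>x w. (\<And>v. length v = length w \<Longrightarrow> P v) \<Longrightarrow> P (x # w)"
  shows "P w"
proof (induction w rule: length_induct)
  case (1 w)
  then show ?case using assms by (cases w) auto
qed

(* Iterated faces count down by Suc, so here 1 is better unfolded. *)
declare One_nat_def [simp]

context simplicial_ab_group
begin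

subsection \<open>Front and back faces\<close>

lemma last_faces_closed: "\<lbrakk>i \<le> k; x \<in> carrier (level X k)\<rbrakk> \<Longrightarrow> last_faces X k i x \<in> carrier (level X (k - i))"
proof (induction i)
  case (Suc i)
  then show ?case using face_closed[of "k - i" "k - i" "last_faces X k i x"] by simp
qed simp

lemma first_faces_closed: "\<lbrakk>m \<le> k; x \<in> carrier (level X k)\<rbrakk> \<Longrightarrow> first_faces X k m x \<in> carrier (level X (k - m))"
proof (induction m)
  case (Suc m)
  then show ?case using face_closed[of "k - m" 0 "first_faces X k m x"] by simp
qed simp

lemma last_faces_mult:
  "\<lbrakk>i \<le> k; x \<in> carrier (level X k); y \<in> carrier (level X k)\<rbrakk> \<Longrightarrow>
    last_faces X k i (x \<otimes>\<^bsub>level X k\<^esub> y) = last_faces X k i x \<otimes>\<^bsub>level X (k - i)\<^esub> last_faces X k i y"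
proof (induction i)
  case (Suc i)
  then show ?case
    using hom_mult[OF face_hom[of "k - i" "k - i"] last_faces_closed[of i k x] last_faces_closed[of i k y]] by simp
qed simp

lemma first_faces_mult:
  "\<lbrakk>m \<le> k; x \<in> carrier (level X k); y \<in> carrier (level X k)\<rbrakk> \<Longrightarrow>
    first_faces X k m (x \<otimes>\<^bsub>level X k\<^esub> y) = first_faces X k m x \<otimes>\<^bsub>level X (k - m)\<^esub> first_faces X k m y"
proof (induction m)
  case (Suc m)
  then show ?case
    using hom_mult[OF face_hom[of "k - m" 0] first_faces_closed[of m k x] first_faces_closed[of m k y]] by simp
qed simp

lemma first_faces_lists:
  "\<lbrakk>m \<le> k; w \<in> lists (carrier (level X k))\<rbrakk> \<Longrightarrow> map (first_faces X k m) w \<in> lists (carrier (level X (k - m)))"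
  using first_faces_closed by (auto simp: lists_eq_set)

text \<open>
  A face map omits either a vertex of the front face or one of the vertices that the front face
  omits anyway; similarly for back faces.
\<close>

lemma last_faces_face:
  assumes x: "x \<in> carrier (level X k)" and "i < k" "j \<le> k"
  shows "last_faces X (k - 1) i (face X k j x) =
    (if j < k - i then face X (k - i) j (last_faces X k i x) else last_faces X k (Suc i) x)"
  using assms(2)
proof (induction i)
  case 0
  then show ?case using assms by simp
next
  case (Suc i)
  let ?n = "k - i" and ?y = "last_faces X k i x"
  have y: "?y \<in> carrier (level X ?n)" using Suc.prems x by (intro last_faces_closed) auto
  have n: "2 \<le> ?n" and e: "k - 1 - i = ?n - 1" using Suc.prems by auto
  show ?case
  proof (cases "j < ?n")
    case True
    then have "last_faces X (k - 1) (Suc i) (face X k j x) = face X (?n - 1) (?n - 1) (face X ?n j ?y)"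
      using Suc by (simp add: e)
    also have "\<dots> = face X (?n - 1) j (face X ?n ?n ?y)"
      using face_face[OF n True _ y] by simp
    finally show ?thesis
    proof (cases "j < k - Suc i")
      case False
      then have "j = ?n - 1" using True by simp
      then show ?thesis
        using Suc.IH Suc.prems face_face[OF n True _ y] False by (simp add: e)
    qed simp
  next
    case False
    then have "k - Suc i = ?n - 1" "\<not> j < k - Suc i" by auto
    then show ?thesis using Suc False by (simp add: e)
  qed
qed

lemma first_faces_face:
  assumes x: "x \<in> carrier (level X k)" and "m < k" "j \<le> k"
  shows "first_faces X (k - 1) m (face X k j x) =
    (if j \<le> m then first_faces X k (Suc m) x else face X (k - m) (j - m) (first_faces X k m x))"
  using assms(2)
proof (induction m)
  case 0
  then show ?case by simp
next
  case (Suc m)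
  let ?n = "k - m" and ?y = "first_faces X k m x"
  have y: "?y \<in> carrier (level X ?n)" using Suc.prems x by (intro first_faces_closed) auto
  have n: "2 \<le> ?n" and e: "k - 1 - m = ?n - 1" "k - Suc m = ?n - 1" using Suc.prems by auto
  have IH: "first_faces X (k - 1) m (face X k j x) = (if j \<le> m then first_faces X k (Suc m) x else face X ?n (j - m) ?y)"
    using Suc.prems by (intro Suc.IH) simp
  have step: "first_faces X (k - 1) (Suc m) (face X k j x) = face X (?n - 1) 0 (first_faces X (k - 1) m (face X k j x))"
    by (simp only: first_faces.simps e)
  have ff: "first_faces X k (Suc m) x = face X ?n 0 ?y"
    "first_faces X k (Suc (Suc m)) x = face X (?n - 1) 0 (face X ?n 0 ?y)"
    by (simp_all only: first_faces.simps e)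
  show ?case
  proof (cases "j \<le> m")
    case True
    then show ?thesis unfolding step IH ff by simp
  next
    case False
    then have "0 < j - m" "j - m \<le> ?n" using assms(3) by auto
    then have "face X (?n - 1) 0 (face X ?n (j - m) ?y) = face X (?n - 1) (j - m - 1) (face X ?n 0 ?y)"
      by (rule face_face[OF n _ _ y])
    moreover have "j - m - 1 = (if j \<le> Suc m then 0 else j - Suc m)" using False by auto
    ultimately show ?thesis unfolding step IH ff e using False by simp
  qed
qed

lemma last_faces_degen:
  assumes x: "x \<in> carrier (level X (k - 1))" and "j < k - i"
  shows "last_faces X k i (degen X (k - 1) j x) = degen X (k - 1 - i) j (last_faces X (k - 1) i x)"
  using assms(2)
proof (induction i)
  case (Suc i)
  let ?n = "k - 1 - i" and ?y = "last_faces X (k - 1) i x"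
  have y: "?y \<in> carrier (level X ?n)" using Suc.prems x by (intro last_faces_closed) auto
  have e: "k - i = Suc ?n" "k - 1 - Suc i = ?n - 1" using Suc.prems by auto
  have "last_faces X k (Suc i) (degen X (k - 1) j x) = face X (Suc ?n) (Suc ?n) (degen X ?n j ?y)"
    using Suc by (simp add: e)
  also have "\<dots> = degen X (?n - 1) j (face X ?n ?n ?y)"
    using face_degen[of j ?n "Suc ?n" ?y] y Suc.prems by (simp add: e)
  finally show ?case by (simp add: e)
qed simp

lemma first_faces_degen:
  assumes x: "x \<in> carrier (level X (k - 1))" and "m \<le> j" "j < k"
  shows "first_faces X k m (degen X (k - 1) j x) = degen X (k - 1 - m) (j - m) (first_faces X (k - 1) m x)"
  using assms(2)
proof (induction m)
  case (Suc m)
  let ?n = "k - 1 - m" and ?y = "first_faces X (k - 1) m x"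
  have y: "?y \<in> carrier (level X ?n)" using Suc.prems x assms by (intro first_faces_closed) auto
  have e: "k - m = Suc ?n" "k - 1 - Suc m = ?n - 1" using Suc.prems assms by auto
  have "first_faces X k (Suc m) (degen X (k - 1) j x) = face X (Suc ?n) 0 (degen X ?n (j - m) ?y)"
    using Suc by (simp add: e)
  also have "\<dots> = degen X (?n - 1) (j - m - 1) (face X ?n 0 ?y)"
    using face_degen[of "j - m" ?n 0 ?y] y Suc.prems assms by simp
  finally show ?case by (simp add: e)
qed simp

end

declare One_nat_def [simp del]

subsection \<open>Formal Alexander--Whitney sums\<close>

context simplicial_ab_group
begin

lemma N_graded_group: "graded_group (N X)"
  using N_comm_group by (simp add: graded_group_def)

sublocale NX: cochain_complex "N X" by (rule N_cochain_complex)

abbreviation letter :: "nat \<Rightarrow> 'a \<Rightarrow> ((nat \<times> 'a set) list \<Rightarrow>\<^sub>0 int)" where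
  "letter n x \<equiv> frag_of [(n, N_cls X n x)]"

lemma aw_word_Cons:
  "aw_word X k (x # w) =
    (\<Sum>i\<le>k. concat_prod (letter (k - i) (last_faces X k i x)) (aw_word X i (map (first_faces X k (k - i)) w)))"
  by (simp add: concat_prod_of_left)

declare aw_word.simps(2) [simp del]

lemma letter_gwords: "x \<in> carrier (level X n) \<Longrightarrow> Poly_Mapping.keys (letter n x) \<subseteq> gwords (N X) n"
  using N_cls_closed by (simp add: gwords_iff)

lemma letter_lists: "x \<in> carrier (level X n) \<Longrightarrow> Poly_Mapping.keys (letter n x) \<subseteq> lists (letters (N X))"
  using N_cls_closed by simp

lemma aw_word_gwords:
  "w \<in> lists (carrier (level X k)) \<Longrightarrow> Poly_Mapping.keys (aw_word X k w) \<subseteq> gwords (N X) k"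
proof (induction w arbitrary: k rule: length_list_induct)
  case (Cons x w)
  show ?case unfolding aw_word_Cons
  proof (rule keys_sum_subset)
    fix i assume i: "i \<in> {..k}"
    have "map (first_faces X k (k - i)) w \<in> lists (carrier (level X i))"
      using first_faces_lists[of "k - i" k w] Cons.prems i by simp
    then show "Poly_Mapping.keys (concat_prod (letter (k - i) (last_faces X k i x))
        (aw_word X i (map (first_faces X k (k - i)) w))) \<subseteq> gwords (N X) k"
      using NX.concat_prod_gwords[OF letter_gwords[OF last_faces_closed[of i k x]] Cons.IH,
          of "map (first_faces X k (k - i)) w" i] Cons.prems i by simp
  qed
qed (simp add: gwords_iff)

lemma aw_word_lists:
  "w \<in> lists (carrier (level X k)) \<Longrightarrow> Poly_Mapping.keys (aw_word X k w) \<subseteq> lists (letters (N X))"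
  by (rule NX.gwords_lists[OF aw_word_gwords])

lemma aw_word_term_lists:
  assumes "w \<in> lists (carrier (level X k))" "i \<le> k"
  shows "Poly_Mapping.keys (aw_word X i (map (first_faces X k (k - i)) w)) \<subseteq> lists (letters (N X))"
  using assms first_faces_lists[of "k - i" k w] by (intro aw_word_lists) simp

lemma letter_mult:
  assumes "x \<in> carrier (level X n)" "y \<in> carrier (level X n)"
  shows "letter n (x \<otimes>\<^bsub>level X n\<^esub> y) - letter n x - letter n y \<in> trel (N X)"
  using trel_letter[of "N_cls X n x" "N X" n "N_cls X n y"] assms N_cls_closed
  by (simp add: hom_mult[OF N_cls_hom])

lemma aw_word_multilinear:
  assumes "us \<in> lists (carrier (level X k))" "vs \<in> lists (carrier (level X k))"
    "x \<in> carrier (level X k)" "y \<in> carrier (level X k)"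
  shows "aw_word X k (us @ (x \<otimes>\<^bsub>level X k\<^esub> y) # vs) - aw_word X k (us @ x # vs) - aw_word X k (us @ y # vs) \<in> trel (N X)"
  using assms
proof (induction us arbitrary: k x y vs rule: length_list_induct)
  case Nil
  have "aw_word X k ((x \<otimes>\<^bsub>level X k\<^esub> y) # vs) - aw_word X k (x # vs) - aw_word X k (y # vs)
      = (\<Sum>i\<le>k. concat_prod (letter (k - i) (last_faces X k i x \<otimes>\<^bsub>level X (k - i)\<^esub> last_faces X k i y)
          - letter (k - i) (last_faces X k i x) - letter (k - i) (last_faces X k i y))
          (aw_word X i (map (first_faces X k (k - i)) vs)))"
    unfolding aw_word_Cons sum_subtractf[symmetric] using Nil
    by (intro sum.cong) (simp_all add: last_faces_mult concat_prod_diff_left)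
  also have "\<dots> \<in> trel (N X)"
    using Nil by (intro trel_sum trel_concat_right letter_mult last_faces_closed aw_word_term_lists) auto
  finally show ?case by simp
next
  case (Cons a us)
  let ?f = "\<lambda>i. first_faces X k (k - i)"
  have "aw_word X k ((a # us) @ (x \<otimes>\<^bsub>level X k\<^esub> y) # vs) - aw_word X k ((a # us) @ x # vs) - aw_word X k ((a # us) @ y # vs)
      = (\<Sum>i\<le>k. concat_prod (letter (k - i) (last_faces X k i a))
          (aw_word X i (map (?f i) us @ (?f i x \<otimes>\<^bsub>level X i\<^esub> ?f i y) # map (?f i) vs)
           - aw_word X i (map (?f i) us @ ?f i x # map (?f i) vs) - aw_word X i (map (?f i) us @ ?f i y # map (?f i) vs)))"
    unfolding append_Cons aw_word_Cons sum_subtractf[symmetric] using Cons.prems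
    by (intro sum.cong) (simp_all add: first_faces_mult concat_prod_diff_right)
  also have "\<dots> \<in> trel (N X)"
  proof (rule trel_sum)
    fix i assume i: "i \<in> {..k}"
    then have k: "k - (k - i) = i" by simp
    have l: "map (?f i) us \<in> lists (carrier (level X i))" "map (?f i) vs \<in> lists (carrier (level X i))"
      using Cons.prems first_faces_lists[of "k - i" k us] first_faces_lists[of "k - i" k vs] k by auto
    have xy: "?f i x \<in> carrier (level X i)" "?f i y \<in> carrier (level X i)"
      using Cons.prems first_faces_closed[of "k - i" k x] first_faces_closed[of "k - i" k y] k by auto
    have a: "Poly_Mapping.keys (letter (k - i) (last_faces X k i a)) \<subseteq> lists (letters (N X))"
      using Cons.prems i by (intro letter_lists last_faces_closed) auto
    show "concat_prod (letter (k - i) (last_faces X k i a))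
          (aw_word X i (map (?f i) us @ (?f i x \<otimes>\<^bsub>level X i\<^esub> ?f i y) # map (?f i) vs)
           - aw_word X i (map (?f i) us @ ?f i x # map (?f i) vs) - aw_word X i (map (?f i) us @ ?f i y # map (?f i) vs)) \<in> trel (N X)"
      by (rule trel_concat_left[OF Cons.IH[OF _ l xy] a]) simp
  qed
  finally show ?case .
qed

lemma letter_degen:
  assumes "j < n" "x \<in> carrier (level X (n - 1))"
  shows "letter n (degen X (n - 1) j x) \<in> trel (N X)"
  using NX.one_in_trel[of "[]" "[]" n] by (simp add: N_cls_degen[OF assms])

text \<open>
  In each term a degeneracy \<open>s\<^sub>j\<close> survives either in the front face of the first letter or in
  the back face of the rest of the word.
\<close>

lemma aw_word_degen:
  assumes "w \<in> lists (carrier (level X (k - 1)))" "j < k"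
  shows "aw_word X k (map (degen X (k - 1) j) w) \<in> trel (N X)"
  using assms
proof (induction w arbitrary: k j rule: length_list_induct)
  case (Cons x w)
  have dw: "map (degen X (k - 1) j) w \<in> lists (carrier (level X k))"
    using Cons.prems degen_closed'[OF Cons.prems(2)] by (auto simp: lists_eq_set)
  have dx: "degen X (k - 1) j x \<in> carrier (level X k)"
    using Cons.prems by (intro degen_closed') auto
  show ?case unfolding list.map aw_word_Cons
  proof (rule trel_sum)
    fix i assume "i \<in> {..k}" then have i: "i \<le> k" by simp
    let ?l = "letter (k - i) (last_faces X k i (degen X (k - 1) j x))"
    let ?r = "aw_word X i (map (first_faces X k (k - i)) (map (degen X (k - 1) j) w))"
    show "concat_prod ?l ?r \<in> trel (N X)"
    proof (cases "j < k - i")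
      case True
      have "k - 1 - i = k - i - 1" by simp
      then have "?l \<in> trel (N X)"
        using letter_degen[OF True, of "last_faces X (k - 1) i x"] last_faces_closed[of i "k - 1" x]
          last_faces_degen[OF _ True, of x] Cons.prems True by simp
      then show ?thesis by (rule trel_concat_right[OF _ aw_word_term_lists[OF dw i]])
    next
      case False
      let ?w = "map (first_faces X (k - 1) (k - i)) w"
      have e: "k - 1 - (k - i) = i - 1" "k - (1 + (k - i)) = i - 1" and m: "k - i \<le> j" "j - (k - i) < i" using i False Cons.prems(2) by auto
      have w: "?w \<in> lists (carrier (level X (i - 1)))"
        using first_faces_lists[of "k - i" "k - 1" w] m Cons.prems by (simp add: e)
      have "map (first_faces X k (k - i)) (map (degen X (k - 1) j) w) = map (degen X (i - 1) (j - (k - i))) ?w"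
        using Cons.prems(1) first_faces_degen[OF _ m(1) Cons.prems(2)] by (auto simp: lists_eq_set e)
      then have "?r \<in> trel (N X)"
        using Cons.IH[OF _ w m(2)] by (simp del: map_map map_eq_conv)
      then show ?thesis
        using dx i by (intro trel_concat_left letter_lists last_faces_closed)
    qed
  qed
qed simp

text \<open>A letter given by an alternating sum of simplices expands by multilinearity.\<close>

lemma letter_lin_ext:
  assumes "Poly_Mapping.keys c \<subseteq> carrier (level X n)"
  shows "frag_of [(n, lin_ext (grp (N X) n) (N_cls X n) c)] - frag_extend (letter n) c \<in> trel (N X)"
  using assms
proof (induction c rule: frag_keys_induct)
  interpret K: comm_group "grp (N X) n" by (rule N_comm_group)
  { case zero
    then show ?case using NX.one_in_trel[of "[]" "[]" n] by simp
  next
    case (diff a b)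
    have ab: "N_cls X n ` Poly_Mapping.keys a \<subseteq> carrier (grp (N X) n)" "N_cls X n ` Poly_Mapping.keys b \<subseteq> carrier (grp (N X) n)"
      using diff.hyps(1,2) N_cls_closed by blast+
    define u v where "u = lin_ext (grp (N X) n) (N_cls X n) a" and "v = lin_ext (grp (N X) n) (N_cls X n) b"
    have uv: "u \<in> carrier (grp (N X) n)" "v \<in> carrier (grp (N X) n)"
      using K.lin_ext_closed ab by (simp_all add: u_def v_def)
    let ?d = "u \<otimes>\<^bsub>grp (N X) n\<^esub> inv\<^bsub>grp (N X) n\<^esub> v"
    have "?d \<otimes>\<^bsub>grp (N X) n\<^esub> v = u" using uv by (simp add: K.m_assoc)
    then have "frag_of [(n, u)] - frag_of [(n, ?d)] - frag_of [(n, v)] \<in> trel (N X)"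
      using trel_letter[of ?d "N X" n v] uv by simp
    moreover have "frag_of [(n, u)] - frag_extend (letter n) a \<in> trel (N X)"
      "frag_of [(n, v)] - frag_extend (letter n) b \<in> trel (N X)"
      using diff by (simp_all add: u_def v_def)
    moreover have "frag_of [(n, ?d)] - frag_extend (letter n) (a - b)
      = (frag_of [(n, u)] - frag_extend (letter n) a) - (frag_of [(n, v)] - frag_extend (letter n) b)
        - (frag_of [(n, u)] - frag_of [(n, ?d)] - frag_of [(n, v)])"
      by (simp add: frag_extend_diff)
    ultimately have "frag_of [(n, ?d)] - frag_extend (letter n) (a - b) \<in> trel (N X)"
      by (simp only: trel.diff)
    then show ?case using ab by (simp add: K.lin_ext_diff u_def v_def)
  next
    case (gen x)
    then show ?case using N_cls_closed[of x n] by simp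
  }
qed

lemma bd_letter:
  assumes n: "0 < n" and x: "x \<in> carrier (level X n)"
  shows "bd_word (N X) [(n, N_cls X n x)] - (\<Sum>j\<le>n. frag_cmul ((- 1) ^ j) (letter (n - 1) (face X n j x))) \<in> trel (N X)"
proof -
  have "frag_extend (letter (n - 1)) (face_sum X n x) = (\<Sum>j\<le>n. frag_cmul ((- 1) ^ j) (letter (n - 1) (face X n j x)))"
    unfolding face_sum_def by (simp add: frag_extend_sum frag_extend_cmul comp_def)
  then show ?thesis
    using letter_lin_ext[OF face_sum_keys_level[OF n x]] n by (simp add: N_bd[OF n x])
qed

lemma aw_word_degree_0: "w \<in> lists (carrier (level X 0)) \<Longrightarrow> frag_extend (bd_word (N X)) (aw_word X 0 w) = 0"
  using aw_word_gwords[of w 0] by (intro frag_extend_eq_0 NX.bd_word_degree_0) (auto simp: gwords_iff)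

text \<open>
  The boundary of a term of \<open>AW\<close> consists of the faces of the front face and those of the back
  face. The last face of the former agrees, up to sign, with the zeroth face of the latter in the
  adjacent term, and these two cancel; the remaining ones make up the Alexander--Whitney sums of the
  faces of the word.
\<close>

lemma aw_word_bd:
  assumes "w \<in> lists (carrier (level X k))" "0 < k"
  shows "frag_extend (bd_word (N X)) (aw_word X k w)
    - (\<Sum>j\<le>k. frag_cmul ((- 1) ^ j) (aw_word X (k - 1) (map (face X k j) w))) \<in> trel (N X)"
  using assms
proof (induction w arbitrary: k rule: length_list_induct)
  case Nil
  then show ?case by (cases "k = 1") (auto simp: One_nat_def)
next
  case (Cons x w)
  have k: "0 < k" and x: "x \<in> carrier (level X k)" and w: "w \<in> lists (carrier (level X k))"
    using Cons.prems by auto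
  define y where "y i = last_faces X k i x" for i
  define v where "v m = map (first_faces X k m) w" for m
  have y: "y i \<in> carrier (level X (k - i))" if "i \<le> k" for i
    using last_faces_closed[OF that x] by (simp add: y_def)
  have v: "v m \<in> lists (carrier (level X (k - m)))" if "m \<le> k" for m
    using first_faces_lists[OF that w] by (simp add: v_def)
  have vi: "v (k - i) \<in> lists (carrier (level X i))" if "i \<le> k" for i
    using v[of "k - i"] that by simp
  have av: "Poly_Mapping.keys (aw_word X i (v (k - i))) \<subseteq> lists (letters (N X))" if "i \<le> k" for i
    using vi[OF that] by (rule aw_word_lists)
  let ?D = "frag_extend (bd_word (N X))"
  \<comment> \<open>\<open>P i\<close> and \<open>Q i\<close> are the boundaries of the front and of the back face in the \<open>i\<close>-th term, expanded.\<close>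
  define P where "P i = (if i < k then (\<Sum>j\<le>k - i. frag_cmul ((- 1) ^ j)
      (concat_prod (letter (k - i - 1) (face X (k - i) j (y i))) (aw_word X i (v (k - i))))) else 0)" for i
  define Q where "Q i = (if 0 < i then frag_cmul ((- 1) ^ (k - i)) (\<Sum>j\<le>i. frag_cmul ((- 1) ^ j)
      (concat_prod (letter (k - i) (y i)) (aw_word X (i - 1) (map (face X i j) (v (k - i)))))) else 0)" for i
  have termwise: "?D (concat_prod (letter (k - i) (y i)) (aw_word X i (v (k - i)))) - (P i + Q i) \<in> trel (N X)"
    if "i \<in> {..k}" for i
  proof -
    have i: "i \<le> k" using that by simp
    let ?b = "bd_word (N X) [(k - i, N_cls X (k - i) (y i))]" and ?a = "aw_word X i (v (k - i))"
    have P: "concat_prod ?b ?a - P i \<in> trel (N X)"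
    proof (cases "i < k")
      case True
      have "concat_prod ?b ?a - P i = concat_prod (?b - (\<Sum>j\<le>k - i. frag_cmul ((- 1) ^ j) (letter (k - i - 1) (face X (k - i) j (y i))))) ?a"
        using True by (simp add: P_def concat_prod_diff_left concat_prod_sum_left concat_prod_cmul_left del: bd_word.simps)
      also have "\<dots> \<in> trel (N X)"
        using True y[OF i] by (intro trel_concat_right bd_letter av i) auto
      finally show ?thesis .
    qed (simp add: P_def)
    have Q: "frag_cmul ((- 1) ^ (k - i)) (concat_prod (letter (k - i) (y i)) (?D ?a)) - Q i \<in> trel (N X)"
    proof (cases "0 < i")
      case True
      have "frag_cmul ((- 1) ^ (k - i)) (concat_prod (letter (k - i) (y i)) (?D ?a)) - Q i
          = frag_cmul ((- 1) ^ (k - i)) (concat_prod (letter (k - i) (y i))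
              (?D ?a - (\<Sum>j\<le>i. frag_cmul ((- 1) ^ j) (aw_word X (i - 1) (map (face X i j) (v (k - i)))))))"
        using True by (simp add: Q_def concat_prod_diff_right concat_prod_sum_right concat_prod_cmul_right frag_cmul_diff2)
      also have "\<dots> \<in> trel (N X)"
        using True y[OF i] vi[OF i] by (intro trel_cmul trel_concat_left Cons.IH letter_lists) (simp_all add: v_def)
      finally show ?thesis .
    next
      case False
      then have "?D ?a = 0" using aw_word_degree_0 vi[OF i] by simp
      then show ?thesis using False by (simp add: Q_def)
    qed
    have "?D (concat_prod (letter (k - i) (y i)) ?a)
        = concat_prod ?b ?a + frag_cmul ((- 1) ^ (k - i)) (concat_prod (letter (k - i) (y i)) (?D ?a))"
      using NX.frag_extend_bd_word_concat[OF letter_gwords[OF y[OF i]]] by simp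
    then show ?thesis using trel_add[OF P Q] by (simp add: algebra_simps)
  qed
  have D: "?D (aw_word X k (x # w)) = (\<Sum>i\<le>k. ?D (concat_prod (letter (k - i) (y i)) (aw_word X i (v (k - i)))))"
    by (simp add: aw_word_Cons frag_extend_sum comp_def y_def v_def)
  have "?D (aw_word X k (x # w)) - (\<Sum>i\<le>k. P i + Q i) \<in> trel (N X)"
    unfolding D sum_subtractf[symmetric] by (rule trel_sum[OF termwise])
  also have "(\<Sum>i\<le>k. P i + Q i) = (\<Sum>i<k. P i + Q (Suc i))"
  proof -
    obtain n where n: "k = Suc n" using k by (cases k) auto
    have "(\<Sum>i\<le>k. P i) = (\<Sum>i<k. P i)" unfolding n by (simp add: P_def n lessThan_Suc_atMost)
    moreover have "(\<Sum>i\<le>k. Q i) = (\<Sum>i<k. Q (Suc i))"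
      unfolding n sum.atMost_Suc_shift by (simp add: Q_def lessThan_Suc_atMost)
    ultimately show ?thesis by (simp add: sum.distrib)
  qed
  also have "\<dots> = (\<Sum>i<k. \<Sum>j\<le>k. frag_cmul ((- 1) ^ j) (concat_prod (letter (k - 1 - i) (last_faces X (k - 1) i (face X k j x)))
       (aw_word X i (map (first_faces X (k - 1) (k - 1 - i)) (map (face X k j) w)))))"
  proof (rule sum.cong[OF refl])
    fix i assume "i \<in> {..<k}" then have i: "i < k" by simp
    define m where "m = k - 1 - i"
    have m: "k - i = Suc m" "k - Suc i = m" "k - i - 1 = m" "m < k" "k - m = Suc i" "k = m + Suc i" using i by (auto simp: m_def)
    let ?R = "\<lambda>j. concat_prod (letter m (last_faces X (k - 1) i (face X k j x)))
       (aw_word X i (map (first_faces X (k - 1) m) (map (face X k j) w)))"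
    let ?A = "\<lambda>j. concat_prod (letter m (face X (Suc m) j (y i))) (aw_word X i (v (Suc m)))"
    let ?C = "\<lambda>j. concat_prod (letter m (y (Suc i))) (aw_word X i (map (face X (Suc i) j) (v m)))"
    have R1: "?R j = ?A j" if "j \<le> m" for j
    proof -
      have "last_faces X (k - 1) i (face X k j x) = face X (Suc m) j (y i)"
        using last_faces_face[OF x i, of j] that m by (simp add: y_def)
      moreover have "map (first_faces X (k - 1) m) (map (face X k j) w) = v (Suc m)"
        using first_faces_face[OF _ m(4), of _ j] that m w by (auto simp: v_def lists_eq_set)
      ultimately show ?thesis by simp
    qed
    have R2: "?R (Suc m + j) = ?C (Suc j)" if "j \<le> i" for j
    proof -
      have "last_faces X (k - 1) i (face X k (Suc m + j) x) = y (Suc i)"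
        using last_faces_face[OF x i, of "Suc m + j"] that m by (simp add: y_def)
      moreover have "map (first_faces X (k - 1) m) (map (face X k (Suc m + j)) w) = map (face X (Suc i) (Suc j)) (v m)"
        using first_faces_face[OF _ m(4), of _ "Suc m + j"] that m w by (auto simp: v_def lists_eq_set)
      ultimately show ?thesis by simp
    qed
    \<comment> \<open>The last face in \<open>P i\<close> is the zeroth one in \<open>Q (Suc i)\<close>; the signs are opposite.\<close>
    have AC: "?A (Suc m) = ?C 0"
    proof -
      have "y (Suc i) = face X (Suc m) (Suc m) (y i)" by (simp add: y_def m)
      moreover have "map (face X (Suc i) 0) (v m) = v (Suc m)" by (simp add: v_def m comp_def)
      ultimately show ?thesis by simp
    qed
    have P: "P i = (\<Sum>j\<le>m. frag_cmul ((- 1) ^ j) (?A j)) + frag_cmul ((- 1) ^ Suc m) (?A (Suc m))"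
      using i by (simp add: P_def m)
    have "Q (Suc i) = frag_cmul ((- 1) ^ m) (\<Sum>j\<le>Suc i. frag_cmul ((- 1) ^ j) (?C j))"
      by (simp add: Q_def m)
    also have "\<dots> = frag_cmul ((- 1) ^ m) (?C 0) + (\<Sum>j\<le>i. frag_cmul ((- 1) ^ (Suc m + j)) (?C (Suc j)))"
      unfolding sum.atMost_Suc_shift by (simp add: frag_cmul_distrib2 frag_cmul_sum power_add)
    finally have Q: "Q (Suc i) = frag_cmul ((- 1) ^ m) (?C 0) + (\<Sum>j\<le>i. frag_cmul ((- 1) ^ (Suc m + j)) (?C (Suc j)))" .
    have "P i + Q (Suc i) = (\<Sum>j\<le>m. frag_cmul ((- 1) ^ j) (?A j)) + (\<Sum>j\<le>i. frag_cmul ((- 1) ^ (Suc m + j)) (?C (Suc j)))"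
      unfolding P Q AC by (simp flip: frag_cmul_distrib add: add.assoc[symmetric])
    also have "\<dots> = (\<Sum>j\<le>m. frag_cmul ((- 1) ^ j) (?R j)) + (\<Sum>j\<le>i. frag_cmul ((- 1) ^ (Suc m + j)) (?R (Suc m + j)))"
      using R1 R2 by (intro arg_cong2[where f = plus] sum.cong refl arg_cong2[where f = frag_cmul]) auto
    also have "\<dots> = (\<Sum>j\<le>k. frag_cmul ((- 1) ^ j) (?R j))"
    proof -
      have "(\<Sum>j\<le>i. frag_cmul ((- 1) ^ (Suc m + j)) (?R (Suc m + j))) = (\<Sum>j\<in>{Suc m..Suc m + i}. frag_cmul ((- 1) ^ j) (?R j))"
        using sum.shift_bounds_cl_nat_ivl[of "\<lambda>j. frag_cmul ((- 1) ^ j) (?R j)" 0 "Suc m" i]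
        by (simp add: atMost_atLeast0 add.commute)
      moreover have "{..k} = {..m} \<union> {Suc m..Suc m + i}" "{..m} \<inter> {Suc m..Suc m + i} = {}" using m by auto
      ultimately show ?thesis by (simp add: sum.union_disjoint)
    qed
    finally show "P i + Q (Suc i) = (\<Sum>j\<le>k. frag_cmul ((- 1) ^ j)
       (concat_prod (letter (k - 1 - i) (last_faces X (k - 1) i (face X k j x)))
       (aw_word X i (map (first_faces X (k - 1) (k - 1 - i)) (map (face X k j) w)))))"
      by (simp add: m_def)
  qed
  also have "\<dots> = (\<Sum>j\<le>k. frag_cmul ((- 1) ^ j) (aw_word X (k - 1) (map (face X k j) (x # w))))"
  proof -
    have "{..k - 1} = {..<k}" using k by auto
    then show ?thesis unfolding list.map aw_word_Cons frag_cmul_sum by (subst sum.swap) simp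
  qed
  finally show ?case .
qed

end

subsection \<open>The Alexander--Whitney map is a map of complexes\<close>

context simplicial_ab_group
begin

interpretation TD: simplicial_ab_group "T_Delta X" by (rule T_Delta_simplicial)

text \<open>\<^const>\<open>AW\<close> before normalization.\<close>

definition aw_tensor :: "nat \<Rightarrow> ('a list \<Rightarrow>\<^sub>0 int) set \<Rightarrow> ((nat \<times> 'a set) list \<Rightarrow>\<^sub>0 int) set" where
  "aw_tensor k = induced (lin_ext (grp (T_dg (N X)) k) (\<lambda>w. gtensor_cls (N X) k (aw_word X k w)))"

lemma gtensor_N_group: "Group.group (gtensor (N X) k)"
  using NX.gtensor_comm_group by (simp add: comm_group_def)

lemma aw_cls_closed: "w \<in> lists (carrier (level X k)) \<Longrightarrow> gtensor_cls (N X) k (aw_word X k w) \<in> carrier (gtensor (N X) k)"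
  by (intro NX.gtensor_cls_closed aw_word_gwords)

lemma aw_cls_multilinear:
  assumes "us \<in> lists (carrier (level X k))" "x \<in> carrier (level X k)" "y \<in> carrier (level X k)" "vs \<in> lists (carrier (level X k))"
  shows "gtensor_cls (N X) k (aw_word X k (us @ (x \<otimes>\<^bsub>level X k\<^esub> y) # vs))
    = gtensor_cls (N X) k (aw_word X k (us @ x # vs)) \<otimes>\<^bsub>gtensor (N X) k\<^esub> gtensor_cls (N X) k (aw_word X k (us @ y # vs))"
proof -
  have l: "us @ (x \<otimes>\<^bsub>level X k\<^esub> y) # vs \<in> lists (carrier (level X k))" "us @ x # vs \<in> lists (carrier (level X k))"
    "us @ y # vs \<in> lists (carrier (level X k))" using assms by auto
  have "gtensor_cls (N X) k (aw_word X k (us @ (x \<otimes>\<^bsub>level X k\<^esub> y) # vs))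
      = gtensor_cls (N X) k (aw_word X k (us @ x # vs) + aw_word X k (us @ y # vs))"
    using aw_word_multilinear[OF assms(1,4,2,3)] l
    by (intro NX.gtensor_cls_eqI NX.gwords_add aw_word_gwords) (simp_all add: diff_diff_eq)
  then show ?thesis using l by (simp only: NX.gtensor_cls_add aw_word_gwords)
qed

lemma aw_tensor_lift:
  shows aw_tensor_hom: "aw_tensor k \<in> hom (tensor (level X k)) (gtensor (N X) k)"
    and aw_tensor_word: "w \<in> lists (carrier (level X k)) \<Longrightarrow>
      aw_tensor k (tensor_cls (level X k) (frag_of w)) = gtensor_cls (N X) k (aw_word X k w)"
    and aw_tensor_cls: "Poly_Mapping.keys c \<subseteq> lists (carrier (level X k)) \<Longrightarrow>
      aw_tensor k (tensor_cls (level X k) c) = gtensor_cls (N X) k (frag_extend (aw_word X k) c)"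
proof -
  let ?f = "\<lambda>w. gtensor_cls (N X) k (aw_word X k w)"
  show "aw_tensor k \<in> hom (tensor (level X k)) (gtensor (N X) k)"
    unfolding aw_tensor_def NX.grp_T_dg by (rule L.tensor_lift_hom[OF NX.gtensor_comm_group aw_cls_closed aw_cls_multilinear])
  show "w \<in> lists (carrier (level X k)) \<Longrightarrow> aw_tensor k (tensor_cls (level X k) (frag_of w)) = ?f w"
    unfolding aw_tensor_def NX.grp_T_dg by (rule L.tensor_lift_word[OF NX.gtensor_comm_group aw_cls_closed aw_cls_multilinear])
  assume c: "Poly_Mapping.keys c \<subseteq> lists (carrier (level X k))"
  have "aw_tensor k (tensor_cls (level X k) c) = lin_ext (gtensor (N X) k) ?f c"
    unfolding aw_tensor_def NX.grp_T_dg
    by (rule L.tensor_lift_cls[OF NX.gtensor_comm_group aw_cls_closed aw_cls_multilinear c])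
  also have "\<dots> = gtensor_cls (N X) k (frag_extend (aw_word X k) c)"
    using c by (intro NX.lin_ext_gtensor_cls aw_word_gwords) blast
  finally show "aw_tensor k (tensor_cls (level X k) c) = gtensor_cls (N X) k (frag_extend (aw_word X k) c)" .
qed

lemma aw_tensor_degen:
  assumes j: "j < k" and t: "t \<in> carrier (level (T_Delta X) (k - 1))"
  shows "aw_tensor k (degen (T_Delta X) (k - 1) j t) = \<one>\<^bsub>gtensor (N X) k\<^esub>"
proof -
  have d: "degen X (k - 1) j \<in> hom (level X (k - 1)) (level X k)" by (rule degen_hom'[OF j])
  note lc = level_comm_group
  have k: "Suc (k - 1) = k" using j by simp
  have h: "(\<lambda>t. aw_tensor k (tensor_map (level X k) (degen X (k - 1) j) t)) \<in> hom (tensor (level X (k - 1))) (gtensor (N X) k)"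
    using hom_compose[OF tensor_map_hom[OF lc lc d] aw_tensor_hom] by (simp add: comp_def)
  have one: "(\<lambda>t. \<one>\<^bsub>gtensor (N X) k\<^esub>) \<in> hom (tensor (level X (k - 1))) (gtensor (N X) k)"
    using gtensor_N_group[of k] by (auto simp: hom_def group.is_monoid monoid.l_one monoid.one_closed)
  have w: "aw_tensor k (tensor_map (level X k) (degen X (k - 1) j) (tensor_cls (level X (k - 1)) (frag_of w))) = \<one>\<^bsub>gtensor (N X) k\<^esub>"
    if "w \<in> lists (carrier (level X (k - 1)))" for w
    using aw_word_degen[OF that j] map_hom_lists[OF lc lc d that]
    by (simp only: tensor_map_word[OF lc lc d that] aw_tensor_word NX.gtensor_cls_one aw_word_gwords)
  show ?thesis
    using L.tensor_hom_eqI[OF gtensor_N_group h one w t[unfolded T_Delta_simps]] by (simp only: T_Delta_simps k)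
qed

lemma AW_eq: "AW X k = induced (aw_tensor k)"
  by (simp add: AW_def aw_tensor_def)

lemma
  shows AW_hom: "AW X k \<in> hom (grp (N (T_Delta X)) k) (gtensor (N X) k)"
    and AW_N_cls: "t \<in> carrier (tensor (level X k)) \<Longrightarrow> AW X k (N_cls (T_Delta X) k t) = aw_tensor k t"
proof -
  have h: "aw_tensor k \<in> hom (level (T_Delta X) k) (gtensor (N X) k)"
    using aw_tensor_hom by simp
  show "AW X k \<in> hom (grp (N (T_Delta X)) k) (gtensor (N X) k)"
    unfolding AW_eq by (rule TD.N_induced_hom[OF gtensor_N_group h aw_tensor_degen])
  show "t \<in> carrier (tensor (level X k)) \<Longrightarrow> AW X k (N_cls (T_Delta X) k t) = aw_tensor k t"
    unfolding AW_eq using TD.N_induced_cls[OF gtensor_N_group h aw_tensor_degen, of t] by simp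
qed

lemma face_lists: "\<lbrakk>0 < k; j \<le> k; w \<in> lists (carrier (level X k))\<rbrakk> \<Longrightarrow> map (face X k j) w \<in> lists (carrier (level X (k - 1)))"
  using face_closed by (auto simp: lists_eq_set)

lemma AW_bd_word:
  assumes k: "0 < k" and w: "w \<in> lists (carrier (level X k))"
  shows "AW X (k - 1) (bd (N (T_Delta X)) k (N_cls (T_Delta X) k (tensor_cls (level X k) (frag_of w))))
    = bd (T_dg (N X)) k (gtensor_cls (N X) k (aw_word X k w))"
proof -
  let ?t = "tensor_cls (level X k) (frag_of w)" and ?G = "gtensor (N X) (k - 1)"
  interpret G: comm_group ?G by (rule NX.gtensor_comm_group)
  note lc = level_comm_group
  have t: "?t \<in> carrier (level (T_Delta X) k)" using L.tensor_word_closed[OF w] by simp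
  let ?s = "\<lambda>j. tensor_cls (level X (k - 1)) (frag_of (map (face X k j) w))"
  let ?S = "\<Sum>j\<le>k. frag_cmul ((- 1) ^ j) (aw_word X (k - 1) (map (face X k j) w))"
  have fw: "map (face X k j) w \<in> lists (carrier (level X (k - 1)))" if "j \<le> k" for j
    by (rule face_lists[OF k that w])
  have s: "face (T_Delta X) k j ?t = ?s j" if "j \<le> k" for j
    using tensor_map_word[OF lc lc face_hom[OF k that] w] by simp
  have sc: "?s j \<in> carrier (level (T_Delta X) (k - 1))" if "j \<le> k" for j
    using L.tensor_word_closed[OF fw[OF that]] by simp
  have AWs: "AW X (k - 1) (N_cls (T_Delta X) (k - 1) (?s j)) = gtensor_cls (N X) (k - 1) (aw_word X (k - 1) (map (face X k j) w))"
    if "j \<le> k" for j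
    using AW_N_cls[of "?s j" "k - 1"] sc[OF that] aw_tensor_word[OF fw[OF that]] by simp
  have fs: "face_sum (T_Delta X) k ?t = (\<Sum>j\<le>k. frag_cmul ((- 1) ^ j) (frag_of (?s j)))"
    unfolding face_sum_def by (intro sum.cong) (simp_all only: s atMost_iff)
  have "AW X (k - 1) (bd (N (T_Delta X)) k (N_cls (T_Delta X) k ?t))
      = lin_ext ?G (\<lambda>u. AW X (k - 1) (N_cls (T_Delta X) (k - 1) u)) (face_sum (T_Delta X) k ?t)"
    unfolding TD.N_bd[OF k t]
    by (rule comm_group.hom_lin_ext[OF TD.N_comm_group NX.gtensor_comm_group AW_hom TD.N_cls_face_sum_keys[OF k t]])
  also have "\<dots> = finprod ?G (\<lambda>j. AW X (k - 1) (N_cls (T_Delta X) (k - 1) (?s j)) [^]\<^bsub>?G\<^esub> ((- 1) ^ j :: int)) {..k}"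
    unfolding fs using AWs aw_cls_closed[OF fw] by (intro G.lin_ext_signed_sum) simp_all
  also have "\<dots> = finprod ?G (\<lambda>j. gtensor_cls (N X) (k - 1) (aw_word X (k - 1) (map (face X k j) w)) [^]\<^bsub>?G\<^esub> ((- 1) ^ j :: int)) {..k}"
    using AWs aw_cls_closed[OF fw] by (intro G.finprod_cong') simp_all
  also have "\<dots> = lin_ext ?G (\<lambda>v. gtensor_cls (N X) (k - 1) (aw_word X (k - 1) v)) (\<Sum>j\<le>k. frag_cmul ((- 1) ^ j) (frag_of (map (face X k j) w)))"
    using aw_cls_closed[OF fw] by (intro G.lin_ext_signed_sum[symmetric]) simp_all
  also have "\<dots> = gtensor_cls (N X) (k - 1) (frag_extend (aw_word X (k - 1)) (\<Sum>j\<le>k. frag_cmul ((- 1) ^ j) (frag_of (map (face X k j) w))))"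
  proof (rule NX.lin_ext_gtensor_cls)
    fix v assume "v \<in> Poly_Mapping.keys (\<Sum>j\<le>k. frag_cmul ((- 1) ^ j) (frag_of (map (face X k j) w)))"
    moreover have "Poly_Mapping.keys (\<Sum>j\<le>k. frag_cmul ((- 1) ^ j) (frag_of (map (face X k j) w))) \<subseteq> lists (carrier (level X (k - 1)))"
      using keys_cmul fw by (intro keys_sum_subset) fastforce
    ultimately show "Poly_Mapping.keys (aw_word X (k - 1) v) \<subseteq> gwords (N X) (k - 1)"
      using aw_word_gwords by blast
  qed
  also have "\<dots> = gtensor_cls (N X) (k - 1) ?S"
    by (simp add: frag_extend_sum frag_extend_cmul comp_def)
  also have "\<dots> = gtensor_cls (N X) (k - 1) (frag_extend (bd_word (N X)) (aw_word X k w))"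
  proof (rule NX.gtensor_cls_eqI[symmetric])
    show "frag_extend (bd_word (N X)) (aw_word X k w) - ?S \<in> trel (N X)" by (rule aw_word_bd[OF w k])
    show "Poly_Mapping.keys (frag_extend (bd_word (N X)) (aw_word X k w)) \<subseteq> gwords (N X) (k - 1)"
      by (rule NX.frag_extend_bd_word_gwords[OF aw_word_gwords[OF w]])
    show "Poly_Mapping.keys ?S \<subseteq> gwords (N X) (k - 1)"
      by (rule keys_sum_subset, rule NX.gwords_cmul, rule aw_word_gwords, rule fw) simp
  qed
  also have "\<dots> = bd (T_dg (N X)) k (gtensor_cls (N X) k (aw_word X k w))"
    by (rule NX.bd_T_dg[OF aw_word_gwords[OF w], symmetric])
  finally show ?thesis .
qed

lemma AW_cpx_hom: "cpx_hom (N (T_Delta X)) (T_dg (N X)) (AW X)"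
  unfolding cpx_hom_def NX.grp_T_dg
proof (intro conjI allI impI ballI AW_hom)
  fix k :: nat and u assume k: "0 < k" and "u \<in> carrier (grp (N (T_Delta X)) k)"
  then obtain t where t: "t \<in> carrier (tensor (level X k))" "u = N_cls (T_Delta X) k t"
    by (auto elim: TD.N_cases)
  have Nh: "N_cls (T_Delta X) k \<in> hom (tensor (level X k)) (grp (N (T_Delta X)) k)"
    using TD.N_cls_hom[of k] by simp
  have h1: "(\<lambda>t. AW X (k - 1) (bd (N (T_Delta X)) k (N_cls (T_Delta X) k t))) \<in> hom (tensor (level X k)) (gtensor (N X) (k - 1))"
    using hom_compose[OF hom_compose[OF Nh TD.N_bd_hom[OF k]] AW_hom] by (simp add: comp_def)
  have h2: "(\<lambda>t. bd (T_dg (N X)) k (AW X k (N_cls (T_Delta X) k t))) \<in> hom (tensor (level X k)) (gtensor (N X) (k - 1))"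
    using hom_compose[OF hom_compose[OF Nh AW_hom] NX.bd_T_dg_hom] by (simp add: comp_def)
  have "AW X (k - 1) (bd (N (T_Delta X)) k (N_cls (T_Delta X) k t)) = bd (T_dg (N X)) k (AW X k (N_cls (T_Delta X) k t))"
  proof (rule L.tensor_hom_eqI[OF gtensor_N_group h1 h2 _ t(1)])
    fix w assume w: "w \<in> lists (carrier (level X k))"
    show "AW X (k - 1) (bd (N (T_Delta X)) k (N_cls (T_Delta X) k (tensor_cls (level X k) (frag_of w))))
      = bd (T_dg (N X)) k (AW X k (N_cls (T_Delta X) k (tensor_cls (level X k) (frag_of w))))"
      by (simp only: AW_bd_word[OF k w] AW_N_cls[OF L.tensor_word_closed[OF w]] aw_tensor_word[OF w])
  qed
  then show "AW X (k - 1) (bd (N (T_Delta X)) k u) = bd (T_dg (N X)) k (AW X k u)"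
    by (simp only: t(2))
qed

lemma AW_word:
  "w \<in> lists (carrier (level X k)) \<Longrightarrow>
    AW X k (N_cls (T_Delta X) k (tensor_cls (level X k) (frag_of w))) = gtensor_cls (N X) k (aw_word X k w)"
  by (simp only: AW_N_cls L.tensor_word_closed aw_tensor_word)

lemma aw_word_single: "aw_word X k [x] = letter k x"
proof -
  have "aw_word X k [x] = (\<Sum>i\<le>k. if i = 0 then letter k x else 0)"
    unfolding aw_word_Cons by (intro sum.cong) auto
  then show ?thesis by simp
qed

lemma aw_word_pair:
  "aw_word X k [x, y] = (\<Sum>i\<le>k. frag_of [(k - i, N_cls X (k - i) (last_faces X k i x)), (i, N_cls X i (first_faces X k (k - i) y))])"
  unfolding aw_word_Cons[of k x] by (simp add: aw_word_single)

end

subsection \<open>Naturality\<close>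

lemma frag_extend_map_concat:
  "frag_extend (\<lambda>u. frag_of (map g u)) (concat_prod c d)
    = concat_prod (frag_extend (\<lambda>u. frag_of (map g u)) c) (frag_extend (\<lambda>u. frag_of (map g u)) d)"
proof (induction c rule: frag_induction[OF subset_UNIV])
  case (2 u)
  show ?case
    by (induction d rule: frag_induction[OF subset_UNIV]) (auto simp: concat_prod_simps frag_extend_simps)
qed (auto simp: concat_prod_simps frag_extend_simps)

context
  fixes X :: "'a simp_ab" and Y :: "'b simp_ab" and f
  assumes X: "simplicial_ab_group X" and Y: "simplicial_ab_group Y" and f: "simp_ab_hom X Y f"
begin

interpretation X: simplicial_ab_group X by (rule X)
interpretation Y: simplicial_ab_group Y by (rule Y)

lemma simp_ab_hom_face: "\<lbrakk>0 < n; i \<le> n; x \<in> carrier (level X n)\<rbrakk> \<Longrightarrow> f (n - 1) (face X n i x) = face Y n i (f n x)"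
  using f by (simp add: simp_ab_hom_def)

lemma last_faces_natural: "\<lbrakk>i \<le> k; x \<in> carrier (level X k)\<rbrakk> \<Longrightarrow> f (k - i) (last_faces X k i x) = last_faces Y k i (f k x)"
proof (induction i)
  case (Suc i)
  have "k - Suc i = k - i - 1" by simp
  then show ?case
    using Suc simp_ab_hom_face[of "k - i" "k - i" "last_faces X k i x"] X.last_faces_closed[of i k x] by (simp only: last_faces.simps)
qed simp

lemma first_faces_natural: "\<lbrakk>i \<le> k; x \<in> carrier (level X k)\<rbrakk> \<Longrightarrow> f (k - i) (first_faces X k i x) = first_faces Y k i (f k x)"
proof (induction i)
  case (Suc i)
  have "k - Suc i = k - i - 1" by simp
  then show ?case
    using Suc simp_ab_hom_face[of "k - i" 0 "first_faces X k i x"] X.first_faces_closed[of i k x] by (simp only: first_faces.simps)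
qed simp

lemma aw_word_natural:
  "w \<in> lists (carrier (level X k)) \<Longrightarrow>
    frag_extend (\<lambda>u. frag_of (map (\<lambda>(i, v). (i, N_map Y f i v)) u)) (aw_word X k w) = aw_word Y k (map (f k) w)"
proof (induction w arbitrary: k rule: length_list_induct)
  case (Cons x w)
  let ?g = "\<lambda>(i, v). (i, N_map Y f i v)"
  have t: "frag_extend (\<lambda>u. frag_of (map ?g u)) (concat_prod (X.letter (k - i) (last_faces X k i x)) (aw_word X i (map (first_faces X k (k - i)) w)))
      = concat_prod (Y.letter (k - i) (last_faces Y k i (f k x))) (aw_word Y i (map (first_faces Y k (k - i)) (map (f k) w)))"
    if i: "i \<in> {..k}" for i
  proof -
    have fw: "map (first_faces X k (k - i)) w \<in> lists (carrier (level X i))"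
      using X.first_faces_lists[of "k - i" k w] Cons.prems i by simp
    have m: "map (f i) (map (first_faces X k (k - i)) w) = map (first_faces Y k (k - i)) (map (f k) w)"
      using first_faces_natural[of "k - i" k] Cons.prems i by (auto simp: lists_eq_set)
    have "N_map Y f (k - i) (N_cls X (k - i) (last_faces X k i x)) = N_cls Y (k - i) (last_faces Y k i (f k x))"
      using N_map_cls[OF X Y f X.last_faces_closed, of i k x] last_faces_natural[of i k x] Cons.prems i by simp
    then show ?thesis
      using Cons.IH[OF _ fw] by (simp add: frag_extend_map_concat m del: map_map)
  qed
  show ?case
    unfolding list.map X.aw_word_Cons Y.aw_word_Cons using t
    by (simp add: frag_extend_sum comp_def del: map_map) 
qed simp

lemma T_dg_map_gtensor_cls:
  assumes c: "Poly_Mapping.keys c \<subseteq> gwords (N X) k"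
  shows "T_dg_map (N Y) (N_map Y f) k (gtensor_cls (N X) k c)
    = gtensor_cls (N Y) k (frag_extend (\<lambda>u. frag_of (map (\<lambda>(i, v). (i, N_map Y f i v)) u)) c)"
proof -
  let ?g = "\<lambda>(i, v). (i, N_map Y f i v)"
  interpret C: cpx_to_dg "N X" "T_dg (N Y)" "\<lambda>k v. T_dg_gen (N Y) k (N_map Y f k v)"
    using X.N_cochain_complex Y.NX.T_dg_dg_ring cpx_hom_comp[OF N_map_cpx_hom[OF X Y f] Y.NX.T_dg_gen_cpx_hom]
    by (simp add: cpx_to_dg_def cpx_to_dg_axioms_def)
  have gw: "map ?g u \<in> gwords (N Y) k" if "u \<in> gwords (N X) k" for u k
    using that hom_in_carrier[OF N_map_hom[OF X Y f]] by (induction u arbitrary: k) (auto simp: gwords_iff)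
  have wp: "word_prod (T_dg (N Y)) (\<lambda>k v. T_dg_gen (N Y) k (N_map Y f k v)) u = gtensor_cls (N Y) k (frag_of (map ?g u))"
    if "u \<in> gwords (N X) k" for u k
    using that
  proof (induction u arbitrary: k)
    case Nil
    then show ?case by (simp add: Y.NX.gone_T_dg gwords_iff)
  next
    case (Cons a u)
    obtain i v where a: "a = (i, v)" by force
    have u: "u \<in> gwords (N X) (wdeg u)" and v: "[(i, v)] \<in> gwords (N X) i" and k: "k = i + wdeg u"
      using Cons.prems by (auto simp: a gwords_iff)
    show ?case
      using Cons.IH[OF u] Y.NX.gmult_T_dg[of "frag_of [(i, N_map Y f i v)]" i "frag_of (map ?g u)" "wdeg u"] gw[OF u] gw[OF v]
      by (simp add: a k T_dg_gen_def)
  qed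
  have "T_dg_map (N Y) (N_map Y f) k (gtensor_cls (N X) k c)
      = lin_ext (gtensor (N Y) k) (word_prod (T_dg (N Y)) (\<lambda>k v. T_dg_gen (N Y) k (N_map Y f k v))) c"
    unfolding T_dg_map_def using C.T_dg_lift_cls[OF c] by simp
  also have "\<dots> = lin_ext (gtensor (N Y) k) (\<lambda>u. gtensor_cls (N Y) k (frag_of (map ?g u))) c"
  proof (rule comm_group.lin_ext_cong[OF Y.NX.gtensor_comm_group])
    show "(\<lambda>u. gtensor_cls (N Y) k (frag_of (map ?g u))) ` Poly_Mapping.keys c \<subseteq> carrier (gtensor (N Y) k)"
      by (rule image_subsetI, rule Y.NX.gtensor_cls_closed) (use c gw in auto)
  qed (use c wp in blast)
  also have "\<dots> = gtensor_cls (N Y) k (frag_extend (\<lambda>u. frag_of (map ?g u)) c)"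
    using c gw by (intro Y.NX.lin_ext_gtensor_cls) auto
  finally show ?thesis .
qed

lemma T_Delta_map_simp_ab_hom:
  "simp_ab_hom (T_Delta X) (T_Delta Y) (\<lambda>n. tensor_map (level Y n) (f n))"
  unfolding simp_ab_hom_def T_Delta_simps
proof (intro conjI allI ballI impI)
  note lcX = X.level_comm_group and lcY = Y.level_comm_group
  show "tensor_map (level Y n) (f n) \<in> hom (tensor (level X n)) (tensor (level Y n))" for n
    by (rule tensor_map_hom[OF lcX lcY simp_ab_hom_hom[OF X Y f]])
  fix n i t assume t: "t \<in> carrier (tensor (level X n))"
  { assume "0 < n \<and> i \<le> n"
    then have n: "0 < n" "i \<le> n" by auto
    show "tensor_map (level Y (n - 1)) (f (n - 1)) (tensor_map (level X (n - 1)) (face X n i) t)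
        = tensor_map (level Y (n - 1)) (face Y n i) (tensor_map (level Y n) (f n) t)"
      by (rule tensor_map_square[OF lcX lcX lcY lcY X.face_hom[OF n] simp_ab_hom_hom[OF X Y f] simp_ab_hom_hom[OF X Y f] Y.face_hom[OF n] simp_ab_hom_face[OF n] t]) }
  { assume n: "i \<le> n"
    have fd: "f (Suc n) (degen X n i x) = degen Y n i (f n x)" if "x \<in> carrier (level X n)" for x
      using f that n by (simp add: simp_ab_hom_def)
    show "tensor_map (level Y (Suc n)) (f (Suc n)) (tensor_map (level X (Suc n)) (degen X n i) t)
        = tensor_map (level Y (Suc n)) (degen Y n i) (tensor_map (level Y n) (f n) t)"
      by (rule tensor_map_square[OF lcX lcX lcY lcY X.degen_hom[OF n] simp_ab_hom_hom[OF X Y f] simp_ab_hom_hom[OF X Y f] Y.degen_hom[OF n] fd t]) }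
qed

lemma AW_natural:
  assumes "u \<in> carrier (grp (N (T_Delta X)) k)"
  shows "AW Y k (N_map (T_Delta Y) (\<lambda>n. tensor_map (level Y n) (f n)) k u)
    = T_dg_map (N Y) (N_map Y f) k (AW X k u)"
proof -
  let ?F = "\<lambda>n. tensor_map (level Y n) (f n)"
  note F = T_Delta_map_simp_ab_hom
  note lcX = X.level_comm_group and lcY = Y.level_comm_group
  obtain t where t: "t \<in> carrier (tensor (level X k))" "u = N_cls (T_Delta X) k t"
    using simplicial_ab_group.N_cases[OF X.T_Delta_simplicial assms] by auto
  have NX: "N_cls (T_Delta X) k \<in> hom (tensor (level X k)) (grp (N (T_Delta X)) k)"
    using simplicial_ab_group.N_cls_hom[OF X.T_Delta_simplicial, of k] by simp
  have h1: "(\<lambda>t. AW Y k (N_map (T_Delta Y) ?F k (N_cls (T_Delta X) k t))) \<in> hom (tensor (level X k)) (gtensor (N Y) k)"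
    using hom_compose[OF hom_compose[OF NX N_map_hom[OF X.T_Delta_simplicial Y.T_Delta_simplicial F]] Y.AW_hom] by (simp add: comp_def)
  have Th: "T_dg_map (N Y) (N_map Y f) k \<in> hom (gtensor (N X) k) (gtensor (N Y) k)"
    using dg_hom_hom[OF T_dg_map_dg_hom(1)[OF X.N_cochain_complex Y.N_cochain_complex N_map_cpx_hom[OF X Y f]], of k] by simp
  have h2: "(\<lambda>t. T_dg_map (N Y) (N_map Y f) k (AW X k (N_cls (T_Delta X) k t))) \<in> hom (tensor (level X k)) (gtensor (N Y) k)"
    using hom_compose[OF hom_compose[OF NX X.AW_hom] Th] by (simp add: comp_def)
  have "AW Y k (N_map (T_Delta Y) ?F k (N_cls (T_Delta X) k t)) = T_dg_map (N Y) (N_map Y f) k (AW X k (N_cls (T_Delta X) k t))"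
  proof (rule X.L.tensor_hom_eqI[OF Y.gtensor_N_group h1 h2 _ t(1)])
    fix w assume w: "w \<in> lists (carrier (level X k))"
    have c: "tensor_cls (level X k) (frag_of w) \<in> carrier (level (T_Delta X) k)"
      using X.L.tensor_word_closed[OF w] by simp
    have "AW Y k (N_map (T_Delta Y) ?F k (N_cls (T_Delta X) k (tensor_cls (level X k) (frag_of w))))
        = AW Y k (N_cls (T_Delta Y) k (tensor_cls (level Y k) (frag_of (map (f k) w))))"
      by (simp only: N_map_cls[OF X.T_Delta_simplicial Y.T_Delta_simplicial F c] tensor_map_word[OF lcX lcY simp_ab_hom_hom[OF X Y f] w])
    also have "\<dots> = gtensor_cls (N Y) k (aw_word Y k (map (f k) w))"
      by (rule Y.AW_word[OF map_hom_lists[OF lcX lcY simp_ab_hom_hom[OF X Y f] w]])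
    also have "\<dots> = T_dg_map (N Y) (N_map Y f) k (gtensor_cls (N X) k (aw_word X k w))"
      by (simp only: T_dg_map_gtensor_cls[OF X.aw_word_gwords[OF w]] aw_word_natural[OF w])
    also have "\<dots> = T_dg_map (N Y) (N_map Y f) k (AW X k (N_cls (T_Delta X) k (tensor_cls (level X k) (frag_of w))))"
      by (simp only: X.AW_word[OF w])
    finally show "AW Y k (N_map (T_Delta Y) ?F k (N_cls (T_Delta X) k (tensor_cls (level X k) (frag_of w))))
      = T_dg_map (N Y) (N_map Y f) k (AW X k (N_cls (T_Delta X) k (tensor_cls (level X k) (frag_of w))))" .
  qed
  then show ?thesis by (simp only: t(2))
qed

end

section \<open>The shuffle map and its left inverse\<close>

text \<open>
  The increasing lists of indices along which an \<open>n\<close>-simplex can be degenerated: by the bound on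
  its entries, the \<open>t\<close>-th one is at most \<open>n + t\<close>.
\<close>

definition admissible :: "nat \<Rightarrow> nat list \<Rightarrow> bool" where
  "admissible n js \<longleftrightarrow> sorted_wrt (<) js \<and> set js \<subseteq> {..<n + length js}"

definition shuffle_sets :: "nat \<Rightarrow> nat \<Rightarrow> nat set set" where
  "shuffle_sets p q = {M. M \<subseteq> {..<p + q} \<and> card M = p}"

lemma admissible_Nil [simp]: "admissible n []"
  by (simp add: admissible_def)

lemma admissible_snoc:
  assumes "admissible n (js @ [k])"
  shows "admissible n js" "k \<le> n + length js" "\<And>j. j \<in> set js \<Longrightarrow> j < k"
  using assms by (auto simp: admissible_def sorted_wrt_append)

lemma degens_snoc: "degens X n (js @ [k]) x = degen X (n + length js) k (degens X n js x)"
  by (induction js arbitrary: n x) auto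

context simplicial_ab_group
begin

lemma degens_closed:
  "\<lbrakk>admissible n js; x \<in> carrier (level X n)\<rbrakk> \<Longrightarrow> degens X n js x \<in> carrier (level X (n + length js))"
proof (induction js rule: rev_induct)
  case (snoc k js)
  then show ?case
    using admissible_snoc[OF snoc.prems(1)] degen_closed[of k "n + length js" "degens X n js x"]
    by (simp add: degens_snoc)
qed simp

lemma degens_mult:
  "\<lbrakk>admissible n js; x \<in> carrier (level X n); y \<in> carrier (level X n)\<rbrakk> \<Longrightarrow>
    degens X n js (x \<otimes>\<^bsub>level X n\<^esub> y) = degens X n js x \<otimes>\<^bsub>level X (n + length js)\<^esub> degens X n js y"
proof (induction js rule: rev_induct)
  case (snoc k js)
  note a = admissible_snoc[OF snoc.prems(1)]
  show ?case
    using snoc.IH[OF a(1)] snoc.prems hom_mult[OF degen_hom[OF a(2)] degens_closed[OF a(1)] degens_closed[OF a(1)], of x y]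
    by (simp add: degens_snoc)
qed simp

text \<open>An iterated degeneracy is degenerate in each of its directions.\<close>

lemma degens_in_degen_image:
  assumes "admissible n js" "x \<in> carrier (level X n)" "m \<in> set js"
  shows "\<exists>z \<in> carrier (level X (n + length js - 1)). degens X n js x = degen X (n + length js - 1) m z"
  using assms
proof (induction js rule: rev_induct)
  case (snoc k js)
  note a = admissible_snoc[OF snoc.prems(1)]
  let ?N = "n + length js"
  have c: "degens X n js x \<in> carrier (level X ?N)" by (rule degens_closed[OF a(1) snoc.prems(2)])
  show ?case
  proof (cases "m = k")
    case True
    then show ?thesis using c by (auto simp: degens_snoc)
  next
    case False
    then have m: "m \<in> set js" "m < k" using snoc.prems a(3) by auto
    then obtain z where z: "z \<in> carrier (level X (?N - 1))" "degens X n js x = degen X (?N - 1) m z"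
      using snoc.IH[OF a(1) snoc.prems(2)] by auto
    have N: "Suc (?N - 1) = ?N" "m \<le> k - 1" "k - 1 \<le> ?N - 1" "Suc (k - 1) = k" using m a(2) by auto
    have "degens X n (js @ [k]) x = degen X ?N m (degen X (?N - 1) (k - 1) z)"
      using degen_degen[OF N(2,3) z(1)] by (simp only: degens_snoc z(2) N(1,4))
    moreover have "degen X (?N - 1) (k - 1) z \<in> carrier (level X ?N)"
      using degen_closed[OF N(3) z(1)] by (simp only: N(1))
    ultimately show ?thesis by auto
  qed
qed simp

text \<open>
  Iterated degeneracies of a degenerate simplex are degenerate in one further direction: the
  original degeneracy \<open>s\<^sub>j\<close> is moved to the left, and its index is raised by those that it passes.
\<close>

lemma degens_degen_in_image:
  assumes "admissible (Suc n) js" "x \<in> carrier (level X n)" "j \<le> n"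
  shows "\<exists>m z. m \<notin> set js \<and> m \<le> n + length js \<and> z \<in> carrier (level X (n + length js)) \<and>
    degens X (Suc n) js (degen X n j x) = degen X (n + length js) m z"
  using assms
proof (induction js rule: rev_induct)
  case Nil
  then show ?case by auto
next
  case (snoc k js)
  note a = admissible_snoc[OF snoc.prems(1)]
  let ?N = "n + length js"
  obtain m z where m: "m \<notin> set js" "m \<le> ?N" and z: "z \<in> carrier (level X ?N)"
    and e: "degens X (Suc n) js (degen X n j x) = degen X ?N m z"
    using snoc.IH[OF a(1) snoc.prems(2,3)] by blast
  have s: "degens X (Suc n) (js @ [k]) (degen X n j x) = degen X (Suc ?N) k (degen X ?N m z)"
    by (simp add: degens_snoc e)
  show ?case
  proof (cases "k \<le> m")
    case True
    have "degens X (Suc n) (js @ [k]) (degen X n j x) = degen X (Suc ?N) (Suc m) (degen X ?N k z)"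
      unfolding s by (rule degen_degen[OF True m(2) z])
    moreover have "degen X ?N k z \<in> carrier (level X (Suc ?N))"
      using True m z by (intro degen_closed) auto
    moreover have "Suc m \<notin> set (js @ [k])" using a(3) True by fastforce
    ultimately show ?thesis using m(2) by (intro exI[of _ "Suc m"] exI[of _ "degen X ?N k z"]) auto
  next
    case False
    then have k: "m \<le> k - 1" "k - 1 \<le> ?N" "Suc (k - 1) = k" using a(2) by auto
    have "degens X (Suc n) (js @ [k]) (degen X n j x) = degen X (Suc ?N) m (degen X ?N (k - 1) z)"
      unfolding s using degen_degen[OF k(1,2) z] k(3) by simp
    moreover have "degen X ?N (k - 1) z \<in> carrier (level X (Suc ?N))"
      using k z by (intro degen_closed) auto
    ultimately show ?thesis using m False by (intro exI[of _ m] exI[of _ "degen X ?N (k - 1) z"]) auto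
  qed
qed

subsection \<open>Well-definedness of the shuffle map\<close>

lemma finite_shuffle_sets: "finite (shuffle_sets p q)"
  unfolding shuffle_sets_def by (rule finite_subset[of _ "Pow {..<p + q}"]) auto

lemma admissible_sorted_list:
  assumes "S \<subseteq> {..<n + card S}" shows "admissible n (sorted_list_of_set S)"
  using assms finite_subset[OF assms] by (simp add: admissible_def)

lemma shuffle_admissible:
  assumes "M \<in> shuffle_sets p q"
  shows "admissible p (sorted_list_of_set ({..<p + q} - M))" "length (sorted_list_of_set ({..<p + q} - M)) = q"
    "set (sorted_list_of_set ({..<p + q} - M)) = {..<p + q} - M"
    "admissible q (sorted_list_of_set M)" "length (sorted_list_of_set M) = p" "set (sorted_list_of_set M) = M"
proof -
  have f: "finite M" "card M = p" "M \<subseteq> {..<p + q}"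
    using assms finite_subset by (auto simp: shuffle_sets_def)
  then have c: "card ({..<p + q} - M) = q" by (simp add: card_Diff_subset)
  show "admissible p (sorted_list_of_set ({..<p + q} - M))" "admissible q (sorted_list_of_set M)"
    by (rule admissible_sorted_list; use f c in \<open>auto simp: add.commute\<close>)+
  show "length (sorted_list_of_set ({..<p + q} - M)) = q" "set (sorted_list_of_set ({..<p + q} - M)) = {..<p + q} - M"
    "length (sorted_list_of_set M) = p" "set (sorted_list_of_set M) = M"
    using f c by simp_all
qed

definition shuffle_word :: "nat \<Rightarrow> nat \<Rightarrow> nat set \<Rightarrow> 'a \<Rightarrow> 'a \<Rightarrow> 'a list" where
  "shuffle_word p q M x y =
     [degens X p (sorted_list_of_set ({..<p + q} - M)) x, degens X q (sorted_list_of_set M) y]"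

lemma shuffle_word_lists:
  assumes "M \<in> shuffle_sets p q" "x \<in> carrier (level X p)" "y \<in> carrier (level X q)"
  shows "shuffle_word p q M x y \<in> lists (carrier (level X (p + q)))"
  using degens_closed[OF shuffle_admissible(1)[OF assms(1)] assms(2)] shuffle_admissible(2)[OF assms(1)]
    degens_closed[OF shuffle_admissible(4)[OF assms(1)] assms(3)] shuffle_admissible(5)[OF assms(1)]
  by (simp add: shuffle_word_def add.commute)

lemma shuffle_sum_eq:
  "shuffle_sum X p q x y = (\<Sum>M\<in>shuffle_sets p q. frag_cmul (shuffle_sign (p + q) M) (frag_of (shuffle_word p q M x y)))"
  by (simp add: shuffle_sum_def shuffle_word_def shuffle_sets_def)

lemma shuffle_sum_lists:
  assumes "x \<in> carrier (level X p)" "y \<in> carrier (level X q)"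
  shows "Poly_Mapping.keys (shuffle_sum X p q x y) \<subseteq> lists (carrier (level X (p + q)))"
  unfolding shuffle_sum_eq
proof (rule keys_sum_subset)
  fix M assume "M \<in> shuffle_sets p q"
  then show "Poly_Mapping.keys (frag_cmul (shuffle_sign (p + q) M) (frag_of (shuffle_word p q M x y))) \<subseteq> lists (carrier (level X (p + q)))"
    using keys_cmul[of "shuffle_sign (p + q) M" "frag_of (shuffle_word p q M x y)"] shuffle_word_lists[OF _ assms, of M] by auto
qed

interpretation TD: simplicial_ab_group "T_Delta X" by (rule T_Delta_simplicial)

definition shuffle_term :: "nat \<Rightarrow> nat \<Rightarrow> nat set \<Rightarrow> 'a \<Rightarrow> 'a \<Rightarrow> ('a list \<Rightarrow>\<^sub>0 int) set set" where
  "shuffle_term p q M x y = N_cls (T_Delta X) (p + q) (tensor_cls (level X (p + q)) (frag_of (shuffle_word p q M x y)))"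

definition shuffle_prod :: "nat \<Rightarrow> nat \<Rightarrow> 'a \<Rightarrow> 'a \<Rightarrow> ('a list \<Rightarrow>\<^sub>0 int) set set" where
  "shuffle_prod p q x y = N_cls (T_Delta X) (p + q) (tensor_cls (level X (p + q)) (shuffle_sum X p q x y))"

lemma N_word_closed:
  "w \<in> lists (carrier (level X k)) \<Longrightarrow> N_cls (T_Delta X) k (tensor_cls (level X k) (frag_of w)) \<in> carrier (grp (N (T_Delta X)) k)"
  by (rule TD.N_cls_closed) (simp add: L.tensor_word_closed)

lemma shuffle_term_closed:
  "\<lbrakk>M \<in> shuffle_sets p q; x \<in> carrier (level X p); y \<in> carrier (level X q)\<rbrakk> \<Longrightarrow>
    shuffle_term p q M x y \<in> carrier (grp (N (T_Delta X)) (p + q))"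
  unfolding shuffle_term_def by (intro N_word_closed shuffle_word_lists)

lemma N_tensor_cls_hom: "N_cls (T_Delta X) k \<in> hom (tensor (level X k)) (grp (N (T_Delta X)) k)"
  using TD.N_cls_hom[of k] by simp

lemma shuffle_prod_finprod:
  assumes "x \<in> carrier (level X p)" "y \<in> carrier (level X q)"
  shows "shuffle_prod p q x y = finprod (grp (N (T_Delta X)) (p + q))
    (\<lambda>M. shuffle_term p q M x y [^]\<^bsub>grp (N (T_Delta X)) (p + q)\<^esub> shuffle_sign (p + q) M) (shuffle_sets p q)"
proof -
  let ?k = "p + q"
  let ?c = "shuffle_sum X p q x y"
  have "tensor_cls (level X ?k) ?c = lin_ext (tensor (level X ?k)) (\<lambda>w. tensor_cls (level X ?k) (frag_of w)) ?c"
    using L.lin_ext_tensor_cls[of ?c frag_of ?k] shuffle_sum_lists[OF assms] by (auto simp flip: frag_expansion)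
  moreover have "(\<lambda>w. tensor_cls (level X ?k) (frag_of w)) ` Poly_Mapping.keys ?c \<subseteq> carrier (tensor (level X ?k))"
    using shuffle_sum_lists[OF assms] by (intro image_subsetI L.tensor_word_closed) blast
  ultimately have "shuffle_prod p q x y = lin_ext (grp (N (T_Delta X)) ?k) (\<lambda>w. N_cls (T_Delta X) ?k (tensor_cls (level X ?k) (frag_of w))) ?c"
    unfolding shuffle_prod_def
    by (simp only: comm_group.hom_lin_ext[OF L.tensor_comm_group TD.N_comm_group N_tensor_cls_hom])
  also have "\<dots> = finprod (grp (N (T_Delta X)) (p + q))
    (\<lambda>M. shuffle_term p q M x y [^]\<^bsub>grp (N (T_Delta X)) (p + q)\<^esub> shuffle_sign (p + q) M) (shuffle_sets p q)"
    unfolding shuffle_sum_eq shuffle_term_def using shuffle_word_lists[OF _ assms] N_word_closed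
    by (intro comm_group.lin_ext_signed_sum[OF TD.N_comm_group finite_shuffle_sets]) blast
  finally show ?thesis .
qed

lemma shuffle_prod_closed:
  "\<lbrakk>x \<in> carrier (level X p); y \<in> carrier (level X q)\<rbrakk> \<Longrightarrow> shuffle_prod p q x y \<in> carrier (grp (N (T_Delta X)) (p + q))"
  unfolding shuffle_prod_def by (rule TD.N_cls_closed) (simp add: L.tensor_cls_closed shuffle_sum_lists)

lemma shuffle_term_mult_left:
  assumes "M \<in> shuffle_sets p q" "x \<in> carrier (level X p)" "x' \<in> carrier (level X p)" "y \<in> carrier (level X q)"
  shows "shuffle_term p q M (x \<otimes>\<^bsub>level X p\<^esub> x') y
    = shuffle_term p q M x y \<otimes>\<^bsub>grp (N (T_Delta X)) (p + q)\<^esub> shuffle_term p q M x' y"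
proof -
  let ?a = "degens X p (sorted_list_of_set ({..<p + q} - M))" and ?b = "degens X q (sorted_list_of_set M) y"
  have l: "?a x \<in> carrier (level X (p + q))" "?a x' \<in> carrier (level X (p + q))" "?b \<in> carrier (level X (p + q))"
    using shuffle_word_lists[OF assms(1,2,4)] shuffle_word_lists[OF assms(1,3,4)] by (auto simp: shuffle_word_def)
  have w: "shuffle_word p q M (x \<otimes>\<^bsub>level X p\<^esub> x') y = [?a x \<otimes>\<^bsub>level X (p + q)\<^esub> ?a x', ?b]"
    using degens_mult[OF shuffle_admissible(1)[OF assms(1)] assms(2,3)] shuffle_admissible(2)[OF assms(1)]
    by (simp add: shuffle_word_def)
  have "tensor_cls (level X (p + q)) (frag_of [?a x \<otimes>\<^bsub>level X (p + q)\<^esub> ?a x', ?b])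
    = tensor_cls (level X (p + q)) (frag_of [?a x, ?b]) \<otimes>\<^bsub>tensor (level X (p + q))\<^esub> tensor_cls (level X (p + q)) (frag_of [?a x', ?b])"
    using L.tensor_cls_multilinear[where us = "[]" and vs = "[?b]" and x = "?a x" and y = "?a x'"] l by simp
  then show ?thesis
    unfolding shuffle_term_def w
    using hom_mult[OF N_tensor_cls_hom L.tensor_word_closed L.tensor_word_closed, of "[?a x, ?b]" "p + q" "[?a x', ?b]"] l
    by (simp add: shuffle_word_def)
qed

lemma shuffle_term_mult_right:
  assumes "M \<in> shuffle_sets p q" "x \<in> carrier (level X p)" "y \<in> carrier (level X q)" "y' \<in> carrier (level X q)"
  shows "shuffle_term p q M x (y \<otimes>\<^bsub>level X q\<^esub> y')
    = shuffle_term p q M x y \<otimes>\<^bsub>grp (N (T_Delta X)) (p + q)\<^esub> shuffle_term p q M x y'"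
proof -
  let ?a = "degens X p (sorted_list_of_set ({..<p + q} - M)) x" and ?b = "degens X q (sorted_list_of_set M)"
  have l: "?a \<in> carrier (level X (p + q))" "?b y \<in> carrier (level X (p + q))" "?b y' \<in> carrier (level X (p + q))"
    using shuffle_word_lists[OF assms(1,2,3)] shuffle_word_lists[OF assms(1,2,4)] by (auto simp: shuffle_word_def)
  have w: "shuffle_word p q M x (y \<otimes>\<^bsub>level X q\<^esub> y') = [?a, ?b y \<otimes>\<^bsub>level X (p + q)\<^esub> ?b y']"
    using degens_mult[OF shuffle_admissible(4)[OF assms(1)] assms(3,4)] shuffle_admissible(5)[OF assms(1)]
    by (simp add: shuffle_word_def add.commute)
  have "tensor_cls (level X (p + q)) (frag_of [?a, ?b y \<otimes>\<^bsub>level X (p + q)\<^esub> ?b y'])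
    = tensor_cls (level X (p + q)) (frag_of [?a, ?b y]) \<otimes>\<^bsub>tensor (level X (p + q))\<^esub> tensor_cls (level X (p + q)) (frag_of [?a, ?b y'])"
    using L.tensor_cls_multilinear[where us = "[?a]" and vs = "[]" and x = "?b y" and y = "?b y'"] l by simp
  then show ?thesis
    unfolding shuffle_term_def w
    using hom_mult[OF N_tensor_cls_hom L.tensor_word_closed L.tensor_word_closed, of "[?a, ?b y]" "p + q" "[?a, ?b y']"] l
    by (simp add: shuffle_word_def)
qed

lemma N_word_degen:
  assumes "m < k" "a \<in> carrier (level X (k - 1))" "b \<in> carrier (level X (k - 1))"
  shows "N_cls (T_Delta X) k (tensor_cls (level X k) (frag_of [degen X (k - 1) m a, degen X (k - 1) m b])) = \<one>\<^bsub>grp (N (T_Delta X)) k\<^esub>"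
proof -
  have k: "Suc (k - 1) = k" using assms by simp
  have ab: "[a, b] \<in> lists (carrier (level X (k - 1)))" using assms by simp
  have "degen (T_Delta X) (k - 1) m (tensor_cls (level X (k - 1)) (frag_of [a, b]))
      = tensor_cls (level X k) (frag_of [degen X (k - 1) m a, degen X (k - 1) m b])"
    using tensor_map_word[OF level_comm_group level_comm_group degen_hom'[OF assms(1)] ab] by (simp add: k)
  moreover have "tensor_cls (level X (k - 1)) (frag_of [a, b]) \<in> carrier (level (T_Delta X) (k - 1))"
    using L.tensor_word_closed[OF ab] by simp
  ultimately show ?thesis using TD.N_cls_degen[OF assms(1)] by metis
qed

text \<open>
  If \<open>x\<close> is degenerate, then \<open>x\<close> degenerated along the complement of \<open>M\<close> is degenerate in some
  further direction \<open>m\<close>, which must lie in \<open>M\<close>; and \<open>y\<close> is degenerated along all of \<open>M\<close>. So each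
  single term of the shuffle product is degenerate, in the direction \<open>m\<close>.
\<close>

lemma shuffle_term_degen_left:
  assumes M: "M \<in> shuffle_sets p q" and j: "j < p" and x: "x \<in> carrier (level X (p - 1))" and y: "y \<in> carrier (level X q)"
  shows "shuffle_term p q M (degen X (p - 1) j x) y = \<one>\<^bsub>grp (N (T_Delta X)) (p + q)\<^esub>"
proof -
  let ?k = "p + q"
  have p: "Suc (p - 1) = p" "p - 1 + q = ?k - 1" "j \<le> p - 1" using j by auto
  obtain m a where m: "m \<notin> {..<?k} - M" "m \<le> ?k - 1" and a: "a \<in> carrier (level X (?k - 1))"
    and ea: "degens X p (sorted_list_of_set ({..<p + q} - M)) (degen X (p - 1) j x) = degen X (?k - 1) m a"
    using degens_degen_in_image[of "p - 1" "sorted_list_of_set ({..<p + q} - M)", unfolded p shuffle_admissible(2,3)[OF M],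
        OF shuffle_admissible(1)[OF M] x p(3)]
    by blast
  have mM: "m \<in> M" "m < ?k" using m j by auto
  obtain b where b: "b \<in> carrier (level X (?k - 1))" "degens X q (sorted_list_of_set M) y = degen X (?k - 1) m b"
    using degens_in_degen_image[OF shuffle_admissible(4)[OF M] y, of m] shuffle_admissible(5,6)[OF M] mM
    by (auto simp: add.commute)
  show ?thesis
    unfolding shuffle_term_def shuffle_word_def ea b(2) by (rule N_word_degen[OF mM(2) a b(1)])
qed

lemma shuffle_term_degen_right:
  assumes M: "M \<in> shuffle_sets p q" and j: "j < q" and x: "x \<in> carrier (level X p)" and y: "y \<in> carrier (level X (q - 1))"
  shows "shuffle_term p q M x (degen X (q - 1) j y) = \<one>\<^bsub>grp (N (T_Delta X)) (p + q)\<^esub>"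
proof -
  let ?k = "p + q"
  have q: "Suc (q - 1) = q" "q - 1 + p = ?k - 1" "j \<le> q - 1" using j by auto
  obtain m b where m: "m \<notin> M" "m \<le> ?k - 1" and b: "b \<in> carrier (level X (?k - 1))"
    and eb: "degens X q (sorted_list_of_set M) (degen X (q - 1) j y) = degen X (?k - 1) m b"
    using degens_degen_in_image[of "q - 1" "sorted_list_of_set M", unfolded q shuffle_admissible(5,6)[OF M],
        OF shuffle_admissible(4)[OF M] y q(3)]
    by blast
  have mM: "m \<in> {..<?k} - M" "m < ?k" using m j by auto
  obtain a where a: "a \<in> carrier (level X (?k - 1))" "degens X p (sorted_list_of_set ({..<?k} - M)) x = degen X (?k - 1) m a"
    using degens_in_degen_image[OF shuffle_admissible(1)[OF M] x, of m] shuffle_admissible(2,3)[OF M] mM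
    by auto
  show ?thesis
    unfolding shuffle_term_def shuffle_word_def eb a(2) by (rule N_word_degen[OF mM(2) a(1) b])
qed

lemma shuffle_prod_left_hom:
  assumes y: "y \<in> carrier (level X q)"
  shows "(\<lambda>x. shuffle_prod p q x y) \<in> hom (level X p) (grp (N (T_Delta X)) (p + q))"
proof (rule homI)
  let ?G = "grp (N (T_Delta X)) (p + q)"
  interpret G: comm_group ?G by (rule TD.N_comm_group)
  show "shuffle_prod p q x y \<in> carrier ?G" if "x \<in> carrier (level X p)" for x
    by (rule shuffle_prod_closed[OF that y])
  fix x x' assume x: "x \<in> carrier (level X p)" "x' \<in> carrier (level X p)"
  have xx: "x \<otimes>\<^bsub>level X p\<^esub> x' \<in> carrier (level X p)"
    using x level_group[of p] by (simp add: group.is_monoid monoid.m_closed)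
  have "shuffle_prod p q (x \<otimes>\<^bsub>level X p\<^esub> x') y = finprod ?G (\<lambda>M.
      shuffle_term p q M x y [^]\<^bsub>?G\<^esub> shuffle_sign (p + q) M \<otimes>\<^bsub>?G\<^esub>
      shuffle_term p q M x' y [^]\<^bsub>?G\<^esub> shuffle_sign (p + q) M) (shuffle_sets p q)"
    unfolding shuffle_prod_finprod[OF xx y]
    by (rule G.finprod_cong') (use shuffle_term_closed x y in \<open>auto simp: shuffle_term_mult_left G.int_pow_distrib\<close>)
  also have "\<dots> = shuffle_prod p q x y \<otimes>\<^bsub>?G\<^esub> shuffle_prod p q x' y"
    unfolding shuffle_prod_finprod[OF x(1) y] shuffle_prod_finprod[OF x(2) y]
    by (rule G.finprod_multf) (use shuffle_term_closed x y in auto)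
  finally show "shuffle_prod p q (x \<otimes>\<^bsub>level X p\<^esub> x') y = shuffle_prod p q x y \<otimes>\<^bsub>?G\<^esub> shuffle_prod p q x' y" .
qed

lemma shuffle_prod_right_hom:
  assumes x: "x \<in> carrier (level X p)"
  shows "shuffle_prod p q x \<in> hom (level X q) (grp (N (T_Delta X)) (p + q))"
proof (rule homI)
  let ?G = "grp (N (T_Delta X)) (p + q)"
  interpret G: comm_group ?G by (rule TD.N_comm_group)
  show "shuffle_prod p q x y \<in> carrier ?G" if "y \<in> carrier (level X q)" for y
    by (rule shuffle_prod_closed[OF x that])
  fix y y' assume y: "y \<in> carrier (level X q)" "y' \<in> carrier (level X q)"
  have yy: "y \<otimes>\<^bsub>level X q\<^esub> y' \<in> carrier (level X q)"
    using y level_group[of q] by (simp add: group.is_monoid monoid.m_closed)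
  have "shuffle_prod p q x (y \<otimes>\<^bsub>level X q\<^esub> y') = finprod ?G (\<lambda>M.
      shuffle_term p q M x y [^]\<^bsub>?G\<^esub> shuffle_sign (p + q) M \<otimes>\<^bsub>?G\<^esub>
      shuffle_term p q M x y' [^]\<^bsub>?G\<^esub> shuffle_sign (p + q) M) (shuffle_sets p q)"
    unfolding shuffle_prod_finprod[OF x yy]
    by (rule G.finprod_cong') (use shuffle_term_closed x y in \<open>auto simp: shuffle_term_mult_right G.int_pow_distrib\<close>)
  also have "\<dots> = shuffle_prod p q x y \<otimes>\<^bsub>?G\<^esub> shuffle_prod p q x y'"
    unfolding shuffle_prod_finprod[OF x y(1)] shuffle_prod_finprod[OF x y(2)]
    by (rule G.finprod_multf) (use shuffle_term_closed x y in auto)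
  finally show "shuffle_prod p q x (y \<otimes>\<^bsub>level X q\<^esub> y') = shuffle_prod p q x y \<otimes>\<^bsub>?G\<^esub> shuffle_prod p q x y'" .
qed

lemma shuffle_prod_degen:
  shows "\<lbrakk>j < p; x \<in> carrier (level X (p - 1)); y \<in> carrier (level X q)\<rbrakk> \<Longrightarrow>
      shuffle_prod p q (degen X (p - 1) j x) y = \<one>\<^bsub>grp (N (T_Delta X)) (p + q)\<^esub>"
    and "\<lbrakk>j < q; x \<in> carrier (level X p); y \<in> carrier (level X (q - 1))\<rbrakk> \<Longrightarrow>
      shuffle_prod p q x (degen X (q - 1) j y) = \<one>\<^bsub>grp (N (T_Delta X)) (p + q)\<^esub>"
proof -
  let ?G = "grp (N (T_Delta X)) (p + q)"
  interpret G: comm_group ?G by (rule TD.N_comm_group)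
  show "shuffle_prod p q (degen X (p - 1) j x) y = \<one>\<^bsub>?G\<^esub>"
    if "j < p" "x \<in> carrier (level X (p - 1))" "y \<in> carrier (level X q)"
    unfolding shuffle_prod_finprod[OF degen_closed'[OF that(1,2)] that(3)]
    by (rule G.finprod_one_eqI) (simp only: shuffle_term_degen_left[OF _ that] G.int_pow_one)
  show "shuffle_prod p q x (degen X (q - 1) j y) = \<one>\<^bsub>?G\<^esub>"
    if "j < q" "x \<in> carrier (level X p)" "y \<in> carrier (level X (q - 1))"
    unfolding shuffle_prod_finprod[OF that(2) degen_closed'[OF that(1,3)]]
    by (rule G.finprod_one_eqI) (simp only: shuffle_term_degen_right[OF _ that] G.int_pow_one)
qed

lemma nabla_cls:
  assumes x: "x \<in> carrier (level X p)" and y: "y \<in> carrier (level X q)"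
  shows "nabla X p q (N_cls X p x) (N_cls X q y) = shuffle_prod p q x y"
proof -
  have "induced2 (shuffle_prod p q) (N_cls X p x) (N_cls X q y) = shuffle_prod p q x y"
    unfolding N_cls_def
  proof (rule induced2_cls[OF level_comm_group degenerate_subgroup level_comm_group degenerate_subgroup
        TD.N_group[of "p + q"] shuffle_prod_left_hom shuffle_prod_right_hom _ _ x y])
    show "shuffle_prod p q x y = \<one>\<^bsub>grp (N (T_Delta X)) (p + q)\<^esub>" if "x \<in> degenerate X p" "y \<in> carrier (level X q)" for x y
      by (rule degenerate_hom_one[OF TD.N_group shuffle_prod_left_hom[OF that(2)] shuffle_prod_degen(1)[OF _ _ that(2)] that(1)])
    show "shuffle_prod p q x y = \<one>\<^bsub>grp (N (T_Delta X)) (p + q)\<^esub>" if "x \<in> carrier (level X p)" "y \<in> degenerate X q" for x y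
      by (rule degenerate_hom_one[OF TD.N_group shuffle_prod_right_hom[OF that(1)] shuffle_prod_degen(2)[OF _ that(1)] that(2)])
  qed
  then show ?thesis unfolding nabla_def shuffle_prod_def[symmetric] .
qed

subsection \<open>Alexander--Whitney after shuffle is the identity\<close>

lemma last_faces_degens: "x \<in> carrier (level X p) \<Longrightarrow> last_faces X (p + q) q (degens X p [p..<p + q] x) = x"
proof (induction q)
  case (Suc q)
  let ?z = "degens X p [p..<p + q] x"
  have z: "?z \<in> carrier (level X (p + q))"
    using degens_closed[of p "[p..<p + q]" x] Suc.prems by (auto simp: admissible_def atLeastLessThan_def)
  have s: "degen X (p + q) (p + q) ?z \<in> carrier (level X (Suc (p + q)))" using z by (intro degen_closed) auto
  have "last_faces X (p + Suc q) (Suc q) (degens X p [p..<p + Suc q] x)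
      = last_faces X (Suc (p + q)) (Suc q) (degen X (p + q) (p + q) ?z)"
    using degens_snoc[of X p "[p..<p + q]" "p + q" x] by simp
  also have "\<dots> = last_faces X (p + q) q (face X (Suc (p + q)) (Suc (p + q)) (degen X (p + q) (p + q) ?z))"
    using last_faces_face[OF s, of q "Suc (p + q)"] by simp
  also have "\<dots> = last_faces X (p + q) q ?z"
    using face_degen[of "p + q" "p + q" "Suc (p + q)" ?z] z by simp
  finally show ?case using Suc by simp
qed simp

lemma first_faces_degens: "y \<in> carrier (level X q) \<Longrightarrow> first_faces X (p + q) p (degens X q [0..<p] y) = y"
proof (induction p)
  case (Suc p)
  let ?z = "degens X q [0..<p] y"
  have z: "?z \<in> carrier (level X (p + q))"
    using degens_closed[of q "[0..<p]" y] Suc.prems by (auto simp: admissible_def add.commute atLeastLessThan_def)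
  have "first_faces X (Suc p + q) (Suc p) (degens X q [0..<Suc p] y)
      = face X (Suc q) 0 (first_faces X (Suc (p + q)) p (degen X (p + q) p ?z))"
    using degens_snoc[of X q "[0..<p]" p y] by (simp add: add.commute)
  also have "first_faces X (Suc (p + q)) p (degen X (p + q) p ?z) = degen X q 0 (first_faces X (p + q) p ?z)"
    using first_faces_degen[of ?z "Suc (p + q)" p p] z by simp
  also have "face X (Suc q) 0 \<dots> = y"
    using Suc face_degen[of 0 q 0 y] by simp
  finally show ?case .
qed simp

text \<open>
  In the \<open>i\<close>-th term of \<open>AW\<close> the front face of \<open>a\<close> is nondegenerate only if no degeneracy of \<open>a\<close>
  has an index below \<open>p + q - i\<close>, and the back face of \<open>b\<close> only if none of \<open>b\<close> has an index of
  \<open>p + q - i\<close> or more. As these indices together exhaust \<open>{..<p + q}\<close>, a single shuffle and a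
  single \<open>i\<close> remain.
\<close>

lemma shuffle_aw_term_trel:
  assumes M: "M \<in> shuffle_sets p q" and x: "x \<in> carrier (level X p)" and y: "y \<in> carrier (level X q)" and i: "i \<le> p + q"
    and a: "a = degens X p (sorted_list_of_set ({..<p + q} - M)) x" and b: "b = degens X q (sorted_list_of_set M) y"
    and ne: "\<not> (M = {..<p} \<and> i = q)"
  shows "frag_of [(p + q - i, N_cls X (p + q - i) (last_faces X (p + q) i a)),
    (i, N_cls X i (first_faces X (p + q) (p + q - i) b))] \<in> trel (N X)"
proof -
  let ?k = "p + q"
  have ab: "a \<in> carrier (level X ?k)" "b \<in> carrier (level X ?k)"
    using shuffle_word_lists[OF M x y] by (auto simp: shuffle_word_def a b)
  have la: "N_cls X (?k - i) (last_faces X ?k i a) \<in> carrier (grp (N X) (?k - i))"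
    using ab i by (intro N_cls_closed last_faces_closed)
  have fb: "N_cls X i (first_faces X ?k (?k - i) b) \<in> carrier (grp (N X) i)"
    using ab i first_faces_closed[of "?k - i" ?k b] by (intro N_cls_closed) simp
  consider n where "n \<in> {..<?k} - M" "n < ?k - i" | m where "m \<in> M" "?k - i \<le> m"
  proof (cases "\<exists>n\<in>{..<?k} - M. n < ?k - i")
    case False
    have "\<exists>m\<in>M. ?k - i \<le> m"
    proof (rule ccontr)
      assume "\<not> (\<exists>m\<in>M. ?k - i \<le> m)"
      then have "M = {..<?k - i}" using False M by (fastforce simp: shuffle_sets_def)
      then show False using M ne i by (auto simp: shuffle_sets_def)
    qed
    then show ?thesis using that by blast
  qed (use that in blast)
  then show ?thesis
  proof cases
    case (1 n)
    obtain z where z: "z \<in> carrier (level X (?k - 1))" "a = degen X (?k - 1) n z"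
      using degens_in_degen_image[OF shuffle_admissible(1)[OF M] x, of n] shuffle_admissible(2,3)[OF M] 1 a by auto
    have e: "?k - 1 - i = ?k - i - 1" by simp
    have "last_faces X ?k i a = degen X (?k - i - 1) n (last_faces X (?k - 1) i z)"
      using last_faces_degen[OF z(1) 1(2)] unfolding z(2) e .
    moreover have "last_faces X (?k - 1) i z \<in> carrier (level X (?k - i - 1))"
      using last_faces_closed[OF _ z(1), of i] 1 unfolding e by simp
    ultimately have "N_cls X (?k - i) (last_faces X ?k i a) = \<one>\<^bsub>grp (N X) (?k - i)\<^esub>"
      using N_cls_degen[OF 1(2)] by simp
    then show ?thesis
      using NX.one_in_trel[of "[]" "[(i, N_cls X i (first_faces X ?k (?k - i) b))]"] fb by simp
  next
    case (2 m)
    have mk: "m < ?k" using 2 M by (auto simp: shuffle_sets_def)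
    obtain z where z: "z \<in> carrier (level X (?k - 1))" "b = degen X (?k - 1) m z"
      using degens_in_degen_image[OF shuffle_admissible(4)[OF M] y, of m] shuffle_admissible(5,6)[OF M] 2 b
      by (auto simp: add.commute)
    have e: "?k - 1 - (?k - i) = i - 1" and mi: "m - (?k - i) < i" using i 2 mk by auto
    have "first_faces X ?k (?k - i) b = degen X (i - 1) (m - (?k - i)) (first_faces X (?k - 1) (?k - i) z)"
      using first_faces_degen[OF z(1) 2(2) mk] unfolding z(2) e .
    moreover have "first_faces X (?k - 1) (?k - i) z \<in> carrier (level X (i - 1))"
      using first_faces_closed[OF _ z(1), of "?k - i"] 2 mk unfolding e by simp
    ultimately have "N_cls X i (first_faces X ?k (?k - i) b) = \<one>\<^bsub>grp (N X) i\<^esub>"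
      using N_cls_degen[OF mi] by simp
    then show ?thesis
      using NX.one_in_trel[of "[(?k - i, N_cls X (?k - i) (last_faces X ?k i a))]" "[]"] la by simp
  qed
qed

lemma AW_shuffle_word:
  assumes M: "M \<in> shuffle_sets p q" and x: "x \<in> carrier (level X p)" and y: "y \<in> carrier (level X q)"
  shows "aw_word X (p + q) (shuffle_word p q M x y)
    - (if M = {..<p} then frag_of [(p, N_cls X p x), (q, N_cls X q y)] else 0) \<in> trel (N X)"
proof -
  let ?k = "p + q"
  define a b where "a = degens X p (sorted_list_of_set ({..<p + q} - M)) x" and "b = degens X q (sorted_list_of_set M) y"
  let ?t = "\<lambda>i. frag_of [(?k - i, N_cls X (?k - i) (last_faces X ?k i a)), (i, N_cls X i (first_faces X ?k (?k - i) b))]"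
  have w: "aw_word X ?k (shuffle_word p q M x y) = (\<Sum>i\<le>?k. ?t i)"
    unfolding shuffle_word_def aw_word_pair a_def b_def ..
  have tr: "?t i \<in> trel (N X)" if "i \<le> ?k" "\<not> (M = {..<p} \<and> i = q)" for i
    by (rule shuffle_aw_term_trel[OF M x y that(1) a_def b_def that(2)])
  show ?thesis
  proof (cases "M = {..<p}")
    case True
    have "{..<p + q} - M = {p..<p + q}" using True by auto
    then have "sorted_list_of_set ({..<p + q} - M) = [p..<p + q]" "sorted_list_of_set M = [0..<p]"
      using True sorted_list_of_set_range[of 0 p] by (simp_all add: atLeast0LessThan)
    then have tq: "?t q = frag_of [(p, N_cls X p x), (q, N_cls X q y)]"
      using last_faces_degens[OF x, of q] first_faces_degens[OF y, of p] by (simp add: a_def b_def)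
    have "(\<Sum>i\<le>?k. ?t i) = ?t q + (\<Sum>i\<in>{..?k} - {q}. ?t i)"
      by (rule sum.remove) auto
    then have "aw_word X ?k (shuffle_word p q M x y) - frag_of [(p, N_cls X p x), (q, N_cls X q y)] = (\<Sum>i\<in>{..?k} - {q}. ?t i)"
      unfolding w tq by simp
    moreover have "(\<Sum>i\<in>{..?k} - {q}. ?t i) \<in> trel (N X)" by (rule trel_sum) (use tr in auto)
    ultimately show ?thesis using True by simp
  next
    case False
    then show ?thesis unfolding w using tr by (auto intro!: trel_sum)
  qed
qed

lemma AW_shuffle_prod:
  assumes x: "x \<in> carrier (level X p)" and y: "y \<in> carrier (level X q)"
  shows "AW X (p + q) (shuffle_prod p q x y) = gtensor_cls (N X) (p + q) (frag_of [(p, N_cls X p x), (q, N_cls X q y)])"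
proof -
  let ?k = "p + q" and ?c = "shuffle_sum X p q x y" and ?r = "frag_of [(p, N_cls X p x), (q, N_cls X q y)]"
  have c: "Poly_Mapping.keys ?c \<subseteq> lists (carrier (level X ?k))" by (rule shuffle_sum_lists[OF x y])
  have "{(m, l). m \<in> {..<p} \<and> l \<in> {..<?k} - {..<p} \<and> l < m} = {}" by auto
  then have sgn: "shuffle_sign ?k {..<p} = 1" unfolding shuffle_sign_def by (simp only: card.empty power_0)
  have M0: "{..<p} \<in> shuffle_sets p q" by (auto simp: shuffle_sets_def)
  have "?r = (\<Sum>M\<in>shuffle_sets p q. if M = {..<p} then ?r else 0)"
    using M0 finite_shuffle_sets by (subst sum.delta) auto
  also have "\<dots> = (\<Sum>M\<in>shuffle_sets p q. frag_cmul (shuffle_sign ?k M) (if M = {..<p} then ?r else 0))"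
    by (rule sum.cong) (auto simp: sgn)
  finally have r: "?r = (\<Sum>M\<in>shuffle_sets p q. frag_cmul (shuffle_sign ?k M) (if M = {..<p} then ?r else 0))" .
  have "frag_extend (aw_word X ?k) ?c - ?r
      = (\<Sum>M\<in>shuffle_sets p q. frag_cmul (shuffle_sign ?k M) (aw_word X ?k (shuffle_word p q M x y) - (if M = {..<p} then ?r else 0)))"
    by (subst r) (simp add: shuffle_sum_eq frag_extend_sum[OF finite_shuffle_sets] frag_extend_cmul comp_def frag_cmul_diff2 sum_subtractf)
  also have "\<dots> \<in> trel (N X)"
    by (intro trel_sum trel_cmul AW_shuffle_word x y)
  finally have d: "frag_extend (aw_word X ?k) ?c - ?r \<in> trel (N X)" .
  have "AW X ?k (shuffle_prod p q x y) = gtensor_cls (N X) ?k (frag_extend (aw_word X ?k) ?c)"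
    unfolding shuffle_prod_def by (simp only: AW_N_cls[OF L.tensor_cls_closed[OF c]] aw_tensor_cls[OF c])
  also have "\<dots> = gtensor_cls (N X) ?k ?r"
  proof (rule NX.gtensor_cls_eqI[OF d])
    show "Poly_Mapping.keys (frag_extend (aw_word X ?k) ?c) \<subseteq> gwords (N X) ?k"
      using c aw_word_gwords by (intro keys_frag_extend_subset) blast
    show "Poly_Mapping.keys ?r \<subseteq> gwords (N X) ?k"
      using N_cls_closed x y by (simp add: gwords_iff)
  qed
  finally show ?thesis .
qed

end

section \<open>The co-equalizer and the quotient of the normalized complex\<close>

lemma additive_simps [simp]:
  "level (additive X) n = add_monoid (level X n)" "face (additive X) = face X" "degen (additive X) = degen X"
  by (simp_all add: additive_def)

lemma (in ring) foldr_mult_closed: "w \<in> lists (carrier R) \<Longrightarrow> foldr (\<otimes>) w \<one> \<in> carrier R"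
  by (induction w) auto

lemma (in ring) foldr_mult_multilinear:
  assumes "us \<in> lists (carrier R)" "x \<in> carrier R" "y \<in> carrier R" "vs \<in> lists (carrier R)"
  shows "foldr (\<otimes>) (us @ (x \<oplus> y) # vs) \<one> = foldr (\<otimes>) (us @ x # vs) \<one> \<oplus> foldr (\<otimes>) (us @ y # vs) \<one>"
  using assms(1)
proof (induction us rule: list.induct)
  case Nil
  then show ?case using assms foldr_mult_closed by (simp add: l_distr)
next
  case (Cons a us)
  have "foldr (\<otimes>) (us @ x # vs) \<one> \<in> carrier R" "foldr (\<otimes>) (us @ y # vs) \<one> \<in> carrier R"
    using Cons.prems assms by (auto intro!: foldr_mult_closed simp del: foldr_append)
  then show ?case using Cons by (simp add: r_distr del: foldr_append)
qed

lemma ring_hom_foldr_mult: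
  assumes R: "ring R" and h: "h \<in> ring_hom R S" and w: "w \<in> lists (carrier R)"
  shows "foldr (\<otimes>\<^bsub>S\<^esub>) (map h w) \<one>\<^bsub>S\<^esub> = h (foldr (\<otimes>\<^bsub>R\<^esub>) w \<one>\<^bsub>R\<^esub>)"
  using w
proof (induction w rule: list.induct)
  case Nil
  then show ?case using h by (simp add: ring_hom_one)
next
  case (Cons x w)
  then show ?case using ring.foldr_mult_closed[OF R, of w] by (simp add: ring_hom_mult[OF h])
qed

lemma ring_hom_add_hom: "h \<in> ring_hom R S \<Longrightarrow> h \<in> hom (add_monoid R) (add_monoid S)"
  by (auto simp: ring_hom_def hom_def)

context simplicial_ring
begin

abbreviation A where "A \<equiv> additive X"

sublocale A: simplicial_ab_group "additive X" by (rule additive_simplicial)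

lemma T_Delta_prod_lift:
  shows T_Delta_prod_hom: "T_Delta_prod X n \<in> hom (tensor (level A n)) (level A n)"
    and T_Delta_prod_word: "w \<in> lists (carrier (level X n)) \<Longrightarrow>
      T_Delta_prod X n (tensor_cls (level A n) (frag_of w)) = foldr (\<otimes>\<^bsub>level X n\<^esub>) w \<one>\<^bsub>level X n\<^esub>"
proof -
  interpret R: ring "level X n" by (rule level_ring)
  let ?f = "\<lambda>w. foldr (\<otimes>\<^bsub>level X n\<^esub>) w \<one>\<^bsub>level X n\<^esub>"
  have K: "comm_group (level A n)" by (rule A.level_comm_group)
  have c: "?f w \<in> carrier (level A n)" if "w \<in> lists (carrier (level A n))" for w
    using R.foldr_mult_closed that by simp
  have ml: "?f (us @ (x \<otimes>\<^bsub>level A n\<^esub> y) # vs) = ?f (us @ x # vs) \<otimes>\<^bsub>level A n\<^esub> ?f (us @ y # vs)"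
    if "us \<in> lists (carrier (level A n))" "x \<in> carrier (level A n)" "y \<in> carrier (level A n)" "vs \<in> lists (carrier (level A n))" for us x y vs
    using R.foldr_mult_multilinear that by simp
  show "T_Delta_prod X n \<in> hom (tensor (level A n)) (level A n)"
    using A.L.tensor_lift_hom[OF K c ml] by (simp add: T_Delta_prod_def)
  show "w \<in> lists (carrier (level X n)) \<Longrightarrow> T_Delta_prod X n (tensor_cls (level A n) (frag_of w)) = ?f w"
    using A.L.tensor_lift_word[OF K c ml, of w] by (simp add: T_Delta_prod_def)
qed

lemma T_Delta_prod_natural:
  assumes B: "simplicial_ring Y" and h: "h \<in> ring_hom (level X m) (level Y n)" and t: "t \<in> carrier (tensor (level A m))"
  shows "T_Delta_prod Y n (tensor_map (level (additive Y) n) h t) = h (T_Delta_prod X m t)"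
proof -
  interpret Y: simplicial_ring Y by (rule B)
  have ha: "h \<in> hom (level A m) (level (additive Y) n)" using ring_hom_add_hom[OF h] by simp
  note mh = tensor_map_hom[OF A.level_comm_group Y.A.level_comm_group ha]
  have h1: "(\<lambda>t. T_Delta_prod Y n (tensor_map (level (additive Y) n) h t)) \<in> hom (tensor (level A m)) (level (additive Y) n)"
    using hom_compose[OF mh Y.T_Delta_prod_hom] by (simp add: comp_def)
  have h2: "(\<lambda>t. h (T_Delta_prod X m t)) \<in> hom (tensor (level A m)) (level (additive Y) n)"
    using hom_compose[OF T_Delta_prod_hom ha] by (simp add: comp_def)
  show ?thesis
  proof (rule A.L.tensor_hom_eqI[OF Y.A.level_group h1 h2 _ t])
    fix w assume w: "w \<in> lists (carrier (level A m))"
    have w': "w \<in> lists (carrier (level X m))" using w by simp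
    have hw: "map h w \<in> lists (carrier (level Y n))"
      using map_hom_lists[OF A.level_comm_group Y.A.level_comm_group ha w] by simp
    show "T_Delta_prod Y n (tensor_map (level (additive Y) n) h (tensor_cls (level A m) (frag_of w)))
        = h (T_Delta_prod X m (tensor_cls (level A m) (frag_of w)))"
      unfolding tensor_map_word[OF A.level_comm_group Y.A.level_comm_group ha w] Y.T_Delta_prod_word[OF hw]
        T_Delta_prod_word[OF w'] by (rule ring_hom_foldr_mult[OF level_ring h w'])
  qed
qed

lemma T_Delta_prod_simp_ab_hom: "simp_ab_hom (T_Delta A) A (T_Delta_prod X)"
  unfolding simp_ab_hom_def T_Delta_simps
proof (intro conjI allI ballI impI)
  show "T_Delta_prod X n \<in> hom (tensor (level A n)) (level A n)" for n by (rule T_Delta_prod_hom)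
  fix n i t assume t: "t \<in> carrier (tensor (level A n))"
  show "T_Delta_prod X (n - 1) (tensor_map (level A (n - 1)) (face A n i) t) = face A n i (T_Delta_prod X n t)"
    if "0 < n \<and> i \<le> n"
    using T_Delta_prod_natural[OF simplicial_ring_axioms face_ring_hom t] that by simp
  show "T_Delta_prod X (Suc n) (tensor_map (level A (Suc n)) (degen A n i) t) = degen A n i (T_Delta_prod X n t)"
    if "i \<le> n"
    using T_Delta_prod_natural[OF simplicial_ring_axioms degen_ring_hom t] that by simp
qed

lemma TA_simplicial: "simplicial_ab_group (T_Delta A)" by (rule A.T_Delta_simplicial)

lemma N_TA_complex: "cochain_complex (N (T_Delta A))"
  by (rule simplicial_ab_group.N_cochain_complex[OF TA_simplicial])

abbreviation gen where "gen \<equiv> T_dg_gen (N A)"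

abbreviation Tgen where "Tgen \<equiv> T_dg_gen (N (T_Delta A))"

abbreviation prod_map where "prod_map \<equiv> N_map A (T_Delta_prod X)"

lemma prod_map_cpx_hom: "cpx_hom (N (T_Delta A)) (N A) prod_map"
  by (rule N_map_cpx_hom[OF TA_simplicial additive_simplicial T_Delta_prod_simp_ab_hom])

lemma prod_map_cls: "t \<in> carrier (tensor (level A k)) \<Longrightarrow> prod_map k (N_cls (T_Delta A) k t) = N_cls A k (T_Delta_prod X k t)"
  using N_map_cls[OF TA_simplicial additive_simplicial T_Delta_prod_simp_ab_hom, of t k] by simp

lemma prod_map_closed: "u \<in> carrier (grp (N (T_Delta A)) k) \<Longrightarrow> prod_map k u \<in> carrier (grp (N A) k)"
  by (rule hom_in_carrier[OF N_map_hom[OF TA_simplicial additive_simplicial T_Delta_prod_simp_ab_hom]])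

lemma T_L_dg_ring: "dg_ring (T_L X)"
  unfolding T_L_def by (rule A.NX.T_dg_dg_ring)

lemma grp_T_L [simp]: "grp (T_L X) = gtensor (N A)"
  by (simp add: T_L_def)

lemma grp_T_L_T [simp]: "grp (T_L_T X) = gtensor (N (T_Delta A))"
  using graded_group.grp_T_dg[OF simplicial_ab_group.N_graded_group[OF TA_simplicial]] by (simp add: T_L_T_def)

lemma alpha_dg_hom: "dg_hom (T_L_T X) (T_L X) (alpha X)"
  unfolding T_L_T_def T_L_def alpha_def
  by (rule T_dg_map_dg_hom(1)[OF N_TA_complex A.N_cochain_complex prod_map_cpx_hom])

lemma alpha_gen: "u \<in> carrier (grp (N (T_Delta A)) k) \<Longrightarrow> alpha X k (Tgen k u) = gen k (prod_map k u)"
  unfolding alpha_def by (rule T_dg_map_dg_hom(2)[OF N_TA_complex A.N_cochain_complex prod_map_cpx_hom])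

lemma AW_lift: "cpx_to_dg (N (T_Delta A)) (T_L X) (AW A)"
  unfolding T_L_def cpx_to_dg_def cpx_to_dg_axioms_def
  using N_TA_complex A.NX.T_dg_dg_ring A.AW_cpx_hom by simp

lemma beta_dg_hom: "dg_hom (T_L_T X) (T_L X) (beta X)"
  unfolding T_L_T_def beta_def by (rule cpx_to_dg.T_dg_lift_dg_hom[OF AW_lift])

lemma beta_gen: "u \<in> carrier (grp (N (T_Delta A)) k) \<Longrightarrow> beta X k (Tgen k u) = AW A k u"
  unfolding beta_def by (rule cpx_to_dg.T_dg_lift_gen[OF AW_lift])

lemma Tgen_closed: "u \<in> carrier (grp (N (T_Delta A)) k) \<Longrightarrow> Tgen k u \<in> carrier (grp (T_L_T X) k)"
  using cochain_complex.T_dg_gen_closed[OF N_TA_complex] by simp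

lemma gen_closed: "v \<in> carrier (grp (N A) k) \<Longrightarrow> gen k v \<in> carrier (grp (T_L X) k)"
  using A.NX.T_dg_gen_closed by simp

lemma gen_hom: "gen k \<in> hom (grp (N A) k) (grp (T_L X) k)"
  using A.NX.T_dg_gen_cpx_hom by (simp add: cpx_hom_def)

subsection \<open>The common section\<close>

text \<open>The inclusion of \<open>X\<close> as the words of length one.\<close>

definition word1 :: "nat \<Rightarrow> 'a \<Rightarrow> ('a list \<Rightarrow>\<^sub>0 int) set" where
  "word1 n x = tensor_cls (level A n) (frag_of [x])"

lemma word1_simp_ab_hom: "simp_ab_hom A (T_Delta A) word1"
  unfolding simp_ab_hom_def T_Delta_simps
proof (intro conjI allI ballI impI)
  show "word1 n \<in> hom (level A n) (tensor (level A n))" for n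
  proof (rule homI)
    fix x y assume "x \<in> carrier (level A n)" "y \<in> carrier (level A n)"
    then show "word1 n (x \<otimes>\<^bsub>level A n\<^esub> y) = word1 n x \<otimes>\<^bsub>tensor (level A n)\<^esub> word1 n y"
      using A.L.tensor_cls_multilinear[where us = "[]" and vs = "[]" and x = x and y = y] by (simp add: word1_def)
  qed (use A.L.tensor_word_closed in \<open>simp add: word1_def\<close>)
  fix n i x assume x: "x \<in> carrier (level A n)"
  show "word1 (n - 1) (face A n i x) = tensor_map (level A (n - 1)) (face A n i) (word1 n x)" if "0 < n \<and> i \<le> n"
    using tensor_map_word[OF A.level_comm_group A.level_comm_group A.face_hom, of n i "[x]"] x that by (simp add: word1_def)
  show "word1 (Suc n) (degen A n i x) = tensor_map (level A (Suc n)) (degen A n i) (word1 n x)" if "i \<le> n"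
    using tensor_map_word[OF A.level_comm_group A.level_comm_group A.degen_hom, of i n "[x]"] x that by (simp add: word1_def)
qed

abbreviation section_map where "section_map \<equiv> T_dg_map (N (T_Delta A)) (N_map (T_Delta A) word1)"

lemma word1_cpx_hom: "cpx_hom (N A) (N (T_Delta A)) (N_map (T_Delta A) word1)"
  by (rule N_map_cpx_hom[OF additive_simplicial TA_simplicial word1_simp_ab_hom])

lemma section_dg_hom: "dg_hom (T_L X) (T_L_T X) section_map"
  unfolding T_L_T_def T_L_def by (rule T_dg_map_dg_hom(1)[OF A.N_cochain_complex N_TA_complex word1_cpx_hom])

lemma section_gen: "v \<in> carrier (grp (N A) k) \<Longrightarrow> section_map k (gen k v) = Tgen k (N_map (T_Delta A) word1 k v)"
  by (rule T_dg_map_dg_hom(2)[OF A.N_cochain_complex N_TA_complex word1_cpx_hom])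

lemma T_L_eqI:
  assumes "dg_hom (T_L X) B f" "dg_hom (T_L X) B g"
    and "\<And>k v. v \<in> carrier (grp (N A) k) \<Longrightarrow> f k (gen k v) = g k (gen k v)" and "t \<in> carrier (grp (T_L X) k)"
  shows "f k t = g k t"
  using A.NX.T_dg_dg_hom_eqI[of B f g t k] assms unfolding T_L_def by blast

lemma
  assumes t: "t \<in> carrier (grp (T_L X) k)"
  shows alpha_section: "alpha X k (section_map k t) = t" and beta_section: "beta X k (section_map k t) = t"
proof -
  have gens: "alpha X k (section_map k (gen k v)) = gen k v \<and> beta X k (section_map k (gen k v)) = gen k v"
    if v: "v \<in> carrier (grp (N A) k)" for k v
  proof -
    obtain x where x: "x \<in> carrier (level A k)" "v = N_cls A k x" by (rule A.N_cases[OF v])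
    interpret R: ring "level X k" by (rule level_ring)
    have Nv: "N_map (T_Delta A) word1 k v = N_cls (T_Delta A) k (word1 k x)"
      using N_map_cls[OF additive_simplicial TA_simplicial word1_simp_ab_hom x(1)] by (simp add: x(2))
    have c: "N_map (T_Delta A) word1 k v \<in> carrier (grp (N (T_Delta A)) k)"
      by (rule hom_in_carrier[OF N_map_hom[OF additive_simplicial TA_simplicial word1_simp_ab_hom] v])
    have w: "word1 k x \<in> carrier (tensor (level A k))"
      using A.L.tensor_word_closed[of "[x]" k] x(1) by (simp add: word1_def)
    have "prod_map k (N_map (T_Delta A) word1 k v) = v"
      using T_Delta_prod_word[of "[x]" k] x unfolding Nv prod_map_cls[OF w] by (simp add: word1_def)
    moreover have "AW A k (N_map (T_Delta A) word1 k v) = gen k v"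
      using A.AW_word[of "[x]" k] x unfolding Nv by (simp add: word1_def A.aw_word_single T_dg_gen_def)
    ultimately show ?thesis
      by (simp only: section_gen[OF v] alpha_gen[OF c] beta_gen[OF c])
  qed
  note id = dg_hom_id[OF T_L_dg_ring]
  show "alpha X k (section_map k t) = t"
    by (rule T_L_eqI[OF dg_hom_comp[OF section_dg_hom alpha_dg_hom] id _ t]) (use gens in blast)
  show "beta X k (section_map k t) = t"
    by (rule T_L_eqI[OF dg_hom_comp[OF section_dg_hom beta_dg_hom] id _ t]) (use gens in blast)
qed

subsection \<open>The ideal defining the co-equalizer\<close>

abbreviation I where "I \<equiv> L_mon_ideal X"

lemma I_ideal_dg: "dg_ideal (T_L X) I"
  unfolding L_mon_ideal_def by (rule dg_quot_coequalizer(1)[OF alpha_dg_hom beta_dg_hom])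

lemma L_mon_coequalizer:
  "dg_coequalizer TYPE('d) (T_L_T X) (T_L X) (alpha X) (beta X) (L_mon X) (dg_quot_cls (T_L X) I)"
  unfolding L_mon_def L_mon_ideal_def by (rule dg_quot_coequalizer(2)[OF alpha_dg_hom beta_dg_hom])

sublocale T_L: dg_ring "T_L X" by (rule T_L_dg_ring)

sublocale T_L_T: dg_ring "T_L_T X"
  unfolding T_L_T_def by (rule cochain_complex.T_dg_dg_ring[OF N_TA_complex])

sublocale Q: dg_ideal_quotient "T_L X" I by (rule dg_ring_ideal_quotient[OF T_L_dg_ring I_ideal_dg])

abbreviation \<pi> where "\<pi> \<equiv> dg_quot_cls (T_L X) I"

lemma L_mon_dg_ring: "dg_ring (L_mon X)" and \<pi>_dg_hom: "dg_hom (T_L X) (L_mon X) \<pi>"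
  unfolding L_mon_def
  by (rule dg_quot_dg_ring[OF T_L_dg_ring I_ideal_dg], rule dg_quot_cls_dg_hom[OF T_L_dg_ring I_ideal_dg])

lemma alpha_beta_diff:
  assumes "z \<in> carrier (grp (T_L_T X) k)"
  shows "alpha X k z \<otimes>\<^bsub>grp (T_L X) k\<^esub> inv\<^bsub>grp (T_L X) k\<^esub> beta X k z \<in> I k"
  unfolding L_mon_ideal_def by (rule subsetD[OF dg_ideal_generated_incl]) (use assms in blast)

lemma \<pi>_alpha_beta:
  assumes "z \<in> carrier (grp (T_L_T X) k)" shows "\<pi> k (alpha X k z) = \<pi> k (beta X k z)"
  using alpha_beta_diff[OF assms] Q.quot_cls_eq_iff[OF dg_hom_closed[OF alpha_dg_hom assms] dg_hom_closed[OF beta_dg_hom assms]]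
  by blast

text \<open>
  Because \<^const>\<open>alpha\<close> and \<^const>\<open>beta\<close> have a common section \<open>s\<close>, a difference
  \<open>alpha z - beta z\<close> is the value of \<^const>\<open>alpha\<close> at \<open>z - s (beta z)\<close>, an element of the kernel of
  \<^const>\<open>beta\<close>.
\<close>

lemma I_ideal_eq: "I_ideal X k = I k"
proof
  show "I_ideal X k \<subseteq> I k"
  proof
    fix t assume "t \<in> I_ideal X k"
    then obtain z where z: "z \<in> carrier (grp (T_L_T X) k)" "beta X k z = \<one>\<^bsub>grp (T_L X) k\<^esub>" "t = alpha X k z"
      by (auto simp: I_ideal_def K_ker_def kernel_def)
    interpret G: Group.group "grp (T_L X) k" by (rule T_L.grp_is_group)
    show "t \<in> I k"
      using alpha_beta_diff[OF z(1)] dg_hom_closed[OF alpha_dg_hom z(1)] by (simp only: z(2,3) G.inv_one G.r_one)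
  qed
  have ker: "K_ker X k = {z \<in> carrier (grp (T_L_T X) k). beta X k z \<in> {\<one>\<^bsub>grp (T_L X) k\<^esub>}}" for k
    by (auto simp: K_ker_def kernel_def)
  have K: "dg_ideal (T_L_T X) (K_ker X)"
    using dg_ideal_preimage[OF beta_dg_hom dg_ideal_zero[OF T_L_dg_ring]] ker by (simp add: dg_ideal_def)
  have Kc: "z \<in> carrier (grp (T_L_T X) k)" if "z \<in> K_ker X k" for z k using that ker by simp
  have gh: "group_hom (grp (T_L_T X) k) (grp (T_L X) k) (alpha X k)" for k
    by (simp add: group_hom_def group_hom_axioms_def T_L_T.grp_is_group T_L.grp_is_group dg_hom_hom[OF alpha_dg_hom] del: grp_T_L grp_T_L_T)
  have sc: "section_map k t \<in> carrier (grp (T_L_T X) k)" if "t \<in> carrier (grp (T_L X) k)" for t k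
    by (rule dg_hom_closed[OF section_dg_hom that])
  have "dg_ideal (T_L X) (I_ideal X)"
    unfolding dg_ideal_def
  proof (intro conjI allI ballI impI)
    show "subgroup (I_ideal X k) (grp (T_L X) k)" for k
      unfolding I_ideal_def by (rule group_hom.subgroup_img_is_subgroup[OF gh dg_ideal_subgroup[OF K]])
  next
    fix k :: nat and t assume k: "0 < k" and "t \<in> I_ideal X k"
    then obtain z where z: "z \<in> K_ker X k" "t = alpha X k z" by (auto simp: I_ideal_def)
    then show "bd (T_L X) k t \<in> I_ideal X (k - 1)"
      using dg_ideal_bd[OF K k z(1)] dg_hom_bd[OF alpha_dg_hom k Kc[OF z(1)]] by (metis I_ideal_def imageI)
  next
    fix i j s t assume s: "s \<in> carrier (grp (T_L X) i)" and "t \<in> I_ideal X j"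
    then obtain z where z: "z \<in> K_ker X j" "t = alpha X j z" by (auto simp: I_ideal_def)
    show "gmult (T_L X) i j s t \<in> I_ideal X (i + j)"
      using dg_ideal_left[OF K sc[OF s] z(1)] dg_hom_mult[OF alpha_dg_hom sc[OF s] Kc[OF z(1)]] alpha_section[OF s] z(2)
      by (metis I_ideal_def imageI)
  next
    fix i j s t assume "s \<in> I_ideal X i" and t: "t \<in> carrier (grp (T_L X) j)"
    then obtain z where z: "z \<in> K_ker X i" "s = alpha X i z" by (auto simp: I_ideal_def)
    show "gmult (T_L X) i j s t \<in> I_ideal X (i + j)"
      using dg_ideal_right[OF K z(1) sc[OF t]] dg_hom_mult[OF alpha_dg_hom Kc[OF z(1)] sc[OF t]] alpha_section[OF t] z(2)
      by (metis I_ideal_def imageI)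
  qed
  then show "I k \<subseteq> I_ideal X k"
    unfolding L_mon_ideal_def
  proof (rule dg_ideal_generated_le, safe)
    fix k z assume z: "z \<in> carrier (grp (T_L_T X) k)"
    interpret a: group_hom "grp (T_L_T X) k" "grp (T_L X) k" "alpha X k" by (rule gh)
    interpret b: group_hom "grp (T_L_T X) k" "grp (T_L X) k" "beta X k"
      by (simp add: group_hom_def group_hom_axioms_def T_L_T.grp_is_group T_L.grp_is_group dg_hom_hom[OF beta_dg_hom] del: grp_T_L grp_T_L_T)
    let ?s = "section_map k (beta X k z)"
    have bz: "beta X k z \<in> carrier (grp (T_L X) k)" by (rule dg_hom_closed[OF beta_dg_hom z])
    have s: "?s \<in> carrier (grp (T_L_T X) k)" by (rule sc[OF bz])
    have "z \<otimes>\<^bsub>grp (T_L_T X) k\<^esub> inv\<^bsub>grp (T_L_T X) k\<^esub> ?s \<in> K_ker X k"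
      unfolding ker using z s beta_section[OF bz] by (simp del: grp_T_L grp_T_L_T)
    moreover have "alpha X k (z \<otimes>\<^bsub>grp (T_L_T X) k\<^esub> inv\<^bsub>grp (T_L_T X) k\<^esub> ?s)
        = alpha X k z \<otimes>\<^bsub>grp (T_L X) k\<^esub> inv\<^bsub>grp (T_L X) k\<^esub> beta X k z"
      using z s alpha_section[OF bz] by (simp del: grp_T_L grp_T_L_T)
    ultimately show "alpha X k z \<otimes>\<^bsub>grp (T_L X) k\<^esub> inv\<^bsub>grp (T_L X) k\<^esub> beta X k z \<in> I_ideal X k"
      unfolding I_ideal_def by (metis imageI)
  qed
qed

subsection \<open>The shuffle product on the normalized complex\<close>

lemma L_simps:
  "grp (L X) = grp (N A)" "bd (L X) = bd (N A)" "gone (L X) = N_cls A 0 \<one>\<^bsub>level X 0\<^esub>"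
  by (simp_all add: L_def)

lemma L_mult_cls:
  "\<lbrakk>x \<in> carrier (level A p); y \<in> carrier (level A q)\<rbrakk> \<Longrightarrow>
    gmult (L X) p q (N_cls A p x) (N_cls A q y) = prod_map (p + q) (A.shuffle_prod p q x y)"
  by (simp add: L_def A.nabla_cls)

lemma one_closed_A: "\<one>\<^bsub>level X n\<^esub> \<in> carrier (level A n)"
  using ring.ring_simprules(6)[OF level_ring] by simp

lemma L_graded_mult: "graded_mult (L X)"
proof (intro graded_mult.intro graded_mult_axioms.intro graded_group.intro)
  show "comm_group (grp (L X) k)" for k unfolding L_simps by (rule A.N_comm_group)
  show "gone (L X) \<in> carrier (grp (L X) 0)"
    unfolding L_simps by (rule A.N_cls_closed[OF one_closed_A])
  fix u v i j assume u: "u \<in> carrier (grp (L X) i)" and v: "v \<in> carrier (grp (L X) j)"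
  obtain x where x: "x \<in> carrier (level A i)" "u = N_cls A i x" using A.N_cases u unfolding L_simps by metis
  obtain y where y: "y \<in> carrier (level A j)" "v = N_cls A j y" using A.N_cases v unfolding L_simps by metis
  note ph = N_map_hom[OF TA_simplicial additive_simplicial T_Delta_prod_simp_ab_hom]
  show "gmult (L X) i j u v \<in> carrier (grp (L X) (i + j))"
    unfolding x(2) y(2) L_mult_cls[OF x(1) y(1)] L_simps by (rule prod_map_closed[OF A.shuffle_prod_closed[OF x(1) y(1)]])
  { fix u' assume u': "u' \<in> carrier (grp (L X) i)"
    obtain x' where x': "x' \<in> carrier (level A i)" "u' = N_cls A i x'" using A.N_cases u' unfolding L_simps by metis
    have xx: "x \<otimes>\<^bsub>level A i\<^esub> x' \<in> carrier (level A i)"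
      using x x' A.level_group[of i] by (simp only: group.is_monoid monoid.m_closed)
    show "gmult (L X) i j (u \<otimes>\<^bsub>grp (L X) i\<^esub> u') v = gmult (L X) i j u v \<otimes>\<^bsub>grp (L X) (i + j)\<^esub> gmult (L X) i j u' v"
      unfolding L_simps x(2) x'(2) y(2) hom_mult[OF A.N_cls_hom x(1) x'(1), symmetric] L_mult_cls[OF xx y(1)]
        L_mult_cls[OF x(1) y(1)] L_mult_cls[OF x'(1) y(1)] hom_mult[OF A.shuffle_prod_left_hom[OF y(1)] x(1) x'(1)]
      by (rule hom_mult[OF ph A.shuffle_prod_closed[OF x(1) y(1)] A.shuffle_prod_closed[OF x'(1) y(1)]]) }
  { fix v' assume v': "v' \<in> carrier (grp (L X) j)"
    obtain y' where y': "y' \<in> carrier (level A j)" "v' = N_cls A j y'" using A.N_cases v' unfolding L_simps by metis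
    have yy: "y \<otimes>\<^bsub>level A j\<^esub> y' \<in> carrier (level A j)"
      using y y' A.level_group[of j] by (simp only: group.is_monoid monoid.m_closed)
    show "gmult (L X) i j u (v \<otimes>\<^bsub>grp (L X) j\<^esub> v') = gmult (L X) i j u v \<otimes>\<^bsub>grp (L X) (i + j)\<^esub> gmult (L X) i j u v'"
      unfolding L_simps x(2) y'(2) y(2) hom_mult[OF A.N_cls_hom y(1) y'(1), symmetric] L_mult_cls[OF x(1) yy]
        L_mult_cls[OF x(1) y(1)] L_mult_cls[OF x(1) y'(1)] hom_mult[OF A.shuffle_prod_right_hom[OF x(1)] y(1) y'(1)]
      by (rule hom_mult[OF ph A.shuffle_prod_closed[OF x(1) y(1)] A.shuffle_prod_closed[OF x(1) y'(1)]]) }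
qed

sublocale L: graded_mult "L X" by (rule L_graded_mult)

lemma degens_one: "degens X n js \<one>\<^bsub>level X n\<^esub> = \<one>\<^bsub>level X (n + length js)\<^esub>" if "admissible n js"
  using that
proof (induction js rule: rev_induct)
  case (snoc k js)
  then show ?case
    using admissible_snoc[OF snoc.prems] ring_hom_one[OF degen_ring_hom[of k "n + length js"]] by (simp add: degens_snoc)
qed simp

text \<open>
  The only shuffle of type \<open>(k, 0)\<close> leaves \<open>x\<close> as it is and degenerates the unit.
\<close>

lemma L_mult_one:
  assumes v: "v \<in> carrier (grp (N A) k)" shows "gmult (L X) k 0 v (gone (L X)) = v"
proof -
  obtain x where x: "x \<in> carrier (level A k)" "v = N_cls A k x" by (rule A.N_cases[OF v])
  interpret R: ring "level X k" by (rule level_ring)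
  have "M = {..<k}" if "M \<subseteq> {..<k}" "card M = k" for M :: "nat set"
    using that card_subset_eq[of "{..<k}" M] by simp
  then have S: "shuffle_sets k 0 = {{..<k}}" by (auto simp: shuffle_sets_def)
  have sl: "sorted_list_of_set {..<k} = [0..<k]"
    using sorted_list_of_set_range[of 0 k] by (simp add: atLeast0LessThan)
  have "shuffle_sign (k + 0) {..<k} = 1"
  proof -
    have "{(m, l). m \<in> {..<k} \<and> l \<in> {..<k + 0} - {..<k} \<and> l < m} = {}" by auto
    then show ?thesis unfolding shuffle_sign_def by (simp only: card.empty power_0)
  qed
  moreover have "degens A 0 [0..<k] \<one>\<^bsub>level X 0\<^esub> = \<one>\<^bsub>level X k\<^esub>"
  proof -
    have "degens A n js y = degens X n js y" for n js y
      by (induction js arbitrary: n y) auto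
    moreover have "admissible 0 [0..<k]" by (auto simp: admissible_def atLeastLessThan_def)
    ultimately show ?thesis using degens_one[of 0 "[0..<k]"] by simp
  qed
  ultimately have "shuffle_sum A k 0 x \<one>\<^bsub>level X 0\<^esub> = frag_of [x, \<one>\<^bsub>level X k\<^esub>]"
    unfolding A.shuffle_sum_eq S by (simp add: A.shuffle_word_def sl)
  then have sp: "A.shuffle_prod k 0 x \<one>\<^bsub>level X 0\<^esub> = N_cls (T_Delta A) k (tensor_cls (level A k) (frag_of [x, \<one>\<^bsub>level X k\<^esub>]))"
    by (simp add: A.shuffle_prod_def)
  have w: "[x, \<one>\<^bsub>level X k\<^esub>] \<in> lists (carrier (level A k))" using x one_closed_A by simp
  have "gmult (L X) k 0 v (gone (L X)) = prod_map (k + 0) (A.shuffle_prod k 0 x \<one>\<^bsub>level X 0\<^esub>)"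
    unfolding x(2) L_simps by (rule L_mult_cls[OF x(1) one_closed_A])
  also have "\<dots> = N_cls A k (T_Delta_prod X k (tensor_cls (level A k) (frag_of [x, \<one>\<^bsub>level X k\<^esub>])))"
    using prod_map_cls[OF A.L.tensor_word_closed[OF w]] unfolding sp by simp
  also have "\<dots> = v"
    using T_Delta_prod_word[of "[x, \<one>\<^bsub>level X k\<^esub>]" k] w x by simp
  finally show ?thesis .
qed

text \<open>
  Here \<open>AW \<circ> \<nabla> = id\<close> enters: at the generator \<open>\<nabla> (u \<otimes> v)\<close> the relation
  \<open>alpha = beta\<close> identifies the product of \<open>u\<close> and \<open>v\<close> in \<open>L X\<close> with their product as generators of
  the free monoid.
\<close>

lemma \<pi>_gen_mult:
  assumes u: "u \<in> carrier (grp (N A) p)" and v: "v \<in> carrier (grp (N A) q)"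
  shows "\<pi> (p + q) (gen (p + q) (gmult (L X) p q u v)) = \<pi> (p + q) (gmult (T_L X) p q (gen p u) (gen q v))"
proof -
  obtain x where x: "x \<in> carrier (level A p)" "u = N_cls A p x" by (rule A.N_cases[OF u])
  obtain y where y: "y \<in> carrier (level A q)" "v = N_cls A q y" by (rule A.N_cases[OF v])
  let ?z = "A.shuffle_prod p q x y"
  have z: "?z \<in> carrier (grp (N (T_Delta A)) (p + q))" by (rule A.shuffle_prod_closed[OF x(1) y(1)])
  have "\<pi> (p + q) (gen (p + q) (gmult (L X) p q u v)) = \<pi> (p + q) (alpha X (p + q) (Tgen (p + q) ?z))"
    by (simp only: alpha_gen[OF z] x(2) y(2) L_mult_cls[OF x(1) y(1)])
  also have "\<dots> = \<pi> (p + q) (AW A (p + q) ?z)"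
    by (simp only: \<pi>_alpha_beta[OF Tgen_closed[OF z]] beta_gen[OF z])
  also have "AW A (p + q) ?z = gtensor_cls (N A) (p + q) (frag_of [(p, u), (q, v)])"
    by (simp only: A.AW_shuffle_prod[OF x(1) y(1)] x(2) y(2))
  also have "\<dots> = gmult (T_L X) p q (gen p u) (gen q v)"
    using A.NX.gmult_T_dg[of "frag_of [(p, u)]" p "frag_of [(q, v)]" q] u v by (simp add: T_L_def T_dg_gen_def gwords_iff)
  finally show ?thesis .
qed

lemma \<pi>_gen_one: "\<pi> 0 (gen 0 (gone (L X))) = \<pi> 0 (gone (T_L X))"
proof -
  have w: "[] \<in> lists (carrier (level A 0))" by simp
  let ?z = "N_cls (T_Delta A) 0 (tensor_cls (level A 0) (frag_of []))"
  have z: "?z \<in> carrier (grp (N (T_Delta A)) 0)" by (rule A.N_word_closed[OF w])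
  have "prod_map 0 ?z = gone (L X)"
    using T_Delta_prod_word[of "[]" 0] by (simp only: prod_map_cls[OF A.L.tensor_word_closed[OF w]] L_simps) simp
  then have "\<pi> 0 (gen 0 (gone (L X))) = \<pi> 0 (alpha X 0 (Tgen 0 ?z))" by (simp only: alpha_gen[OF z])
  also have "\<dots> = \<pi> 0 (AW A 0 ?z)" by (simp only: \<pi>_alpha_beta[OF Tgen_closed[OF z]] beta_gen[OF z])
  also have "AW A 0 ?z = gone (T_L X)"
    unfolding A.AW_word[OF w] by (simp add: T_L_def A.NX.gone_T_dg)
  finally show ?thesis .
qed

sublocale m: graded_lift "N A" "L X" "\<lambda>k v. v"
  by (intro graded_lift.intro graded_lift_axioms.intro A.N_graded_group L_graded_mult)
    (auto simp: L_simps hom_def)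

lemma m_nabla_hom: "m_nabla X k \<in> hom (grp (T_L X) k) (grp (L X) k)"
  unfolding m_nabla_def grp_T_L by (rule m.T_dg_lift_hom)

lemma m_nabla_closed: "t \<in> carrier (grp (T_L X) k) \<Longrightarrow> m_nabla X k t \<in> carrier (grp (N A) k)"
  using hom_in_carrier[OF m_nabla_hom] by (simp add: L_simps)

lemma m_nabla_word: "w \<in> gwords (N A) k \<Longrightarrow> m_nabla X k (gtensor_cls (N A) k (frag_of w)) = word_prod (L X) (\<lambda>k v. v) w"
  unfolding m_nabla_def using m.T_dg_lift_cls[of "frag_of w" k] m.lin_ext_word_prod_of[of w k] by simp

lemma m_nabla_gen: "v \<in> carrier (grp (N A) k) \<Longrightarrow> m_nabla X k (gen k v) = v"
  using m_nabla_word[of "[(k, v)]" k] L_mult_one by (simp add: T_dg_gen_def gwords_iff)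

text \<open>
  Modulo \<open>I\<close> every element of the free monoid agrees with the generator given by its iterated
  shuffle product, by repeated use of \<open>\<pi>_gen_mult\<close>. In particular the generators map onto the
  co-equalizer.
\<close>

lemma \<pi>_gen_m_nabla:
  assumes t: "t \<in> carrier (grp (T_L X) k)" shows "\<pi> k (gen k (m_nabla X k t)) = \<pi> k t"
proof -
  have word: "\<pi> k (gen k (word_prod (L X) (\<lambda>k v. v) w)) = \<pi> k (gtensor_cls (N A) k (frag_of w))" if "w \<in> gwords (N A) k" for w k
    using that
  proof (induction w arbitrary: k rule: list.induct)
    case Nil
    then show ?case using \<pi>_gen_one by (simp add: gwords_iff T_L_def A.NX.gone_T_dg)
  next
    case (Cons a w)
    obtain i v where a: "a = (i, v)" by force
    let ?j = "wdeg w"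
    have v: "v \<in> carrier (grp (N A) i)" and w: "w \<in> gwords (N A) ?j" and k: "k = i + ?j"
      using Cons.prems by (auto simp: a gwords_iff)
    let ?p = "word_prod (L X) (\<lambda>k v. v) w" and ?c = "gtensor_cls (N A) ?j (frag_of w)"
    have p: "?p \<in> carrier (grp (N A) ?j)" using m.word_prod_gwords[OF w] by (simp add: L_simps)
    have c: "?c \<in> carrier (grp (T_L X) ?j)" using A.NX.gtensor_cls_closed[of "frag_of w" ?j] w by simp
    have "\<pi> k (gen k (word_prod (L X) (\<lambda>k v. v) (a # w))) = \<pi> k (gmult (T_L X) i ?j (gen i v) (gen ?j ?p))"
      using \<pi>_gen_mult[OF v p] by (simp add: a k)
    also have "\<dots> = gmult (L_mon X) i ?j (\<pi> i (gen i v)) (\<pi> ?j (gen ?j ?p))"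
      unfolding k by (rule dg_hom_mult[OF \<pi>_dg_hom gen_closed[OF v] gen_closed[OF p]])
    also have "\<dots> = gmult (L_mon X) i ?j (\<pi> i (gen i v)) (\<pi> ?j ?c)"
      by (simp only: Cons.IH[OF w])
    also have "\<dots> = \<pi> k (gmult (T_L X) i ?j (gen i v) ?c)"
      unfolding k by (rule dg_hom_mult[OF \<pi>_dg_hom gen_closed[OF v] c, symmetric])
    also have "gmult (T_L X) i ?j (gen i v) ?c = gtensor_cls (N A) k (frag_of (a # w))"
      using A.NX.gmult_T_dg[of "frag_of [(i, v)]" i "frag_of w" ?j] v w by (simp add: T_L_def T_dg_gen_def gwords_iff a k)
    finally show ?case .
  qed
  have h1: "(\<lambda>t. \<pi> k (gen k (m_nabla X k t))) \<in> hom (gtensor (N A) k) (grp (L_mon X) k)"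
    using hom_compose[OF hom_compose[OF m_nabla_hom[unfolded L_simps] gen_hom] dg_hom_hom[OF \<pi>_dg_hom]] by (simp add: comp_def)
  have h2: "\<pi> k \<in> hom (gtensor (N A) k) (grp (L_mon X) k)"
    using dg_hom_hom[OF \<pi>_dg_hom, of k] by simp
  have G: "Group.group (grp (L_mon X) k)" using graded_mult.grp_is_group[OF dg_ring_graded_mult[OF L_mon_dg_ring]] .
  show ?thesis
    using A.NX.T.Q_hom_eqI[OF G h1[unfolded A.NX.gtensor_eq] h2[unfolded A.NX.gtensor_eq]] t word
    by (simp add: A.NX.gtensor_eq m_nabla_word flip: A.NX.gtensor_cls_eq)
qed

text \<open>
  If \<open>t\<close> lies in \<open>I\<close>, then so does the generator at \<open>m_nabla t\<close>, being congruent to \<open>t\<close>;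
  conversely \<open>v\<close> is the value of \<^const>\<open>m_nabla\<close> at its own generator. So \<^const>\<open>J_ideal\<close> is the
  kernel of the map from \<open>L X\<close> onto the co-equalizer.
\<close>

lemma J_ideal_eq: "J_ideal X k = {v \<in> carrier (grp (N A) k). gen k v \<in> I k}"
proof (intro equalityI subsetI)
  fix v assume "v \<in> J_ideal X k"
  then obtain t where t: "t \<in> I k" "v = m_nabla X k t" by (auto simp: J_ideal_def I_ideal_eq)
  have tc: "t \<in> carrier (grp (T_L X) k)" by (rule Q.J_carrier[OF t(1)])
  have vc: "v \<in> carrier (grp (N A) k)" using m_nabla_closed[OF tc] t(2) by simp
  have "\<pi> k (gen k v) = \<one>\<^bsub>grp (dg_quot (T_L X) I) k\<^esub>"
    using \<pi>_gen_m_nabla[OF tc] Q.quot_cls_one_iff[OF tc] t by simp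
  then show "v \<in> {v \<in> carrier (grp (N A) k). gen k v \<in> I k}"
    using vc Q.quot_cls_one_iff[OF gen_closed[OF vc]] by simp
next
  fix v assume "v \<in> {v \<in> carrier (grp (N A) k). gen k v \<in> I k}"
  then show "v \<in> J_ideal X k"
    unfolding J_ideal_def I_ideal_eq using m_nabla_gen by (auto intro!: image_eqI[of _ _ "gen k v"])
qed

lemma \<pi>_gen_one_iff: "v \<in> carrier (grp (N A) k) \<Longrightarrow> v \<in> J_ideal X k \<longleftrightarrow> \<pi> k (gen k v) = \<one>\<^bsub>grp (L_mon X) k\<^esub>"
  using Q.quot_cls_one_iff[OF gen_closed] by (simp add: J_ideal_eq L_mon_def)

lemma J_dg_ideal: "dg_ideal (L X) (J_ideal X)"
  unfolding dg_ideal_def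
proof (intro conjI allI ballI impI)
  fix k
  interpret g: group_hom "grp (N A) k" "grp (T_L X) k" "gen k"
    using gen_hom[of k] A.N_group[of k] T_L.grp_is_group[of k] by (simp add: group_hom_def group_hom_axioms_def)
  interpret Ik: subgroup "I k" "grp (T_L X) k" by (rule Q.J_subgroup)
  show "subgroup (J_ideal X k) (grp (L X) k)"
    unfolding L_simps J_ideal_eq by (rule g.G.subgroupI) (auto simp del: grp_T_L)
next
  fix k :: nat and v assume k: "0 < k" and "v \<in> J_ideal X k"
  then have v: "v \<in> carrier (grp (N A) k)" "gen k v \<in> I k" by (auto simp: J_ideal_eq)
  have "gen (k - 1) (bd (N A) k v) = bd (T_L X) k (gen k v)"
    using A.NX.T_dg_gen_cpx_hom v(1) k by (simp add: cpx_hom_def T_L_def)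
  then show "bd (L X) k v \<in> J_ideal X (k - 1)"
    using dg_ideal_bd[OF I_ideal_dg k v(2)] A.NX.bd_closed[OF k v(1)] by (simp add: J_ideal_eq L_simps)
next
  fix i j u v assume u: "u \<in> carrier (grp (L X) i)" and "v \<in> J_ideal X j"
  then have v: "v \<in> carrier (grp (N A) j)" "gen j v \<in> I j" by (auto simp: J_ideal_eq)
  have u': "u \<in> carrier (grp (N A) i)" using u by (simp add: L_simps)
  have c: "gmult (L X) i j u v \<in> carrier (grp (N A) (i + j))" using L.mult_closed[OF u, of v j] v by (simp add: L_simps)
  have "gmult (T_L X) i j (gen i u) (gen j v) \<in> I (i + j)" by (rule dg_ideal_left[OF I_ideal_dg gen_closed[OF u'] v(2)])
  then have "\<pi> (i + j) (gmult (T_L X) i j (gen i u) (gen j v)) = \<one>\<^bsub>grp (L_mon X) (i + j)\<^esub>"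
    using Q.quot_cls_one_iff[OF Q.J_carrier] unfolding L_mon_def by blast
  then show "gmult (L X) i j u v \<in> J_ideal X (i + j)"
    unfolding \<pi>_gen_one_iff[OF c] \<pi>_gen_mult[OF u' v(1)] .
next
  fix i j u v assume "u \<in> J_ideal X i" and v: "v \<in> carrier (grp (L X) j)"
  then have u: "u \<in> carrier (grp (N A) i)" "gen i u \<in> I i" by (auto simp: J_ideal_eq)
  have v': "v \<in> carrier (grp (N A) j)" using v by (simp add: L_simps)
  have c: "gmult (L X) i j u v \<in> carrier (grp (N A) (i + j))" using L.mult_closed[OF _ v, of u i] u by (simp add: L_simps)
  have "gmult (T_L X) i j (gen i u) (gen j v) \<in> I (i + j)" by (rule dg_ideal_right[OF I_ideal_dg u(2) gen_closed[OF v']])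
  then have "\<pi> (i + j) (gmult (T_L X) i j (gen i u) (gen j v)) = \<one>\<^bsub>grp (L_mon X) (i + j)\<^esub>"
    using Q.quot_cls_one_iff[OF Q.J_carrier] unfolding L_mon_def by blast
  then show "gmult (L X) i j u v \<in> J_ideal X (i + j)"
    unfolding \<pi>_gen_one_iff[OF c] \<pi>_gen_mult[OF u(1) v'] .
qed

sublocale LJ: dg_ideal_quotient "L X" "J_ideal X"
  by (intro dg_ideal_quotient.intro dg_ideal_quotient_axioms.intro L_graded_mult J_dg_ideal)
    (simp add: L_simps A.N_bd_hom)

subsection \<open>The isomorphism\<close>

text \<open>
  The inverse of the map induced by the generators, given without a choice of representatives: a
  coset of \<open>I\<close> is sent to its preimage, which is a coset of \<^const>\<open>J_ideal\<close>.
\<close>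

definition \<theta> :: "nat \<Rightarrow> ((nat \<times> 'a set) list \<Rightarrow>\<^sub>0 int) set set \<Rightarrow> 'a set set" where
  "\<theta> k c = {v \<in> carrier (grp (N A) k). gen k v \<in> c}"

abbreviation \<rho> where "\<rho> \<equiv> dg_quot_cls (L X) (J_ideal X)"

lemma gen_diff:
  assumes "v \<in> carrier (grp (N A) k)" "w \<in> carrier (grp (N A) k)"
  shows "gen k (v \<otimes>\<^bsub>grp (N A) k\<^esub> inv\<^bsub>grp (N A) k\<^esub> w) = gen k v \<otimes>\<^bsub>grp (T_L X) k\<^esub> inv\<^bsub>grp (T_L X) k\<^esub> gen k w"
    and "v \<otimes>\<^bsub>grp (N A) k\<^esub> inv\<^bsub>grp (N A) k\<^esub> w \<in> carrier (grp (N A) k)"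
proof -
  interpret g: group_hom "grp (N A) k" "grp (T_L X) k" "gen k"
    using gen_hom[of k] A.N_group[of k] T_L.grp_is_group[of k] by (simp add: group_hom_def group_hom_axioms_def)
  show "gen k (v \<otimes>\<^bsub>grp (N A) k\<^esub> inv\<^bsub>grp (N A) k\<^esub> w) = gen k v \<otimes>\<^bsub>grp (T_L X) k\<^esub> inv\<^bsub>grp (T_L X) k\<^esub> gen k w"
    and "v \<otimes>\<^bsub>grp (N A) k\<^esub> inv\<^bsub>grp (N A) k\<^esub> w \<in> carrier (grp (N A) k)"
    using assms by (simp_all del: grp_T_L)
qed

lemma \<theta>_gen:
  assumes v: "v \<in> carrier (grp (N A) k)" shows "\<theta> k (\<pi> k (gen k v)) = \<rho> k v"
proof (intro equalityI subsetI)
  have vL: "v \<in> carrier (grp (L X) k)" using v by (simp add: L_simps)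
  have iff: "w \<in> \<rho> k v \<longleftrightarrow> gen k w \<in> \<pi> k (gen k v)" if w: "w \<in> carrier (grp (N A) k)" for w
    using LJ.quot_cls_mem_iff[of w k v] Q.quot_cls_mem_iff[OF gen_closed[OF w] gen_closed[OF v]] gen_diff[OF w v] w v
    by (simp add: L_simps J_ideal_eq)
  show "w \<in> \<rho> k v" if "w \<in> \<theta> k (\<pi> k (gen k v))" for w
    using that iff by (auto simp: \<theta>_def)
  show "w \<in> \<theta> k (\<pi> k (gen k v))" if "w \<in> \<rho> k v" for w
    using that iff LJ.quot_cls_subset[OF vL that] by (auto simp: \<theta>_def L_simps)
qed

lemma L_mon_cases:
  assumes "c \<in> carrier (grp (L_mon X) k)"
  obtains v where "v \<in> carrier (grp (N A) k)" "c = \<pi> k (gen k v)"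
proof -
  obtain t where t: "t \<in> carrier (grp (T_L X) k)" "c = \<pi> k t"
    using Q.quot_cases assms unfolding L_mon_def by metis
  show ?thesis
    by (rule that[OF m_nabla_closed[OF t(1)]]) (simp only: t(2) \<pi>_gen_m_nabla[OF t(1)])
qed

lemma \<pi>_gen_bd: 
  "v \<in> carrier (grp (N A) k) \<Longrightarrow> 0 < k \<Longrightarrow> bd (L_mon X) k (\<pi> k (gen k v)) = \<pi> (k - 1) (gen (k - 1) (bd (N A) k v))"
  using dg_hom_bd[OF \<pi>_dg_hom, of k "gen k v"] gen_closed[of v k] A.NX.T_dg_gen_cpx_hom by (simp add: cpx_hom_def T_L_def)

lemma \<theta>_surj: "carrier (grp (L_tilde X) k) \<subseteq> \<theta> k ` carrier (grp (L_mon X) k)"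
proof
  fix d assume "d \<in> carrier (grp (L_tilde X) k)"
  then obtain v where v: "v \<in> carrier (grp (N A) k)" "d = \<rho> k v"
    unfolding L_tilde_def by (metis LJ.quot_cases L_simps(1))
  then show "d \<in> \<theta> k ` carrier (grp (L_mon X) k)"
    using \<theta>_gen[OF v(1)] dg_hom_closed[OF \<pi>_dg_hom gen_closed[OF v(1)]] by (metis imageI)
qed

lemma L_tilde_image:
  shows L_tilde_dg_ring: "dg_ring (L_tilde X)" and \<theta>_dg_hom: "dg_hom (L_mon X) (L_tilde X) \<theta>"
proof -
  have Lc: "grp (L_tilde X) k = grp (dg_quot (L X) (J_ideal X)) k" for k by (simp add: L_tilde_def)
  have comm: "comm_group (grp (L_tilde X) k)" for k unfolding Lc by (rule LJ.quot_comm_group)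
  have \<pi>g: "(\<lambda>v. \<pi> k (gen k v)) \<in> hom (grp (N A) k) (grp (L_mon X) k)" for k
    using hom_compose[OF gen_hom dg_hom_hom[OF \<pi>_dg_hom]] by (simp add: comp_def)
  have hom: "\<theta> k \<in> hom (grp (L_mon X) k) (grp (L_tilde X) k)" for k
  proof (rule homI)
    fix c assume "c \<in> carrier (grp (L_mon X) k)"
    then obtain v where v: "v \<in> carrier (grp (N A) k)" "c = \<pi> k (gen k v)" by (rule L_mon_cases)
    then show "\<theta> k c \<in> carrier (grp (L_tilde X) k)"
      unfolding Lc using LJ.quot_cls_closed[of v k] by (simp add: \<theta>_gen L_simps)
  next
    fix c d assume "c \<in> carrier (grp (L_mon X) k)" "d \<in> carrier (grp (L_mon X) k)"
    then obtain v w where v: "v \<in> carrier (grp (N A) k)" "c = \<pi> k (gen k v)" and w: "w \<in> carrier (grp (N A) k)" "d = \<pi> k (gen k w)"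
      by (metis L_mon_cases)
    have vw: "v \<otimes>\<^bsub>grp (N A) k\<^esub> w \<in> carrier (grp (N A) k)" using v w by (simp add: A.NX.grp_m_closed)
    show "\<theta> k (c \<otimes>\<^bsub>grp (L_mon X) k\<^esub> d) = \<theta> k c \<otimes>\<^bsub>grp (L_tilde X) k\<^esub> \<theta> k d"
      unfolding v(2) w(2) hom_mult[OF \<pi>g v(1) w(1), symmetric] \<theta>_gen[OF vw] \<theta>_gen[OF v(1)] \<theta>_gen[OF w(1)] Lc
      using hom_mult[OF LJ.quot_cls_hom, of v k w] v(1) w(1) by (simp add: L_simps)
  qed
  have bd: "bd (L_tilde X) k (\<theta> k c) = \<theta> (k - 1) (bd (L_mon X) k c)" if k: "0 < k" and c: "c \<in> carrier (grp (L_mon X) k)" for k c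
  proof -
    obtain v where v: "v \<in> carrier (grp (N A) k)" "c = \<pi> k (gen k v)" by (rule L_mon_cases[OF c])
    have vL: "v \<in> carrier (grp (L X) k)" using v by (simp add: L_simps)
    show ?thesis
      unfolding v(2) \<pi>_gen_bd[OF v(1) k] \<theta>_gen[OF v(1)] \<theta>_gen[OF A.NX.bd_closed[OF k v(1)]] L_tilde_def LJ.quot_bd[OF k vL] L_simps ..
  qed
  have mult: "gmult (L_tilde X) i j (\<theta> i c) (\<theta> j d) = \<theta> (i + j) (gmult (L_mon X) i j c d)"
    if c: "c \<in> carrier (grp (L_mon X) i)" and d: "d \<in> carrier (grp (L_mon X) j)" for i j c d
  proof -
    obtain v where v: "v \<in> carrier (grp (N A) i)" "c = \<pi> i (gen i v)" by (rule L_mon_cases[OF c])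
    obtain w where w: "w \<in> carrier (grp (N A) j)" "d = \<pi> j (gen j w)" by (rule L_mon_cases[OF d])
    have L: "v \<in> carrier (grp (L X) i)" "w \<in> carrier (grp (L X) j)" using v w by (simp_all add: L_simps)
    have vw: "gmult (L X) i j v w \<in> carrier (grp (N A) (i + j))" using L.mult_closed[OF L] by (simp add: L_simps)
    show ?thesis
      unfolding v(2) w(2) dg_hom_mult[OF \<pi>_dg_hom gen_closed[OF v(1)] gen_closed[OF w(1)], symmetric]
        \<pi>_gen_mult[OF v(1) w(1), symmetric] \<theta>_gen[OF vw] \<theta>_gen[OF v(1)] \<theta>_gen[OF w(1)] L_tilde_def
      by (rule LJ.quot_mult[OF L])
  qed
  have one: "gone (L_tilde X) = \<theta> 0 (gone (L_mon X))"
  proof -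
    have g: "gone (L X) \<in> carrier (grp (N A) 0)" using L.unit_closed by (simp add: L_simps)
    show ?thesis
      unfolding dg_hom_one[OF \<pi>_dg_hom, symmetric] \<pi>_gen_one[symmetric] \<theta>_gen[OF g] L_tilde_def by (rule LJ.gone_quot)
  qed
  show "dg_ring (L_tilde X)" "dg_hom (L_mon X) (L_tilde X) \<theta>"
    by (rule dg_ring_image[OF L_mon_dg_ring comm hom \<theta>_surj bd mult one]; assumption)+
qed

lemma \<theta>_dg_iso: "dg_iso (L_mon X) (L_tilde X) \<theta>"
  unfolding dg_iso_def
proof (intro conjI allI \<theta>_dg_hom)
  fix k
  have "inj_on (\<theta> k) (carrier (grp (L_mon X) k))"
  proof (rule inj_onI)
    fix c d assume c: "c \<in> carrier (grp (L_mon X) k)" and d: "d \<in> carrier (grp (L_mon X) k)" and eq: "\<theta> k c = \<theta> k d"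
    obtain v where v: "v \<in> carrier (grp (N A) k)" "c = \<pi> k (gen k v)" by (rule L_mon_cases[OF c])
    have "v \<in> \<rho> k v" using LJ.quot_cls_mem_iff[of v k v] v(1) A.N_group[of k] subgroup.one_closed[OF LJ.J_subgroup, of k]
      by (simp add: L_simps group.r_inv)
    then have "gen k v \<in> d" using eq \<theta>_gen[OF v(1)] by (auto simp: v(2) \<theta>_def)
    moreover obtain w where w: "w \<in> carrier (grp (N A) k)" "d = \<pi> k (gen k w)" by (rule L_mon_cases[OF d])
    ultimately show "c = d"
      unfolding v(2) w(2) using Q.quot_cls_mem_iff[OF gen_closed[OF v(1)] gen_closed[OF w(1)]] Q.quot_cls_eq_iff[OF gen_closed[OF v(1)] gen_closed[OF w(1)]]
      by blast
  qed
  moreover have "\<theta> k ` carrier (grp (L_mon X) k) \<subseteq> carrier (grp (L_tilde X) k)"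
    using dg_hom_closed[OF \<theta>_dg_hom] by blast
  ultimately show "\<theta> k \<in> iso (grp (L_mon X) k) (grp (L_tilde X) k)"
    using \<theta>_surj[of k] dg_hom_hom[OF \<theta>_dg_hom, of k] by (simp add: iso_def bij_betw_def subset_antisym)
qed

end

section \<open>Functoriality\<close>

lemma dg_hom_image:
  assumes f: "dg_hom A B f" and p: "dg_hom A A' p" and q: "dg_hom B B' q"
    and surj: "\<And>k. carrier (grp A' k) \<subseteq> p k ` carrier (grp A k)"
    and g: "\<And>k a. a \<in> carrier (grp A k) \<Longrightarrow> g k (p k a) = q k (f k a)"
  shows "dg_hom A' B' g"
  unfolding dg_hom_def
proof (intro conjI allI ballI impI)
  interpret A: dg_ring A using f by (simp add: dg_hom_def)
  interpret A': dg_ring A' using p by (simp add: dg_hom_def)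
  note qf = dg_hom_comp[OF f q]
  have ex: "\<exists>a. a \<in> carrier (grp A k) \<and> c = p k a" if "c \<in> carrier (grp A' k)" for k c
    using surj that by blast
  show "dg_ring A'" "dg_ring B'" using p q by (simp_all add: dg_hom_def)
  show "g k \<in> hom (grp A' k) (grp B' k)" for k
  proof (rule homI)
    fix c assume "c \<in> carrier (grp A' k)"
    then obtain a where a: "a \<in> carrier (grp A k)" "c = p k a" using ex by blast
    then show "g k c \<in> carrier (grp B' k)" using dg_hom_closed[OF qf a(1)] by (simp add: g)
  next
    fix c d assume "c \<in> carrier (grp A' k)" "d \<in> carrier (grp A' k)"
    then obtain a b where a: "a \<in> carrier (grp A k)" "c = p k a" and b: "b \<in> carrier (grp A k)" "d = p k b"
      using ex by metis
    show "g k (c \<otimes>\<^bsub>grp A' k\<^esub> d) = g k c \<otimes>\<^bsub>grp B' k\<^esub> g k d"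
      unfolding a(2) b(2) hom_mult[OF dg_hom_hom[OF p] a(1) b(1), symmetric]
        g[OF a(1)] g[OF b(1)] g[OF A.grp_m_closed[OF a(1) b(1)]]
      by (rule hom_mult[OF dg_hom_hom[OF qf] a(1) b(1)])
  qed
  fix k :: nat and c assume k: "0 < k" and "c \<in> carrier (grp A' k)"
  then obtain a where a: "a \<in> carrier (grp A k)" "c = p k a" using ex by blast
  show "g (k - 1) (bd A' k c) = bd B' k (g k c)"
    unfolding a(2) dg_hom_bd[OF p k a(1), symmetric] g[OF a(1)] g[OF A.bd_closed[OF k a(1)]]
    by (rule dg_hom_bd[OF qf k a(1)])
next
  interpret A: dg_ring A using f by (simp add: dg_hom_def)
  note qf = dg_hom_comp[OF f q]
  fix i j c d assume "c \<in> carrier (grp A' i)" "d \<in> carrier (grp A' j)"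
  then obtain a b where a: "a \<in> carrier (grp A i)" "c = p i a" and b: "b \<in> carrier (grp A j)" "d = p j b"
    using surj by blast
  show "g (i + j) (gmult A' i j c d) = gmult B' i j (g i c) (g j d)"
    unfolding a(2) b(2) dg_hom_mult[OF p a(1) b(1), symmetric] g[OF a(1)] g[OF b(1)] g[OF A.gmult_closed[OF a(1) b(1)]]
    by (rule dg_hom_mult[OF qf a(1) b(1)])
next
  interpret A: dg_ring A using f by (simp add: dg_hom_def)
  show "g 0 (gone A') = gone B'"
    unfolding dg_hom_one[OF p, symmetric] g[OF A.gone_closed] by (rule dg_hom_one[OF dg_hom_comp[OF f q]])
qed

lemma simp_ring_hom_comp:
  assumes f: "simp_ring_hom X Y f" and g: "simp_ring_hom Y Z g"
  shows "simp_ring_hom X Z (\<lambda>n x. g n (f n x))"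
proof -
  have c: "f n x \<in> carrier (level Y n)" if "x \<in> carrier (level X n)" for n x
    using f that unfolding simp_ring_hom_def by (blast intro: ring_hom_closed)
  have "(\<lambda>x. g n (f n x)) \<in> ring_hom (level X n) (level Z n)" for n
    using ring_hom_trans[of "f n" "level X n" "level Y n" "g n" "level Z n"] f g
    by (simp add: simp_ring_hom_def comp_def)
  then show ?thesis
    using f g c unfolding simp_ring_hom_def by auto
qed

lemma simp_ring_hom_id: "simplicial_ring X \<Longrightarrow> simp_ring_hom X X (\<lambda>n x. x)"
  unfolding simp_ring_hom_def by (auto intro: ring_hom_memI simp: simplicial_ring.level_ring ring.ring_simprules)

lemma simp_ring_hom_additive:
  assumes "simp_ring_hom X Y f" shows "simp_ab_hom (additive X) (additive Y) f"
  unfolding simp_ab_hom_def additive_simps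
  using assms by (intro conjI allI ring_hom_add_hom) (simp_all add: simp_ring_hom_def)

text \<open>
  Along a natural family of surjective maps of monoids the functor laws pass from the source to the
  target. So \<^const>\<open>L_tilde\<close> inherits them from \<^const>\<open>L_mon\<close>, without an appeal to the naturality of
  the shuffle map.
\<close>

lemma dg_functor_image:
  assumes F: "dg_functor F Fm"
    and \<tau>: "\<And>X. simplicial_ring X \<Longrightarrow> dg_hom (F X) (G X) (\<tau> X)"
    and surj: "\<And>X k. simplicial_ring X \<Longrightarrow> carrier (grp (G X) k) \<subseteq> \<tau> X k ` carrier (grp (F X) k)"
    and nat: "\<And>X Y f k c. \<lbrakk>simp_ring_hom X Y f; c \<in> carrier (grp (F X) k)\<rbrakk> \<Longrightarrow>
      Gm X Y f k (\<tau> X k c) = \<tau> Y k (Fm X Y f k c)"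
  shows "dg_functor G Gm"
proof -
  have ex: "\<exists>a. a \<in> carrier (grp (F X) k) \<and> c = \<tau> X k a" if "simplicial_ring X" "c \<in> carrier (grp (G X) k)" for X k c
    using surj that by blast
  note Fs = F[unfolded dg_functor_def]
  note Fhom = Fs[THEN conjunct2, THEN conjunct1, rule_format]
    and Fcong = Fs[THEN conjunct2, THEN conjunct2, THEN conjunct1, rule_format]
    and Fid = Fs[THEN conjunct2, THEN conjunct2, THEN conjunct2, THEN conjunct1, rule_format]
    and Fcomp = Fs[THEN conjunct2, THEN conjunct2, THEN conjunct2, THEN conjunct2, rule_format]
  have rings: "simplicial_ring X" "simplicial_ring Y" if "simp_ring_hom X Y f" for X Y :: "'a simp_ring" and f
    using that by (simp_all add: simp_ring_hom_def)
  show ?thesis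
    unfolding dg_functor_def
  proof (intro conjI allI impI ballI)
    show "dg_ring (G X)" if "simplicial_ring X" for X using \<tau>[OF that] by (simp add: dg_hom_def)
    show "dg_hom (G X) (G Y) (Gm X Y f)" if f: "simp_ring_hom X Y f" for X Y f
      by (rule dg_hom_image[OF Fhom[OF f] \<tau>[OF rings(1)[OF f]] \<tau>[OF rings(2)[OF f]] surj[OF rings(1)[OF f]] nat[OF f]])
  next
    fix X Y :: "'a simp_ring" and f g k c
    assume fg: "simp_ring_hom X Y f \<and> simp_ring_hom X Y g \<and> (\<forall>n. \<forall>x\<in>carrier (level X n). f n x = g n x)"
      and c: "c \<in> carrier (grp (G X) k)"
    obtain a where a: "a \<in> carrier (grp (F X) k)" "c = \<tau> X k a"
      using ex[OF rings(1)[OF conjunct1[OF fg]] c] by blast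
    show "Gm X Y f k c = Gm X Y g k c"
      unfolding a(2) nat[OF conjunct1[OF fg] a(1)] nat[OF conjunct1[OF conjunct2[OF fg]] a(1)] Fcong[OF fg a(1)] ..
  next
    fix X k c assume X: "simplicial_ring X" and c: "c \<in> carrier (grp (G X) k)"
    obtain a where a: "a \<in> carrier (grp (F X) k)" "c = \<tau> X k a" using ex[OF X c] by blast
    show "Gm X X (\<lambda>n x. x) k c = c"
      unfolding a(2) nat[OF simp_ring_hom_id[OF X] a(1)] Fid[OF X a(1)] ..
  next
    fix X Y Z :: "'a simp_ring" and f g k c assume fg: "simp_ring_hom X Y f \<and> simp_ring_hom Y Z g" and c: "c \<in> carrier (grp (G X) k)"
    note f = conjunct1[OF fg] and g = conjunct2[OF fg]
    obtain a where a: "a \<in> carrier (grp (F X) k)" "c = \<tau> X k a" using ex[OF rings(1)[OF f] c] by blast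
    show "Gm X Z (\<lambda>n x. g n (f n x)) k c = Gm Y Z g k (Gm X Y f k c)"
      unfolding a(2) nat[OF simp_ring_hom_comp[OF f g] a(1)] nat[OF f a(1)]
        nat[OF g dg_hom_closed[OF Fhom[OF f] a(1)]] Fcomp[OF fg a(1)] ..
  qed
qed

context
  fixes X Y :: "'a simp_ring" and f
  assumes f: "simp_ring_hom X Y f"
begin

interpretation X: simplicial_ring X using f by (simp add: simp_ring_hom_def)
interpretation Y: simplicial_ring Y using f by (simp add: simp_ring_hom_def)

lemma additive_hom: "simp_ab_hom (additive X) (additive Y) f"
  by (rule simp_ring_hom_additive[OF f])

lemma f_ring_hom: "f n \<in> ring_hom (level X n) (level Y n)"
  using f by (simp add: simp_ring_hom_def)

abbreviation T_Delta_map where "T_Delta_map \<equiv> (\<lambda>n. tensor_map (level (additive Y) n) (f n))"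

lemma Nf_cpx_hom: "cpx_hom (N (additive X)) (N (additive Y)) (N_map (additive Y) f)"
  by (rule N_map_cpx_hom[OF X.additive_simplicial Y.additive_simplicial additive_hom])

lemma Nf_closed: "v \<in> carrier (grp (N (additive X)) k) \<Longrightarrow> N_map (additive Y) f k v \<in> carrier (grp (N (additive Y)) k)"
  by (rule hom_in_carrier[OF N_map_hom[OF X.additive_simplicial Y.additive_simplicial additive_hom]])

lemma tensor_map_simp_ab_hom: "simp_ab_hom (T_Delta (additive X)) (T_Delta (additive Y)) T_Delta_map"
  by (rule T_Delta_map_simp_ab_hom[OF X.additive_simplicial Y.additive_simplicial additive_hom])

lemma NT_cpx_hom: "cpx_hom (N (T_Delta (additive X))) (N (T_Delta (additive Y))) (N_map (T_Delta (additive Y)) T_Delta_map)"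
  by (rule N_map_cpx_hom[OF X.TA_simplicial Y.TA_simplicial tensor_map_simp_ab_hom])

lemma NT_closed:
  "u \<in> carrier (grp (N (T_Delta (additive X))) k) \<Longrightarrow>
    N_map (T_Delta (additive Y)) T_Delta_map k u \<in> carrier (grp (N (T_Delta (additive Y))) k)"
  by (rule hom_in_carrier[OF N_map_hom[OF X.TA_simplicial Y.TA_simplicial tensor_map_simp_ab_hom]])

abbreviation T_L_map where "T_L_map \<equiv> T_dg_map (N (additive Y)) (N_map (additive Y) f)"
abbreviation T_L_T_map where "T_L_T_map \<equiv> T_dg_map (N (T_Delta (additive Y))) (N_map (T_Delta (additive Y)) T_Delta_map)"

lemma T_L_map_dg_hom: "dg_hom (T_L X) (T_L Y) T_L_map"
  unfolding T_L_def by (rule T_dg_map_dg_hom(1)[OF X.A.N_cochain_complex Y.A.N_cochain_complex Nf_cpx_hom])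

lemma T_L_map_gen: "v \<in> carrier (grp (N (additive X)) k) \<Longrightarrow> T_L_map k (X.gen k v) = Y.gen k (N_map (additive Y) f k v)"
  by (rule T_dg_map_dg_hom(2)[OF X.A.N_cochain_complex Y.A.N_cochain_complex Nf_cpx_hom])

lemma T_L_T_map_dg_hom: "dg_hom (T_L_T X) (T_L_T Y) T_L_T_map"
  unfolding T_L_T_def by (rule T_dg_map_dg_hom(1)[OF X.N_TA_complex Y.N_TA_complex NT_cpx_hom])

lemma T_L_T_map_gen:
  "u \<in> carrier (grp (N (T_Delta (additive X))) k) \<Longrightarrow> T_L_T_map k (X.Tgen k u) = Y.Tgen k (N_map (T_Delta (additive Y)) T_Delta_map k u)"
  by (rule T_dg_map_dg_hom(2)[OF X.N_TA_complex Y.N_TA_complex NT_cpx_hom])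

lemma prod_map_natural:
  assumes "u \<in> carrier (grp (N (T_Delta (additive X))) k)"
  shows "Y.prod_map k (N_map (T_Delta (additive Y)) T_Delta_map k u) = N_map (additive Y) f k (X.prod_map k u)"
proof -
  obtain t where t': "t \<in> carrier (level (T_Delta (additive X)) k)" "u = N_cls (T_Delta (additive X)) k t"
    by (rule simplicial_ab_group.N_cases[OF X.TA_simplicial assms])
  have t: "t \<in> carrier (tensor (level (additive X) k))" using t'(1) by simp
  have c: "T_Delta_map k t \<in> carrier (tensor (level (additive Y) k))"
    using simp_ab_hom_closed[OF X.TA_simplicial Y.TA_simplicial tensor_map_simp_ab_hom t'(1)] by simp
  have p: "T_Delta_prod X k t \<in> carrier (level (additive X) k)" by (rule hom_in_carrier[OF X.T_Delta_prod_hom t])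
  show ?thesis
    unfolding t'(2) N_map_cls[OF X.TA_simplicial Y.TA_simplicial tensor_map_simp_ab_hom t'(1)] Y.prod_map_cls[OF c]
      X.prod_map_cls[OF t] N_map_cls[OF X.additive_simplicial Y.additive_simplicial additive_hom p]
      X.T_Delta_prod_natural[OF Y.simplicial_ring_axioms f_ring_hom t] ..
qed

lemma T_L_T_eqI:
  assumes "dg_hom (T_L_T X) B h" "dg_hom (T_L_T X) B h'"
    and "\<And>k u. u \<in> carrier (grp (N (T_Delta (additive X))) k) \<Longrightarrow> h k (X.Tgen k u) = h' k (X.Tgen k u)"
    and "z \<in> carrier (grp (T_L_T X) k)"
  shows "h k z = h' k z"
  using cochain_complex.T_dg_dg_hom_eqI[OF X.N_TA_complex, of B h h' z k] assms unfolding T_L_T_def by blast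

lemma alpha_natural: "z \<in> carrier (grp (T_L_T X) k) \<Longrightarrow> alpha Y k (T_L_T_map k z) = T_L_map k (alpha X k z)"
  by (rule T_L_T_eqI[OF dg_hom_comp[OF T_L_T_map_dg_hom Y.alpha_dg_hom] dg_hom_comp[OF X.alpha_dg_hom T_L_map_dg_hom]])
    (simp_all only: T_L_T_map_gen Y.alpha_gen NT_closed X.alpha_gen prod_map_natural T_L_map_gen X.prod_map_closed)

lemma beta_natural: "z \<in> carrier (grp (T_L_T X) k) \<Longrightarrow> beta Y k (T_L_T_map k z) = T_L_map k (beta X k z)"
  by (rule T_L_T_eqI[OF dg_hom_comp[OF T_L_T_map_dg_hom Y.beta_dg_hom] dg_hom_comp[OF X.beta_dg_hom T_L_map_dg_hom]])
    (simp_all only: T_L_T_map_gen Y.beta_gen NT_closed X.beta_gen AW_natural[OF X.additive_simplicial Y.additive_simplicial additive_hom])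

text \<open>By naturality of \<^const>\<open>alpha\<close> and \<^const>\<open>beta\<close>, generators of one ideal are sent to those of the other.\<close>

lemma T_L_map_ideal:
  assumes "t \<in> L_mon_ideal X k" shows "T_L_map k t \<in> L_mon_ideal Y k"
proof -
  have "L_mon_ideal X k \<subseteq> {t \<in> carrier (grp (T_L X) k). T_L_map k t \<in> L_mon_ideal Y k}"
    unfolding L_mon_ideal_def[of X]
  proof (rule dg_ideal_generated_le[OF dg_ideal_preimage[OF T_L_map_dg_hom Y.I_ideal_dg]], safe)
    fix k z assume z: "z \<in> carrier (grp (T_L_T X) k)"
    interpret h: group_hom "grp (T_L X) k" "grp (T_L Y) k" "T_L_map k"
      by (simp add: group_hom_def group_hom_axioms_def X.T_L.grp_is_group Y.T_L.grp_is_group dg_hom_hom[OF T_L_map_dg_hom] del: X.grp_T_L Y.grp_T_L)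
    have ab: "alpha X k z \<in> carrier (grp (T_L X) k)" "beta X k z \<in> carrier (grp (T_L X) k)"
      by (rule dg_hom_closed[OF X.alpha_dg_hom z], rule dg_hom_closed[OF X.beta_dg_hom z])
    show "alpha X k z \<otimes>\<^bsub>grp (T_L X) k\<^esub> inv\<^bsub>grp (T_L X) k\<^esub> beta X k z \<in> carrier (grp (T_L X) k)"
      using ab by (simp del: X.grp_T_L)
    have "T_L_map k (alpha X k z \<otimes>\<^bsub>grp (T_L X) k\<^esub> inv\<^bsub>grp (T_L X) k\<^esub> beta X k z)
        = alpha Y k (T_L_T_map k z) \<otimes>\<^bsub>grp (T_L Y) k\<^esub> inv\<^bsub>grp (T_L Y) k\<^esub> beta Y k (T_L_T_map k z)"
      by (simp only: alpha_natural[OF z] beta_natural[OF z] h.hom_mult h.hom_inv h.G.inv_closed ab)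
    then show "T_L_map k (alpha X k z \<otimes>\<^bsub>grp (T_L X) k\<^esub> inv\<^bsub>grp (T_L X) k\<^esub> beta X k z) \<in> L_mon_ideal Y k"
      using Y.alpha_beta_diff[OF dg_hom_closed[OF T_L_T_map_dg_hom z]] by simp
  qed
  then show ?thesis using assms by blast
qed

lemma
  shows L_mon_map_dg_hom: "dg_hom (L_mon X) (L_mon Y) (L_mon_map X Y f)"
    and L_mon_map_cls: "t \<in> carrier (grp (T_L X) k) \<Longrightarrow> L_mon_map X Y f k (X.\<pi> k t) = Y.\<pi> k (T_L_map k t)"
proof -
  note h = dg_hom_comp[OF T_L_map_dg_hom Y.\<pi>_dg_hom]
  have one: "Y.\<pi> k (T_L_map k t) = \<one>\<^bsub>grp (L_mon Y) k\<^esub>" if "t \<in> L_mon_ideal X k" for k t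
    using Y.Q.quot_cls_one_iff[OF Y.Q.J_carrier] T_L_map_ideal[OF that] unfolding L_mon_def by blast
  have m: "L_mon_map X Y f = (\<lambda>k. induced (\<lambda>t. Y.\<pi> k (T_L_map k t)))"
    by (simp add: L_mon_map_def fun_eq_iff)
  show "dg_hom (L_mon X) (L_mon Y) (L_mon_map X Y f)"
    unfolding m L_mon_def[of X] by (rule dg_quot_induced_dg_hom[OF X.T_L_dg_ring X.I_ideal_dg h one])
  show "t \<in> carrier (grp (T_L X) k) \<Longrightarrow> L_mon_map X Y f k (X.\<pi> k t) = Y.\<pi> k (T_L_map k t)"
    unfolding m by (rule dg_quot_induced_cls[OF X.T_L_dg_ring X.I_ideal_dg h one])
qed

lemma L_mon_map_gen:
  "v \<in> carrier (grp (N (additive X)) k) \<Longrightarrow>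
    L_mon_map X Y f k (X.\<pi> k (X.gen k v)) = Y.\<pi> k (Y.gen k (N_map (additive Y) f k v))"
  using L_mon_map_cls[OF X.gen_closed] by (simp add: T_L_map_gen)

lemma L_tilde_map_cls:
  assumes v: "v \<in> carrier (grp (N (additive X)) k)"
  shows "L_tilde_map X Y f k (X.\<rho> k v) = Y.\<rho> k (N_map (additive Y) f k v)"
  unfolding L_tilde_map_def
proof (rule X.LJ.quot_induced_cls[OF Y.LJ.quot_group])
  show "(\<lambda>v. Y.\<rho> k (N_map (additive Y) f k v)) \<in> hom (grp (L X) k) (grp (dg_quot (L Y) (J_ideal Y)) k)"
    using hom_compose[OF N_map_hom[OF X.additive_simplicial Y.additive_simplicial additive_hom] Y.LJ.quot_cls_hom[unfolded Y.L_simps]]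
    by (simp add: comp_def X.L_simps)
  show "v \<in> carrier (grp (L X) k)" using v by (simp add: X.L_simps)
  fix w assume "w \<in> J_ideal X k"
  then have w: "w \<in> carrier (grp (N (additive X)) k)" "X.gen k w \<in> L_mon_ideal X k" by (auto simp: X.J_ideal_eq)
  have "Y.gen k (N_map (additive Y) f k w) \<in> L_mon_ideal Y k"
    using T_L_map_ideal[OF w(2)] by (simp add: T_L_map_gen[OF w(1)])
  then have "N_map (additive Y) f k w \<in> J_ideal Y k" using Nf_closed[OF w(1)] by (simp add: Y.J_ideal_eq)
  then show "Y.\<rho> k (N_map (additive Y) f k w) = \<one>\<^bsub>grp (dg_quot (L Y) (J_ideal Y)) k\<^esub>"
    using Y.LJ.quot_cls_one_iff[OF Y.LJ.J_carrier] by blast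
qed

lemma \<theta>_natural:
  assumes c: "c \<in> carrier (grp (L_mon X) k)"
  shows "L_tilde_map X Y f k (X.\<theta> k c) = Y.\<theta> k (L_mon_map X Y f k c)"
proof -
  obtain v where v: "v \<in> carrier (grp (N (additive X)) k)" "c = X.\<pi> k (X.gen k v)" by (rule X.L_mon_cases[OF c])
  show ?thesis
    unfolding v(2) X.\<theta>_gen[OF v(1)] L_tilde_map_cls[OF v(1)] L_mon_map_gen[OF v(1)] Y.\<theta>_gen[OF Nf_closed[OF v(1)]] ..
qed

end

lemma L_mon_functor: "dg_functor (L_mon :: 'a simp_ring \<Rightarrow> _) L_mon_map"
  unfolding dg_functor_def
proof (intro conjI allI impI ballI)
  show "dg_ring (L_mon X)" if "simplicial_ring X" for X :: "'a simp_ring"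
    by (rule simplicial_ring.L_mon_dg_ring[OF that])
  show "dg_hom (L_mon X) (L_mon Y) (L_mon_map X Y f)" if "simp_ring_hom X Y f" for X Y :: "'a simp_ring" and f
    by (rule L_mon_map_dg_hom[OF that])
next
  fix X Y :: "'a simp_ring" and f g k c
  assume fg: "simp_ring_hom X Y f \<and> simp_ring_hom X Y g \<and> (\<forall>n. \<forall>x\<in>carrier (level X n). f n x = g n x)"
    and c: "c \<in> carrier (grp (L_mon X) k)"
  then have f: "simp_ring_hom X Y f" and g: "simp_ring_hom X Y g" by auto
  interpret X: simplicial_ring X using f by (simp add: simp_ring_hom_def)
  interpret Y: simplicial_ring Y using f by (simp add: simp_ring_hom_def)
  obtain v where v: "v \<in> carrier (grp (N (additive X)) k)" "c = X.\<pi> k (X.gen k v)" by (rule X.L_mon_cases[OF c])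
  obtain x where x: "x \<in> carrier (level (additive X) k)" "v = N_cls (additive X) k x" by (rule X.A.N_cases[OF v(1)])
  have "f k x = g k x" using fg x(1) by simp
  then have "N_map (additive Y) f k v = N_map (additive Y) g k v"
    unfolding x(2) by (simp only: N_map_cls[OF X.additive_simplicial Y.additive_simplicial _ x(1)] simp_ring_hom_additive f g)
  then show "L_mon_map X Y f k c = L_mon_map X Y g k c"
    by (simp only: v(2) L_mon_map_gen[OF f v(1)] L_mon_map_gen[OF g v(1)])
next
  fix X :: "'a simp_ring" and k c assume X: "simplicial_ring X" and c: "c \<in> carrier (grp (L_mon X) k)"
  interpret X: simplicial_ring X by (rule X)
  note i = simp_ring_hom_id[OF X]
  obtain v where v: "v \<in> carrier (grp (N (additive X)) k)" "c = X.\<pi> k (X.gen k v)" by (rule X.L_mon_cases[OF c])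
  obtain x where x: "x \<in> carrier (level (additive X) k)" "v = N_cls (additive X) k x" by (rule X.A.N_cases[OF v(1)])
  have "N_map (additive X) (\<lambda>n x. x) k v = v"
    unfolding x(2) by (rule N_map_cls[OF X.additive_simplicial X.additive_simplicial simp_ring_hom_additive[OF i] x(1)])
  then show "L_mon_map X X (\<lambda>n x. x) k c = c" by (simp only: v(2) L_mon_map_gen[OF i v(1)])
next
  fix X Y Z :: "'a simp_ring" and f g k c
  assume fg: "simp_ring_hom X Y f \<and> simp_ring_hom Y Z g" and c: "c \<in> carrier (grp (L_mon X) k)"
  then have f: "simp_ring_hom X Y f" and g: "simp_ring_hom Y Z g" by auto
  note gf = simp_ring_hom_comp[OF f g]
  interpret X: simplicial_ring X using f by (simp add: simp_ring_hom_def)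
  interpret Y: simplicial_ring Y using f by (simp add: simp_ring_hom_def)
  interpret Z: simplicial_ring Z using g by (simp add: simp_ring_hom_def)
  note fa = simp_ring_hom_additive[OF f] and ga = simp_ring_hom_additive[OF g] and gfa = simp_ring_hom_additive[OF gf]
  obtain v where v: "v \<in> carrier (grp (N (additive X)) k)" "c = X.\<pi> k (X.gen k v)" by (rule X.L_mon_cases[OF c])
  obtain x where x: "x \<in> carrier (level (additive X) k)" "v = N_cls (additive X) k x" by (rule X.A.N_cases[OF v(1)])
  have fx: "f k x \<in> carrier (level (additive Y) k)"
    by (rule simp_ab_hom_closed[OF X.additive_simplicial Y.additive_simplicial fa x(1)])
  have "N_map (additive Z) (\<lambda>n x. g n (f n x)) k v = N_map (additive Z) g k (N_map (additive Y) f k v)"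
    unfolding x(2) N_map_cls[OF X.additive_simplicial Z.additive_simplicial gfa x(1)]
      N_map_cls[OF X.additive_simplicial Y.additive_simplicial fa x(1)] N_map_cls[OF Y.additive_simplicial Z.additive_simplicial ga fx] ..
  then show "L_mon_map X Z (\<lambda>n x. g n (f n x)) k c = L_mon_map Y Z g k (L_mon_map X Y f k c)"
    by (simp only: v(2) L_mon_map_gen[OF f v(1)] L_mon_map_gen[OF gf v(1)] L_mon_map_gen[OF g Nf_closed[OF f v(1)]])
qed

lemma L_tilde_functor: "dg_functor (L_tilde :: 'a simp_ring \<Rightarrow> _) L_tilde_map"
  by (rule dg_functor_image[OF L_mon_functor simplicial_ring.\<theta>_dg_hom simplicial_ring.\<theta>_surj \<theta>_natural])

theorem theorem4p1:
  shows "(\<forall>X :: 'a simp_ring. simplicial_ring X \<longrightarrow>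
            dg_coequalizer TYPE('d) (T_L_T X) (T_L X) (alpha X) (beta X)
              (L_mon X) (dg_quot_cls (T_L X) (L_mon_ideal X))) \<and>
         (\<forall>X :: 'a simp_ring. simplicial_ring X \<longrightarrow> dg_ideal (L X) (J_ideal X)) \<and>
         dg_functor (L_mon :: 'a simp_ring \<Rightarrow> _) L_mon_map \<and>
         dg_functor (L_tilde :: 'a simp_ring \<Rightarrow> _) L_tilde_map \<and>
         (\<exists>\<theta>. functor_iso (L_mon :: 'a simp_ring \<Rightarrow> _) L_mon_map L_tilde L_tilde_map \<theta>)"
proof (intro conjI allI impI exI L_mon_functor L_tilde_functor)
  fix X :: "'a simp_ring" assume X: "simplicial_ring X"
  show "dg_coequalizer TYPE('d) (T_L_T X) (T_L X) (alpha X) (beta X) (L_mon X) (dg_quot_cls (T_L X) (L_mon_ideal X))"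
    by (rule simplicial_ring.L_mon_coequalizer[OF X])
  show "dg_ideal (L X) (J_ideal X)"
    by (rule simplicial_ring.J_dg_ideal[OF X])
next
  show "functor_iso (L_mon :: 'a simp_ring \<Rightarrow> _) L_mon_map L_tilde L_tilde_map simplicial_ring.\<theta>"
    unfolding functor_iso_def
    by (intro conjI allI impI ballI simplicial_ring.\<theta>_dg_iso \<theta>_natural[symmetric])
qed

end
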